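(* Let $F: M^n\times(-\infty,0]\to\mathbb{R}^{n+1}$ be a complete ancient solution to the mean curvature flow, with Gauss map $\gamma:M^n\times(-\infty,0]\to\mathbb{S}^n$. Let $\rho$ be the distance function on $\mathbb{S}^n$ from some point $p_0\in\mathbb{S}^n$. Suppose that, as $t\to-\infty$, the image of the Gauss map is contained in the open hemisphere centered at $p_0$, i.e. there is $t_0\le 0$ such that $\rho(\gamma(x,t))<\frac{\pi}{2}$ for all $x\in M$ and all $t\le t_0$; and suppose that $$ \left(\frac{\pi}{2}-\rho\circ\gamma(x,t)\right)^{-1}=o\left(\sqrt{|F(x,t)|+\sqrt{|t|}}\right) $$ near infinity, i.e. for every $\varepsilon>0$ there is $K>0$ such that $\left|\frac{\pi}{2}-\rho(\gamma(x,t))\right|^{-1}\le\varepsilon\sqrt{|F(x,t)|+\sqrt{|t|}}$ for all $(x,t)\in M\times(-\infty,0]$ with $|F(x,t)|+\sqrt{|t|}\ge K$. Then $M_t$ is affine linear (an affine hyperplane of $\mathbb{R}^{n+1}$) for every $t\in(-\infty,0]$.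
   Context: $M^n$ is a connected oriented $n$-dimensional smooth manifold. A solution to the mean curvature flow on a time interval $I$ is a smooth one-parameter family of immersions $F_t=F(\cdot,t):M^n\to\mathbb{R}^{n+1}$, $t\in I$, with $\frac{\partial}{\partial t}F(x,t)=H(x,t)$, where $H(x,t)$ is the mean curvature vector (the trace of the second fundamental form) of $M_t:=F_t(M)$ at $F(x,t)$. It is ancient if it exists on a time interval extending to $-\infty$ (here $(-\infty,0]$), and complete if each $M_t$, with the metric induced by $F_t$, is a complete Riemannian manifold. The Gauss map $\gamma(x,t)\in\mathbb{S}^n$ is the unit normal of $M_t$ at $F(x,t)$ determined by the orientation. The distance on $\mathbb{S}^n$ is that of the standard round metric on the unit sphere. $|F(x,t)|$ is the Euclidean norm of the position vector. *)

theory Defs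
  imports "HOL-Analysis.Analysis"
begin

section \<open>Smooth maps between Euclidean spaces\<close>

text \<open>The predicate \<open>Ck_on k U f\<close> is only meaningful for open \<open>U\<close>; smoothness on an
  arbitrary set, such as \<open>V \<times> {..0}\<close>, means that \<open>f\<close> has smooth local extensions
  to open sets.\<close>

primrec Ck_on ::
  "nat \<Rightarrow> 'a set \<Rightarrow> ('a::euclidean_space \<Rightarrow> 'b::euclidean_space) \<Rightarrow> bool" where
  "Ck_on 0 U f \<longleftrightarrow> continuous_on U f"
| "Ck_on (Suc k) U f \<longleftrightarrow>
     (\<forall>x\<in>U. f differentiable (at x)) \<and>
     (\<forall>v. Ck_on k U (\<lambda>x. frechet_derivative f (at x) v))"

definition smooth_on :: "'a set \<Rightarrow> ('a::euclidean_space \<Rightarrow> 'b::euclidean_space) \<Rightarrow> bool" where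
  "smooth_on S f \<longleftrightarrow>
     (\<forall>x\<in>S. \<exists>U g. open U \<and> x \<in> U \<and> (\<forall>k. Ck_on k U g) \<and> (\<forall>y\<in>S \<inter> U. g y = f y))"

definition partial :: "'n::finite \<Rightarrow> (real^'n \<Rightarrow> 'b::real_normed_vector) \<Rightarrow> real^'n \<Rightarrow> 'b" where
  "partial i f y = frechet_derivative f (at y) (axis i 1)"


section \<open>Connected oriented smooth manifolds\<close>

text \<open>A chart is a pair of its domain and its coordinate map.  The smooth structure and the
  orientation are those determined by the given atlas, which need not be maximal.\<close>

type_synonym ('m, 'n) chart = "'m set \<times> ('m \<Rightarrow> real^'n)"

definition is_chart :: "'m topology \<Rightarrow> ('m, 'n::finite) chart \<Rightarrow> bool" where
  "is_chart X = (\<lambda>(U, \<phi>). openin X U \<and> open (\<phi> ` U) \<and>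
     homeomorphic_map (subtopology X U) (top_of_set (\<phi> ` U)) \<phi>)"

definition oriented_compatible :: "('m, 'n::finite) chart \<Rightarrow> ('m, 'n) chart \<Rightarrow> bool" where
  "oriented_compatible = (\<lambda>(U, \<phi>) (V, \<psi>).
     smooth_on (\<phi> ` (U \<inter> V)) (\<psi> \<circ> inv_into U \<phi>) \<and>
     (\<forall>y\<in>\<phi> ` (U \<inter> V). det (matrix (frechet_derivative (\<psi> \<circ> inv_into U \<phi>) (at y))) > 0))"

definition connected_oriented_manifold ::
  "'m topology \<Rightarrow> ('m, 'n::finite) chart set \<Rightarrow> bool" where
  "connected_oriented_manifold X A \<longleftrightarrow>
     Hausdorff_space X \<and> second_countable X \<and> connected_space X \<and> topspace X \<noteq> {} \<and>
     (\<forall>c\<in>A. is_chart X c) \<and> (\<Union>c\<in>A. fst c) = topspace X \<and>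
     (\<forall>c\<in>A. \<forall>c'\<in>A. oriented_compatible c c')"


section \<open>Local geometry of a parametrized hypersurface\<close>

text \<open>The ambient space of dimension \<open>CARD('n) + 1\<close> is \<open>real^('n option)\<close>.  In the following,
  \<open>f\<close> is an immersion of an open subset of \<open>real^'n\<close>, and \<open>y\<close> a point in that subset.\<close>

definition gram :: "(real^'n::finite \<Rightarrow> real^('n option)) \<Rightarrow> real^'n \<Rightarrow> real^'n^'n" where
  "gram f y = (\<chi> i j. partial i f y \<bullet> partial j f y)"

text \<open>The component of \<open>w\<close> orthogonal to the tangent space spanned by the \<open>partial i f y\<close>;
  the subtracted sum is the orthogonal projection of \<open>w\<close> to that space.\<close>

definition normal_part ::
  "(real^'n::finite \<Rightarrow> real^('n option)) \<Rightarrow> real^'n \<Rightarrow> real^('n option) \<Rightarrow> real^('n option)" where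
  "normal_part f y w =
     w - (\<Sum>k\<in>UNIV. \<Sum>l\<in>UNIV. (matrix_inv (gram f y) $ k $ l * (w \<bullet> partial l f y)) *\<^sub>R partial k f y)"

definition second_fundamental_form ::
  "(real^'n::finite \<Rightarrow> real^('n option)) \<Rightarrow> real^'n \<Rightarrow> 'n \<Rightarrow> 'n \<Rightarrow> real^('n option)" where
  "second_fundamental_form f y i j = normal_part f y (partial i (partial j f) y)"

definition mean_curvature_vector ::
  "(real^'n::finite \<Rightarrow> real^('n option)) \<Rightarrow> real^'n \<Rightarrow> real^('n option)" where
  "mean_curvature_vector f y =
     (\<Sum>i\<in>UNIV. \<Sum>j\<in>UNIV. matrix_inv (gram f y) $ i $ j *\<^sub>R second_fundamental_form f y i j)"

text \<open>\<open>\<nu>\<close> is the unit normal for which \<open>(\<nu>, partial 1 f y, ..., partial n f y)\<close> is a positive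
  basis of the ambient space; the column index \<open>None\<close> comes first.\<close>

definition is_unit_normal ::
  "(real^'n::finite \<Rightarrow> real^('n option)) \<Rightarrow> real^'n \<Rightarrow> real^('n option) \<Rightarrow> bool" where
  "is_unit_normal f y \<nu> \<longleftrightarrow>
     norm \<nu> = 1 \<and> (\<forall>i. \<nu> \<bullet> partial i f y = 0) \<and>
     det (\<chi> r c. (case c of None \<Rightarrow> \<nu> | Some i \<Rightarrow> partial i f y) $ r) > 0"


section \<open>Lengths, distances, completeness\<close>

text \<open>Lengths are extended nonnegative reals, so that a curve whose speed is not integrable has
  infinite length.\<close>

definition curve_length :: "(real \<Rightarrow> 'a::euclidean_space) \<Rightarrow> ennreal" where
  "curve_length c = (\<integral>\<^sup>+ s\<in>{0..1}. ennreal (norm (vector_derivative c (at s))) \<partial>lborel)"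

definition sphere_dist :: "'a::euclidean_space \<Rightarrow> 'a \<Rightarrow> real" where
  "sphere_dist p q = enn2real (INF c \<in> {c. c piecewise_C1_differentiable_on {0..1} \<and>
     c ` {0..1} \<subseteq> sphere 0 1 \<and> c 0 = p \<and> c 1 = q}. curve_length c)"

definition piecewise_C1_curve ::
  "'m topology \<Rightarrow> ('m, 'n::finite) chart set \<Rightarrow> (real \<Rightarrow> 'm) \<Rightarrow> bool" where
  "piecewise_C1_curve X A c \<longleftrightarrow> pathin X c \<and>
     (\<forall>(U, \<phi>)\<in>A. \<forall>a b. 0 \<le> a \<longrightarrow> a \<le> b \<longrightarrow> b \<le> 1 \<longrightarrow> c ` {a..b} \<subseteq> U \<longrightarrow>
        (\<phi> \<circ> c) piecewise_C1_differentiable_on {a..b})"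

text \<open>The Riemannian distance of the metric induced by the immersion \<open>f\<close>, in which a curve \<open>c\<close>
  has the speed of its image \<open>f \<circ> c\<close> in the ambient space.\<close>

definition induced_dist ::
  "'m topology \<Rightarrow> ('m, 'n::finite) chart set \<Rightarrow> ('m \<Rightarrow> real^('n option)) \<Rightarrow> 'm \<Rightarrow> 'm \<Rightarrow> real" where
  "induced_dist X A f p q = enn2real (INF c \<in> {c. piecewise_C1_curve X A c \<and>
     c 0 = p \<and> c 1 = q}. curve_length (f \<circ> c))"

definition complete_immersion ::
  "'m topology \<Rightarrow> ('m, 'n::finite) chart set \<Rightarrow> ('m \<Rightarrow> real^('n option)) \<Rightarrow> bool" where
  "complete_immersion X A f \<longleftrightarrow> Metric_space.mcomplete (topspace X) (induced_dist X A f)"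


section \<open>Mean curvature flow\<close>

definition mean_curvature_flow ::
  "('m, 'n::finite) chart set \<Rightarrow> real set \<Rightarrow>
   ('m \<Rightarrow> real \<Rightarrow> real^('n option)) \<Rightarrow> bool" where
  "mean_curvature_flow A I F \<longleftrightarrow>
     (\<forall>(U, \<phi>)\<in>A.
        smooth_on (\<phi> ` U \<times> I) (\<lambda>(y, t). F (inv_into U \<phi> y) t) \<and>
        (\<forall>t\<in>I. \<forall>x\<in>U.
           inj (frechet_derivative (\<lambda>y. F (inv_into U \<phi> y) t) (at (\<phi> x))) \<and>
           (F x has_vector_derivative
              mean_curvature_vector (\<lambda>y. F (inv_into U \<phi> y) t) (\<phi> x)) (at t within I)))"

definition complete_ancient_mcf ::
  "'m topology \<Rightarrow> ('m, 'n::finite) chart set \<Rightarrow> ('m \<Rightarrow> real \<Rightarrow> real^('n option)) \<Rightarrow> bool" where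
  "complete_ancient_mcf X A F \<longleftrightarrow>
     mean_curvature_flow A {..0} F \<and> (\<forall>t\<le>0. complete_immersion X A (\<lambda>x. F x t))"

definition is_gauss_map ::
  "('m, 'n::finite) chart set \<Rightarrow> real set \<Rightarrow>
   ('m \<Rightarrow> real \<Rightarrow> real^('n option)) \<Rightarrow> ('m \<Rightarrow> real \<Rightarrow> real^('n option)) \<Rightarrow> bool" where
  "is_gauss_map A I F \<gamma> \<longleftrightarrow>
     (\<forall>(U, \<phi>)\<in>A. \<forall>t\<in>I. \<forall>x\<in>U.
        is_unit_normal (\<lambda>y. F (inv_into U \<phi> y) t) (\<phi> x) (\<gamma> x t))"

end

(*
  In coordinates in which p0 is the vertical direction, W = <p0, gamma> is the cosine of the distance
  to p0, and where M_t is a graph with gradient Du we have 1/W^2 = 1 + |Du|^2 =: v^2.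

  An entire graphical ancient solution with v = o(sqrt(|F| + sqrt|t|)) is flat: for the second
  derivatives u_ee, the quantity u_ee eta / ((1 + u_e^2) sqrt(1 - k v^2)), with
  eta = R^2 - |F|^2 + (t - s1) and 2 k V^2 = 1 for the bound V of v on {eta >= 0}, has a maximum over
  e and spacetime.  There M_t is rewritten as a graph over its tangent plane; the maximum principle
  bounds the curvature by V^2 / R up to constants, which tends to 0 as R grows.  Hence u is affine,
  and as the velocity is normal, the flow is stationary.

  To see that M_t is an entire graph, the projection p_t to the horizontal hyperplane is inverted
  along segments.  Where v is bounded by C (1 + |F|), a partial inverse over a ball is Lipschitz for
  the Riemannian distance by Gronwall's inequality, and completeness extends it beyond the ball.  For
  t near -infinity the growth hypothesis gives such a bound on all of M_t.  For later times it gives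
  it only far out; but while the flow is stationary M_t is a hyperplane, so in the bounded part the
  bound persists for a short time.  The maximal time up to which the flow is stationary is therefore 0.
*)
theory Submission imports Defs begin

section \<open>Calculus of smooth maps\<close>

text \<open>Apart from the cutoff, the quantity to be maximized is the normal curvature in direction
  e times v / sqrt(1 - k v^2), a directional form of the Ecker-Huisken test function. Treating one
  direction at a time avoids tensor calculus: in the graph over the tangent plane the gradient
  vanishes at the maximum, the metric agrees there with the Euclidean one to first order, and the
  maximum principle is a second derivative test with ordinary partial derivatives. To allow this
  change of graph, the flow is expressed by its normal velocity, tested on orthonormal frames; this
  form survives reparametrizations and isometries. The cutoff confines spacetime to |F| \<le> R and
  0 \<le> s1 - t \<le> R^2, where |F| + sqrt|t| = O(R), so the growth hypothesis yields v^2 = o(R)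
  there. The curvature bound has the order of sup v^2 / R; this is where the square root comes from.
  An ancient solution is used because the region has no initial data. The obstacle to inverting the
  projection is that the gradient bound depends on |F|, hence on the unknown height: a section must
  be controlled together with its own height.\<close>

abbreviation dd :: "'a::real_normed_vector \<Rightarrow> ('a \<Rightarrow> 'b::real_normed_vector) \<Rightarrow> 'a \<Rightarrow> 'b" where
  "dd v f x \<equiv> frechet_derivative f (at x) v"

text \<open>Companion of \<open>smooth_on\<close> for open sets, where a map is its own extension.
  Openness is built in because \<open>Ck_on\<close> is meaningful only then.\<close>

definition smooth_open :: "'a set \<Rightarrow> ('a::euclidean_space \<Rightarrow> 'b::euclidean_space) \<Rightarrow> bool" where
  "smooth_open U f \<longleftrightarrow> open U \<and> (\<forall>k. Ck_on k U f)"

lemma has_derivative_frechet: "f differentiable at x \<Longrightarrow> (f has_derivative frechet_derivative f (at x)) (at x)"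
  by (simp add: frechet_derivative_works[symmetric])

lemma Ck_on_SucI:
  assumes "\<And>x. x \<in> U \<Longrightarrow> f differentiable (at x)" "\<And>v. Ck_on k U (dd v f)"
  shows "Ck_on (Suc k) U f"
  using assms by simp

lemma Ck_on_cong:
  assumes "open U" "\<And>x. x \<in> U \<Longrightarrow> f x = g x" "Ck_on k U f"
  shows "Ck_on k U g"
  using assms(2,3)
proof (induction k arbitrary: f g)
  case 0
  then show ?case using continuous_on_cong by fastforce
next
  case (Suc k)
  have d: "(g has_derivative frechet_derivative f (at x)) (at x)" if "x \<in> U" for x
    using Suc.prems that assms(1)
    by (intro has_derivative_transform_within_open[of f _ x UNIV U g])
       (auto simp: has_derivative_frechet)
  have "dd v g x = dd v f x" if "x \<in> U" for x v
    using frechet_derivative_at[OF d[OF that]] by simp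
  then have "Ck_on k U (dd v g)" for v
    using Suc.IH[of "dd v f" "dd v g"] Suc.prems(2) by simp
  then show ?case using d by (auto simp: differentiable_def)
qed

text \<open>Most closure properties below are inductions on k through this rule: an explicit formula
  for the derivative replaces the choice in \<open>frechet_derivative\<close>, and only that formula
  has to be \<open>Ck_on k\<close>.\<close>

lemma Ck_on_has_derivative_Suc:
  assumes "open U" "\<And>x. x \<in> U \<Longrightarrow> (f has_derivative f' x) (at x)"
    and "\<And>v. Ck_on k U (\<lambda>x. f' x v)"
  shows "Ck_on (Suc k) U f"
proof (rule Ck_on_SucI)
  show "f differentiable at x" if "x \<in> U" for x
    using assms(2)[OF that] by (auto simp: differentiable_def)
  show "Ck_on k U (dd v f)" for v
    using frechet_derivative_at[OF assms(2)]
    by (intro Ck_on_cong[OF assms(1) _ assms(3)[of v]]) simp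
qed

lemma Ck_on_SucD: "Ck_on (Suc k) U f \<Longrightarrow> x \<in> U \<Longrightarrow> (f has_derivative frechet_derivative f (at x)) (at x)"
  using has_derivative_frechet by auto

lemma Ck_on_imp_continuous_on: "Ck_on k U f \<Longrightarrow> continuous_on U f"
  by (cases k) (auto intro!: continuous_at_imp_continuous_on differentiable_imp_continuous_within)

lemma Ck_on_pred: "Ck_on (Suc k) U f \<Longrightarrow> Ck_on k U f"
proof (induction k arbitrary: f)
  case 0
  then show ?case using Ck_on_imp_continuous_on by (metis Ck_on.simps(1))
next
  case (Suc k)
  then show ?case by (metis Ck_on.simps(2))
qed

lemma Ck_on_subset: "Ck_on k U f \<Longrightarrow> V \<subseteq> U \<Longrightarrow> Ck_on k V f"
  by (induction k arbitrary: f) (auto intro: continuous_on_subset)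

lemma Ck_on_local:
  assumes "\<And>x. x \<in> U \<Longrightarrow> \<exists>V. open V \<and> x \<in> V \<and> Ck_on k V f"
  shows "Ck_on k U f"
  using assms
proof (induction k arbitrary: f)
  case 0
  then show ?case
    by (auto intro!: continuous_at_imp_continuous_on) (metis at_within_open continuous_on_eq_continuous_within)
next
  case (Suc k)
  show ?case
  proof (rule Ck_on_SucI)
    show "f differentiable at x" if "x \<in> U" for x
      using Suc.prems[OF that] by auto
    show "Ck_on k U (dd v f)" for v
      by (rule Suc.IH) (use Suc.prems in force)
  qed
qed

lemma Ck_on_const: "open U \<Longrightarrow> Ck_on k U (\<lambda>x. c)"
  by (induction k arbitrary: c) (auto intro!: Ck_on_cong[where f="\<lambda>x. 0"] simp: frechet_derivative_const)

lemma Ck_on_linear: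
  assumes "bounded_linear f" "open U"
  shows "Ck_on k U f"
proof (cases k)
  case 0
  then show ?thesis using assms by (simp add: linear_continuous_on)
next
  case (Suc j)
  show ?thesis unfolding Suc
    by (rule Ck_on_has_derivative_Suc[where f'="\<lambda>x. f"])
       (use assms in \<open>auto intro: Ck_on_const bounded_linear_imp_has_derivative\<close>)
qed

lemma Ck_on_add:
  assumes "open U" "Ck_on k U f" "Ck_on k U g"
  shows "Ck_on k U (\<lambda>x. f x + g x)"
  using assms(2,3)
proof (induction k arbitrary: f g)
  case 0
  then show ?case by (auto intro: continuous_on_add)
next
  case (Suc k)
  show ?case
    by (rule Ck_on_has_derivative_Suc[OF assms(1), where f'="\<lambda>x v. dd v f x + dd v g x"])
       (use Suc in \<open>auto intro!: has_derivative_add Ck_on_SucD\<close>)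
qed

lemma Ck_on_bounded_linear_compose:
  assumes "bounded_linear h" "open U" "Ck_on k U f"
  shows "Ck_on k U (\<lambda>x. h (f x))"
  using assms(3)
proof (induction k arbitrary: f)
  case 0
  then show ?case using assms(1) by (auto intro: bounded_linear.continuous_on)
next
  case (Suc k)
  show ?case
  proof (rule Ck_on_has_derivative_Suc[OF assms(2), where f'="\<lambda>x v. h (dd v f x)"])
    show "((\<lambda>x. h (f x)) has_derivative (\<lambda>v. h (dd v f x))) (at x)" if "x \<in> U" for x
      by (rule bounded_linear.has_derivative[OF assms(1) Ck_on_SucD[OF Suc.prems that]])
    show "Ck_on k U (\<lambda>x. h (dd v f x))" for v
      using Suc.IH[of "dd v f"] Suc.prems by simp
  qed
qed

lemma Ck_on_bilinear:
  assumes "bounded_bilinear h" "open U" "Ck_on k U f" "Ck_on k U g"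
  shows "Ck_on k U (\<lambda>x. h (f x) (g x))"
  using assms(3,4)
proof (induction k arbitrary: f g)
  case 0
  then show ?case using assms(1) by (auto intro: bounded_bilinear.continuous_on)
next
  case (Suc k)
  have "Ck_on k U f" "Ck_on k U g" using Suc.prems Ck_on_pred by auto
  then show ?case using Suc
    by (intro Ck_on_has_derivative_Suc[OF assms(2), where f'="\<lambda>x v. h (f x) (dd v g x) + h (dd v f x) (g x)"])
       (auto intro!: bounded_bilinear.FDERIV[OF assms(1)] Ck_on_SucD Ck_on_add assms)
qed

lemma Ck_on_sum:
  assumes "open U" "\<And>i. i \<in> I \<Longrightarrow> Ck_on k U (f i)"
  shows "Ck_on k U (\<lambda>x. \<Sum>i\<in>I. f i x)"
  using assms(2)
  by (induction I rule: infinite_finite_induct) (auto intro!: Ck_on_const Ck_on_add assms(1))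

lemma Ck_on_mult:
  fixes f g :: "'a::euclidean_space \<Rightarrow> real"
  shows "open U \<Longrightarrow> Ck_on k U f \<Longrightarrow> Ck_on k U g \<Longrightarrow> Ck_on k U (\<lambda>x. f x * g x)"
  by (rule Ck_on_bilinear[OF bounded_bilinear_mult])

lemma Ck_on_prod:
  fixes f :: "'i \<Rightarrow> 'a::euclidean_space \<Rightarrow> real"
  assumes "open U" "\<And>i. i \<in> I \<Longrightarrow> Ck_on k U (f i)"
  shows "Ck_on k U (\<lambda>x. \<Prod>i\<in>I. f i x)"
  using assms(2)
  by (induction I rule: infinite_finite_induct) (auto intro!: Ck_on_const Ck_on_mult assms(1))

text \<open>The derivative of 1/f is a polynomial in 1/f and the derivative of f, so regularity of
  1/f at order k feeds order \<open>Suc k\<close>.\<close>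

lemma Ck_on_inverse:
  fixes f :: "'a::euclidean_space \<Rightarrow> real"
  assumes "open U" "Ck_on k U f" "\<And>x. x \<in> U \<Longrightarrow> f x \<noteq> 0"
  shows "Ck_on k U (\<lambda>x. inverse (f x))"
  using assms(2)
proof (induction k)
  case 0
  then show ?case using assms(3) by (auto intro: continuous_on_inverse)
next
  case (Suc k)
  have "Ck_on k U (\<lambda>x. inverse (f x))" using Suc Ck_on_pred by blast
  then show ?case using Suc.prems
    by (intro Ck_on_has_derivative_Suc[OF assms(1), where f'="\<lambda>x v. - (inverse (f x) * dd v f x * inverse (f x))"])
       (auto intro!: Ck_on_mult Ck_on_bounded_linear_compose[OF bounded_linear_minus[OF bounded_linear_ident]]
         assms Ck_on_SucD derivative_eq_intros)
qed

lemma Ck_on_compose: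
  assumes "open U" "open V" "f ` U \<subseteq> V" "Ck_on k U f" "Ck_on k V g"
  shows "Ck_on k U (\<lambda>x. g (f x))"
  using assms(4,5)
proof (induction k arbitrary: g)
  case 0
  then show ?case using assms(3) by (auto intro: continuous_on_compose2)
next
  case (Suc k)
  have g: "Ck_on k U (\<lambda>x. dd b g (f x))" for b
    using Suc.IH[of "dd b g"] Suc.prems Ck_on_pred by auto
  \<comment> \<open>The direction \<open>dd v f x\<close> moves with x, whereas the induction
    hypothesis concerns fixed directions; hence the expansion in \<open>Basis\<close>.\<close>
  have *: "dd w g (f x) = (\<Sum>b\<in>Basis. (w \<bullet> b) *\<^sub>R dd b g (f x))" if "x \<in> U" for x w
  proof -
    have "linear (frechet_derivative g (at (f x)))"
      using Ck_on_SucD[OF Suc.prems(2)] assms(3) that has_derivative_linear by blast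
    then have "dd (\<Sum>b\<in>Basis. (w \<bullet> b) *\<^sub>R b) g (f x) = (\<Sum>b\<in>Basis. (w \<bullet> b) *\<^sub>R dd b g (f x))"
      by (simp add: linear_sum linear_scale)
    then show ?thesis by (simp only: euclidean_representation)
  qed
  have "Ck_on k U (\<lambda>x. dd (dd v f x) g (f x))" for v
    by (rule Ck_on_cong[OF assms(1) *[symmetric]])
      (use g Suc.prems in \<open>auto intro!: Ck_on_sum assms(1) Ck_on_bilinear[OF bounded_bilinear_scaleR]
        Ck_on_bounded_linear_compose[OF bounded_linear_inner_left]\<close>)
  then show ?case
    by (intro Ck_on_has_derivative_Suc[OF assms(1), where f'="\<lambda>x v. dd (dd v f x) g (f x)"])
       (use Suc.prems assms(3) in \<open>auto intro!: has_derivative_compose[where g=g] Ck_on_SucD\<close>)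
qed

lemma smooth_openD:
  assumes "smooth_open U f"
  shows "open U" "x \<in> U \<Longrightarrow> (f has_derivative frechet_derivative f (at x)) (at x)"
    "smooth_open U (dd v f)" "continuous_on U f" "x \<in> U \<Longrightarrow> linear (frechet_derivative f (at x))"
    "x \<in> U \<Longrightarrow> f differentiable at x"
proof -
  show "open U" using assms by (simp add: smooth_open_def)
  have *: "Ck_on (Suc k) U f" for k using assms unfolding smooth_open_def by blast
  then show d: "x \<in> U \<Longrightarrow> (f has_derivative frechet_derivative f (at x)) (at x)"
    using Ck_on_SucD by blast
  show "smooth_open U (dd v f)" using * \<open>open U\<close> by (auto simp: smooth_open_def)
  show "continuous_on U f" using * Ck_on_imp_continuous_on by blast
  show "x \<in> U \<Longrightarrow> linear (frechet_derivative f (at x))" using d has_derivative_linear by blast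
  show "x \<in> U \<Longrightarrow> f differentiable at x" using d by (auto simp: differentiable_def)
qed

lemma smooth_open_has_derivative:
  assumes "open U" "\<And>x. x \<in> U \<Longrightarrow> (f has_derivative f' x) (at x)" "\<And>v. smooth_open U (\<lambda>x. f' x v)"
  shows "smooth_open U f"
proof -
  have "Ck_on k U f" for k
    using Ck_on_pred[OF Ck_on_has_derivative_Suc[OF assms(1,2)]] assms(3)
    by (metis smooth_open_def)
  then show ?thesis using assms(1) by (simp add: smooth_open_def)
qed

lemma smooth_open_cong: "smooth_open U f \<Longrightarrow> (\<And>x. x \<in> U \<Longrightarrow> f x = g x) \<Longrightarrow> smooth_open U g"
  unfolding smooth_open_def using Ck_on_cong by blast

lemma smooth_open_subset: "smooth_open U f \<Longrightarrow> open V \<Longrightarrow> V \<subseteq> U \<Longrightarrow> smooth_open V f"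
  unfolding smooth_open_def using Ck_on_subset by blast

lemma smooth_open_local:
  assumes "open U" "\<And>x. x \<in> U \<Longrightarrow> \<exists>V g. x \<in> V \<and> smooth_open V g \<and> (\<forall>y\<in>V. g y = f y)"
  shows "smooth_open U f"
  unfolding smooth_open_def
proof (intro conjI assms(1) allI Ck_on_local)
  fix k x assume "x \<in> U"
  then obtain V g where "x \<in> V" "smooth_open V g" "\<forall>y\<in>V. g y = f y" using assms(2) by blast
  then show "\<exists>V. open V \<and> x \<in> V \<and> Ck_on k V f"
    using Ck_on_cong[of V g f k] unfolding smooth_open_def by blast
qed

lemma dd_transform:
  assumes "open U" "x \<in> U" "\<And>y. y \<in> U \<Longrightarrow> f y = g y"
  shows "frechet_derivative f (at x) = frechet_derivative g (at x)"
proof -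
  have "(f has_derivative h) (at x) \<longleftrightarrow> (g has_derivative h) (at x)" for h
    using assms has_derivative_transform_within_open[of _ h x UNIV U] by metis
  then show ?thesis unfolding frechet_derivative_def by simp
qed

lemma smooth_open_const: "open U \<Longrightarrow> smooth_open U (\<lambda>x. c)"
  and smooth_open_linear: "bounded_linear l \<Longrightarrow> open U \<Longrightarrow> smooth_open U l"
  and smooth_open_add: "smooth_open U f \<Longrightarrow> smooth_open U g \<Longrightarrow> smooth_open U (\<lambda>x. f x + g x)"
  and smooth_open_linear_compose: "bounded_linear h \<Longrightarrow> smooth_open U f \<Longrightarrow> smooth_open U (\<lambda>x. h (f x))"
  and smooth_open_bilinear: "bounded_bilinear b \<Longrightarrow> smooth_open U f' \<Longrightarrow> smooth_open U g' \<Longrightarrow> smooth_open U (\<lambda>x. b (f' x) (g' x))"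
  by (auto simp: smooth_open_def intro: Ck_on_const Ck_on_linear Ck_on_add Ck_on_bounded_linear_compose Ck_on_bilinear)

lemma smooth_open_sum: "open U \<Longrightarrow> (\<And>i. i \<in> I \<Longrightarrow> smooth_open U (f i)) \<Longrightarrow> smooth_open U (\<lambda>x. \<Sum>i\<in>I. f i x)"
  by (auto simp: smooth_open_def intro: Ck_on_sum)

lemma smooth_open_mult:
  fixes f g :: "'a::euclidean_space \<Rightarrow> real"
  shows "smooth_open U f \<Longrightarrow> smooth_open U g \<Longrightarrow> smooth_open U (\<lambda>x. f x * g x)"
  by (rule smooth_open_bilinear[OF bounded_bilinear_mult])

lemma smooth_open_minus: "smooth_open U f \<Longrightarrow> smooth_open U (\<lambda>x. - f x)"
  by (rule smooth_open_linear_compose[OF bounded_linear_minus[OF bounded_linear_ident]])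

lemma smooth_open_diff: "smooth_open U f \<Longrightarrow> smooth_open U g \<Longrightarrow> smooth_open U (\<lambda>x. f x - g x)"
  using smooth_open_add[OF _ smooth_open_minus] by fastforce

lemma smooth_open_inverse:
  fixes f :: "'a::euclidean_space \<Rightarrow> real"
  shows "smooth_open U f \<Longrightarrow> (\<And>x. x \<in> U \<Longrightarrow> f x \<noteq> 0) \<Longrightarrow> smooth_open U (\<lambda>x. inverse (f x))"
  by (auto simp: smooth_open_def intro: Ck_on_inverse)

lemma smooth_open_compose:
  "smooth_open U f \<Longrightarrow> smooth_open V g \<Longrightarrow> f ` U \<subseteq> V \<Longrightarrow> smooth_open U (\<lambda>x. g (f x))"
  by (auto simp: smooth_open_def intro: Ck_on_compose)

lemma smooth_open_Pair:
  assumes "smooth_open U f" "smooth_open U g"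
  shows "smooth_open U (\<lambda>x. (f x, g x))"
proof -
  have 1: "bounded_linear (\<lambda>a::'b. (a, 0::'c))" and 2: "bounded_linear (\<lambda>a::'c. (0::'b, a))"
    by (auto intro!: bounded_linear_Pair bounded_linear_ident bounded_linear_zero)
  show ?thesis
    using smooth_open_add[OF smooth_open_linear_compose[OF 1 assms(1)] smooth_open_linear_compose[OF 2 assms(2)]]
    by simp
qed

lemma dd_eqI: "(f has_derivative f') (at x) \<Longrightarrow> dd v f x = f' v"
  using frechet_derivative_at by metis

lemma dd_compose:
  assumes "g differentiable at (f x)" "f differentiable at x"
  shows "dd v (\<lambda>x. g (f x)) x = dd (dd v f x) g (f x)"
  using frechet_derivative_at[OF has_derivative_compose[OF has_derivative_frechet[OF assms(2)] has_derivative_frechet[OF assms(1)]]]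
  by (metis (no_types))

lemma smooth_open_line:
  assumes "smooth_open U f" "x + s *\<^sub>R v \<in> U"
  shows "((\<lambda>s. f (x + s *\<^sub>R v)) has_vector_derivative dd v f (x + s *\<^sub>R v)) (at s)"
proof -
  have "((\<lambda>s. x + s *\<^sub>R v) has_derivative (\<lambda>s. s *\<^sub>R v)) (at s)"
    by (auto intro!: derivative_eq_intros)
  from has_derivative_compose[OF this smooth_openD(2)[OF assms]]
  show ?thesis unfolding has_vector_derivative_def
    by (simp add: linear_scale[OF smooth_openD(5)[OF assms]])
qed

text \<open>Schwarz's theorem: the second difference of \<open>f\<close> on the parallelogram spanned by \<open>h a\<close> and
  \<open>h b\<close> is \<open>h\<^sup>2\<close> times either mixed derivative at some nearby point.\<close>

lemma second_difference_mvt: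
  fixes f :: "'a::euclidean_space \<Rightarrow> real"
  assumes "smooth_open U f" "h > 0"
    and U: "\<And>s r. s \<in> {0..h} \<Longrightarrow> r \<in> {0..h} \<Longrightarrow> x + s *\<^sub>R a + r *\<^sub>R b \<in> U"
  shows "\<exists>s\<in>{0..h}. \<exists>r\<in>{0..h}. f (x + h *\<^sub>R a + h *\<^sub>R b) - f (x + h *\<^sub>R a) - f (x + h *\<^sub>R b) + f x
     = h * h * dd b (dd a f) (x + s *\<^sub>R a + r *\<^sub>R b)"
proof -
  have da: "((\<lambda>s. f (x + s *\<^sub>R a + r *\<^sub>R b)) has_real_derivative dd a f (x + s *\<^sub>R a + r *\<^sub>R b)) (at s)"
    if "s \<in> {0..h}" "r \<in> {0..h}" for s r
    using smooth_open_line[OF assms(1), of "x + r *\<^sub>R b" s a] U[OF that]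
    by (simp add: has_real_derivative_iff_has_vector_derivative ac_simps)
  have db: "((\<lambda>r. dd a f (x + s *\<^sub>R a + r *\<^sub>R b)) has_real_derivative dd b (dd a f) (x + s *\<^sub>R a + r *\<^sub>R b)) (at r)"
    if "s \<in> {0..h}" "r \<in> {0..h}" for s r
    using smooth_open_line[OF smooth_openD(3)[OF assms(1)], of "x + s *\<^sub>R a" r b] U[OF that]
    by (simp add: has_real_derivative_iff_has_vector_derivative ac_simps)
  let ?g = "\<lambda>s. f (x + s *\<^sub>R a + h *\<^sub>R b) - f (x + s *\<^sub>R a + 0 *\<^sub>R b)"
  have "\<exists>s. 0 < s \<and> s < h \<and> ?g h - ?g 0 = (h - 0) * (dd a f (x + s *\<^sub>R a + h *\<^sub>R b) - dd a f (x + s *\<^sub>R a + 0 *\<^sub>R b))"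
    by (rule MVT2) (use \<open>h > 0\<close> in \<open>auto intro!: DERIV_diff da da[of _ 0, simplified]\<close>)
  then obtain s where s: "0 < s" "s < h" "?g h - ?g 0 = h * (dd a f (x + s *\<^sub>R a + h *\<^sub>R b) - dd a f (x + s *\<^sub>R a + 0 *\<^sub>R b))"
    by auto
  have "\<exists>r. 0 < r \<and> r < h \<and> dd a f (x + s *\<^sub>R a + h *\<^sub>R b) - dd a f (x + s *\<^sub>R a + 0 *\<^sub>R b)
    = (h - 0) * dd b (dd a f) (x + s *\<^sub>R a + r *\<^sub>R b)"
    by (rule MVT2) (use \<open>h > 0\<close> s in \<open>auto intro!: db\<close>)
  then obtain r where r: "0 < r" "r < h" "dd a f (x + s *\<^sub>R a + h *\<^sub>R b) - dd a f (x + s *\<^sub>R a + 0 *\<^sub>R b)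
    = h * dd b (dd a f) (x + s *\<^sub>R a + r *\<^sub>R b)" by auto
  show ?thesis
    using s r by (intro bexI[of _ s] bexI[of _ r]) (auto simp: algebra_simps)
qed

lemma second_difference_limit:
  fixes f :: "'a::euclidean_space \<Rightarrow> real"
  assumes "smooth_open U f" "x \<in> U"
  shows "((\<lambda>h. (f (x + h *\<^sub>R a + h *\<^sub>R b) - f (x + h *\<^sub>R a) - f (x + h *\<^sub>R b) + f x) / (h * h))
    \<longlongrightarrow> dd b (dd a f) x) (at_right 0)"
proof (rule tendstoI)
  fix e :: real assume "e > 0"
  have c: "continuous_on U (dd b (dd a f))"
    by (intro smooth_openD(4) smooth_openD(3)) (rule assms(1))
  obtain d0 where d0: "d0 > 0" "ball x d0 \<subseteq> U" using smooth_openD(1)[OF assms(1)] assms(2) openE by blast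
  obtain d1 where d1: "d1 > 0" "\<And>y. y \<in> U \<Longrightarrow> dist y x < d1 \<Longrightarrow> dist (dd b (dd a f) y) (dd b (dd a f) x) < e"
    using c assms(2) \<open>e > 0\<close> unfolding continuous_on_iff by blast
  \<comment> \<open>For h < d the whole parallelogram lies within \<open>min d0 d1\<close> of x; the
    summand 1 covers the case a = b = 0.\<close>
  define d where "d = min d0 d1 / (norm a + norm b + 1)"
  have "d > 0" using d0 d1 by (simp add: d_def add_nonneg_pos)
  have near: "dist (x + s *\<^sub>R a + r *\<^sub>R b) x < min d0 d1" if "s \<in> {0..h}" "r \<in> {0..h}" "h < d" for s r h
  proof -
    have "dist (x + s *\<^sub>R a + r *\<^sub>R b) x = norm (s *\<^sub>R a + r *\<^sub>R b)" by (simp add: dist_norm algebra_simps)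
    also have "\<dots> \<le> s * norm a + r * norm b"
      using that norm_triangle_ineq[of "s *\<^sub>R a" "r *\<^sub>R b"] by auto
    also have "\<dots> \<le> h * norm a + h * norm b"
      using that by (intro add_mono mult_right_mono) auto
    also have "\<dots> \<le> h * (norm a + norm b + 1)" using that by (auto simp: algebra_simps)
    also have "\<dots> < d * (norm a + norm b + 1)"
      using that by (intro mult_strict_right_mono) (auto simp: add_nonneg_pos)
    also have "\<dots> = min d0 d1" unfolding d_def by (simp add: add_nonneg_eq_0_iff add_nonneg_pos less_imp_neq[symmetric])
    finally show ?thesis .
  qed
  show "\<forall>\<^sub>F h in at_right 0. dist ((f (x + h *\<^sub>R a + h *\<^sub>R b) - f (x + h *\<^sub>R a) - f (x + h *\<^sub>R b) + f x) / (h * h)) (dd b (dd a f) x) < e"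
  proof (rule eventually_at_rightI[OF _ \<open>d > 0\<close>])
    fix h assume h: "h \<in> {0<..<d}"
    have U: "x + s *\<^sub>R a + r *\<^sub>R b \<in> U" if "s \<in> {0..h}" "r \<in> {0..h}" for s r
      using near[OF that] h d0(2) by (auto simp: subset_iff dist_commute)
    obtain s r where sr: "s\<in>{0..h}" "r\<in>{0..h}" and
      eq: "f (x + h *\<^sub>R a + h *\<^sub>R b) - f (x + h *\<^sub>R a) - f (x + h *\<^sub>R b) + f x
      = h * h * dd b (dd a f) (x + s *\<^sub>R a + r *\<^sub>R b)"
      using second_difference_mvt[OF assms(1), of h x a b, OF _ U] h by auto
    have "dist (x + s *\<^sub>R a + r *\<^sub>R b) x < d1" using near[OF sr] h by simp
    from d1(2)[OF U[OF sr] this]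
    show "dist ((f (x + h *\<^sub>R a + h *\<^sub>R b) - f (x + h *\<^sub>R a) - f (x + h *\<^sub>R b) + f x) / (h * h)) (dd b (dd a f) x) < e"
      unfolding eq using h by simp
  qed
qed

text \<open>The second difference is symmetric in a and b, so the two mixed derivatives are limits
  of the same quotient. Vector values are reduced to real ones by pairing with basis
  vectors.\<close>

lemma dd_commute:
  fixes f :: "'a::euclidean_space \<Rightarrow> 'b::euclidean_space"
  assumes "smooth_open U f" "x \<in> U"
  shows "dd a (dd b f) x = dd b (dd a f) x"
proof -
  have real: "dd a (dd b g) x = dd b (dd a g) x" if "smooth_open U g" for g :: "'a \<Rightarrow> real"
  proof (rule tendsto_unique[OF _ second_difference_limit[OF that assms(2)]])
    show "((\<lambda>h. (g (x + h *\<^sub>R b + h *\<^sub>R a) - g (x + h *\<^sub>R b) - g (x + h *\<^sub>R a) + g x) / (h * h))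
      \<longlongrightarrow> dd b (dd a g) x) (at_right 0)"
      by (rule Lim_transform_eventually[OF second_difference_limit[OF that assms(2)]])
         (auto intro!: always_eventually simp: algebra_simps)
  qed simp
  have inn: "dd v (\<lambda>x. f x \<bullet> c) y = dd v f y \<bullet> c" if "smooth_open U f" "y \<in> U" for f :: "'a \<Rightarrow> 'b" and c v y
    using frechet_derivative_at[OF has_derivative_inner_left[OF smooth_openD(2)[OF that], of c]] by metis
  have inn2: "dd v (dd w (\<lambda>x. f x \<bullet> c)) x = dd v (dd w f) x \<bullet> c" for c v w
    using dd_transform[OF smooth_openD(1)[OF assms(1)] assms(2), of "dd w (\<lambda>x. f x \<bullet> c)" "\<lambda>x. dd w f x \<bullet> c"]
      inn[OF assms(1)] inn[OF smooth_openD(3)[OF assms(1)] assms(2)] by simp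
  show ?thesis
  proof (rule euclidean_eqI)
    fix c :: 'b
    have "smooth_open U (\<lambda>x. f x \<bullet> c)"
      by (rule smooth_open_linear_compose[OF bounded_linear_inner_left assms(1)])
    from real[OF this] show "dd a (dd b f) x \<bullet> c = dd b (dd a f) x \<bullet> c" by (simp add: inn2)
  qed
qed

section \<open>Local graphs\<close>

lemma smooth_open_vec:
  fixes f :: "'a::euclidean_space \<Rightarrow> real^'n"
  assumes "open U" "\<And>k. smooth_open U (\<lambda>x. f x $ k)"
  shows "smooth_open U f"
proof -
  have eq: "(\<Sum>k\<in>UNIV. (f x $ k) *\<^sub>R axis k 1) = f x" for x
    using basis_expansion[of "f x"] by (simp add: scalar_mult_eq_scaleR)
  have "smooth_open U (\<lambda>x. \<Sum>k\<in>UNIV. (f x $ k) *\<^sub>R (axis k 1 :: real^'n))"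
    by (rule smooth_open_sum[OF assms(1) smooth_open_linear_compose[OF bounded_linear_scaleR_left assms(2)]])
  then show ?thesis unfolding eq .
qed

lemma smooth_open_det:
  fixes A :: "'a::euclidean_space \<Rightarrow> real^'n^'n"
  assumes "open U" "\<And>i j. smooth_open U (\<lambda>x. A x $ i $ j)"
  shows "smooth_open U (\<lambda>x. det (A x))"
proof -
  have "smooth_open U (\<lambda>x. \<Prod>i\<in>UNIV. A x $ i $ p i)" for p
    using assms unfolding smooth_open_def by (auto intro!: Ck_on_prod)
  then show ?thesis unfolding det_def
    by (intro smooth_open_sum smooth_open_mult smooth_open_const assms(1))
qed

lemma matrix_inv_works:
  fixes A :: "real^'n^'n"
  assumes "invertible A"
  shows "A ** matrix_inv A = mat 1" "matrix_inv A ** A = mat 1"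
proof -
  have "A ** matrix_inv A = mat 1 \<and> matrix_inv A ** A = mat 1"
    using assms unfolding invertible_def matrix_inv_def by (rule someI_ex)
  then show "A ** matrix_inv A = mat 1" "matrix_inv A ** A = mat 1" by auto
qed

text \<open>By Cramer's rule each coordinate of the solution is a quotient of determinants in the
  entries of A and b.\<close>

lemma smooth_open_solve:
  fixes A :: "'a::euclidean_space \<Rightarrow> real^'n^'n" and b :: "'a \<Rightarrow> real^'n"
  assumes "open U" "\<And>i j. smooth_open U (\<lambda>x. A x $ i $ j)" "smooth_open U b"
    and det: "\<And>x. x \<in> U \<Longrightarrow> det (A x) \<noteq> 0"
  shows "smooth_open U (\<lambda>x. matrix_inv (A x) *v b x)"
proof (rule smooth_open_vec[OF assms(1)])
  fix k
  let ?d = "\<lambda>x. det (\<chi> i j. if j = k then b x $ i else A x $ i $ j)"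
  have sb: "smooth_open U (\<lambda>x. b x $ i)" for i
    by (rule smooth_open_linear_compose[OF bounded_linear_vec_nth assms(3)])
  have "smooth_open U ?d"
  proof (rule smooth_open_det[OF assms(1)])
    show "smooth_open U (\<lambda>x. (\<chi> i j. if j = k then b x $ i else A x $ i $ j) $ i $ j)" for i j
      using sb[of i] assms(2)[of i j] by (cases "j = k") simp_all
  qed
  moreover have "smooth_open U (\<lambda>x. inverse (det (A x)))"
    by (rule smooth_open_inverse[OF smooth_open_det[OF assms(1,2)] det])
  moreover have "(matrix_inv (A x) *v b x) $ k = ?d x * inverse (det (A x))" if "x \<in> U" for x
  proof -
    have "A x *v (matrix_inv (A x) *v b x) = b x"
      using det[OF that] by (simp add: matrix_vector_mul_assoc invertible_det_nz matrix_inv_works)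
    then show ?thesis using cramer[OF det[OF that]] by (simp add: divide_inverse)
  qed
  ultimately show "smooth_open U (\<lambda>x. (matrix_inv (A x) *v b x) $ k)"
    using smooth_open_cong[OF smooth_open_mult] by (metis (no_types, lifting))
qed

lemma linear_blinfun_apply: "linear (blinfun_apply f)"
  using blinfun.bounded_linear_right linear_conv_bounded_linear bounded_linear.linear by blast

text \<open>In a spacetime \<open>(real^'n) \<times> real\<close> the second coordinate is time, and only maps preserving
  time are inverted.\<close>

lemma slice_derivative_linear:
  fixes f :: "(real^'n) \<times> real \<Rightarrow> 'b::euclidean_space"
  assumes "smooth_open U f" "x \<in> U"
  shows "linear (\<lambda>c. dd (c, 0) f x)"
    "dd v f x = dd (fst v, 0) f x + snd v *\<^sub>R dd (0, 1) f x"
proof -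
  note l = smooth_openD(5)[OF assms]
  show "linear (\<lambda>c. dd (c, 0) f x)"
  proof (rule linearI)
    fix a b :: "real^'n" and r
    show "dd (a + b, 0) f x = dd (a, 0) f x + dd (b, 0) f x"
      using linear_add[OF l, of "(a, 0)" "(b, 0)"] by simp
    show "dd (r *\<^sub>R a, 0) f x = r *\<^sub>R dd (a, 0) f x"
      using linear_scale[OF l, of r "(a, 0)"] by simp
  qed
  have "dd ((fst v, 0) + snd v *\<^sub>R (0, 1)) f x = dd (fst v, 0) f x + snd v *\<^sub>R dd (0, 1) f x"
    by (simp only: linear_add[OF l] linear_scale[OF l])
  then show "dd v f x = dd (fst v, 0) f x + snd v *\<^sub>R dd (0, 1) f x"
    by simp
qed

text \<open>Inverse function theorem for (y, t) -> (q(y, t), t). Injectivity of the spatial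
  derivative of q suffices, since the full derivative is block triangular. The inverse is smooth
  because its derivative is a smooth function of the inverse itself.\<close>

lemma slice_inverse:
  fixes q :: "(real^'n) \<times> real \<Rightarrow> real^'n"
  assumes q: "smooth_open U q" and x0: "x0 \<in> U" and inj: "inj (\<lambda>c. dd (c, 0) q x0)"
  obtains U' Z \<Psi> where "open U'" "x0 \<in> U'" "U' \<subseteq> U" "open Z"
    "homeomorphism U' Z (\<lambda>x. (q x, snd x)) \<Psi>" "smooth_open Z \<Psi>"
    "\<And>x. x \<in> U' \<Longrightarrow> inj (\<lambda>c. dd (c, 0) q x)"
proof -
  define A where "A x = matrix (\<lambda>c. dd (c, 0) q x)" for x
  have A: "A x *v c = dd (c, 0) q x" if "x \<in> U" for x c
    unfolding A_def
    by (rule matrix_works) (simp add: linear_matrix_vector_mul_eq slice_derivative_linear(1)[OF q that])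
  have openU: "open U" by (rule smooth_openD(1)[OF q])
  have Aij: "smooth_open U (\<lambda>x. A x $ i $ j)" for i j
    unfolding A_def matrix_def
    by (simp, rule smooth_open_linear_compose[OF bounded_linear_vec_nth smooth_openD(3)[OF q]])
  have sdet: "smooth_open U (\<lambda>x. det (A x))" by (rule smooth_open_det[OF openU Aij])
  define U1 where "U1 = {x \<in> U. det (A x) \<noteq> 0}"
  have "open U1"
    using continuous_open_preimage[OF smooth_openD(4)[OF sdet] openU, of "- {0}"]
      open_Compl[OF closed_singleton[of "0::real"]]
    by (simp add: U1_def vimage_def Int_def)
  have inj_iff: "inj (\<lambda>c. dd (c, 0) q x) \<longleftrightarrow> det (A x) \<noteq> 0" if "x \<in> U" for x
    unfolding A_def using det_nz_iff_inj[OF slice_derivative_linear(1)[OF q that]] by simp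
  have x1: "x0 \<in> U1" using x0 inj inj_iff by (simp add: U1_def)
  have q1: "smooth_open U1 q" by (rule smooth_open_subset[OF q \<open>open U1\<close>]) (auto simp: U1_def)
  define f where "f x = (q x, snd x)" for x
  define f' where "f' x = Blinfun (\<lambda>v. (dd v q x, snd v))" for x
  have "bounded_linear (\<lambda>v. (dd v q x, snd v))" if "x \<in> U1" for x
    using smooth_openD(5)[OF q1 that]
    by (auto intro!: bounded_linear_Pair bounded_linear_snd simp: linear_conv_bounded_linear)
  then have f'_app: "blinfun_apply (f' x) v = (dd v q x, snd v)" if "x \<in> U1" for x v
    using that by (simp add: f'_def bounded_linear_Blinfun_apply)
  have derf: "(f has_derivative blinfun_apply (f' x)) (at x)" if "x \<in> U1" for x
    unfolding f_def
    by (rule has_derivative_eq_rhs[OF has_derivative_Pair[OF smooth_openD(2)[OF q1 that]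
      bounded_linear_imp_has_derivative[OF bounded_linear_snd]]]) (simp add: f'_app that fun_eq_iff)
  have contf: "continuous_on U1 f'"
  proof (rule continuous_on_blinfun_componentwise)
    fix i :: "(real^'n) \<times> real"
    have "continuous_on U1 (\<lambda>x. (dd i q x, snd i))"
      by (intro continuous_intros smooth_openD(4)[OF smooth_openD(3)[OF q1]])
    then show "continuous_on U1 (\<lambda>x. blinfun_apply (f' x) i)"
      by (simp add: f'_app cong: continuous_on_cong)
  qed
  have "inj (blinfun_apply (f' x0))"
    using linear_injective_0[OF slice_derivative_linear(1)[OF q x0]] inj
    by (subst linear_injective_0[OF linear_blinfun_apply])
       (auto simp: f'_app x1 zero_prod_def)
  then obtain h where h: "linear h" "h \<circ> blinfun_apply (f' x0) = id"
    using linear_injective_left_inverse[OF linear_blinfun_apply] by blast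
  have invf: "Blinfun h o\<^sub>L f' x0 = id_blinfun"
    using h(1) pointfree_idE[OF h(2)]
    by (intro blinfun_eqI) (simp add: bounded_linear_Blinfun_apply linear_conv_bounded_linear)
  obtain U' V g g' where g: "open U'" "U' \<subseteq> U1" "x0 \<in> U'" "open V" "homeomorphism U' V f g"
    and g': "\<And>y. y \<in> V \<Longrightarrow> (g has_derivative g' y) (at y)"
      "\<And>y. y \<in> V \<Longrightarrow> g' y = inv (blinfun_apply (f' (g y)))"
      "\<And>y. y \<in> V \<Longrightarrow> bij (blinfun_apply (f' (g y)))"
    using inverse_function_theorem[OF \<open>open U1\<close> derf contf x1 invf] by metis
  have gV: "g ` V \<subseteq> U1" using g(2,5) by (auto simp: homeomorphism_def)
  \<comment> \<open>Solves the block triangular system: the time part of v is kept, its effect on q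
    is subtracted, and the rest is solved with the spatial matrix \<open>A x\<close>.\<close>
  define k where "k x v = (matrix_inv (A x) *v (fst v - snd v *\<^sub>R dd (0, 1) q x), snd v)" for x v
  have g'k: "g' y v = k (g y) v" if "y \<in> V" for y v
  proof -
    have gy: "g y \<in> U1" using gV that by auto
    let ?b = "fst v - snd v *\<^sub>R dd (0, 1) q (g y)"
    have "dd (matrix_inv (A (g y)) *v ?b, 0) q (g y) = A (g y) *v (matrix_inv (A (g y)) *v ?b)"
      using A gy by (simp add: U1_def)
    also have "\<dots> = ?b"
      using gy by (simp add: matrix_vector_mul_assoc invertible_det_nz matrix_inv_works U1_def)
    finally have "blinfun_apply (f' (g y)) (k (g y) v) = v"
      using gy slice_derivative_linear(2)[OF q1 gy, of "k (g y) v"] by (simp add: f'_app k_def prod_eq_iff)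
    then show ?thesis using g'(2,3)[OF that] by (metis bij_is_inj inv_f_eq)
  qed
  have k: "smooth_open U1 (\<lambda>x. k x v)" for v
    unfolding k_def
    by (intro smooth_open_Pair smooth_open_const \<open>open U1\<close> smooth_open_solve smooth_open_diff
      smooth_open_linear_compose[OF bounded_linear_scaleR_right] smooth_openD(3)[OF q1]
      smooth_open_subset[OF Aij]) (auto simp: U1_def)
  \<comment> \<open>Bootstrapping: if g is \<open>Ck_on j\<close>, then so is its derivative
    \<open>k (g y) v\<close>, hence g is \<open>Ck_on (Suc j)\<close>.\<close>
  have "Ck_on j V g" for j
  proof (induction j)
    case 0
    then show ?case using g(5) by (simp add: homeomorphism_def)
  next
    case (Suc j)
    have "Ck_on j V (\<lambda>y. k (g y) v)" for v
      using Ck_on_compose[OF g(4) \<open>open U1\<close> gV Suc, of "\<lambda>x. k x v"] k[of v]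
      by (simp add: smooth_open_def)
    then have "Ck_on j V (\<lambda>y. g' y v)" for v
      using Ck_on_cong[OF g(4), of "\<lambda>y. k (g y) v" "\<lambda>y. g' y v" j] g'k by simp
    then show ?case
      by (intro Ck_on_has_derivative_Suc[OF g(4) g'(1)])
  qed
  then have "smooth_open V g" using g(4) by (simp add: smooth_open_def)
  show ?thesis
    by (rule that[of U' V g])
      (use g \<open>smooth_open V g\<close> inj_iff in \<open>auto simp: f_def[abs_def] U1_def subset_iff\<close>)
qed

text \<open>For any frame \<open>\<xi>\<close> that is orthonormal in the metric induced by \<open>f\<close> at fixed time and any
  normal \<open>N\<close>, the normal velocity is the trace of the second fundamental form.  This
  formulation does not see tangential velocities, hence is invariant under reparametrization.\<close>

definition normal_mcf :: "((real^'n) \<times> real \<Rightarrow> 'v::euclidean_space) \<Rightarrow> (real^'n) \<times> real \<Rightarrow> bool" where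
  "normal_mcf f x \<longleftrightarrow> (\<forall>N. \<forall>\<xi> :: real^'n \<Rightarrow> real^'n. (\<forall>c. N \<bullet> dd (c, 0) f x = 0) \<longrightarrow>
     (\<forall>a\<in>Basis. \<forall>b\<in>Basis. dd (\<xi> a, 0) f x \<bullet> dd (\<xi> b, 0) f x = (if a = b then 1 else 0)) \<longrightarrow>
     N \<bullet> dd (0, 1) f x = (\<Sum>a\<in>Basis. N \<bullet> dd (\<xi> a, 0) (dd (\<xi> a, 0) f) x))"

lemma normal_mcf_cong:
  assumes "open U" "x \<in> U" "\<And>y. y \<in> U \<Longrightarrow> f y = g y" "normal_mcf f x"
  shows "normal_mcf g x"
proof -
  have 1: "dd v f y = dd v g y" if "y \<in> U" for v y
    using dd_transform[OF assms(1) that assms(3)] by simp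
  have "dd w (dd v f) x = dd w (dd v g) x" for v w
    using dd_transform[OF assms(1,2), of "dd v f" "dd v g"] 1 by simp
  then show ?thesis using assms(4) 1[OF assms(2)] by (simp add: normal_mcf_def)
qed

text \<open>Second order chain rule. The term with the second derivative of P is a first derivative
  of f, hence tangential when P preserves time.\<close>

lemma dd_dd_compose:
  assumes f: "smooth_open U f" and P: "smooth_open Z P" and PZ: "P ` Z \<subseteq> U" and z: "z \<in> Z"
  shows "dd v (\<lambda>z. f (P z)) z = dd (dd v P z) f (P z)"
    "dd v (dd v (\<lambda>z. f (P z))) z = dd (dd v P z) (dd (dd v P z) f) (P z) + dd (dd v (dd v P) z) f (P z)"
proof -
  have 1: "dd w (\<lambda>z. f (P z)) y = dd (dd w P y) f (P y)" if "y \<in> Z" for y w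
    by (rule dd_compose) (use smooth_openD(6)[OF f] smooth_openD(6)[OF P] PZ that in auto)
  show "dd v (\<lambda>z. f (P z)) z = dd (dd v P z) f (P z)" by (rule 1[OF z])
  have Pz: "P z \<in> U" using PZ z by auto
  have expand: "dd w f x = (\<Sum>b\<in>Basis. (w \<bullet> b) *\<^sub>R dd b f x)" if "x \<in> U" for w x
    using linear_sum[OF smooth_openD(5)[OF f that], of "\<lambda>b. (w \<bullet> b) *\<^sub>R b" Basis]
      linear_scale[OF smooth_openD(5)[OF f that]] by (simp add: euclidean_representation)
  have "dd v (dd v (\<lambda>z. f (P z))) z = dd v (\<lambda>y. \<Sum>b\<in>Basis. (dd v P y \<bullet> b) *\<^sub>R dd b f (P y)) z"
    using dd_transform[OF smooth_openD(1)[OF P] z, of "dd v (\<lambda>z. f (P z))"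
      "\<lambda>y. \<Sum>b\<in>Basis. (dd v P y \<bullet> b) *\<^sub>R dd b f (P y)"] 1 expand PZ by (simp add: image_subset_iff)
  also have "\<dots> = (\<Sum>b\<in>Basis. (dd v P z \<bullet> b) *\<^sub>R dd (dd v P z) (dd b f) (P z) + (dd v (dd v P) z \<bullet> b) *\<^sub>R dd b f (P z))"
  proof -
    have "((\<lambda>y. \<Sum>b\<in>Basis. (dd v P y \<bullet> b) *\<^sub>R dd b f (P y)) has_derivative
      (\<lambda>w. \<Sum>b\<in>Basis. (dd v P z \<bullet> b) *\<^sub>R dd (dd w P z) (dd b f) (P z) + (dd w (dd v P) z \<bullet> b) *\<^sub>R dd b f (P z))) (at z)"
      by (intro has_derivative_sum has_derivative_scaleR has_derivative_inner_left
        has_derivative_compose[of P _ z UNIV "dd _ f"] smooth_openD(2)[OF smooth_openD(3)[OF P] z]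
        smooth_openD(2)[OF P z] smooth_openD(2)[OF smooth_openD(3)[OF f] Pz])
    from dd_eqI[OF this] show ?thesis .
  qed
  also have "(\<Sum>b\<in>Basis. (dd v P z \<bullet> b) *\<^sub>R dd (dd v P z) (dd b f) (P z)) = dd (dd v P z) (dd (dd v P z) f) (P z)"
  proof -
    have "dd (dd v P z) (dd (dd v P z) f) (P z) = dd (dd v P z) (\<lambda>x. \<Sum>b\<in>Basis. (dd v P z \<bullet> b) *\<^sub>R dd b f x) (P z)"
      using dd_transform[OF smooth_openD(1)[OF f] Pz, of "dd (dd v P z) f"
        "\<lambda>x. \<Sum>b\<in>Basis. (dd v P z \<bullet> b) *\<^sub>R dd b f x"] expand by simp
    moreover have "((\<lambda>x. \<Sum>b\<in>Basis. (dd v P z \<bullet> b) *\<^sub>R dd b f x) has_derivative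
      (\<lambda>w. \<Sum>b\<in>Basis. (dd v P z \<bullet> b) *\<^sub>R dd w (dd b f) (P z))) (at (P z))"
      by (intro has_derivative_sum has_derivative_scaleR_right smooth_openD(2)[OF smooth_openD(3)[OF f] Pz])
    from dd_eqI[OF this] have "dd (dd v P z) (\<lambda>x. \<Sum>b\<in>Basis. (dd v P z \<bullet> b) *\<^sub>R dd b f x) (P z)
      = (\<Sum>b\<in>Basis. (dd v P z \<bullet> b) *\<^sub>R dd (dd v P z) (dd b f) (P z))" .
    ultimately show ?thesis by simp
  qed
  ultimately show "dd v (dd v (\<lambda>z. f (P z))) z = dd (dd v P z) (dd (dd v P z) f) (P z) + dd (dd v (dd v P) z) f (P z)"
    using expand[OF Pz, of "dd v (dd v P) z"] by (simp add: sum.distrib)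
qed

text \<open>As P preserves time, its second derivatives and the spatial part of its time derivative
  contribute only tangential vectors, which N annihilates. By \<open>surj\<close> a normal of the
  composition is a normal of f.\<close>

lemma normal_mcf_reparam:
  fixes f :: "(real^'n) \<times> real \<Rightarrow> 'v::euclidean_space" and P :: "(real^'n) \<times> real \<Rightarrow> (real^'n) \<times> real"
  assumes f: "smooth_open U f" and P: "smooth_open Z P" and PZ: "P ` Z \<subseteq> U" and z: "z \<in> Z"
    and snd: "\<And>y. y \<in> Z \<Longrightarrow> snd (P y) = snd y"
    and surj: "\<And>c. \<exists>c'. dd (c', 0) P z = (c, 0)"
    and mcf: "normal_mcf f (P z)"
  shows "normal_mcf (\<lambda>z. f (P z)) z"
  unfolding normal_mcf_def
proof (intro allI impI)
  fix N and \<xi> :: "real^'n \<Rightarrow> real^'n"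
  assume N: "\<forall>c. N \<bullet> dd (c, 0) (\<lambda>z. f (P z)) z = 0"
    and \<xi>: "\<forall>a\<in>Basis. \<forall>b\<in>Basis. dd (\<xi> a, 0) (\<lambda>z. f (P z)) z \<bullet> dd (\<xi> b, 0) (\<lambda>z. f (P z)) z = (if a = b then 1 else 0)"
  have Pz: "P z \<in> U" using PZ z by auto
  have openZ: "open Z" by (rule smooth_openD(1)[OF P])
  have snd1: "snd (dd v P y) = snd v" if "y \<in> Z" for v y
  proof -
    have "((\<lambda>y. snd (P y)) has_derivative (\<lambda>v. snd (dd v P y))) (at y)"
      by (rule has_derivative_snd[OF smooth_openD(2)[OF P that]])
    moreover have "((\<lambda>y. snd (P y)) has_derivative snd) (at y)"
      by (rule has_derivative_transform_within_open[OF bounded_linear_imp_has_derivative[OF bounded_linear_snd] openZ that])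
        (simp add: snd)
    ultimately show ?thesis using has_derivative_unique by metis
  qed
  have snd2: "snd (dd v (dd v P) z) = 0" for v
  proof -
    have "((\<lambda>y. snd (dd v P y)) has_derivative (\<lambda>w. snd (dd w (dd v P) z))) (at z)"
      by (rule has_derivative_snd[OF smooth_openD(2)[OF smooth_openD(3)[OF P] z]])
    moreover have "((\<lambda>y. snd (dd v P y)) has_derivative (\<lambda>w. 0)) (at z)"
      by (rule has_derivative_transform_within_open[OF has_derivative_const[of "snd v"] openZ z])
        (simp add: snd1)
    ultimately show ?thesis using has_derivative_unique by metis
  qed
  have p1: "dd (c, 0) P z = (fst (dd (c, 0) P z), 0)" for c
    using snd1[OF z, of "(c,0)"] by (simp add: prod_eq_iff)
  have p2: "dd (0, 1) P z = (fst (dd (0, 1) P z), 1)"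
    using snd1[OF z, of "(0,1)"] by (simp add: prod_eq_iff)
  have p3: "dd v (dd v P) z = (fst (dd v (dd v P) z), 0)" for v
    using snd2 by (simp add: prod_eq_iff)
  note c = dd_dd_compose[OF f P PZ z]
  have N': "N \<bullet> dd (c, 0) f (P z) = 0" for c
    using surj[of c] N c(1) by metis
  have "N \<bullet> dd (0, 1) f (P z) = (\<Sum>a\<in>Basis. N \<bullet> dd (fst (dd (\<xi> a, 0) P z), 0) (dd (fst (dd (\<xi> a, 0) P z), 0) f) (P z))"
    using mcf[unfolded normal_mcf_def, rule_format, of N "\<lambda>a. fst (dd (\<xi> a, 0) P z)"] N' \<xi>
    by (simp add: c(1) flip: p1)
  also have "\<dots> = (\<Sum>a\<in>Basis. N \<bullet> dd (\<xi> a, 0) (dd (\<xi> a, 0) (\<lambda>z. f (P z))) z)"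
  proof (intro sum.cong refl)
    fix a
    obtain e where e: "dd (\<xi> a, 0) P z = (e, 0)" using p1 by blast
    obtain r where r: "dd (\<xi> a, 0) (dd (\<xi> a, 0) P) z = (r, 0)" using p3 by blast
    show "N \<bullet> dd (fst (dd (\<xi> a, 0) P z), 0) (dd (fst (dd (\<xi> a, 0) P z), 0) f) (P z)
      = N \<bullet> dd (\<xi> a, 0) (dd (\<xi> a, 0) (\<lambda>z. f (P z))) z"
      unfolding c(2) e r inner_add_right N' by simp
  qed
  moreover have "N \<bullet> dd (0, 1) (\<lambda>z. f (P z)) z = N \<bullet> dd (0, 1) f (P z)"
  proof -
    obtain e where e: "dd (0, 1) P z = (e, 1)" using p2 by blast
    show ?thesis
      using slice_derivative_linear(2)[OF f Pz, of "(e, 1)"] N'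
      by (simp add: c(1) e inner_add_right)
  qed
  ultimately show "N \<bullet> dd (0, 1) (\<lambda>z. f (P z)) z = (\<Sum>a\<in>Basis. N \<bullet> dd (\<xi> a, 0) (dd (\<xi> a, 0) (\<lambda>z. f (P z))) z)"
    by simp
qed

section \<open>Graphs and the graphical flow equation\<close>

definition graph_map :: "((real^'n) \<times> real \<Rightarrow> real) \<Rightarrow> (real^'n) \<times> real \<Rightarrow> (real^'n) \<times> real" where
  "graph_map w z = (fst z, w z)"

lemma smooth_graph_map: "smooth_open U w \<Longrightarrow> smooth_open U (graph_map w)"
  unfolding graph_map_def[abs_def]
  by (rule smooth_open_Pair[OF smooth_open_linear[OF bounded_linear_fst smooth_openD(1)]])

lemma dd_graph_map:
  assumes "smooth_open U w" "z \<in> U"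
  shows "dd v (graph_map w) z = (fst v, dd v w z)"
    "dd v (dd v' (graph_map w)) z = (0, dd v (dd v' w) z)"
proof -
  have d: "dd v (graph_map w) z = (fst v, dd v w z)" if "z \<in> U" for v z
    unfolding graph_map_def[abs_def]
    by (rule dd_eqI[OF has_derivative_Pair[OF bounded_linear_imp_has_derivative[OF bounded_linear_fst] smooth_openD(2)[OF assms(1) that]]])
  then show "dd v (graph_map w) z = (fst v, dd v w z)" using assms by simp
  have "dd v (dd v' (graph_map w)) z = dd v (\<lambda>z. (fst v', dd v' w z)) z"
    using dd_transform[OF smooth_openD(1)[OF assms(1)] assms(2), of "dd v' (graph_map w)"] d by simp
  also have "\<dots> = (0, dd v (dd v' w) z)"
    by (rule dd_eqI[OF has_derivative_Pair[OF has_derivative_const smooth_openD(2)[OF smooth_openD(3)[OF assms(1)] assms(2)]]])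
  finally show "dd v (dd v' (graph_map w)) z = (0, dd v (dd v' w) z)" .
qed

text \<open>Injectivity of the horizontal part of the tangent map makes (y, t) ->
  (\<open>fst (f (y, t))\<close>, t) locally invertible. In the new parameters f is a graph, and the
  flow equation is inherited by \<open>normal_mcf_reparam\<close>.\<close>

lemma local_graph:
  fixes f :: "(real^'n) \<times> real \<Rightarrow> (real^'n) \<times> real"
  assumes f: "smooth_open U f" and x0: "x0 \<in> U" and inj: "inj (\<lambda>c. fst (dd (c, 0) f x0))"
  obtains U' Z \<Psi> w where "open U'" "x0 \<in> U'" "U' \<subseteq> U" "open Z"
    "homeomorphism U' Z (\<lambda>x. (fst (f x), snd x)) \<Psi>" "smooth_open Z \<Psi>" "smooth_open Z w"
    "\<And>z. z \<in> Z \<Longrightarrow> f (\<Psi> z) = graph_map w z"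
    "\<And>z. z \<in> Z \<Longrightarrow> normal_mcf f (\<Psi> z) \<Longrightarrow> normal_mcf (graph_map w) z"
proof -
  define q where "q x = fst (f x)" for x
  have q: "smooth_open U q"
    unfolding q_def[abs_def] by (rule smooth_open_linear_compose[OF bounded_linear_fst f])
  have dq: "dd v q x = fst (dd v f x)" if "x \<in> U" for v x
    unfolding q_def[abs_def] by (rule dd_eqI[OF has_derivative_fst[OF smooth_openD(2)[OF f that]]])
  have "inj (\<lambda>c. dd (c, 0) q x0)" using inj x0 by (simp add: dq)
  then obtain U' Z \<Psi> where U': "open U'" "x0 \<in> U'" "U' \<subseteq> U" "open Z"
    and hom: "homeomorphism U' Z (\<lambda>x. (q x, snd x)) \<Psi>" and \<Psi>: "smooth_open Z \<Psi>"
    by (rule slice_inverse[OF q x0])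
  have \<Psi>U': "\<Psi> z \<in> U'" and q\<Psi>: "q (\<Psi> z) = fst z" and snd\<Psi>: "snd (\<Psi> z) = snd z"
    if "z \<in> Z" for z
  proof -
    show "\<Psi> z \<in> U'" using homeomorphism_image2[OF hom] that by auto
    have "(q (\<Psi> z), snd (\<Psi> z)) = z" by (rule homeomorphism_apply2[OF hom that])
    then show "q (\<Psi> z) = fst z" "snd (\<Psi> z) = snd z" by (metis fst_conv, metis snd_conv)
  qed
  then have \<Psi>Z: "\<Psi> ` Z \<subseteq> U" using U'(3) by auto
  define w where "w z = snd (f (\<Psi> z))" for z
  have w: "smooth_open Z w"
    unfolding w_def[abs_def]
    by (rule smooth_open_linear_compose[OF bounded_linear_snd smooth_open_compose[OF \<Psi> f \<Psi>Z]])
  have fw: "f (\<Psi> z) = graph_map w z" if "z \<in> Z" for z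
    using q\<Psi>[OF that] by (simp add: graph_map_def w_def q_def prod_eq_iff)
  \<comment> \<open>\<open>\<Psi>\<close> inverts a time-preserving map. Differentiating
    \<open>\<Psi> (q x, snd x) = x\<close> in a spatial direction exhibits that direction in the
    range of its derivative.\<close>
  have surj: "\<exists>c'. dd (c', 0) \<Psi> z = (c, 0)" if z: "z \<in> Z" for z c
  proof -
    let ?x = "\<Psi> z"
    have xU: "?x \<in> U" "?x \<in> U'" using \<Psi>Z \<Psi>U' z by auto
    have \<Theta>x: "(q ?x, snd ?x) = z" using q\<Psi>[OF z] snd\<Psi>[OF z] by (simp add: prod_eq_iff)
    have d: "((\<lambda>x. (q x, snd x)) has_derivative (\<lambda>v. (dd v q ?x, snd v))) (at ?x)"
      by (intro has_derivative_Pair smooth_openD(2)[OF q xU(1)] bounded_linear_imp_has_derivative bounded_linear_snd)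
    have "((\<lambda>x. \<Psi> (q x, snd x)) has_derivative (\<lambda>v. dd (dd v q ?x, snd v) \<Psi> z)) (at ?x)"
      using has_derivative_compose[OF d, of \<Psi>] smooth_openD(2)[OF \<Psi> z] by (simp add: \<Theta>x)
    moreover have "((\<lambda>x. \<Psi> (q x, snd x)) has_derivative (\<lambda>v. v)) (at ?x)"
      by (rule has_derivative_transform_within_open[OF has_derivative_ident U'(1) xU(2)])
        (use hom in \<open>auto simp: homeomorphism_def\<close>)
    ultimately have "(\<lambda>v. dd (dd v q ?x, snd v) \<Psi> z) = (\<lambda>v. v)"
      by (rule has_derivative_unique)
    from fun_cong[OF this, of "(c, 0)"] show ?thesis by auto
  qed
  show ?thesis
  proof (rule that[of U' Z \<Psi> w])
    fix z assume z: "z \<in> Z" "normal_mcf f (\<Psi> z)"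
    from normal_mcf_reparam[OF f \<Psi> \<Psi>Z z(1) snd\<Psi> surj[OF z(1)] z(2)]
    show "normal_mcf (graph_map w) z"
      using normal_mcf_cong[OF U'(4) z(1), of "\<lambda>z. f (\<Psi> z)" "graph_map w"] fw by blast
  qed (use U' hom \<Psi> w fw surj in \<open>auto simp: q_def\<close>)
qed

definition grad :: "((real^'n) \<times> real \<Rightarrow> real) \<Rightarrow> (real^'n) \<times> real \<Rightarrow> real^'n" where
  "grad w z = (\<Sum>i\<in>Basis. dd (i, 0) w z *\<^sub>R i)"

lemma inner_grad:
  assumes "smooth_open U w" "z \<in> U"
  shows "grad w z \<bullet> c = dd (c, 0) w z"
proof -
  note l = slice_derivative_linear(1)[OF assms]
  have "dd (c, 0) w z = (\<Sum>i\<in>Basis. (c \<bullet> i) *\<^sub>R dd (i, 0) w z)"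
    using linear_sum[OF l, of "\<lambda>i. (c \<bullet> i) *\<^sub>R i" Basis] linear_scale[OF l]
    by (simp add: euclidean_representation)
  then show ?thesis by (simp add: grad_def inner_sum_left inner_commute[of c] mult.commute)
qed

text \<open>The frame inserted into \<open>normal_mcf\<close> comes from the inverse square root of
  the induced metric I + g g^T. The normal is taken as (-g, 1), whose pairing with the velocity and
  the second derivatives of the graph just reads off the derivatives of w.\<close>

lemma normal_mcf_graph:
  assumes w: "smooth_open U w" and z: "z \<in> U" and mcf: "normal_mcf (graph_map w) z"
  defines "g \<equiv> grad w z"
  shows "dd (0, 1) w z = (\<Sum>i\<in>Basis. dd (i, 0) (dd (i, 0) w) z) - dd (g, 0) (dd (g, 0) w) z / (1 + g \<bullet> g)"
proof -
  define G where "G = g \<bullet> g"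
  define s where "s = sqrt (1 + G)"
  \<comment> \<open>I - \<mu> g g^T is the inverse square root of the metric: it fixes the vectors
    orthogonal to g and scales g by \<open>1 - \<mu> * G = 1 / s\<close>.\<close>
  define \<mu> where "\<mu> = 1 / (s * (1 + s))"
  have G: "G \<ge> 0" by (simp add: G_def)
  have s: "s \<ge> 1" "s\<^sup>2 = 1 + G" using G by (auto simp: s_def)
  have mu1: "1 - \<mu> * G = 1 / s"
  proof -
    have "G = (s - 1) * (1 + s)" using s(2) by (simp add: power2_eq_square algebra_simps)
    then have "\<mu> * G = (s - 1) / s" using s(1) by (simp add: \<mu>_def)
    then show ?thesis using s(1) by (simp add: field_simps)
  qed
  have mu2: "\<mu> * \<mu> * G - 2 * \<mu> = - (1 / (1 + G))"
  proof -
    have G': "G = s * s - 1" using s(2) by (simp add: power2_eq_square)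
    have "\<mu> * G - 2 = - ((1 + s) / s)" using mu1 s(1) by (simp add: add_divide_distrib)
    have "\<mu> * \<mu> * G - 2 * \<mu> = \<mu> * (\<mu> * G - 2)" by (simp add: algebra_simps)
    also have "\<dots> = - (\<mu> * ((1 + s) / s))" unfolding \<open>\<mu> * G - 2 = - ((1 + s) / s)\<close> by simp
    also have "\<dots> = - (1 / (s * s))"
    proof -
      have "s \<noteq> 0" "1 + s \<noteq> 0" using s(1) by auto
      then show ?thesis by (simp add: \<mu>_def)
    qed
    finally show ?thesis by (simp add: G')
  qed
  define h where "h c d = dd (c, 0) (dd (d, 0) w) z" for c d
  have h_lin: "linear (\<lambda>c. h c d)" for d
    unfolding h_def by (rule slice_derivative_linear(1)[OF smooth_openD(3)[OF w] z])
  have h_sym: "h c d = h d c" for c d unfolding h_def by (rule dd_commute[OF w z])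
  define \<xi> where "\<xi> a = a - (\<mu> * (a \<bullet> g)) *\<^sub>R g" for a
  have hxx: "h (\<xi> a) (\<xi> a) = h a a - 2 * \<mu> * ((a \<bullet> g) * h a g) + \<mu> * \<mu> * ((a \<bullet> g)\<^sup>2 * h g g)" for a
  proof -
    have 1: "h (\<xi> a) d = h a d - (\<mu> * (a \<bullet> g)) * h g d" for d
      unfolding \<xi>_def by (simp add: linear_diff[OF h_lin] linear_scale[OF h_lin])
    have "h (\<xi> a) (\<xi> a) = h a (\<xi> a) - (\<mu> * (a \<bullet> g)) * h g (\<xi> a)" by (rule 1)
    also have "\<dots> = h a a - (\<mu> * (a \<bullet> g)) * h g a - (\<mu> * (a \<bullet> g)) * (h a g - (\<mu> * (a \<bullet> g)) * h g g)"
      by (simp add: h_sym[of a "\<xi> a"] h_sym[of g "\<xi> a"] 1)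
    finally show ?thesis using h_sym[of g a] by (simp add: algebra_simps power2_eq_square)
  qed
  have "(\<Sum>a\<in>Basis. (a \<bullet> g) * h a g) = h g g"
    using linear_sum[OF h_lin, of "\<lambda>a. (g \<bullet> a) *\<^sub>R a" Basis] linear_scale[OF h_lin]
      euclidean_representation[of g] by (simp add: inner_commute)
  moreover have "(\<Sum>a\<in>Basis. (a \<bullet> g)\<^sup>2 * h g g) = G * h g g"
    unfolding G_def euclidean_inner[of g g] by (simp add: sum_distrib_right power2_eq_square inner_commute)
  ultimately have "(\<Sum>a\<in>Basis. h (\<xi> a) (\<xi> a)) = (\<Sum>a\<in>Basis. h a a) - 2 * \<mu> * h g g + \<mu> * \<mu> * (G * h g g)"
    unfolding hxx sum.distrib sum_subtractf by (simp flip: sum_distrib_left)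
  also have "\<dots> = (\<Sum>a\<in>Basis. h a a) + (\<mu> * \<mu> * G - 2 * \<mu>) * h g g" by (simp add: algebra_simps)
  finally have tr: "(\<Sum>a\<in>Basis. h (\<xi> a) (\<xi> a)) = (\<Sum>a\<in>Basis. h a a) - h g g / (1 + G)"
    unfolding mu2 by simp
  have ig: "dd (c, 0) w z = g \<bullet> c" for c unfolding g_def by (rule inner_grad[OF w z, symmetric])
  have on: "dd (\<xi> a, 0) (graph_map w) z \<bullet> dd (\<xi> b, 0) (graph_map w) z = (if a = b then 1 else 0)"
    if "a \<in> Basis" "b \<in> Basis" for a b
  proof -
    have gx: "g \<bullet> \<xi> a = (a \<bullet> g) * (1 / s)" for a
      unfolding mu1[symmetric] by (simp add: \<xi>_def G_def algebra_simps inner_commute)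
    have "\<xi> a \<bullet> \<xi> b = a \<bullet> b + (\<mu> * \<mu> * G - 2 * \<mu>) * ((a \<bullet> g) * (b \<bullet> g))"
      by (simp add: \<xi>_def G_def algebra_simps inner_commute)
    also have "\<dots> = a \<bullet> b - (a \<bullet> g) * (b \<bullet> g) / (s * s)"
      unfolding mu2 using s(2) by (simp add: power2_eq_square)
    finally have "\<xi> a \<bullet> \<xi> b + (g \<bullet> \<xi> a) * (g \<bullet> \<xi> b) = a \<bullet> b"
      unfolding gx by simp
    then show ?thesis using that by (simp add: dd_graph_map[OF w z] ig inner_Basis)
  qed
  have "(- g, 1) \<bullet> dd (c, 0) (graph_map w) z = 0" for c
    by (simp add: dd_graph_map[OF w z] ig)
  with mcf[unfolded normal_mcf_def, rule_format, of "(- g, 1)" \<xi>] on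
  have "dd (0, 1) w z = (\<Sum>a\<in>Basis. h (\<xi> a) (\<xi> a))"
    by (simp add: dd_graph_map[OF w z] h_def)
  then show ?thesis unfolding tr by (simp add: h_def G_def)
qed

section \<open>The curvature estimate at a maximum point\<close>

lemma dd_arith:
  fixes f g :: "'a::euclidean_space \<Rightarrow> real"
  assumes f: "smooth_open U f" and g: "smooth_open U g" and x: "x \<in> U"
  shows dd_add: "dd v (\<lambda>x. f x + g x) x = dd v f x + dd v g x"
    and dd_diff: "dd v (\<lambda>x. f x - g x) x = dd v f x - dd v g x"
    and dd_mult: "dd v (\<lambda>x. f x * g x) x = f x * dd v g x + dd v f x * g x"
    and dd_cmult: "dd v (\<lambda>x. c * g x) x = c * dd v g x"
  by (rule dd_eqI[OF has_derivative_add[OF smooth_openD(2)[OF f x] smooth_openD(2)[OF g x]]],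
    rule dd_eqI[OF has_derivative_diff[OF smooth_openD(2)[OF f x] smooth_openD(2)[OF g x]]],
    rule dd_eqI[OF has_derivative_mult[OF smooth_openD(2)[OF f x] smooth_openD(2)[OF g x]]],
    rule dd_eqI[OF has_derivative_mult_right[OF smooth_openD(2)[OF g x]]])

lemma dd_sum:
  fixes f :: "'i \<Rightarrow> 'a::euclidean_space \<Rightarrow> real"
  assumes f: "\<And>i. i \<in> I \<Longrightarrow> smooth_open U (f i)" and x: "x \<in> U"
  shows "dd v (\<lambda>x. \<Sum>i\<in>I. f i x) x = (\<Sum>i\<in>I. dd v (f i) x)"
  by (rule dd_eqI[OF has_derivative_sum[OF smooth_openD(2)[OF f x]]])

lemma dd_dd_arith:
  fixes f g :: "'a::euclidean_space \<Rightarrow> real"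
  assumes f: "smooth_open U f" and g: "smooth_open U g" and x: "x \<in> U"
  shows dd_dd_add: "dd u (dd v (\<lambda>x. f x + g x)) x = dd u (dd v f) x + dd u (dd v g) x"
    and dd_dd_diff: "dd u (dd v (\<lambda>x. f x - g x)) x = dd u (dd v f) x - dd u (dd v g) x"
    and dd_dd_mult: "dd v (dd v (\<lambda>x. f x * g x)) x = f x * dd v (dd v g) x + 2 * (dd v f x * dd v g x) + dd v (dd v f) x * g x"
    and dd_dd_cmult: "dd u (dd v (\<lambda>x. c * g x)) x = c * dd u (dd v g) x"
proof -
  note o = smooth_openD(1)[OF f]
  have f': "smooth_open U (dd v f)" and g': "smooth_open U (dd v g)"
    using f g smooth_openD(3) by blast+
  have "dd u (dd v (\<lambda>x. f x + g x)) x = dd u (\<lambda>x. dd v f x + dd v g x) x"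
    using dd_transform[OF o x, of "dd v (\<lambda>x. f x + g x)" "\<lambda>x. dd v f x + dd v g x"] dd_add[OF f g] by simp
  then show "dd u (dd v (\<lambda>x. f x + g x)) x = dd u (dd v f) x + dd u (dd v g) x"
    by (simp add: dd_add[OF f' g' x])
  have "dd u (dd v (\<lambda>x. f x - g x)) x = dd u (\<lambda>x. dd v f x - dd v g x) x"
    using dd_transform[OF o x, of "dd v (\<lambda>x. f x - g x)" "\<lambda>x. dd v f x - dd v g x"] dd_diff[OF f g] by simp
  then show "dd u (dd v (\<lambda>x. f x - g x)) x = dd u (dd v f) x - dd u (dd v g) x"
    by (simp add: dd_diff[OF f' g' x])
  have "dd u (dd v (\<lambda>x. c * g x)) x = dd u (\<lambda>x. c * dd v g x) x"
    using dd_transform[OF o x, of "dd v (\<lambda>x. c * g x)" "\<lambda>x. c * dd v g x"] dd_cmult[OF g g] by simp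
  then show "dd u (dd v (\<lambda>x. c * g x)) x = c * dd u (dd v g) x"
    by (simp add: dd_cmult[OF g' g' x])
  have "dd v (dd v (\<lambda>x. f x * g x)) x = dd v (\<lambda>x. f x * dd v g x + dd v f x * g x) x"
    using dd_transform[OF o x, of "dd v (\<lambda>x. f x * g x)" "\<lambda>x. f x * dd v g x + dd v f x * g x"] dd_mult[OF f g] by simp
  also have "\<dots> = (f x * dd v (dd v g) x + dd v f x * dd v g x) + (dd v f x * dd v g x + dd v (dd v f) x * g x)"
    by (simp add: dd_add[OF smooth_open_mult[OF f g'] smooth_open_mult[OF f' g] x]
        dd_mult[OF f g' x] dd_mult[OF f' g x])
  finally show "dd v (dd v (\<lambda>x. f x * g x)) x = f x * dd v (dd v g) x + 2 * (dd v f x * dd v g x) + dd v (dd v f) x * g x"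
    by simp
qed

lemma dd_dd_sum:
  fixes f :: "'i \<Rightarrow> 'a::euclidean_space \<Rightarrow> real"
  assumes o: "open U" and f: "\<And>i. i \<in> I \<Longrightarrow> smooth_open U (f i)" and x: "x \<in> U"
  shows "dd u (dd v (\<lambda>x. \<Sum>i\<in>I. f i x)) x = (\<Sum>i\<in>I. dd u (dd v (f i)) x)"
proof -
  have "dd u (dd v (\<lambda>x. \<Sum>i\<in>I. f i x)) x = dd u (\<lambda>x. \<Sum>i\<in>I. dd v (f i) x) x"
    using dd_transform[OF o x, of "dd v (\<lambda>x. \<Sum>i\<in>I. f i x)" "\<lambda>x. \<Sum>i\<in>I. dd v (f i) x"] dd_sum[of I U f, OF f] by simp
  then show ?thesis by (simp add: dd_sum[OF smooth_openD(3)[OF f] x])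
qed

lemma dd_const: "dd v (\<lambda>x. c) x = 0"
  by (simp add: frechet_derivative_const)

lemma second_derivative_min:
  fixes f f' :: "real \<Rightarrow> real"
  assumes "d > 0" "\<And>s. \<bar>s\<bar> < d \<Longrightarrow> (f has_real_derivative f' s) (at s)"
    "(f' has_real_derivative l) (at 0)" "\<And>s. \<bar>s\<bar> < d \<Longrightarrow> f 0 \<le> f s"
  shows "f' 0 = 0" "l \<ge> 0"
proof -
  show f0: "f' 0 = 0"
    by (rule DERIV_local_min[OF assms(2) assms(1)]) (use assms(1,4) in auto)
  show "l \<ge> 0"
  proof (rule ccontr)
    assume "\<not> l \<ge> 0"
    then obtain e where e: "e > 0" "\<And>h. 0 < h \<Longrightarrow> h < e \<Longrightarrow> f' (0 + h) < f' 0"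
      using has_real_derivative_neg_dec_right[OF assms(3)] by auto
    define r where "r = min d e / 2"
    have r: "0 < r" "r < d" "r < e" using assms(1) e(1) by (auto simp: r_def)
    have "\<exists>z. 0 < z \<and> z < r \<and> f r - f 0 = (r - 0) * f' z"
      by (rule MVT2) (use r assms(2) in auto)
    then obtain z where "0 < z" "z < r" "f r - f 0 = r * f' z" by auto
    moreover have "f' z < 0" using e(2)[of z] f0 \<open>0 < z\<close> \<open>z < r\<close> r by simp
    ultimately have "f r < f 0" using mult_pos_neg[of r "f' z"] r(1) by linarith
    then show False using assms(4)[of r] r by simp
  qed
qed

text \<open>Only times up to that of z are compared, so z is an interior minimum in space but an end
  point in time: the time derivative merely has a sign.\<close>

lemma parabolic_min:
  fixes L :: "(real^'n) \<times> real \<Rightarrow> real"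
  assumes L: "smooth_open Z L" and z: "z \<in> Z" and L0: "L z = 0"
    and pos: "\<And>y. y \<in> Z \<Longrightarrow> snd y \<le> snd z \<Longrightarrow> 0 \<le> L y"
  shows "dd (c, 0) L z = 0" "dd (c, 0) (dd (c, 0) L) z \<ge> 0" "dd (0, 1) L z \<le> 0"
proof -
  have near: "\<exists>d>0. \<forall>s. \<bar>s\<bar> < d \<longrightarrow> z + s *\<^sub>R v \<in> Z" for v
  proof -
    obtain e where e: "e > 0" "ball z e \<subseteq> Z" using smooth_openD(1)[OF L] z openE by blast
    have "z + s *\<^sub>R v \<in> Z" if "\<bar>s\<bar> < e / (norm v + 1)" for s
    proof -
      have "\<bar>s\<bar> * norm v \<le> \<bar>s\<bar> * (norm v + 1)" by (simp add: mult_left_mono)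
      also have "\<dots> < e" using that by (simp add: pos_less_divide_eq add_nonneg_pos)
      finally have "dist z (z + s *\<^sub>R v) < e" by (simp add: dist_norm)
      then show ?thesis using e(2) by (metis mem_ball subsetD)
    qed
    then show ?thesis using e(1) by (intro exI[of _ "e / (norm v + 1)"]) (auto simp: add_nonneg_pos)
  qed
  have line: "((\<lambda>s. f (z + s *\<^sub>R v)) has_real_derivative dd v f (z + s *\<^sub>R v)) (at s)"
    if "smooth_open Z f" "z + s *\<^sub>R v \<in> Z" for f :: "(real^'n) \<times> real \<Rightarrow> real" and s v
    using smooth_open_line[OF that] by (simp add: has_real_derivative_iff_has_vector_derivative)
  obtain d where d: "d > 0" "\<And>s. \<bar>s\<bar> < d \<Longrightarrow> z + s *\<^sub>R (c, 0) \<in> Z" using near by blast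
  have "((\<lambda>s. dd (c, 0) L (z + s *\<^sub>R (c, 0))) has_real_derivative dd (c, 0) (dd (c, 0) L) z) (at 0)"
    using line[OF smooth_openD(3)[OF L], of 0 "(c, 0)" "(c, 0)"] z by (simp add: zero_prod_def[symmetric])
  note * = second_derivative_min[of d "\<lambda>s. L (z + s *\<^sub>R (c, 0))", OF d(1) line[OF L d(2)] this]
  have "L (z + 0 *\<^sub>R (c, 0)) \<le> L (z + s *\<^sub>R (c, 0))" if "\<bar>s\<bar> < d" for s
    using pos[OF d(2)[OF that]] L0 by (simp add: zero_prod_def[symmetric])
  from *[OF _ this] show "dd (c, 0) L z = 0" "dd (c, 0) (dd (c, 0) L) z \<ge> 0"
    by (simp_all add: zero_prod_def[symmetric])
  show "dd (0, 1) L z \<le> 0"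
  proof (rule ccontr)
    assume "\<not> dd (0, 1) L z \<le> 0"
    then have l: "0 < dd (0, 1) L z" by simp
    have "((\<lambda>s. L (z + s *\<^sub>R (0, 1))) has_real_derivative dd (0, 1) L z) (at 0)"
      using line[OF L, of 0 "(0, 1)"] z by (simp add: zero_prod_def[symmetric])
    from has_real_derivative_pos_inc_left[OF this l]
    have "\<exists>e>0. \<forall>h>0. h < e \<longrightarrow> L (z + (0 - h) *\<^sub>R (0, 1)) < L (z + 0 *\<^sub>R (0, 1))"
      by (simp only: UNIV_I simp_thms)
    then obtain e where e: "e > 0" "\<And>h. 0 < h \<Longrightarrow> h < e \<Longrightarrow> L (z + (0 - h) *\<^sub>R (0, 1)) < L (z + 0 *\<^sub>R (0, 1))"
      by blast
    obtain d where d: "d > 0" "\<And>s. \<bar>s\<bar> < d \<Longrightarrow> z + s *\<^sub>R (0, 1) \<in> Z" using near by blast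
    define h where "h = min d e / 2"
    have h: "0 < h" "h < d" "h < e" using d(1) e(1) by (auto simp: h_def)
    have "L (z + (- h) *\<^sub>R (0, 1)) < 0" using e(2)[of h] h L0 by (simp add: zero_prod_def[symmetric])
    moreover have "0 \<le> L (z + (- h) *\<^sub>R (0, 1))" by (rule pos) (use d(2)[of "- h"] h in auto)
    ultimately show False by simp
  qed
qed

definition hess :: "((real^'n) \<times> real \<Rightarrow> real) \<Rightarrow> (real^'n) \<times> real \<Rightarrow> real^'n \<Rightarrow> real^'n \<Rightarrow> real" where
  "hess w z c d = dd (c, 0) (dd (d, 0) w) z"

lemma hess_props:
  assumes w: "smooth_open Z w" and z: "z \<in> Z"
  shows "linear (\<lambda>c. hess w z c d)" "hess w z c d = hess w z d c"
    "(\<Sum>i\<in>Basis. (hess w z i c) *\<^sub>R i) \<bullet> d = hess w z d c"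
    "(\<Sum>i\<in>Basis. (d \<bullet> i) * hess w z i c) = hess w z d c"
proof -
  show l: "linear (\<lambda>c. hess w z c d)" for d
    unfolding hess_def by (rule slice_derivative_linear(1)[OF smooth_openD(3)[OF w] z])
  show "hess w z c d = hess w z d c" unfolding hess_def by (rule dd_commute[OF w z])
  show s: "(\<Sum>i\<in>Basis. (d \<bullet> i) * hess w z i c) = hess w z d c"
    using linear_sum[OF l, of "\<lambda>i. (d \<bullet> i) *\<^sub>R i" Basis c] linear_scale[OF l]
    by (simp add: euclidean_representation)
  show "(\<Sum>i\<in>Basis. (hess w z i c) *\<^sub>R i) \<bullet> d = hess w z d c"
    unfolding s[symmetric] by (simp add: inner_sum_left inner_commute[of d] mult.commute)
qed

text \<open>A maximum point of a quadratic form on the unit sphere is an eigenvector, by varying b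
  in orthogonal directions. Its eigenvalue is bounded by the Frobenius norm, by Cauchy-Schwarz in
  each column.\<close>

lemma hess_eigenvector:
  assumes w: "smooth_open Z w" and z: "z \<in> Z" and b: "norm b = 1"
    and max: "\<And>c. norm c = 1 \<Longrightarrow> hess w z c c \<le> hess w z b b"
  shows "hess w z b d = hess w z b b * (b \<bullet> d)" "(hess w z b b)\<^sup>2 \<le> (\<Sum>i\<in>Basis. \<Sum>j\<in>Basis. (hess w z i j)\<^sup>2)"
proof -
  let ?h = "hess w z"
  note l = hess_props(1)[OF w z] and sym = hess_props(2)[OF w z]
  have bb: "b \<bullet> b = 1" using b by (simp add: norm_eq_1)
  have le: "?h x x \<le> ?h b b * (x \<bullet> x)" for x
  proof (cases "x = 0")
    case True
    then show ?thesis using linear_0[OF l] by simp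
  next
    case False
    let ?y = "(1 / norm x) *\<^sub>R x"
    have "?h ?y ?y = (1 / norm x) * (1 / norm x) * ?h x x"
      using linear_scale[OF l, of "1 / norm x" x ?y] linear_scale[OF l, of "1 / norm x" x x] sym[of x ?y] by simp
    moreover have "?h ?y ?y \<le> ?h b b" using max[of ?y] False by simp
    ultimately have "(1 / norm x) * (1 / norm x) * ?h x x \<le> ?h b b" by simp
    from mult_left_mono[OF this, of "x \<bullet> x"] show ?thesis using False
      by (simp add: dot_square_norm power2_eq_square mult.commute)
  qed
  have orth: "?h b c = 0" if "b \<bullet> c = 0" for c
  proof -
    define C where "C = ?h b b * (c \<bullet> c) - ?h c c"
    have C: "C \<ge> 0" using le[of c] by (simp add: C_def)
    have q: "2 * s * ?h b c \<le> s\<^sup>2 * C" for s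
    proof -
      have "?h (b + s *\<^sub>R c) d = ?h b d + s * ?h c d" for d
        by (simp add: linear_add[OF l] linear_scale[OF l])
      then have "?h (b + s *\<^sub>R c) (b + s *\<^sub>R c) = ?h b b + 2 * s * ?h b c + s\<^sup>2 * ?h c c"
        using sym[of "b + s *\<^sub>R c"] sym[of c b] by (simp add: sym[of b "b + s *\<^sub>R c"] sym[of c "b + s *\<^sub>R c"] power2_eq_square algebra_simps)
      moreover have "(b + s *\<^sub>R c) \<bullet> (b + s *\<^sub>R c) = 1 + s\<^sup>2 * (c \<bullet> c)"
        using that bb by (simp add: algebra_simps inner_commute power2_eq_square)
      ultimately show ?thesis using le[of "b + s *\<^sub>R c"] by (simp add: C_def algebra_simps)
    qed
    \<comment> \<open>\<open>q\<close> compares a term linear in s with a quadratic one; this s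
      makes the linear term win unless \<open>?h b c = 0\<close>. C + 1 stands in for C, which may
      vanish.\<close>
    from q[of "?h b c / (C + 1)"] have "2 * (?h b c)\<^sup>2 / (C + 1) \<le> (?h b c)\<^sup>2 * (C / (C + 1)) / (C + 1)"
      by (simp add: power2_eq_square field_simps)
    also have "\<dots> \<le> (?h b c)\<^sup>2 * 1 / (C + 1)"
      using C by (intro divide_right_mono mult_left_mono) auto
    finally show ?thesis using C by (simp add: divide_le_cancel)
  qed
  show eig: "?h b d = ?h b b * (b \<bullet> d)" for d
  proof -
    have "?h (d - (b \<bullet> d) *\<^sub>R b) b = ?h d b - (b \<bullet> d) * ?h b b"
      by (simp add: linear_diff[OF l] linear_scale[OF l])
    moreover have "?h b (d - (b \<bullet> d) *\<^sub>R b) = 0"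
      by (rule orth) (simp add: inner_diff_right bb)
    ultimately show ?thesis using sym[of b d] sym[of b "d - (b \<bullet> d) *\<^sub>R b"] by (simp add: mult.commute)
  qed
  have "(\<Sum>j\<in>Basis. (b \<bullet> j)\<^sup>2) = 1" using euclidean_inner[of b b] bb by (simp add: power2_eq_square)
  then have "(?h b b)\<^sup>2 = (\<Sum>j\<in>Basis. (?h b b * (b \<bullet> j))\<^sup>2)"
    by (simp add: power_mult_distrib sum_distrib_left[symmetric])
  also have "\<dots> = (\<Sum>j\<in>Basis. (?h b j)\<^sup>2)"
    by (rule sum.cong[OF refl]) (rule arg_cong[where f="\<lambda>x. x\<^sup>2"], rule eig[symmetric])
  also have "\<dots> \<le> (\<Sum>j\<in>Basis. \<Sum>i\<in>Basis. (?h i j)\<^sup>2)"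
  proof (rule sum_mono)
    fix j
    let ?v = "\<Sum>i\<in>Basis. ?h i j *\<^sub>R i"
    have "\<bar>?h b j\<bar> \<le> norm ?v * norm b"
      using Cauchy_Schwarz_ineq2[of ?v b] hess_props(3)[OF w z, of j b] by simp
    then have "(?h b j)\<^sup>2 \<le> (norm ?v)\<^sup>2" using b power_mono[of "\<bar>?h b j\<bar>" "norm ?v" 2] by simp
    also have "\<dots> = (\<Sum>i\<in>Basis. (?v \<bullet> i)\<^sup>2)"
      unfolding dot_square_norm[symmetric] by (subst euclidean_inner) (simp add: power2_eq_square)
    also have "\<dots> = (\<Sum>i\<in>Basis. (?h i j)\<^sup>2)" by (simp only: hess_props(3)[OF w z])
    finally show "(?h b j)\<^sup>2 \<le> (\<Sum>i\<in>Basis. (?h i j)\<^sup>2)" .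
  qed
  also have "\<dots> = (\<Sum>i\<in>Basis. \<Sum>j\<in>Basis. (?h i j)\<^sup>2)" by (rule sum.swap)
  finally show "(?h b b)\<^sup>2 \<le> (\<Sum>i\<in>Basis. \<Sum>j\<in>Basis. (?h i j)\<^sup>2)" .
qed

text \<open>Where the gradient vanishes, the quasilinear term of the graph equation vanishes to second
  order, so only the cube of the Hessian survives in the second derivatives of the equation.\<close>

lemma graph_flow_derivatives:
  fixes w :: "(real^'n) \<times> real \<Rightarrow> real"
  assumes w: "smooth_open Z w" and z: "z \<in> Z" and mcf: "\<And>y. y \<in> Z \<Longrightarrow> normal_mcf (graph_map w) y"
    and crit: "grad w z = 0"
  shows "dd (0, 1) w z = (\<Sum>i\<in>Basis. dd (i, 0) (dd (i, 0) w) z)"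
    "dd (0, 1) (dd (c, 0) w) z = (\<Sum>i\<in>Basis. dd (i, 0) (dd (i, 0) (dd (c, 0) w)) z)"
    "dd (0, 1) (dd (c, 0) (dd (c, 0) w)) z = (\<Sum>i\<in>Basis. dd (i, 0) (dd (i, 0) (dd (c, 0) (dd (c, 0) w))) z)
      - 2 * (\<Sum>i\<in>Basis. \<Sum>j\<in>Basis. hess w z c i * hess w z c j * hess w z i j)"
proof -
  note o = smooth_openD(1)[OF w] and sm = smooth_openD(3)
  define q where "q i = dd (i, 0) w" for i :: "real^'n"
  have q: "smooth_open Z (q i)" for i unfolding q_def by (rule sm[OF w])
  have q0: "q i z = 0" for i using inner_grad[OF w z, of i] crit by (simp add: q_def)
  define S where "S y = inverse (1 + (\<Sum>i\<in>Basis. q i y * q i y))" for y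
  have S: "smooth_open Z S"
    unfolding S_def[abs_def]
  proof (rule smooth_open_inverse)
    show "smooth_open Z (\<lambda>y. 1 + (\<Sum>i\<in>Basis. q i y * q i y))"
      by (intro smooth_open_add smooth_open_const smooth_open_sum smooth_open_mult q o)
    show "1 + (\<Sum>i\<in>Basis. q i y * q i y) \<noteq> 0" for y
    proof -
      have "(\<Sum>i\<in>Basis. q i y * q i y) \<ge> 0" by (intro sum_nonneg) simp
      then show ?thesis by linarith
    qed
  qed
  \<comment> \<open>The quasilinear term is the sum of the products of \<open>q i\<close> and
    \<open>m i\<close>, both zero at z. Hence it vanishes there with its first derivatives, and its
    second derivatives need only first derivatives of the factors.\<close>
  define m where "m i y = (\<Sum>j\<in>Basis. q j y * (dd (i, 0) (q j) y * S y))" for i y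
  have m: "smooth_open Z (m i)" for i
    unfolding m_def[abs_def] by (intro smooth_open_sum smooth_open_mult q S sm[OF q] o)
  have m0: "m i z = 0" for i by (simp add: m_def q0)
  have dm: "dd (d, 0) (m i) z = (\<Sum>j\<in>Basis. hess w z d j * hess w z i j)" for d i
  proof -
    have S0: "S z = 1" by (simp add: S_def q0)
    have "dd (d, 0) (m i) z = (\<Sum>j\<in>Basis. dd (d, 0) (\<lambda>y. q j y * (dd (i, 0) (q j) y * S y)) z)"
      unfolding m_def[abs_def] by (rule dd_sum[OF _ z]) (intro smooth_open_mult q S sm[OF q])
    also have "\<dots> = (\<Sum>j\<in>Basis. dd (d, 0) (q j) z * dd (i, 0) (q j) z)"
      by (intro sum.cong refl) (simp add: dd_mult[OF q smooth_open_mult[OF sm[OF q] S] z] q0 S0)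
    finally show ?thesis by (simp add: hess_def q_def)
  qed
  define R where "R y = (\<Sum>i\<in>Basis. q i y * m i y)" for y
  have R: "smooth_open Z R" unfolding R_def[abs_def] by (intro smooth_open_sum smooth_open_mult q m o)
  have R0: "R z = 0" by (simp add: R_def q0)
  have dR: "dd v R z = 0" for v
    unfolding R_def[abs_def]
    by (simp add: dd_sum[OF smooth_open_mult[OF q m] z] dd_mult[OF q m z] q0 m0)
  have ddR: "dd (c, 0) (dd (c, 0) R) z = 2 * (\<Sum>i\<in>Basis. \<Sum>j\<in>Basis. hess w z c i * hess w z c j * hess w z i j)"
    unfolding R_def[abs_def]
    by (simp add: dd_dd_sum[OF o smooth_open_mult[OF q m] z] dd_dd_mult[OF q m z] q0 m0 dm sum_distrib_left mult.assoc)
      (simp add: q_def hess_def)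
  define D where "D y = (\<Sum>i\<in>Basis. dd (i, 0) (dd (i, 0) w) y)" for y
  have D: "smooth_open Z D" unfolding D_def[abs_def] by (intro smooth_open_sum sm[OF sm[OF w]] o)
  have eq: "dd (0, 1) w y = D y - R y" if y: "y \<in> Z" for y
  proof -
    let ?g = "grad w y"
    have gi: "?g \<bullet> i = q i y" for i using inner_grad[OF w y] by (simp add: q_def)
    have hq: "hess w y i j = dd (i, 0) (q j) y" for i j by (simp add: hess_def q_def)
    have "hess w y ?g ?g = (\<Sum>i\<in>Basis. q i y * hess w y i ?g)"
      unfolding hess_props(4)[OF w y, of ?g ?g, symmetric] gi ..
    also have "\<dots> = (\<Sum>i\<in>Basis. q i y * (\<Sum>j\<in>Basis. q j y * hess w y i j))"
    proof (intro sum.cong refl arg_cong2[of _ _ _ _ "(*)"])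
      fix i
      have "hess w y i ?g = hess w y ?g i" by (rule hess_props(2)[OF w y])
      also have "\<dots> = (\<Sum>j\<in>Basis. q j y * hess w y j i)"
        unfolding hess_props(4)[OF w y, of ?g i, symmetric] gi ..
      also have "\<dots> = (\<Sum>j\<in>Basis. q j y * hess w y i j)"
        by (intro sum.cong refl arg_cong2[of _ _ _ _ "(*)"] hess_props(2)[OF w y])
      finally show "hess w y i ?g = (\<Sum>j\<in>Basis. q j y * hess w y i j)" .
    qed
    finally have "dd (?g, 0) (dd (?g, 0) w) y = (\<Sum>i\<in>Basis. q i y * (\<Sum>j\<in>Basis. q j y * hess w y i j))"
      by (simp only: hess_def)
    moreover have "1 + ?g \<bullet> ?g = 1 + (\<Sum>i\<in>Basis. q i y * q i y)"
      by (subst euclidean_inner) (simp add: gi)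
    ultimately have "dd (?g, 0) (dd (?g, 0) w) y / (1 + ?g \<bullet> ?g) = (\<Sum>i\<in>Basis. q i y * (\<Sum>j\<in>Basis. q j y * hess w y i j)) * S y"
      by (simp only: S_def divide_inverse)
    also have "\<dots> = R y"
      unfolding R_def m_def hq by (simp only: sum_distrib_right mult.assoc)
    finally show ?thesis using normal_mcf_graph[OF w y mcf[OF y]] by (simp add: D_def)
  qed
  show "dd (0, 1) w z = (\<Sum>i\<in>Basis. dd (i, 0) (dd (i, 0) w) z)" using eq[OF z] R0 by (simp add: D_def)
  have comm: "dd u (dd v f) y = dd v (dd u f) y" if "smooth_open Z f" "y \<in> Z" for f :: "(real^'n) \<times> real \<Rightarrow> real" and u v y
    by (rule dd_commute[OF that])
  have comm2: "dd v (dd i (dd i f)) y = dd i (dd i (dd v f)) y" if f: "smooth_open Z f" and y: "y \<in> Z"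
    for f :: "(real^'n) \<times> real \<Rightarrow> real" and v i y
  proof -
    have "dd v (dd i (dd i f)) y = dd i (dd v (dd i f)) y" by (rule comm[OF sm[OF f] y])
    also have "\<dots> = dd i (dd i (dd v f)) y"
      using dd_transform[OF o y, of "dd v (dd i f)" "dd i (dd v f)"] comm[OF f] by simp
    finally show ?thesis .
  qed
  have 1: "dd (0, 1) (dd (c, 0) w) y = dd (c, 0) D y - dd (c, 0) R y" if y: "y \<in> Z" for y
  proof -
    have "dd (0, 1) (dd (c, 0) w) y = dd (c, 0) (dd (0, 1) w) y" by (rule comm[OF w y])
    also have "\<dots> = dd (c, 0) (\<lambda>y. D y - R y) y"
      using dd_transform[OF o y, of "dd (0, 1) w" "\<lambda>y. D y - R y"] eq by simp
    finally show ?thesis by (simp add: dd_diff[OF D R y])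
  qed
  have dD: "dd (c, 0) D y = (\<Sum>i\<in>Basis. dd (i, 0) (dd (i, 0) (dd (c, 0) w)) y)" if y: "y \<in> Z" for y
    unfolding D_def[abs_def] dd_sum[OF sm[OF sm[OF w]] y] by (intro sum.cong refl comm2[OF w y])
  show "dd (0, 1) (dd (c, 0) w) z = (\<Sum>i\<in>Basis. dd (i, 0) (dd (i, 0) (dd (c, 0) w)) z)"
    using 1[OF z] dR dD[OF z] by simp
  have "dd (0, 1) (dd (c, 0) (dd (c, 0) w)) z = dd (c, 0) (dd (0, 1) (dd (c, 0) w)) z"
    by (rule comm[OF sm[OF w] z])
  also have "\<dots> = dd (c, 0) (\<lambda>y. dd (c, 0) D y - dd (c, 0) R y) z"
    using dd_transform[OF o z, of "dd (0, 1) (dd (c, 0) w)" "\<lambda>y. dd (c, 0) D y - dd (c, 0) R y"] 1 by simp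
  also have "\<dots> = dd (c, 0) (dd (c, 0) D) z - dd (c, 0) (dd (c, 0) R) z"
    by (rule dd_diff[OF sm[OF D] sm[OF R] z])
  also have "dd (c, 0) (dd (c, 0) D) z = dd (c, 0) (\<lambda>y. \<Sum>i\<in>Basis. dd (i, 0) (dd (i, 0) (dd (c, 0) w)) y) z"
    using dd_transform[OF o z, of "dd (c, 0) D"] dD by simp
  also have "\<dots> = (\<Sum>i\<in>Basis. dd (i, 0) (dd (i, 0) (dd (c, 0) (dd (c, 0) w))) z)"
    unfolding dd_sum[OF sm[OF sm[OF sm[OF w]]] z] by (intro sum.cong refl comm2[OF sm[OF w] z])
  finally show "dd (0, 1) (dd (c, 0) (dd (c, 0) w)) z = (\<Sum>i\<in>Basis. dd (i, 0) (dd (i, 0) (dd (c, 0) (dd (c, 0) w))) z)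
      - 2 * (\<Sum>i\<in>Basis. \<Sum>j\<in>Basis. hess w z c i * hess w z c j * hess w z i j)"
    unfolding ddR .
qed

text \<open>The hypothesis \<open>max\<close> says that \<open>B \<eta> / ((1 + w\<^sub>b\<^sup>2) sqrt D)\<close> is
  maximal at \<open>z\<close>; it is squared and cleared of denominators to stay polynomial.\<close>

lemma maximum_point_estimate:
  fixes w :: "(real^'n) \<times> real \<Rightarrow> real" and a b :: "real^'n" and r2 s1 k \<beta> :: real
  assumes w: "smooth_open Z w" and z: "z \<in> Z" and mcf: "\<And>y. y \<in> Z \<Longrightarrow> normal_mcf (graph_map w) y"
    and crit: "grad w z = 0" and b: "norm b = 1"
    and hmax: "\<And>c. norm c = 1 \<Longrightarrow> hess w z c c \<le> hess w z b b"
    and \<kappa>: "hess w z b b > 0" and k: "k > 0"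
  defines "\<eta> \<equiv> \<lambda>y. r2 - fst y \<bullet> fst y - w y * w y + (snd y - s1)"
    and "D \<equiv> \<lambda>y. (\<beta> - dd (a, 0) w y) * (\<beta> - dd (a, 0) w y) - k * (1 + (\<Sum>i\<in>Basis. dd (i, 0) w y * dd (i, 0) w y))"
    and "E \<equiv> \<lambda>y. (1 + dd (b, 0) w y * dd (b, 0) w y) * (1 + dd (b, 0) w y * dd (b, 0) w y)"
    and "B \<equiv> dd (b, 0) (dd (b, 0) w)"
  assumes D0: "D z > 0" and \<eta>0: "\<eta> z > 0"
    and max: "\<And>y. y \<in> Z \<Longrightarrow> snd y \<le> snd z \<Longrightarrow> (B y * \<eta> y) * (B y * \<eta> y) * D z \<le> (B z * \<eta> z) * (B z * \<eta> z) * (E y * D y)"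
  shows "(\<eta> z)\<^sup>2 * k * (B z)\<^sup>2 / D z \<le> (\<beta>\<^sup>2 / k + 2) * (4 * (fst z \<bullet> fst z)) + \<eta> z * (2 * real CARD('n) + 1)"
proof -
  note o = smooth_openD(1)[OF w] and sm = smooth_openD(3)
  define q where "q c = dd (c, 0) w" for c :: "real^'n"
  have q: "smooth_open Z (q c)" for c unfolding q_def by (rule sm[OF w])
  have q0: "q c z = 0" for c using inner_grad[OF w z, of c] crit by (simp add: q_def)
  let ?h = "hess w z"
  have h: "dd (c, 0) (q d) z = ?h c d" for c d by (simp add: q_def hess_def)
  define \<kappa> where "\<kappa> = ?h b b"
  have Bz: "B z = \<kappa>" by (simp add: \<kappa>_def B_def hess_def)
  have kap: "\<kappa> > 0" using \<kappa> by (simp add: \<kappa>_def)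
  have eig: "?h b d = \<kappa> * (b \<bullet> d)" for d
    unfolding \<kappa>_def by (rule hess_eigenvector(1)[OF w z b hmax])
  have A2: "\<kappa>\<^sup>2 \<le> (\<Sum>i\<in>Basis. \<Sum>j\<in>Basis. (?h i j)\<^sup>2)"
    unfolding \<kappa>_def by (rule hess_eigenvector(2)[OF w z b hmax])
  have bb: "b \<bullet> b = 1" using b by (simp add: norm_eq_1)
  have bsum: "(\<Sum>i\<in>Basis. (b \<bullet> i) * (b \<bullet> i)) = 1" using euclidean_inner[of b b] bb by simp
  note flow = graph_flow_derivatives[OF w z mcf crit]
  define lap where "lap f = (\<Sum>i\<in>Basis. dd (i, 0) (dd (i, 0) f) z)" for f :: "(real^'n) \<times> real \<Rightarrow> real"
  have wt: "dd (0, 1) w z = lap w" and qt: "dd (0, 1) (q c) z = lap (q c)" for c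
    using flow(1) flow(2)[of c] by (simp_all add: lap_def q_def)
  have Bt: "dd (0, 1) B z = lap B - 2 * \<kappa> ^ 3"
  proof -
    have "(\<Sum>i\<in>Basis. \<Sum>j\<in>Basis. ?h b i * ?h b j * ?h i j) = (\<Sum>i\<in>Basis. \<kappa> * (b \<bullet> i) * (\<kappa> * (\<Sum>j\<in>Basis. (b \<bullet> j) * ?h j i)))"
    proof (intro sum.cong refl)
      fix i
      have "?h b i * ?h b j * ?h i j = \<kappa> * (b \<bullet> i) * (\<kappa> * ((b \<bullet> j) * ?h j i))" for j
        unfolding eig hess_props(2)[OF w z, of i j] by simp
      then show "(\<Sum>j\<in>Basis. ?h b i * ?h b j * ?h i j) = \<kappa> * (b \<bullet> i) * (\<kappa> * (\<Sum>j\<in>Basis. (b \<bullet> j) * ?h j i))"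
        by (simp only: sum_distrib_left)
    qed
    also have "\<dots> = \<kappa> ^ 3 * (\<Sum>i\<in>Basis. (b \<bullet> i) * (b \<bullet> i))"
      unfolding hess_props(4)[OF w z] by (simp add: eig sum_distrib_left power3_eq_cube mult_ac)
    finally show ?thesis using flow(3)[of b] bsum by (simp add: B_def lap_def)
  qed
  have B: "smooth_open Z B" unfolding B_def by (rule sm[OF sm[OF w]])
  \<comment> \<open>In the intended use w is a rotated copy of a graph u, and \<open>om\<close> is
    up to sign the quotient of the two gradient functions. Then \<open>D\<close> is
    \<open>vv w * (1 / vv u - k)\<close>, the rotated form of the denominator.\<close>
  define om where "om y = \<beta> - q a y" for y
  have om: "smooth_open Z om" unfolding om_def[abs_def] by (intro smooth_open_diff smooth_open_const o q)
  have om1: "dd v om z = - dd v (q a) z" and om2: "dd u (dd v om) z = - dd u (dd v (q a)) z" for u v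
  proof -
    have e: "dd v om y = - dd v (q a) y" if "y \<in> Z" for y v
      unfolding om_def[abs_def] using dd_diff[OF smooth_open_const[OF o] q that] by (simp add: dd_const)
    then show "dd v om z = - dd v (q a) z" using z by simp
    have "dd u (dd v om) z = dd u (\<lambda>y. (-1) * dd v (q a) y) z"
      using dd_transform[OF o z, of "dd v om" "\<lambda>y. (-1) * dd v (q a) y"] e by simp
    also have "\<dots> = (-1) * dd u (dd v (q a)) z" by (rule dd_cmult[OF sm[OF q] sm[OF q] z])
    finally show "dd u (dd v om) z = - dd u (dd v (q a)) z" by simp
  qed
  define S where "S y = (\<Sum>i\<in>Basis. q i y * q i y)" for y
  have S: "smooth_open Z S" unfolding S_def[abs_def] by (intro smooth_open_sum smooth_open_mult q o)
  have S0: "S z = 0" by (simp add: S_def q0)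
  have S1: "dd v S z = 0" for v
    unfolding S_def[abs_def] by (simp add: dd_sum[OF smooth_open_mult[OF q q] z] dd_mult[OF q q z] q0)
  have S2: "dd (c, 0) (dd (c, 0) S) z = 2 * (\<Sum>i\<in>Basis. (?h c i)\<^sup>2)" for c
    unfolding S_def[abs_def]
    by (simp add: dd_dd_sum[OF o smooth_open_mult[OF q q] z] dd_dd_mult[OF q q z] q0 h sum_distrib_left power2_eq_square)
  have D_eq: "D = (\<lambda>y. om y * om y - k * (1 + S y))"
    by (simp add: D_def om_def S_def q_def fun_eq_iff)
  have S': "smooth_open Z (\<lambda>y. 1 + S y)" by (intro smooth_open_add smooth_open_const o S)
  have oo: "smooth_open Z (\<lambda>y. om y * om y)" by (rule smooth_open_mult[OF om om])
  have kS: "smooth_open Z (\<lambda>y. k * (1 + S y))" by (rule smooth_open_mult[OF smooth_open_const[OF o] S'])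
  have Dsm: "smooth_open Z D" unfolding D_eq by (rule smooth_open_diff[OF oo kS])
  have om0: "om z = \<beta>" by (simp add: om_def q0)
  have S'1: "dd v (\<lambda>y. 1 + S y) z = 0" for v by (simp add: dd_add[OF smooth_open_const[OF o] S z] dd_const S1)
  have dd_c: "dd v (\<lambda>x. c) = (\<lambda>x. 0)" for v :: "(real^'n) \<times> real" and c :: real by (simp add: fun_eq_iff dd_const)
  have S'2: "dd (c, 0) (dd (c, 0) (\<lambda>y. 1 + S y)) z = 2 * (\<Sum>i\<in>Basis. (?h c i)\<^sup>2)" for c
    by (simp add: dd_dd_add[OF smooth_open_const[OF o] S z] dd_c S2)
  have D1: "dd v D z = - 2 * \<beta> * dd v (q a) z" for v
    unfolding D_eq by (simp add: dd_diff[OF oo kS z] dd_mult[OF om om z] dd_cmult[OF S' S' z] S'1 om0 om1)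
  have D2: "dd (c, 0) (dd (c, 0) D) z = 2 * (?h c a)\<^sup>2 - 2 * \<beta> * dd (c, 0) (dd (c, 0) (q a)) z - 2 * k * (\<Sum>i\<in>Basis. (?h c i)\<^sup>2)" for c
    unfolding D_eq
    by (simp add: dd_dd_diff[OF oo kS z] dd_dd_mult[OF om om z] dd_dd_cmult[OF S' S' z] S'2 om0 om1 om2 h power2_eq_square)
  have Dz: "D z = \<beta>\<^sup>2 - k" by (simp add: D_eq om0 S0 power2_eq_square)
  define P where "P y = 1 + q b y * q b y" for y
  have qq: "smooth_open Z (\<lambda>y. q b y * q b y)" by (rule smooth_open_mult[OF q q])
  have P: "smooth_open Z P" unfolding P_def[abs_def] by (intro smooth_open_add smooth_open_const o qq)
  have P0: "P z = 1" by (simp add: P_def q0)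
  have P1: "dd v P z = 0" for v
    unfolding P_def[abs_def] by (simp add: dd_add[OF smooth_open_const[OF o] qq z] dd_const dd_mult[OF q q z] q0)
  have P2: "dd (c, 0) (dd (c, 0) P) z = 2 * (\<kappa> * (b \<bullet> c))\<^sup>2" for c
    unfolding P_def[abs_def]
    by (simp add: dd_dd_add[OF smooth_open_const[OF o] qq z] dd_c dd_dd_mult[OF q q z] q0 h hess_props(2)[OF w z, of c b] eig power2_eq_square)
  have E_eq: "E = (\<lambda>y. P y * P y)" by (simp add: E_def P_def q_def fun_eq_iff)
  have E: "smooth_open Z E" unfolding E_eq by (rule smooth_open_mult[OF P P])
  have E0: "E z = 1" by (simp add: E_eq P0)
  have E1: "dd v E z = 0" for v unfolding E_eq by (simp add: dd_mult[OF P P z] P1)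
  have E2: "dd (c, 0) (dd (c, 0) E) z = 4 * (\<kappa> * (b \<bullet> c))\<^sup>2" for c
    unfolding E_eq by (simp add: dd_dd_mult[OF P P z] P0 P1 P2)
  define x2 where "x2 y = fst y \<bullet> fst y" for y :: "(real^'n) \<times> real"
  have fsts: "smooth_open Z fst" by (intro smooth_open_linear bounded_linear_fst o)
  have x2: "smooth_open Z x2" unfolding x2_def[abs_def] by (rule smooth_open_bilinear[OF bounded_bilinear_inner fsts fsts])
  have x2d: "dd v x2 y = 2 * (fst v \<bullet> fst y)" for v y
    unfolding x2_def[abs_def]
    by (rule trans[OF dd_eqI[OF has_derivative_inner[OF bounded_linear_imp_has_derivative[OF bounded_linear_fst] bounded_linear_imp_has_derivative[OF bounded_linear_fst]]]])
      (simp add: inner_commute)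
  have x2dd: "dd u (dd v x2) y = 2 * (fst v \<bullet> fst u)" for u v y
  proof -
    have "((\<lambda>y. 2 * (fst v \<bullet> fst y)) has_derivative (\<lambda>u. 2 * (fst v \<bullet> fst u))) (at y)"
      by (intro bounded_linear_imp_has_derivative bounded_linear_const_mult bounded_linear_compose[OF bounded_linear_inner_right bounded_linear_fst])
    from dd_eqI[OF this] show ?thesis by (simp add: x2d[abs_def])
  qed
  define tt where "tt y = snd y - s1" for y :: "(real^'n) \<times> real"
  have tts: "smooth_open Z tt"
    unfolding tt_def[abs_def] by (intro smooth_open_diff smooth_open_linear bounded_linear_snd smooth_open_const o)
  have ttd: "dd v tt = (\<lambda>y. snd v)" for v
  proof
    fix y
    have "(tt has_derivative (\<lambda>v. snd v - 0)) (at y)"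
      unfolding tt_def[abs_def] by (intro has_derivative_diff bounded_linear_imp_has_derivative[OF bounded_linear_snd] has_derivative_const)
    from dd_eqI[OF this] show "dd v tt y = snd v" by simp
  qed
  have ttd1: "dd v tt z = snd v" for v using fun_cong[OF ttd] .
  define g where "g y = r2 - x2 y" for y
  define g' where "g' y = g y - w y * w y" for y
  have g: "smooth_open Z g" unfolding g_def[abs_def] by (intro smooth_open_diff smooth_open_const o x2)
  have ww: "smooth_open Z (\<lambda>y. w y * w y)" by (rule smooth_open_mult[OF w w])
  have g': "smooth_open Z g'" unfolding g'_def[abs_def] by (rule smooth_open_diff[OF g ww])
  have \<eta>_eq: "\<eta> = (\<lambda>y. g' y + tt y)" by (simp add: \<eta>_def g_def g'_def x2_def tt_def fun_eq_iff)
  have \<eta>: "smooth_open Z \<eta>" unfolding \<eta>_eq by (rule smooth_open_add[OF g' tts])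
  have q0': "dd (c, 0) w z = 0" for c using q0[of c] by (simp add: q_def)
  have g1: "dd v g z = - (2 * (fst v \<bullet> fst z))" for v
    unfolding g_def[abs_def] by (simp add: dd_diff[OF smooth_open_const[OF o] x2 z] dd_const x2d)
  have g'1: "dd v g' z = dd v g z - 2 * w z * dd v w z" for v
    unfolding g'_def[abs_def] by (simp add: dd_diff[OF g ww z] dd_mult[OF w w z])
  have g2: "dd (c, 0) (dd (c, 0) g) z = - (2 * (c \<bullet> c))" for c
    unfolding g_def[abs_def] by (simp add: dd_dd_diff[OF smooth_open_const[OF o] x2 z] dd_c dd_const x2dd)
  have g'2: "dd (c, 0) (dd (c, 0) g') z = dd (c, 0) (dd (c, 0) g) z - 2 * w z * dd (c, 0) (dd (c, 0) w) z" for c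
    unfolding g'_def[abs_def] by (simp add: dd_dd_diff[OF g ww z] dd_dd_mult[OF w w z] q0')
  have \<eta>1: "dd (c, 0) \<eta> z = - 2 * (c \<bullet> fst z)" for c
    unfolding \<eta>_eq by (simp add: dd_add[OF g' tts z] ttd1 g'1 g1 q0')
  have \<eta>t: "dd (0, 1) \<eta> z = 1 - 2 * w z * lap w"
    unfolding \<eta>_eq by (simp add: dd_add[OF g' tts z] ttd1 g'1 g1 wt)
  have \<eta>2: "dd (c, 0) (dd (c, 0) \<eta>) z = - 2 * (c \<bullet> c) - 2 * w z * dd (c, 0) (dd (c, 0) w) z" for c
    unfolding \<eta>_eq by (simp add: dd_dd_add[OF g' tts z] ttd dd_const g'2 g2)
  define H where "H y = B y * \<eta> y" for y
  have H: "smooth_open Z H" unfolding H_def[abs_def] by (rule smooth_open_mult[OF B \<eta>])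
  define X where "X i = ?h i a" for i
  define Y where "Y i = dd (i, 0) \<eta> z" for i
  define Hd where "Hd i = dd (i, 0) H z" for i
  define e where "e = \<eta> z"
  define Dn where "Dn = D z"
  have e: "e > 0" and Dn: "Dn > 0" using \<eta>0 D0 by (simp_all add: e_def Dn_def)
  \<comment> \<open>The maximal value of the squared quotient. With it L is nonnegative up to the
    present time and zero at z, so that no quotient or square root has to be differentiated.\<close>
  define m where "m = (\<kappa> * e)\<^sup>2 / Dn"
  have ED: "smooth_open Z (\<lambda>y. E y * D y)" by (rule smooth_open_mult[OF E Dsm])
  have mED: "smooth_open Z (\<lambda>y. m * (E y * D y))" by (rule smooth_open_mult[OF smooth_open_const[OF o] ED])
  have HH: "smooth_open Z (\<lambda>y. H y * H y)" by (rule smooth_open_mult[OF H H])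
  define L where "L y = m * (E y * D y) - H y * H y" for y
  have Lsm: "smooth_open Z L" unfolding L_def[abs_def] by (rule smooth_open_diff[OF mED HH])
  have Hz: "H z = \<kappa> * e" by (simp add: H_def Bz e_def)
  have L0: "L z = 0" using Dn by (simp add: L_def m_def E0 Hz Dn_def[symmetric] power2_eq_square)
  have Lpos: "0 \<le> L y" if "y \<in> Z" "snd y \<le> snd z" for y
  proof -
    have "H y * H y * Dn \<le> (\<kappa> * e)\<^sup>2 * (E y * D y)"
      using max[OF that] by (simp add: H_def Bz Dn_def e_def power2_eq_square)
    then show ?thesis using Dn by (simp add: L_def m_def field_simps)
  qed
  note pm = parabolic_min[OF Lsm z L0 Lpos]
  have first: "m * (- 2 * \<beta> * X i) = 2 * (\<kappa> * e) * Hd i" for i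
  proof -
    have "dd (i, 0) L z = m * (- 2 * \<beta> * X i) - 2 * (\<kappa> * e) * Hd i"
      unfolding L_def[abs_def] dd_diff[OF mED HH z] dd_cmult[OF ED ED z] dd_mult[OF E Dsm z] dd_mult[OF H H z]
      by (simp add: E1 E0 D1 h X_def Hd_def Hz)
    then show ?thesis using pm(1)[of i] by simp
  qed
  have Hd: "Hd i = e * dd (i, 0) B z + \<kappa> * Y i" for i
    by (simp add: Hd_def H_def[abs_def] dd_mult[OF B \<eta> z] Bz e_def Y_def)
  \<comment> \<open>The vanishing spatial gradient of L makes the derivatives of H proportional to
    those of the gradient component \<open>q a\<close>. With \<open>Hd\<close> this eliminates the
    first derivatives of B.\<close>
  have HdX: "Hd i = - (\<kappa> * e * \<beta> / Dn) * X i" for i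
  proof -
    have "\<kappa> * e * (Dn * Hd i) = \<kappa> * e * (- (\<beta> * \<kappa> * e * X i))"
      using first[of i] Dn by (simp add: m_def field_simps power2_eq_square)
    moreover have "\<kappa> * e \<noteq> 0" using kap e by simp
    ultimately have "Dn * Hd i = - (\<beta> * \<kappa> * e * X i)"
      using mult_left_cancel by blast
    then show ?thesis using Dn by (simp add: field_simps)
  qed
  define A where "A i = (\<Sum>j\<in>Basis. (?h i j)\<^sup>2)" for i
  have second: "0 \<le> m * (4 * (\<kappa> * (b \<bullet> i))\<^sup>2 * Dn + (2 * (X i)\<^sup>2 - 2 * \<beta> * dd (i, 0) (dd (i, 0) (q a)) z - 2 * k * A i))
     - (2 * (\<kappa> * e) * (\<kappa> * dd (i, 0) (dd (i, 0) \<eta>) z + 2 * (dd (i, 0) B z * Y i) + dd (i, 0) (dd (i, 0) B) z * e) + 2 * (Hd i)\<^sup>2)" for i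
  proof -
    have HHi: "dd (i, 0) (dd (i, 0) H) z = \<kappa> * dd (i, 0) (dd (i, 0) \<eta>) z + 2 * (dd (i, 0) B z * Y i) + dd (i, 0) (dd (i, 0) B) z * e"
      by (simp add: H_def[abs_def] dd_dd_mult[OF B \<eta> z] Bz e_def Y_def)
    have "dd (i, 0) (dd (i, 0) L) z = m * (dd (i, 0) (dd (i, 0) D) z + 4 * (\<kappa> * (b \<bullet> i))\<^sup>2 * Dn)
      - (2 * (\<kappa> * e * dd (i, 0) (dd (i, 0) H) z) + 2 * (Hd i * Hd i))"
      unfolding L_def[abs_def] dd_dd_diff[OF mED HH z] dd_dd_cmult[OF ED ED z] dd_dd_mult[OF E Dsm z] dd_dd_mult[OF H H z]
      by (simp add: E0 E1 E2 Hz Hd_def Dn_def)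
    then show ?thesis
      using pm(2)[of i] by (simp add: D2 HHi X_def A_def power2_eq_square algebra_simps)
  qed
  have time: "m * (- 2 * \<beta> * lap (q a)) - 2 * (\<kappa> * e) * (\<kappa> * (1 - 2 * w z * lap w) + (lap B - 2 * \<kappa> ^ 3) * e) \<le> 0"
  proof -
    have "dd (0, 1) H z = \<kappa> * (1 - 2 * w z * lap w) + (lap B - 2 * \<kappa> ^ 3) * e"
      by (simp add: H_def[abs_def] dd_mult[OF B \<eta> z] Bz e_def \<eta>t Bt)
    moreover have "dd (0, 1) L z = m * (- 2 * \<beta> * lap (q a)) - 2 * (\<kappa> * e) * dd (0, 1) H z"
      unfolding L_def[abs_def] dd_diff[OF mED HH z] dd_cmult[OF ED ED z] dd_mult[OF E Dsm z] dd_mult[OF H H z]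
      by (simp add: E1 E0 D1 qt Hz)
    ultimately show ?thesis using pm(3) by simp
  qed
  let ?\<Sigma> = "\<lambda>f. \<Sum>i\<in>(Basis :: (real^'n) set). f i :: real"
  have lap\<eta>: "lap \<eta> = - 2 * real CARD('n) - 2 * w z * lap w"
    unfolding lap_def by (simp add: \<eta>2 sum.distrib sum_subtractf sum_negf sum_distrib_left inner_Basis algebra_simps)
  have "0 \<le> ?\<Sigma> (\<lambda>i. m * (4 * (\<kappa> * (b \<bullet> i))\<^sup>2 * Dn + (2 * (X i)\<^sup>2 - 2 * \<beta> * dd (i, 0) (dd (i, 0) (q a)) z - 2 * k * A i))
     - (2 * (\<kappa> * e) * (\<kappa> * dd (i, 0) (dd (i, 0) \<eta>) z + 2 * (dd (i, 0) B z * Y i) + dd (i, 0) (dd (i, 0) B) z * e) + 2 * (Hd i)\<^sup>2))"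
    by (rule sum_nonneg) (rule second)
  also have "\<dots> = m * (4 * \<kappa>\<^sup>2 * Dn * ?\<Sigma> (\<lambda>i. (b \<bullet> i) * (b \<bullet> i)) + 2 * ?\<Sigma> (\<lambda>i. (X i)\<^sup>2) - 2 * \<beta> * lap (q a) - 2 * k * ?\<Sigma> A)
     - 2 * (\<kappa> * e) * (\<kappa> * lap \<eta> + 2 * ?\<Sigma> (\<lambda>i. dd (i, 0) B z * Y i) + lap B * e) - 2 * ?\<Sigma> (\<lambda>i. (Hd i)\<^sup>2)"
    unfolding lap_def
    by (simp add: sum.distrib sum_subtractf sum_distrib_left sum_distrib_right power2_eq_square algebra_simps)
  finally have sec: "0 \<le> m * (4 * \<kappa>\<^sup>2 * Dn + 2 * ?\<Sigma> (\<lambda>i. (X i)\<^sup>2) - 2 * \<beta> * lap (q a) - 2 * k * ?\<Sigma> A)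
     - 2 * (\<kappa> * e) * (\<kappa> * lap \<eta> + 2 * ?\<Sigma> (\<lambda>i. dd (i, 0) B z * Y i) + lap B * e) - 2 * ?\<Sigma> (\<lambda>i. (Hd i)\<^sup>2)"
    by (simp add: bsum)
  define SX where "SX = ?\<Sigma> (\<lambda>i. (X i)\<^sup>2)"
  define SY where "SY = ?\<Sigma> (\<lambda>i. (Y i)\<^sup>2)"
  define SXY where "SXY = ?\<Sigma> (\<lambda>i. X i * Y i)"
  define NN where "NN = 2 * real CARD('n) + 1"
  have SB: "e * ?\<Sigma> (\<lambda>i. dd (i, 0) B z * Y i) = - (\<kappa> * e * \<beta> / Dn) * SXY - \<kappa> * SY"
  proof -
    have "e * dd (i, 0) B z = - (\<kappa> * e * \<beta> / Dn) * X i - \<kappa> * Y i" for i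
      using Hd[of i] HdX[of i] by simp
    then have "e * (dd (i, 0) B z * Y i) = - (\<kappa> * e * \<beta> / Dn) * (X i * Y i) - \<kappa> * (Y i)\<^sup>2" for i
      by (simp only: mult.assoc[symmetric]) (simp add: power2_eq_square algebra_simps)
    then show ?thesis by (simp only: sum_distrib_left sum_subtractf SXY_def SY_def)
  qed
  have SH: "?\<Sigma> (\<lambda>i. (Hd i)\<^sup>2) = (\<kappa> * e * \<beta> / Dn)\<^sup>2 * SX"
    unfolding HdX SX_def sum_distrib_left
    by (intro sum.cong refl) (simp add: power_mult_distrib power_divide)
  \<comment> \<open>The summed second order condition minus the time condition: the Laplacians of
    \<open>q a\<close>, of B and of w all cancel.\<close>
  have "0 \<le> m * (4 * \<kappa>\<^sup>2 * Dn + 2 * SX - 2 * k * ?\<Sigma> A)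
     - 2 * (\<kappa> * e) * (2 * \<kappa> ^ 3 * e - \<kappa> * NN) - 4 * \<kappa> * (e * ?\<Sigma> (\<lambda>i. dd (i, 0) B z * Y i)) - 2 * ?\<Sigma> (\<lambda>i. (Hd i)\<^sup>2)"
    using sec time unfolding lap\<eta> SX_def[symmetric] NN_def by (simp add: algebra_simps)
  \<comment> \<open>The term \<open>4 * \<kappa>\<^sup>2 * Dn\<close>, which stems from E, cancels
    the cubic term of the flow equation; this is why the second derivative is divided by
    \<open>1 + w\<^sub>b\<^sup>2\<close>.\<close>
  also have "\<dots> = 2 * \<kappa>\<^sup>2 * (e\<^sup>2 / Dn * (SX - k * ?\<Sigma> A) + e * NN + 2 * (e * \<beta> / Dn * SXY + SY) - (e * \<beta> / Dn)\<^sup>2 * SX)"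
    unfolding SB SH using Dn by (simp add: m_def field_simps power2_eq_square power3_eq_cube)
  finally have main: "0 \<le> e\<^sup>2 / Dn * (SX - k * ?\<Sigma> A) + e * NN + 2 * (e * \<beta> / Dn * SXY + SY) - (e * \<beta> / Dn)\<^sup>2 * SX"
    using kap by (simp add: zero_le_mult_iff)
  \<comment> \<open>Young's inequality with the weight for which the SX terms match exactly: since
    \<open>\<beta>\<^sup>2 = Dn + k\<close>, the one produced here and the one in
    \<open>main\<close> add up to the one that \<open>main\<close> subtracts.\<close>
  have young: "2 * (e * \<beta> / Dn * SXY) \<le> e\<^sup>2 * k / Dn\<^sup>2 * SX + \<beta>\<^sup>2 / k * SY"
  proof -
    have "0 \<le> ?\<Sigma> (\<lambda>i. (e * sqrt k / Dn * X i - \<beta> / sqrt k * Y i)\<^sup>2)" by (intro sum_nonneg) simp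
    also have "\<dots> = ?\<Sigma> (\<lambda>i. (e * sqrt k / Dn)\<^sup>2 * (X i)\<^sup>2 + (\<beta> / sqrt k)\<^sup>2 * (Y i)\<^sup>2 - 2 * (e * sqrt k / Dn * (\<beta> / sqrt k)) * (X i * Y i))"
      by (intro sum.cong refl) (simp add: power2_eq_square algebra_simps)
    also have "\<dots> = (e * sqrt k / Dn)\<^sup>2 * SX + (\<beta> / sqrt k)\<^sup>2 * SY - 2 * (e * sqrt k / Dn * (\<beta> / sqrt k)) * SXY"
      by (simp add: sum.distrib sum_subtractf sum_distrib_left SX_def SY_def SXY_def)
    also have "\<dots> = e\<^sup>2 * k / Dn\<^sup>2 * SX + \<beta>\<^sup>2 / k * SY - 2 * (e * \<beta> / Dn * SXY)"
      using k by (simp add: power_mult_distrib power_divide)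
    finally show ?thesis by simp
  qed
  have "e\<^sup>2 / Dn * SX + e\<^sup>2 * k / Dn\<^sup>2 * SX = (e * \<beta> / Dn)\<^sup>2 * SX"
  proof -
    have "\<beta>\<^sup>2 = Dn + k" by (simp add: Dn_def Dz)
    show ?thesis
      unfolding power_mult_distrib power_divide \<open>\<beta>\<^sup>2 = Dn + k\<close> using Dn by (simp add: field_simps power2_eq_square)
  qed
  with main young have "e\<^sup>2 / Dn * (k * ?\<Sigma> A) \<le> (\<beta>\<^sup>2 / k + 2) * SY + e * NN"
    unfolding right_diff_distrib distrib_right distrib_left by linarith
  moreover have "e\<^sup>2 / Dn * (k * \<kappa>\<^sup>2) \<le> e\<^sup>2 / Dn * (k * ?\<Sigma> A)"
    using A2 Dn k by (intro mult_left_mono) (auto simp: A_def)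
  moreover have "SY = 4 * (fst z \<bullet> fst z)"
    unfolding SY_def Y_def \<eta>1 by (subst euclidean_inner) (simp add: power_mult_distrib sum_distrib_left inner_commute power2_eq_square)
  ultimately show ?thesis
    by (simp add: e_def[symmetric] Bz Dn_def[symmetric] NN_def mult_ac)
qed

section \<open>Rewriting a graph over its tangent plane\<close>

text \<open>Reflection in the hyperplane orthogonal to a - b. A reflection is convenient because it
  is its own inverse.\<close>

lemma householder_exists:
  fixes a b :: "'a::real_inner"
  assumes "norm a = norm b"
  obtains Q where "bounded_linear Q" "\<And>x y. Q x \<bullet> Q y = x \<bullet> y" "\<And>x. Q (Q x) = x" "Q a = b"
proof -
  define n where "n = a - b"
  \<comment> \<open>For a = b the quotient is 0 by convention and Q is the identity.\<close>
  define Q where "Q x = x - (2 * (x \<bullet> n) / (n \<bullet> n)) *\<^sub>R n" for x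
  have nn: "n \<bullet> n = 2 * (a \<bullet> n)"
    using assms by (simp add: n_def norm_eq algebra_simps inner_commute)
  have Qin: "Q x \<bullet> y = x \<bullet> Q y" for x y
    by (simp add: Q_def inner_diff_left inner_diff_right inner_commute)
  have QQ: "Q (Q x) = x" for x
  proof (cases "n = 0")
    case False
    then show ?thesis by (simp add: Q_def inner_diff_left)
  qed (simp add: Q_def)
  have "Q a = b"
  proof (cases "n = 0")
    case False
    then have "2 * (a \<bullet> n) / (n \<bullet> n) = 1" unfolding nn[symmetric] by simp
    then show ?thesis unfolding Q_def by (simp only: scaleR_one) (simp add: n_def)
  qed (simp add: Q_def n_def)
  moreover have "bounded_linear Q"
    unfolding Q_def[abs_def]
    by (intro bounded_linear_sub bounded_linear_ident bounded_linear_scaleR_const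
      bounded_linear_compose[OF bounded_linear_divide] bounded_linear_const_mult bounded_linear_inner_left)
  ultimately show ?thesis
    by (intro that[of Q]) (auto simp: QQ Qin)
qed

lemma dd_linear:
  assumes "bounded_linear Q" "smooth_open U f" "x \<in> U"
  shows "dd v (\<lambda>x. Q (f x)) x = Q (dd v f x)"
    "dd u (dd v (\<lambda>x. Q (f x))) x = Q (dd u (dd v f) x)"
proof -
  have d: "dd v (\<lambda>x. Q (f x)) x = Q (dd v f x)" if "x \<in> U" "smooth_open U f" for f x v
    by (rule dd_eqI[OF bounded_linear.has_derivative[OF assms(1) smooth_openD(2)[OF that(2,1)]]])
  show "dd v (\<lambda>x. Q (f x)) x = Q (dd v f x)" by (rule d[OF assms(3,2)])
  have "dd u (dd v (\<lambda>x. Q (f x))) x = dd u (\<lambda>x. Q (dd v f x)) x"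
    using dd_transform[OF smooth_openD(1)[OF assms(2)] assms(3), of "dd v (\<lambda>x. Q (f x))" "\<lambda>x. Q (dd v f x)"]
      d[OF _ assms(2)] by simp
  then show "dd u (dd v (\<lambda>x. Q (f x))) x = Q (dd u (dd v f) x)"
    using d[OF assms(3) smooth_openD(3)[OF assms(2)]] by simp
qed

text \<open>Inner products of derivatives are unchanged, so orthonormal frames correspond; a normal
  N of the image is pulled back by the adjoint of Q.\<close>

lemma normal_mcf_isometry:
  fixes Q :: "'a::euclidean_space \<Rightarrow> 'b::euclidean_space"
  assumes Q: "bounded_linear Q" and iso: "\<And>x y. Q x \<bullet> Q y = x \<bullet> y"
    and f: "smooth_open U f" and x: "x \<in> U" and mcf: "normal_mcf f x"
  shows "normal_mcf (\<lambda>x. Q (f x)) x"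
  unfolding normal_mcf_def
proof (intro allI impI)
  fix N and \<xi> :: "real^'c \<Rightarrow> real^'c"
  assume N: "\<forall>c. N \<bullet> dd (c, 0) (\<lambda>x. Q (f x)) x = 0"
    and \<xi>: "\<forall>a\<in>Basis. \<forall>b\<in>Basis. dd (\<xi> a, 0) (\<lambda>x. Q (f x)) x \<bullet> dd (\<xi> b, 0) (\<lambda>x. Q (f x)) x = (if a = b then 1 else 0)"
  have adj: "N \<bullet> Q v = adjoint Q N \<bullet> v" for v
    using adjoint_clauses(2)[of Q N v] bounded_linear.linear[OF Q] by simp
  note d = dd_linear[OF Q f x]
  show "N \<bullet> dd (0, 1) (\<lambda>x. Q (f x)) x = (\<Sum>a\<in>Basis. N \<bullet> dd (\<xi> a, 0) (dd (\<xi> a, 0) (\<lambda>x. Q (f x))) x)"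
    using mcf[unfolded normal_mcf_def, rule_format, of "adjoint Q N" \<xi>] N \<xi> by (simp add: d adj iso)
qed

lemma time_preserving_derivative:
  fixes P :: "(real^'n) \<times> real \<Rightarrow> (real^'n) \<times> real"
  assumes P: "smooth_open Z P" and snd: "\<And>y. y \<in> Z \<Longrightarrow> snd (P y) = snd y" and z: "z \<in> Z"
  shows "snd (dd v P z) = snd v" "snd (dd u (dd v P) z) = 0"
proof -
  note o = smooth_openD(1)[OF P]
  have s: "dd v (\<lambda>y. snd (f y)) y = snd (dd v f y)" if "smooth_open Z f" "y \<in> Z" for f :: "(real^'n) \<times> real \<Rightarrow> (real^'n) \<times> real" and y v
    by (rule dd_eqI[OF has_derivative_snd[OF smooth_openD(2)[OF that]]])
  have 1: "snd (dd v P y) = snd v" if "y \<in> Z" for y v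
    using s[OF P that, of v] dd_transform[OF o that, of "\<lambda>y. snd (P y)" snd] snd
      dd_eqI[OF bounded_linear_imp_has_derivative[OF bounded_linear_snd], where v=v and x=y] by simp
  then show "snd (dd v P z) = snd v" using z by simp
  have "dd u (\<lambda>y. snd (dd v P y)) z = dd u (\<lambda>y. snd v) z"
    using dd_transform[OF o z, of "\<lambda>y. snd (dd v P y)" "\<lambda>y. snd v"] 1 by simp
  then show "snd (dd u (dd v P) z) = 0"
    using s[OF smooth_openD(3)[OF P] z] by (simp add: dd_const)
qed

definition vv :: "((real^'n) \<times> real \<Rightarrow> real) \<Rightarrow> (real^'n) \<times> real \<Rightarrow> real" where
  "vv u x = 1 + grad u x \<bullet> grad u x"

lemma vv_ge_1: "vv u x \<ge> 1" by (simp add: vv_def)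

text \<open>\<open>vv\<close> is the square of the gradient function.  A graph is rewritten as a graph over its tangent
  plane at a point; \<open>(a, \<beta>)\<close> is the unit normal there.\<close>

lemma regraph:
  fixes u :: "(real^'n) \<times> real \<Rightarrow> real"
  assumes u: "smooth_open O' u" and x0: "x0 \<in> O'" and mcf: "\<And>x. x \<in> O' \<Longrightarrow> normal_mcf (graph_map u) x"
    and \<sigma>: "\<sigma> * \<sigma> = (1::real)"
  obtains Z z0 and w :: "(real^'n) \<times> real \<Rightarrow> real" and a \<beta> where "smooth_open Z w" "z0 \<in> Z" "snd z0 = snd x0" "grad w z0 = 0"
    "\<forall>z\<in>Z. normal_mcf (graph_map w) z"
    "\<forall>z\<in>Z. \<exists>x\<in>O'. snd x = snd z \<and> fst x \<bullet> fst x + u x * u x = fst z \<bullet> fst z + w z * w z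
       \<and> (\<beta> - grad w z \<bullet> a)\<^sup>2 * vv u x = vv w z
       \<and> (\<forall>c. c \<noteq> 0 \<longrightarrow> (\<exists>c'. c' \<noteq> 0 \<and> c \<bullet> c + (grad w z \<bullet> c)\<^sup>2 = c' \<bullet> c' + (grad u x \<bullet> c')\<^sup>2
            \<and> (hess w z c c)\<^sup>2 * vv u x = (hess u x c' c')\<^sup>2 * vv w z))"
    "fst x0 \<bullet> fst x0 + u x0 * u x0 = fst z0 \<bullet> fst z0 + w z0 * w z0" "\<beta>\<^sup>2 * vv u x0 = 1"
    "\<forall>c. \<exists>c'. c \<bullet> c = c' \<bullet> c' + (grad u x0 \<bullet> c')\<^sup>2 \<and> sqrt (vv u x0) * hess w z0 c c = \<sigma> * hess u x0 c' c'"
    "\<forall>c'. \<exists>c. c \<bullet> c = c' \<bullet> c' + (grad u x0 \<bullet> c')\<^sup>2 \<and> sqrt (vv u x0) * hess w z0 c c = \<sigma> * hess u x0 c' c'"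
proof -
  define s where "s = sqrt (vv u x0)"
  have s: "s > 0" "s * s = vv u x0" using vv_ge_1[of u x0] by (simp_all add: s_def)
  define Nu where "Nu x = (- grad u x, 1::real)" for x
  have NuNu: "Nu x \<bullet> Nu x = vv u x" for x by (simp add: Nu_def vv_def)
  \<comment> \<open>The unit normal at x0, with its sign \<sigma> left open. The reflection Q
    exchanges it with the vertical direction, so that the graph of u becomes horizontal at
    x0.\<close>
  define Ns where "Ns = (\<sigma> / s) *\<^sub>R Nu x0"
  have "Ns \<bullet> Ns = 1"
    using s(2)[symmetric] s(1) \<sigma> by (simp add: Ns_def NuNu)
  then have "norm (0::real^'n, 1::real) = norm Ns" by (simp add: norm_eq_sqrt_inner)
  then obtain Q where Q: "bounded_linear Q" and iso: "\<And>x y. Q x \<bullet> Q y = x \<bullet> y" and QQ: "\<And>x. Q (Q x) = x" and Q01: "Q (0, 1) = Ns"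
    by (rule householder_exists) blast
  have Qlin: "linear Q" by (rule bounded_linear.linear[OF Q])
  define f where "f x = Q (graph_map u x)" for x
  note gs = smooth_graph_map[OF u]
  have f: "smooth_open O' f" unfolding f_def[abs_def] by (rule smooth_open_linear_compose[OF Q gs])
  have ig: "dd (c, 0) u x = grad u x \<bullet> c" if "x \<in> O'" for x c by (rule inner_grad[OF u that, symmetric])
  have df: "dd (c, 0) f x = Q (c, grad u x \<bullet> c)" if "x \<in> O'" for x c
    unfolding f_def[abs_def] dd_linear(1)[OF Q gs that] dd_graph_map(1)[OF u that] by (simp add: ig that)
  have ddf: "dd (c, 0) (dd (c, 0) f) x = Q (0, hess u x c c)" if "x \<in> O'" for x c
    unfolding f_def[abs_def] dd_linear(2)[OF Q gs that] dd_graph_map(2)[OF u that] hess_def ..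
  have fmcf: "normal_mcf f x" if "x \<in> O'" for x
    unfolding f_def[abs_def] by (rule normal_mcf_isometry[OF Q iso gs that mcf[OF that]])
  have lin: "linear (\<lambda>c. fst (dd (c, 0) f x0))"
    using linear_compose[OF slice_derivative_linear(1)[OF f x0] linear_fst] by (simp add: o_def)
  have "inj (\<lambda>c. fst (dd (c, 0) f x0))"
    unfolding linear_injective_0[OF lin]
  proof (intro allI impI)
    fix c assume "fst (dd (c, 0) f x0) = 0"
    then obtain r where r: "Q (c, grad u x0 \<bullet> c) = (0, r)" unfolding df[OF x0] by (metis prod.collapse)
    then have "Q (0, r) = (c, grad u x0 \<bullet> c)" using QQ by metis
    moreover have "Q (0, r) = r *\<^sub>R Ns" using linear_scale[OF Qlin, of r "(0, 1)"] Q01 by simp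
    ultimately have e: "(c, grad u x0 \<bullet> c) = r *\<^sub>R Ns" by simp
    have "(c, grad u x0 \<bullet> c) \<bullet> Nu x0 = 0" by (simp add: Nu_def inner_commute)
    then have "r * (\<sigma> / s) * vv u x0 = 0" unfolding e by (simp add: Ns_def NuNu)
    then have "r = 0" using s \<sigma> vv_ge_1[of u x0] by auto
    then show "c = 0" using e by (simp add: zero_prod_def)
  qed
  then obtain U' Z \<Psi> w where U': "open U'" "x0 \<in> U'" "U' \<subseteq> O'" "open Z"
    and hom: "homeomorphism U' Z (\<lambda>x. (fst (f x), snd x)) \<Psi>" and \<Psi>: "smooth_open Z \<Psi>" and w: "smooth_open Z w"
    and fw: "\<And>z. z \<in> Z \<Longrightarrow> f (\<Psi> z) = graph_map w z"
    and wmcf: "\<And>z. z \<in> Z \<Longrightarrow> normal_mcf f (\<Psi> z) \<Longrightarrow> normal_mcf (graph_map w) z"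
    by (rule local_graph[OF f x0]) blast
  have "\<Psi> z \<in> U'" and snd\<Psi>: "snd (\<Psi> z) = snd z" if "z \<in> Z" for z
  proof -
    show "\<Psi> z \<in> U'" using homeomorphism_image2[OF hom] that by auto
    have "(fst (f (\<Psi> z)), snd (\<Psi> z)) = z" by (rule homeomorphism_apply2[OF hom that])
    then show "snd (\<Psi> z) = snd z" by (metis snd_conv)
  qed
  then have \<Psi>Z: "\<Psi> ` Z \<subseteq> O'" using U'(3) by auto
  define z0 where "z0 = (fst (f x0), snd x0)"
  have z0: "z0 \<in> Z" using homeomorphism_image1[OF hom] U'(2) by (auto simp: z0_def)
  have \<Psi>0: "\<Psi> z0 = x0" unfolding z0_def by (rule homeomorphism_apply1[OF hom U'(2)])
  have igw: "dd (c, 0) w z = grad w z \<bullet> c" if "z \<in> Z" for z c by (rule inner_grad[OF w that, symmetric])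
  have rel: "\<exists>c'. (c, grad w z \<bullet> c) = Q (c', grad u (\<Psi> z) \<bullet> c') \<and>
      snd (Q (Nu (\<Psi> z))) * hess w z c c = hess u (\<Psi> z) c' c'" if z: "z \<in> Z" for z c
  proof -
    let ?x = "\<Psi> z"
    have x: "?x \<in> O'" using \<Psi>Z z by auto
    have e: "dd v (graph_map w) y = dd v (\<lambda>z. f (\<Psi> z)) y" if "y \<in> Z" for y v
      using dd_transform[OF U'(4) that, of "graph_map w" "\<lambda>z. f (\<Psi> z)"] fw by simp
    have e2: "dd v (dd v (graph_map w)) z = dd v (dd v (\<lambda>z. f (\<Psi> z))) z" for v
      using dd_transform[OF U'(4) z, of "dd v (graph_map w)" "dd v (\<lambda>z. f (\<Psi> z))"] e by simp
    obtain c' where c': "dd (c, 0) \<Psi> z = (c', 0)"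
      using time_preserving_derivative(1)[OF \<Psi> snd\<Psi> z, of "(c, 0)"] by (cases "dd (c, 0) \<Psi> z") auto
    obtain r where r: "dd (c, 0) (dd (c, 0) \<Psi>) z = (r, 0)"
      using time_preserving_derivative(2)[OF \<Psi> snd\<Psi> z, of "(c, 0)" "(c, 0)"]
      by (cases "dd (c, 0) (dd (c, 0) \<Psi>) z") auto
    have "(c, grad w z \<bullet> c) = Q (c', grad u ?x \<bullet> c')"
      using e[OF z, of "(c, 0)"] unfolding dd_dd_compose(1)[OF f \<Psi> \<Psi>Z z] dd_graph_map(1)[OF w z] c' df[OF x]
      by (simp add: igw z)
    moreover have "(0, hess w z c c) = Q (0, hess u ?x c' c') + Q (r, grad u ?x \<bullet> r)"
      using e2[of "(c, 0)"] unfolding dd_dd_compose(2)[OF f \<Psi> \<Psi>Z z] dd_graph_map(2)[OF w z] c' r df[OF x] ddf[OF x]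
      by (simp add: hess_def)
    \<comment> \<open>Pairing with the normal removes the tangential term with r, the second
      derivative of the reparametrization.\<close>
    then have "Q (Nu ?x) \<bullet> (0, hess w z c c) = Nu ?x \<bullet> (0, hess u ?x c' c') + Nu ?x \<bullet> (r, grad u ?x \<bullet> r)"
      by (simp add: inner_add_right iso)
    then have "snd (Q (Nu ?x)) * hess w z c c = hess u ?x c' c'" by (simp add: Nu_def inner_Pair inner_prod_def)
    ultimately show ?thesis by blast
  qed
  \<comment> \<open>The rotated normal is a multiple of (- grad w, 1). Its last coordinate is
    therefore the factor that relates the two gradient functions and the two Hessians.\<close>
  have nrm: "fst (Q (Nu (\<Psi> z))) = - snd (Q (Nu (\<Psi> z))) *\<^sub>R grad w z"
    and lam: "(snd (Q (Nu (\<Psi> z))))\<^sup>2 * vv w z = vv u (\<Psi> z)"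
    and bet: "snd (Q (Nu (\<Psi> z))) * (snd Ns - grad w z \<bullet> fst Ns) = 1" if z: "z \<in> Z" for z
  proof -
    let ?M = "Q (Nu (\<Psi> z))"
    have "(fst ?M + snd ?M *\<^sub>R grad w z) \<bullet> c = 0" for c
    proof -
      obtain c' where "(c, grad w z \<bullet> c) = Q (c', grad u (\<Psi> z) \<bullet> c')" using rel[OF z] by blast
      then have "?M \<bullet> (c, grad w z \<bullet> c) = Nu (\<Psi> z) \<bullet> (c', grad u (\<Psi> z) \<bullet> c')" by (simp add: iso)
      then show ?thesis by (simp add: Nu_def inner_prod_def inner_add_left)
    qed
    from this[of "fst ?M + snd ?M *\<^sub>R grad w z"]
    have 1: "fst ?M + snd ?M *\<^sub>R grad w z = 0" by simp
    then show n: "fst ?M = - snd ?M *\<^sub>R grad w z" by (simp add: eq_neg_iff_add_eq_0)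
    have "?M \<bullet> ?M = vv u (\<Psi> z)" by (simp add: iso NuNu)
    then show "(snd ?M)\<^sup>2 * vv w z = vv u (\<Psi> z)"
      by (simp add: inner_prod_def n vv_def power2_eq_square algebra_simps)
    have "?M \<bullet> Ns = Nu (\<Psi> z) \<bullet> (0, 1)" unfolding Q01[symmetric] by (rule iso)
    also have "\<dots> = 1" by (simp add: Nu_def)
    finally have "fst ?M \<bullet> fst Ns + snd ?M * snd Ns = 1" by (simp only: inner_prod_def inner_real_def)
    then show "snd ?M * (snd Ns - grad w z \<bullet> fst Ns) = 1"
      unfolding n by (simp add: algebra_simps)
  qed
  have M0: "Q (Nu x0) = (0, \<sigma> * s)"
  proof -
    have "Nu x0 = (\<sigma> * s) *\<^sub>R Ns" using s \<sigma> by (simp add: Ns_def)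
    then have "Q (Nu x0) = (\<sigma> * s) *\<^sub>R Q Ns" by (simp add: linear_scale[OF Qlin])
    also have "Q Ns = (0, 1)" using QQ[of "(0, 1)"] Q01 by simp
    finally show ?thesis by simp
  qed
  have sig0: "\<sigma> \<noteq> 0" using \<sigma> by auto
  have gw0: "grad w z0 = 0" using nrm[OF z0] sig0 s by (simp add: \<Psi>0 M0)
  have rel0: "\<exists>c'. (c, 0) = Q (c', grad u x0 \<bullet> c') \<and> s * hess w z0 c c = \<sigma> * hess u x0 c' c'" for c
  proof -
    obtain c' where "(c, 0) = Q (c', grad u x0 \<bullet> c')" "\<sigma> * s * hess w z0 c c = hess u x0 c' c'"
      using rel[OF z0, of c] by (auto simp: \<Psi>0 gw0 M0)
    moreover have "\<sigma> * (\<sigma> * s * hess w z0 c c) = s * hess w z0 c c" using \<sigma> by (simp add: mult.assoc[symmetric])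
    ultimately show ?thesis by metis
  qed
  have isoP: "c \<bullet> c + d\<^sup>2 = c' \<bullet> c' + d'\<^sup>2" if "(c, d) = Q (c', d')" for c c' :: "real^'n" and d d'
    using iso[of "(c', d')" "(c', d')"] unfolding that[symmetric] by (simp add: power2_eq_square)
  have mcfw: "normal_mcf (graph_map w) z" if z: "z \<in> Z" for z
    using wmcf[OF z fmcf] \<Psi>Z z by auto
  have relz: "\<exists>x\<in>O'. snd x = snd z \<and> fst x \<bullet> fst x + u x * u x = fst z \<bullet> fst z + w z * w z
       \<and> (snd Ns - grad w z \<bullet> fst Ns)\<^sup>2 * vv u x = vv w z
       \<and> (\<forall>c. c \<noteq> 0 \<longrightarrow> (\<exists>c'. c' \<noteq> 0 \<and> c \<bullet> c + (grad w z \<bullet> c)\<^sup>2 = c' \<bullet> c' + (grad u x \<bullet> c')\<^sup>2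
            \<and> (hess w z c c)\<^sup>2 * vv u x = (hess u x c' c')\<^sup>2 * vv w z))" if z: "z \<in> Z" for z
  proof -
    let ?x = "\<Psi> z"
    have x: "?x \<in> O'" using \<Psi>Z z by auto
    have "fst ?x \<bullet> fst ?x + u ?x * u ?x = f ?x \<bullet> f ?x" by (simp add: f_def iso graph_map_def)
    also have "\<dots> = fst z \<bullet> fst z + w z * w z" by (simp add: fw z graph_map_def)
    finally have 1: "fst ?x \<bullet> fst ?x + u ?x * u ?x = fst z \<bullet> fst z + w z * w z" .
    have l: "(snd (Q (Nu ?x)))\<^sup>2 * vv w z = vv u ?x" by (rule lam[OF z])
    have "(snd Ns - grad w z \<bullet> fst Ns)\<^sup>2 * vv u ?x = (snd (Q (Nu ?x)) * (snd Ns - grad w z \<bullet> fst Ns))\<^sup>2 * vv w z"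
      unfolding l[symmetric] by (simp add: power_mult_distrib mult_ac)
    then have 2: "(snd Ns - grad w z \<bullet> fst Ns)\<^sup>2 * vv u ?x = vv w z" by (simp add: bet[OF z])
    have 3: "\<exists>c'. c' \<noteq> 0 \<and> c \<bullet> c + (grad w z \<bullet> c)\<^sup>2 = c' \<bullet> c' + (grad u ?x \<bullet> c')\<^sup>2
            \<and> (hess w z c c)\<^sup>2 * vv u ?x = (hess u ?x c' c')\<^sup>2 * vv w z" if "c \<noteq> 0" for c
    proof -
      obtain c' where c': "(c, grad w z \<bullet> c) = Q (c', grad u ?x \<bullet> c')" "snd (Q (Nu ?x)) * hess w z c c = hess u ?x c' c'"
        using rel[OF z, of c] by auto
      have "c' \<noteq> 0"
      proof
        assume "c' = 0"
        then have "(c, grad w z \<bullet> c) = 0" using c'(1) linear_0[OF Qlin] by (simp add: zero_prod_def)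
        then show False using that by (simp add: zero_prod_def)
      qed
      moreover have "(hess w z c c)\<^sup>2 * vv u ?x = (hess u ?x c' c')\<^sup>2 * vv w z"
        unfolding l[symmetric] c'(2)[symmetric] by (simp add: power_mult_distrib)
      ultimately show ?thesis using isoP[OF c'(1)] by blast
    qed
    show ?thesis using x 1 2 3 snd\<Psi>[OF z] by blast
  qed
  have bwd: "\<exists>c. c \<bullet> c = c' \<bullet> c' + (grad u x0 \<bullet> c')\<^sup>2 \<and> sqrt (vv u x0) * hess w z0 c c = \<sigma> * hess u x0 c' c'" for c'
  proof -
    obtain c d where cd: "Q (c', grad u x0 \<bullet> c') = (c, d)" by fastforce
    have "Q (Nu x0) \<bullet> (c, d) = Nu x0 \<bullet> (c', grad u x0 \<bullet> c')" unfolding cd[symmetric] by (rule iso)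
    then have "d = 0" unfolding M0 using sig0 s by (simp add: Nu_def)
    obtain c'' where c'': "(c, 0) = Q (c'', grad u x0 \<bullet> c'')" "s * hess w z0 c c = \<sigma> * hess u x0 c'' c''" using rel0 by blast
    have "Q (c', grad u x0 \<bullet> c') = Q (c'', grad u x0 \<bullet> c'')" using cd \<open>d = 0\<close> c''(1) by simp
    then have "c' = c''" using QQ by (metis fst_conv)
    then show ?thesis
      using isoP[OF c''(1)] c''(2) by (auto simp: s_def)
  qed
  show ?thesis
  proof (rule that[of Z w z0 "snd Ns" "fst Ns"])
    show "\<forall>z\<in>Z. normal_mcf (graph_map w) z" using mcfw by blast
  next
    have "fst x0 \<bullet> fst x0 + u x0 * u x0 = f x0 \<bullet> f x0" by (simp add: f_def iso graph_map_def)
    also have "\<dots> = fst z0 \<bullet> fst z0 + w z0 * w z0" using fw[OF z0] by (simp add: \<Psi>0 graph_map_def)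
    finally show "fst x0 \<bullet> fst x0 + u x0 * u x0 = fst z0 \<bullet> fst z0 + w z0 * w z0" .
    have "snd Ns = \<sigma> / s" by (simp add: Ns_def Nu_def)
    then show "(snd Ns)\<^sup>2 * vv u x0 = 1"
      using s(2)[symmetric] s(1) \<sigma> by (simp add: power_divide power2_eq_square)
  next
    show "\<forall>c. \<exists>c'. c \<bullet> c = c' \<bullet> c' + (grad u x0 \<bullet> c')\<^sup>2 \<and> sqrt (vv u x0) * hess w z0 c c = \<sigma> * hess u x0 c' c'"
    proof
      fix c
      obtain c' where c': "(c, 0) = Q (c', grad u x0 \<bullet> c')" "s * hess w z0 c c = \<sigma> * hess u x0 c' c'" using rel0 by blast
      show "\<exists>c'. c \<bullet> c = c' \<bullet> c' + (grad u x0 \<bullet> c')\<^sup>2 \<and> sqrt (vv u x0) * hess w z0 c c = \<sigma> * hess u x0 c' c'"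
        using isoP[OF c'(1)] c'(2) by (auto simp: s_def)
    qed
  qed (use w z0 gw0 relz bwd in \<open>auto simp: z0_def\<close>)
qed

section \<open>Entire graphical ancient solutions\<close>

lemma hess_homogeneous:
  assumes "smooth_open Z w" "z \<in> Z"
  shows "hess w z (l *\<^sub>R c) (l *\<^sub>R c) = l\<^sup>2 * hess w z c c"
proof -
  note lin = hess_props(1)[OF assms] and sym = hess_props(2)[OF assms]
  have "hess w z (l *\<^sub>R c) (l *\<^sub>R c) = l * hess w z c (l *\<^sub>R c)"
    using linear_scale[OF lin, of l c "l *\<^sub>R c"] by simp
  also have "\<dots> = l * (l * hess w z c c)"
    using linear_scale[OF lin, of l c c] sym[of c "l *\<^sub>R c"] by simp
  finally show ?thesis by (simp add: power2_eq_square)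
qed

text \<open>V bounds the square \<open>vv\<close> of the gradient function, and r2 is a squared
  radius. At a maximum of T over the compact region and all directions, \<open>regraph\<close>
  brings T into the form of \<open>maximum_point_estimate\<close>; the resulting bound on the
  maximum also bounds the value at x1.\<close>

lemma interior_curvature_estimate:
  fixes u :: "(real^'n) \<times> real \<Rightarrow> real" and \<tau> s1 r2 V :: real
  defines "O' \<equiv> UNIV \<times> {..<\<tau>}"
  assumes u: "smooth_open O' u" and mcf: "\<And>x. x \<in> O' \<Longrightarrow> normal_mcf (graph_map u) x"
    and s1: "s1 < \<tau>" and V: "V \<ge> 1"
    and vV: "\<And>x. snd x \<le> s1 \<Longrightarrow> fst x \<bullet> fst x + u x * u x \<le> r2 + (snd x - s1) \<Longrightarrow> vv u x \<le> V"
    and x1: "snd x1 = s1" "fst x1 \<bullet> fst x1 + u x1 * u x1 < r2" and e1: "norm e1 = 1"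
  shows "(hess u x1 e1 e1)\<^sup>2 * (r2 - fst x1 \<bullet> fst x1 - u x1 * u x1)\<^sup>2 / (1 + (grad u x1 \<bullet> e1)\<^sup>2)\<^sup>2
     \<le> 2 * V * (2 * V + 2) * (4 * r2) + 2 * V * (r2 * (2 * real CARD('n) + 1))"
proof (cases "hess u x1 e1 e1 = 0")
  case True
  have "r2 \<ge> 0" using x1(2) by (smt (verit) inner_ge_zero zero_le_square)
  then show ?thesis using True V by simp
next
  case False
  define \<eta> where "\<eta> x = r2 - fst x \<bullet> fst x - u x * u x + (snd x - s1)" for x
  define Reg where "Reg = {x. snd x \<le> s1 \<and> 0 \<le> \<eta> x}"
  have RegO: "Reg \<subseteq> O'" using s1 by (auto simp: Reg_def O'_def)
  have vReg: "vv u x \<le> V" if "x \<in> Reg" for x using vV[of x] that by (simp add: Reg_def \<eta>_def)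
  \<comment> \<open>Keeps \<open>1 - k * vv u x\<close> between 1/2 and 1 on the region.\<close>
  define k where "k = 1 / (2 * V)"
  have k: "k > 0" using V by (simp add: k_def)
  have kv: "1 - k * vv u x \<ge> 1 / 2" if "x \<in> Reg" for x
    using vReg[OF that] V by (simp add: k_def field_simps)
  have cu: "continuous_on O' u" by (rule smooth_openD(4)[OF u])
  have cg: "continuous_on O' (grad u)"
    unfolding grad_def[abs_def] by (intro continuous_intros smooth_openD(4)[OF smooth_openD(3)[OF u]])
  \<comment> \<open>\<open>hess u x e e\<close> divided by \<open>sqrt (vv u x)\<close> and by the
    squared length of the lifted e is the normal curvature in direction e. So T is the square of
    curvature times gradient function times \<open>\<eta>\<close>, divided by
    \<open>1 - k * vv u x\<close>.\<close>
  define T where "T x e = (hess u x e e * \<eta> x)\<^sup>2 / ((e \<bullet> e + (grad u x \<bullet> e)\<^sup>2)\<^sup>2 * (1 - k * vv u x))" for x e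
  have c\<eta>: "continuous_on O' \<eta>" unfolding \<eta>_def[abs_def] by (intro continuous_intros cu)
  have r2: "0 < r2" using x1(2) by (smt (verit) inner_ge_zero zero_le_square)
  have bReg: "Reg \<subseteq> cball 0 (sqrt r2) \<times> {s1 - r2..s1}"
  proof
    fix x assume "x \<in> Reg"
    then have "snd x \<le> s1" and *: "fst x \<bullet> fst x + u x * u x \<le> r2 + (snd x - s1)" by (auto simp: Reg_def \<eta>_def)
    then have "fst x \<bullet> fst x \<le> r2" and "s1 - r2 \<le> snd x" by (smt (verit) inner_ge_zero zero_le_square)+
    then show "x \<in> cball 0 (sqrt r2) \<times> {s1 - r2..s1}" using \<open>snd x \<le> s1\<close>
      by (cases x) (simp add: norm_eq_sqrt_inner)
  qed
  have "compact Reg"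
  proof -
    have C: "compact (cball (0::real^'n) (sqrt r2) \<times> {s1 - r2..s1})" by (intro compact_Times compact_cball compact_Icc)
    have sub: "cball (0::real^'n) (sqrt r2) \<times> {s1 - r2..s1} \<subseteq> O'" using s1 by (auto simp: O'_def)
    have "Reg = (cball 0 (sqrt r2) \<times> {s1 - r2..s1}) \<inter> \<eta> -` {0..}"
      using bReg by (auto simp: Reg_def)
    moreover have "closed ((cball 0 (sqrt r2) \<times> {s1 - r2..s1}) \<inter> \<eta> -` {0..})"
      by (rule continuous_closed_preimage[OF continuous_on_subset[OF c\<eta> sub] compact_imp_closed[OF C] closed_atLeast])
    ultimately show ?thesis using compact_Int_closed[OF C] bReg
      by (metis C bounded_subset compact_eq_bounded_closed compact_imp_bounded)
  qed
  then have K: "compact (Reg \<times> sphere (0::real^'n) 1)" by (intro compact_Times compact_sphere)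
  have KO: "fst ` (Reg \<times> sphere (0::real^'n) 1) \<subseteq> O'" using RegO by auto
  have cont: "continuous_on (Reg \<times> sphere 0 1) (\<lambda>p. T (fst p) (snd p))"
  proof -
    have h: "hess u x e e = (\<Sum>i\<in>Basis. (e \<bullet> i) * (\<Sum>j\<in>Basis. (e \<bullet> j) * dd (j, 0) (dd (i, 0) u) x))" if "x \<in> O'" for x e
    proof -
      have "hess u x e e = (\<Sum>i\<in>Basis. (e \<bullet> i) * hess u x i e)" by (rule hess_props(4)[OF u that, symmetric])
      also have "\<dots> = (\<Sum>i\<in>Basis. (e \<bullet> i) * hess u x e i)"
        by (intro sum.cong refl arg_cong2[of _ _ _ _ "(*)"] hess_props(2)[OF u that])
      also have "\<dots> = (\<Sum>i\<in>Basis. (e \<bullet> i) * (\<Sum>j\<in>Basis. (e \<bullet> j) * hess u x j i))"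
        by (intro sum.cong refl arg_cong2[of _ _ _ _ "(*)"] hess_props(4)[OF u that, symmetric])
      finally show ?thesis by (simp add: hess_def)
    qed
    have c2: "continuous_on (Reg \<times> sphere (0::real^'n) 1) (\<lambda>p. f (fst p))" if "continuous_on O' f" for f :: "(real^'n) \<times> real \<Rightarrow> 'b::topological_space"
      by (rule continuous_on_compose2[OF that continuous_on_fst[OF continuous_on_id] KO])
    have c3: "continuous_on (Reg \<times> sphere (0::real^'n) 1) (\<lambda>p. hess u (fst p) (snd p) (snd p))"
    proof (rule iffD1[OF continuous_on_cong[OF refl]])
      show "continuous_on (Reg \<times> sphere (0::real^'n) 1) (\<lambda>p. \<Sum>i\<in>Basis. (snd p \<bullet> i) * (\<Sum>j\<in>Basis. (snd p \<bullet> j) * dd (j, 0) (dd (i, 0) u) (fst p)))"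
        by (intro continuous_intros c2 smooth_openD(4)[OF smooth_openD(3)[OF smooth_openD(3)[OF u]]])
    qed (use h RegO in auto)
    show ?thesis unfolding T_def vv_def
    proof (intro continuous_intros c3 c2[OF c\<eta>] c2[OF cg])
      show "\<forall>x\<in>Reg \<times> sphere 0 1. (snd x \<bullet> snd x + (grad u (fst x) \<bullet> snd x)\<^sup>2)\<^sup>2 * (1 - k * (1 + grad u (fst x) \<bullet> grad u (fst x))) \<noteq> 0"
      proof
        fix p assume p: "p \<in> Reg \<times> sphere (0::real^'n) 1"
        then have "snd p \<bullet> snd p = 1" by (auto simp: norm_eq_1)
        then have "snd p \<bullet> snd p + (grad u (fst p) \<bullet> snd p)\<^sup>2 > 0" by (simp add: add_pos_nonneg)
        moreover have "1 - k * (1 + grad u (fst p) \<bullet> grad u (fst p)) > 0" using kv[of "fst p"] p by (auto simp: vv_def)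
        ultimately show "(snd p \<bullet> snd p + (grad u (fst p) \<bullet> snd p)\<^sup>2)\<^sup>2 * (1 - k * (1 + grad u (fst p) \<bullet> grad u (fst p))) \<noteq> 0"
          by simp
      qed
    qed
  qed
  have x1R: "x1 \<in> Reg" using x1 by (simp add: Reg_def \<eta>_def)
  have p1: "(x1, e1) \<in> Reg \<times> sphere 0 1" using x1R e1 by simp
  obtain p where p: "p \<in> Reg \<times> sphere 0 1" and pmax: "\<And>q. q \<in> Reg \<times> sphere 0 1 \<Longrightarrow> T (fst q) (snd q) \<le> T (fst p) (snd p)"
    using continuous_attains_sup[OF K _ cont] p1 by (metis empty_iff)
  obtain x0 e0 where pe: "p = (x0, e0)" by (cases p)
  have x0: "x0 \<in> Reg" and e0: "norm e0 = 1" using p pe by auto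
  \<comment> \<open>T is homogeneous of degree 0 in e. This matters because the change of graph does
    not preserve the Euclidean length of directions.\<close>
  have Tscale: "T x (l *\<^sub>R e) = T x e" if "x \<in> O'" "l \<noteq> 0" for x l e
  proof -
    have "(l *\<^sub>R e) \<bullet> (l *\<^sub>R e) + (grad u x \<bullet> (l *\<^sub>R e))\<^sup>2 = l\<^sup>2 * (e \<bullet> e + (grad u x \<bullet> e)\<^sup>2)"
      by (simp add: power2_eq_square algebra_simps)
    then have "T x (l *\<^sub>R e) = (l\<^sup>2)\<^sup>2 * (hess u x e e * \<eta> x)\<^sup>2 / ((l\<^sup>2)\<^sup>2 * ((e \<bullet> e + (grad u x \<bullet> e)\<^sup>2)\<^sup>2 * (1 - k * vv u x)))"
      unfolding T_def hess_homogeneous[OF u that(1)] by (simp add: power_mult_distrib mult_ac)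
    also have "\<dots> = T x e" unfolding T_def using that(2) by (intro mult_divide_mult_cancel_left) simp
    finally show ?thesis .
  qed
  have Tmax: "T x c \<le> T x0 e0" if "x \<in> Reg" "c \<noteq> 0" for x c
  proof -
    have "T x c = T x ((1 / norm c) *\<^sub>R c)" using Tscale[of x "1 / norm c" c] that RegO by auto
    also have "\<dots> \<le> T x0 e0" using pmax[of "(x, (1 / norm c) *\<^sub>R c)"] that pe by simp
    finally show ?thesis .
  qed
  have T1: "T x1 e1 > 0"
  proof -
    have "e1 \<bullet> e1 + (grad u x1 \<bullet> e1)\<^sup>2 > 0" using e1 by (simp add: norm_eq_1 add_pos_nonneg)
    then show ?thesis unfolding T_def using False kv[OF x1R] x1
      by (intro divide_pos_pos mult_pos_pos) (auto simp: \<eta>_def)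
  qed
  have x0O: "x0 \<in> O'" using x0 RegO by auto
  have "T x0 e0 > 0" using Tmax[OF x1R, of e1] T1 e1 by force
  then have h0: "hess u x0 e0 e0 \<noteq> 0" and \<eta>0: "\<eta> x0 > 0"
    using x0 by (auto simp: T_def Reg_def intro: order.not_eq_order_implies_strict)
  \<comment> \<open>Orients the new graph so that its second derivative in the maximal direction is
    positive.\<close>
  define \<sigma> where "\<sigma> = sgn (hess u x0 e0 e0)"
  have \<sigma>: "\<sigma> * \<sigma> = 1" and \<sigma>h: "\<sigma> * hess u x0 e0 e0 = \<bar>hess u x0 e0 e0\<bar>"
    using h0 by (auto simp: \<sigma>_def sgn_if)
  obtain Z z0 and w :: "(real^'n) \<times> real \<Rightarrow> real" and a \<beta> where w: "smooth_open Z w" and z0: "z0 \<in> Z" and sz: "snd z0 = snd x0"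
    and gw: "grad w z0 = 0" and wmcf: "\<forall>z\<in>Z. normal_mcf (graph_map w) z"
    and rel: "\<forall>z\<in>Z. \<exists>x\<in>O'. snd x = snd z \<and> fst x \<bullet> fst x + u x * u x = fst z \<bullet> fst z + w z * w z
       \<and> (\<beta> - grad w z \<bullet> a)\<^sup>2 * vv u x = vv w z
       \<and> (\<forall>c. c \<noteq> 0 \<longrightarrow> (\<exists>c'. c' \<noteq> 0 \<and> c \<bullet> c + (grad w z \<bullet> c)\<^sup>2 = c' \<bullet> c' + (grad u x \<bullet> c')\<^sup>2
            \<and> (hess w z c c)\<^sup>2 * vv u x = (hess u x c' c')\<^sup>2 * vv w z))"
    and pos0: "fst x0 \<bullet> fst x0 + u x0 * u x0 = fst z0 \<bullet> fst z0 + w z0 * w z0" and \<beta>: "\<beta>\<^sup>2 * vv u x0 = 1"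
    and fwd: "\<forall>c. \<exists>c'. c \<bullet> c = c' \<bullet> c' + (grad u x0 \<bullet> c')\<^sup>2 \<and> sqrt (vv u x0) * hess w z0 c c = \<sigma> * hess u x0 c' c'"
    and bwd: "\<forall>c'. \<exists>c. c \<bullet> c = c' \<bullet> c' + (grad u x0 \<bullet> c')\<^sup>2 \<and> sqrt (vv u x0) * hess w z0 c c = \<sigma> * hess u x0 c' c'"
    by (rule regraph[OF u x0O mcf \<sigma>])
  define s where "s = sqrt (vv u x0)"
  have s: "s > 0" "s\<^sup>2 = vv u x0" using vv_ge_1[of u x0] by (simp_all add: s_def)
  obtain c0 where c0: "c0 \<bullet> c0 = 1 + (grad u x0 \<bullet> e0)\<^sup>2" "s * hess w z0 c0 c0 = \<bar>hess u x0 e0 e0\<bar>"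
    using bwd[rule_format, of e0] e0 \<sigma>h by (auto simp: s_def norm_eq_1)
  define m where "m = c0 \<bullet> c0"
  have m: "m > 0" using c0(1) by (simp add: m_def add_pos_nonneg)
  have nc0: "(norm c0)\<^sup>2 = m" by (simp add: m_def dot_square_norm)
  define b where "b = (1 / norm c0) *\<^sub>R c0"
  have c0n: "norm c0 \<noteq> 0" using m nc0 by auto
  have b: "norm b = 1" using c0n by (simp add: b_def)
  have hb: "s * hess w z0 b b = \<bar>hess u x0 e0 e0\<bar> / m"
    unfolding b_def hess_homogeneous[OF w z0] using c0(2) nc0 by (simp add: power_divide field_simps)
  have hbpos: "hess w z0 b b > 0"
    using hb s(1) m h0 by (smt (verit) divide_pos_pos zero_less_mult_pos zero_less_abs_iff)
  \<comment> \<open>Since \<open>\<beta>\<^sup>2 = 1 / vv u x0\<close>, this is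
    \<open>(1 - k * vv u x0) / vv u x0\<close>, the value at z0 of the rotated denominator.\<close>
  define D where "D = \<beta>\<^sup>2 - k"
  have Ds: "D * s\<^sup>2 = 1 - k * vv u x0" using \<beta> s(2) by (simp add: D_def algebra_simps)
  have D: "D > 0" using kv[OF x0] Ds s(1) by (smt (verit) divide_pos_pos zero_less_mult_pos2 zero_less_power half_gt_zero_iff)
  have T0: "T x0 e0 * D = (hess w z0 b b * \<eta> x0)\<^sup>2"
  proof -
    have "e0 \<bullet> e0 + (grad u x0 \<bullet> e0)\<^sup>2 = m" using c0(1) e0 by (simp add: m_def norm_eq_1)
    then have "T x0 e0 = (\<bar>hess u x0 e0 e0\<bar> / m)\<^sup>2 * (\<eta> x0)\<^sup>2 / (D * s\<^sup>2)"
      unfolding T_def Ds by (simp add: power_mult_distrib power_divide)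
    also have "\<dots> = (hess w z0 b b)\<^sup>2 * (\<eta> x0)\<^sup>2 / D"
      unfolding hb[symmetric] using s(1) by (simp add: power_mult_distrib)
    finally show ?thesis using D by (simp add: power_mult_distrib)
  qed
  have hmax: "hess w z0 c c \<le> hess w z0 b b" if c: "norm c = 1" for c
  proof -
    obtain c' where c': "1 = c' \<bullet> c' + (grad u x0 \<bullet> c')\<^sup>2" "s * hess w z0 c c = \<sigma> * hess u x0 c' c'"
      using fwd[rule_format, of c] c by (auto simp: s_def norm_eq_1)
    have "c' \<noteq> 0" using c'(1) by auto
    have sq: "(s * hess w z0 c c)\<^sup>2 = (hess u x0 c' c')\<^sup>2" unfolding c'(2) power_mult_distrib using \<sigma> by (simp add: power2_eq_square)
    have "T x0 c' = (hess u x0 c' c')\<^sup>2 * (\<eta> x0)\<^sup>2 / (D * s\<^sup>2)"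
      unfolding T_def Ds c'(1)[symmetric] by (simp add: power_mult_distrib)
    also have "\<dots> = (hess w z0 c c)\<^sup>2 * (\<eta> x0)\<^sup>2 / D"
      unfolding sq[symmetric] using s(1) by (simp add: power_mult_distrib)
    finally have "(hess w z0 c c)\<^sup>2 * (\<eta> x0)\<^sup>2 = T x0 c' * D" using D by simp
    also have "\<dots> \<le> T x0 e0 * D" using Tmax[OF x0 \<open>c' \<noteq> 0\<close>] D by simp
    also have "\<dots> = (hess w z0 b b)\<^sup>2 * (\<eta> x0)\<^sup>2" unfolding T0 by (simp add: power_mult_distrib)
    finally have "(hess w z0 c c)\<^sup>2 \<le> (hess w z0 b b)\<^sup>2" using \<eta>0 by simp
    then show ?thesis using hbpos by (meson less_imp_le power2_le_imp_le)
  qed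
  define \<zeta> where "\<zeta> z = r2 - fst z \<bullet> fst z - w z * w z + (snd z - s1)" for z
  have \<zeta>0: "\<zeta> z0 = \<eta> x0" using pos0 sz by (simp add: \<zeta>_def \<eta>_def)
  \<comment> \<open>Positivity of the cutoff guarantees that points of Z' no later than z0
    correspond to points of the compact region, where T is maximal at x0.\<close>
  define Z' where "Z' = {z \<in> Z. \<zeta> z > 0}"
  have oZ': "open Z'"
  proof -
    have "continuous_on Z \<zeta>" unfolding \<zeta>_def[abs_def] by (intro continuous_intros smooth_openD(4)[OF w])
    from continuous_open_preimage[OF this smooth_openD(1)[OF w] open_greaterThan[of 0]]
    show ?thesis by (simp add: Z'_def vimage_def Int_def greaterThan_def)
  qed
  have w': "smooth_open Z' w" by (rule smooth_open_subset[OF w oZ']) (auto simp: Z'_def)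
  have z0': "z0 \<in> Z'" using z0 \<zeta>0 \<eta>0 by (simp add: Z'_def)
  have Deq: "(\<beta> - dd (a, 0) w z) * (\<beta> - dd (a, 0) w z) - k * (1 + (\<Sum>i\<in>Basis. dd (i, 0) w z * dd (i, 0) w z))
     = (\<beta> - grad w z \<bullet> a)\<^sup>2 - k * vv w z" if "z \<in> Z" for z
    unfolding vv_def inner_grad[OF w that, symmetric] power2_eq_square
    by (subst (2) euclidean_inner) simp
  have Dz0: "(\<beta> - dd (a, 0) w z0) * (\<beta> - dd (a, 0) w z0) - k * (1 + (\<Sum>i\<in>Basis. dd (i, 0) w z0 * dd (i, 0) w z0)) = D"
    unfolding Deq[OF z0] by (simp add: gw vv_def D_def)
  have max: "(dd (b, 0) (dd (b, 0) w) y * \<zeta> y) * (dd (b, 0) (dd (b, 0) w) y * \<zeta> y) * D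
    \<le> (dd (b, 0) (dd (b, 0) w) z0 * \<zeta> z0) * (dd (b, 0) (dd (b, 0) w) z0 * \<zeta> z0) *
      (((1 + dd (b, 0) w y * dd (b, 0) w y) * (1 + dd (b, 0) w y * dd (b, 0) w y)) *
       ((\<beta> - dd (a, 0) w y) * (\<beta> - dd (a, 0) w y) - k * (1 + (\<Sum>i\<in>Basis. dd (i, 0) w y * dd (i, 0) w y))))"
    if y: "y \<in> Z'" "snd y \<le> snd z0" for y
  proof -
    have yZ: "y \<in> Z" using y by (simp add: Z'_def)
    have "b \<noteq> 0" using b by auto
    then obtain x b' where x: "x \<in> O'" "snd x = snd y" "fst x \<bullet> fst x + u x * u x = fst y \<bullet> fst y + w y * w y"
      "(\<beta> - grad w y \<bullet> a)\<^sup>2 * vv u x = vv w y" and b': "b' \<noteq> 0" "b \<bullet> b + (grad w y \<bullet> b)\<^sup>2 = b' \<bullet> b' + (grad u x \<bullet> b')\<^sup>2"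
      "(hess w y b b)\<^sup>2 * vv u x = (hess u x b' b')\<^sup>2 * vv w y"
      using rel[rule_format, OF yZ] by blast
    have \<eta>x: "\<eta> x = \<zeta> y" using x(2,3) by (simp add: \<eta>_def \<zeta>_def)
    have xR: "x \<in> Reg" using y x0 sz x(2) \<eta>x by (simp add: Reg_def Z'_def)
    define Dy where "Dy = (\<beta> - grad w y \<bullet> a)\<^sup>2 - k * vv w y"
    define Ey where "Ey = (1 + (grad w y \<bullet> b)\<^sup>2)\<^sup>2"
    have vx: "vv u x > 0" using vv_ge_1[of u x] by simp
    \<comment> \<open>Relates the denominators in the two coordinate systems: \<open>Dy\<close> is
      \<open>vv w y / vv u x\<close> times \<open>1 - k * vv u x\<close>.\<close>
    have Dv: "Dy * vv u x = vv w y * (1 - k * vv u x)" using x(4) by (simp add: Dy_def algebra_simps)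
    have kx: "1 - k * vv u x > 0" using kv[OF xR] by simp
    have Dy: "Dy > 0" using Dv vx kx vv_ge_1[of w y] by (smt (verit) mult_pos_pos zero_less_mult_pos2)
    have Ee: "(b' \<bullet> b' + (grad u x \<bullet> b')\<^sup>2)\<^sup>2 = Ey" using b'(2) b by (simp add: Ey_def norm_eq_1)
    have "1 + (grad w y \<bullet> b)\<^sup>2 > 0" by (simp add: add_pos_nonneg)
    then have Ey: "Ey > 0" unfolding Ey_def by simp
    have H: "(hess w y b b)\<^sup>2 * (1 - k * vv u x) = (hess u x b' b')\<^sup>2 * Dy"
    proof -
      have "(hess w y b b)\<^sup>2 * (1 - k * vv u x) * vv u x = (hess u x b' b')\<^sup>2 * vv w y * (1 - k * vv u x)"
        using b'(3) by (simp add: mult_ac)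
      also have "\<dots> = (hess u x b' b')\<^sup>2 * Dy * vv u x" using Dv by (simp add: mult_ac)
      finally show ?thesis using vx by simp
    qed
    have "(hess w y b b)\<^sup>2 = (hess u x b' b')\<^sup>2 * Dy / (1 - k * vv u x)" using H kx by (simp add: field_simps)
    then have TE: "(hess w y b b * \<zeta> y)\<^sup>2 = T x b' * (Ey * Dy)"
      unfolding T_def Ee \<eta>x power_mult_distrib using Ey kx by simp
    have "(hess w y b b * \<zeta> y)\<^sup>2 * D = T x b' * D * (Ey * Dy)" unfolding TE by simp
    also have "\<dots> \<le> T x0 e0 * D * (Ey * Dy)"
      using Tmax[OF xR b'(1)] D Ey Dy by (intro mult_right_mono) auto
    finally have "(hess w y b b * \<zeta> y)\<^sup>2 * D \<le> (hess w z0 b b * \<zeta> z0)\<^sup>2 * (Ey * Dy)" unfolding T0 \<zeta>0 .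
    moreover have "Ey = (1 + dd (b, 0) w y * dd (b, 0) w y) * (1 + dd (b, 0) w y * dd (b, 0) w y)"
      by (simp add: Ey_def inner_grad[OF w yZ] power2_eq_square)
    ultimately show ?thesis unfolding Deq[OF yZ] Dy_def[symmetric]
      by (simp only: hess_def power2_eq_square)
  qed
  have "(\<zeta> z0)\<^sup>2 * k * (dd (b, 0) (dd (b, 0) w) z0)\<^sup>2 / D
     \<le> (\<beta>\<^sup>2 / k + 2) * (4 * (fst z0 \<bullet> fst z0)) + \<zeta> z0 * (2 * real CARD('n) + 1)"
  proof -
    have wm: "normal_mcf (graph_map w) y" if "y \<in> Z'" for y using wmcf that by (simp add: Z'_def)
    have "\<zeta> z0 > 0" using z0' by (simp add: Z'_def)
    with maximum_point_estimate[OF w' z0' wm gw b hmax hbpos k, of \<beta> a r2 s1, folded \<zeta>_def, unfolded Dz0, OF _ _ D _ max]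
    show ?thesis by blast
  qed
  moreover have "(\<zeta> z0)\<^sup>2 * k * (dd (b, 0) (dd (b, 0) w) z0)\<^sup>2 / D = k * T x0 e0"
    using T0 D by (simp add: \<zeta>0 hess_def power_mult_distrib field_simps)
  ultimately have main: "k * T x0 e0 \<le> (\<beta>\<^sup>2 / k + 2) * (4 * (fst z0 \<bullet> fst z0)) + \<eta> x0 * (2 * real CARD('n) + 1)"
    by (simp add: \<zeta>0)
  have \<beta>1: "\<beta>\<^sup>2 \<le> 1" using \<beta> vv_ge_1[of u x0] by (smt (verit) mult_le_cancel_left1 zero_le_power2)
  have f0: "fst z0 \<bullet> fst z0 \<le> r2" and e0r: "\<eta> x0 \<le> r2"
    using x0 pos0 by (auto simp: Reg_def \<eta>_def) (smt (verit) inner_ge_zero zero_le_square)+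
  have "k * T x0 e0 \<le> (2 * V + 2) * (4 * r2) + r2 * (2 * real CARD('n) + 1)"
  proof -
    have "\<beta>\<^sup>2 / k \<le> 2 * V" using \<beta>1 V by (simp add: k_def)
    then have "(\<beta>\<^sup>2 / k + 2) * (4 * (fst z0 \<bullet> fst z0)) \<le> (2 * V + 2) * (4 * r2)"
      using f0 V by (intro mult_mono) auto
    moreover have "\<eta> x0 * (2 * real CARD('n) + 1) \<le> r2 * (2 * real CARD('n) + 1)"
      using e0r by (intro mult_right_mono) auto
    ultimately show ?thesis using main by linarith
  qed
  then have "2 * V * (k * T x0 e0) \<le> 2 * V * ((2 * V + 2) * (4 * r2) + r2 * (2 * real CARD('n) + 1))"
    using V by (intro mult_left_mono) auto
  then have TT: "T x0 e0 \<le> 2 * V * (2 * V + 2) * (4 * r2) + 2 * V * (r2 * (2 * real CARD('n) + 1))"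
    using V by (simp add: k_def distrib_left mult_ac)
  have "(hess u x1 e1 e1)\<^sup>2 * (r2 - fst x1 \<bullet> fst x1 - u x1 * u x1)\<^sup>2 / (1 + (grad u x1 \<bullet> e1)\<^sup>2)\<^sup>2
    = (hess u x1 e1 e1 * \<eta> x1)\<^sup>2 / ((e1 \<bullet> e1 + (grad u x1 \<bullet> e1)\<^sup>2)\<^sup>2)"
    using x1(1) e1 by (simp add: \<eta>_def power_mult_distrib norm_eq_1)
  also have "\<dots> \<le> T x1 e1"
  proof -
    have "1 - k * vv u x1 \<le> 1" using k vv_ge_1[of u x1] by simp
    moreover have "(e1 \<bullet> e1 + (grad u x1 \<bullet> e1)\<^sup>2)\<^sup>2 > 0"
    proof -
      have "e1 \<bullet> e1 + (grad u x1 \<bullet> e1)\<^sup>2 > 0" using e1 by (simp add: norm_eq_1 add_pos_nonneg)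
      then show ?thesis by simp
    qed
    ultimately have "(e1 \<bullet> e1 + (grad u x1 \<bullet> e1)\<^sup>2)\<^sup>2 * (1 - k * vv u x1) \<le> (e1 \<bullet> e1 + (grad u x1 \<bullet> e1)\<^sup>2)\<^sup>2"
      by (simp add: mult_left_le)
    then show ?thesis unfolding T_def using kv[OF x1R] \<open>(e1 \<bullet> e1 + (grad u x1 \<bullet> e1)\<^sup>2)\<^sup>2 > 0\<close>
      by (intro divide_left_mono mult_pos_pos) auto
  qed
  also have "\<dots> \<le> T x0 e0" using Tmax[OF x1R, of e1] e1 by force
  finally show ?thesis using TT by simp
qed

text \<open>For each \<delta> and large R, \<open>vv u\<close> is at most \<delta> R on the region
  of radius R. The interior estimate then bounds the squared curvature term X by a multiple of
  \<delta>^2 that does not depend on R, and \<delta> is arbitrary.\<close>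

theorem graphical_ancient_solution_flat:
  fixes u :: "(real^'n) \<times> real \<Rightarrow> real" and \<tau> :: real
  assumes u: "smooth_open (UNIV \<times> {..<\<tau>}) u"
    and mcf: "\<And>x. x \<in> UNIV \<times> {..<\<tau>} \<Longrightarrow> normal_mcf (graph_map u) x"
    and growth: "\<And>\<epsilon>. \<epsilon> > 0 \<Longrightarrow> \<exists>C. \<forall>y. \<forall>t<\<tau>. sqrt (vv u (y, t)) \<le> C + \<epsilon> * sqrt (norm (y, u (y, t)) + sqrt \<bar>t\<bar>)"
    and s1: "s1 < \<tau>" and e: "norm e = 1"
  shows "hess u (y1, s1) e e = 0"
proof -
  define P where "P = y1 \<bullet> y1 + u (y1, s1) * u (y1, s1)"
  have P: "P \<ge> 0" unfolding P_def by (simp add: add_nonneg_nonneg)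
  define X where "X = (hess u (y1, s1) e e)\<^sup>2 / (1 + (grad u (y1, s1) \<bullet> e)\<^sup>2)\<^sup>2"
  \<comment> \<open>Collects the constants of the estimate once V is replaced by V^2: 32 from its
    first term and 2 (2 n + 1) from its second make 2 N.\<close>
  define N where "N = 2 * real CARD('n) + 17"
  have bound: "X \<le> 8 * N * \<delta>\<^sup>2" if \<delta>: "\<delta> > 0" for \<delta>
  proof -
    \<comment> \<open>On the region |F| + sqrt|t| is at most 2 R + sqrt|s1|. Squaring the growth
      bound costs a factor 2, so R enters the bound for \<open>vv u\<close> with 4 \<epsilon>^2 R =
      \<delta> R / 3.\<close>
    define \<epsilon> where "\<epsilon> = sqrt (\<delta> / 12)"
    have \<epsilon>: "\<epsilon> > 0" "\<epsilon>\<^sup>2 = \<delta> / 12" using \<delta> by (auto simp: \<epsilon>_def)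
    obtain C where C: "\<And>y t. t < \<tau> \<Longrightarrow> sqrt (vv u (y, t)) \<le> C + \<epsilon> * sqrt (norm (y, u (y, t)) + sqrt \<bar>t\<bar>)"
      using growth[OF \<epsilon>(1)] by blast
    define A where "A = 2 * C\<^sup>2 + 1 + 2 * \<epsilon>\<^sup>2 * sqrt \<bar>s1\<bar>"
    \<comment> \<open>Large enough for \<open>A \<le> \<delta> * R / 3\<close>, so that A and the
      term with R fit below \<open>V = \<delta> * R\<close>, and for
      \<open>2 * P < R\<^sup>2\<close>, so that the cutoff at the given point is at least R^2 /
      2.\<close>
    define R where "R = max (max 1 (sqrt (2 * P + 1))) (3 * A / \<delta>)"
    have R1: "R \<ge> 1" and RA: "3 * A / \<delta> \<le> R" and RP: "sqrt (2 * P + 1) \<le> R" by (auto simp: R_def)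
    have R2P: "2 * P < R\<^sup>2"
    proof -
      have "(sqrt (2 * P + 1))\<^sup>2 \<le> R\<^sup>2" using RP P by (intro power_mono) auto
      then show ?thesis using P by simp
    qed
    define V where "V = \<delta> * R"
    have AV: "A + 4 * \<epsilon>\<^sup>2 * R \<le> V"
    proof -
      have "A \<le> \<delta> * R / 3" using RA \<delta> by (simp add: field_simps)
      moreover have "4 * \<epsilon>\<^sup>2 * R = \<delta> * R / 3" using \<epsilon>(2) by simp
      moreover have "0 \<le> \<delta> * R" using \<delta> R1 by simp
      ultimately show ?thesis unfolding V_def by linarith
    qed
    have A1: "A \<ge> 1" by (simp add: A_def)
    have V1: "V \<ge> 1"
    proof -
      have "0 \<le> 4 * \<epsilon>\<^sup>2 * R" using R1 by simp
      then show ?thesis using AV A1 by linarith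
    qed
    have vV: "vv u x \<le> V" if x: "snd x \<le> s1" "fst x \<bullet> fst x + u x * u x \<le> R\<^sup>2 + (snd x - s1)" for x
    proof -
      obtain y t where yt: "x = (y, t)" by (cases x)
      have t: "t \<le> s1" "t < \<tau>" using x yt s1 by auto
      have "y \<bullet> y + u x * u x \<ge> 0" by (simp add: add_nonneg_nonneg)
      moreover have "y \<bullet> y + u x * u x \<le> R\<^sup>2 + (t - s1)" using x(2) yt by simp
      ultimately have le: "y \<bullet> y + u x * u x \<le> R\<^sup>2" and ts: "s1 - t \<le> R\<^sup>2" using t(1) by linarith+
      have "norm (y, u (y, t)) = sqrt (y \<bullet> y + u x * u x)" by (simp add: norm_eq_sqrt_inner yt)
      also have "\<dots> \<le> R" using le R1 by (intro real_le_lsqrt) auto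
      finally have n: "norm (y, u (y, t)) \<le> R" .
      have "sqrt \<bar>t\<bar> \<le> sqrt (\<bar>s1\<bar> + R\<^sup>2)" using ts t by (intro real_sqrt_le_mono) auto
      also have "\<dots> \<le> sqrt \<bar>s1\<bar> + sqrt (R\<^sup>2)" by (rule sqrt_add_le_add_sqrt) auto
      also have "sqrt (R\<^sup>2) = R" using R1 by simp
      finally have "norm (y, u (y, t)) + sqrt \<bar>t\<bar> \<le> 2 * R + sqrt \<bar>s1\<bar>" using n by simp
      then have "\<epsilon> * sqrt (norm (y, u (y, t)) + sqrt \<bar>t\<bar>) \<le> \<epsilon> * sqrt (2 * R + sqrt \<bar>s1\<bar>)"
        using \<epsilon>(1) by (intro mult_left_mono real_sqrt_le_mono) auto
      then have 1: "sqrt (vv u x) \<le> C + \<epsilon> * sqrt (2 * R + sqrt \<bar>s1\<bar>)" using C[OF t(2), of y] yt by simp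
      have "0 \<le> sqrt (vv u x)" using vv_ge_1[of u x] by simp
      then have "vv u x \<le> (C + \<epsilon> * sqrt (2 * R + sqrt \<bar>s1\<bar>))\<^sup>2"
        using power_mono[OF 1, of 2] vv_ge_1[of u x] by simp
      also have "\<dots> \<le> 2 * C\<^sup>2 + 2 * (\<epsilon> * sqrt (2 * R + sqrt \<bar>s1\<bar>))\<^sup>2"
        using zero_le_power2[of "C - \<epsilon> * sqrt (2 * R + sqrt \<bar>s1\<bar>)"] by (simp add: power2_eq_square algebra_simps)
      also have "(\<epsilon> * sqrt (2 * R + sqrt \<bar>s1\<bar>))\<^sup>2 = \<epsilon>\<^sup>2 * (2 * R + sqrt \<bar>s1\<bar>)"
        using R1 by (simp add: power_mult_distrib)
      also have "2 * C\<^sup>2 + 2 * (\<epsilon>\<^sup>2 * (2 * R + sqrt \<bar>s1\<bar>)) \<le> A + 4 * \<epsilon>\<^sup>2 * R"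
        by (simp add: A_def algebra_simps)
      finally show ?thesis using AV by simp
    qed
    have PR: "y1 \<bullet> y1 + u (y1, s1) * u (y1, s1) < R\<^sup>2" 
    proof -
      have "P < R\<^sup>2" using R2P P by linarith
      then show ?thesis by (simp only: P_def)
    qed
    have "(hess u (y1, s1) e e)\<^sup>2 * (R\<^sup>2 - fst (y1, s1) \<bullet> fst (y1, s1) - u (y1, s1) * u (y1, s1))\<^sup>2 / (1 + (grad u (y1, s1) \<bullet> e)\<^sup>2)\<^sup>2
     \<le> 2 * V * (2 * V + 2) * (4 * R\<^sup>2) + 2 * V * (R\<^sup>2 * (2 * real CARD('n) + 1))"
      by (rule interior_curvature_estimate[OF u mcf s1 V1 vV]) (use e PR in auto)
    then have "X * (R\<^sup>2 - P)\<^sup>2 \<le> 2 * V * (2 * V + 2) * (4 * R\<^sup>2) + 2 * V * (R\<^sup>2 * (2 * real CARD('n) + 1))"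
      by (simp add: X_def P_def algebra_simps)
    also have "\<dots> \<le> 2 * V\<^sup>2 * R\<^sup>2 * N"
    proof -
      have "V \<le> V\<^sup>2" using V1 by (simp add: power2_eq_square)
      have "2 * V * (2 * V + 2) * (4 * R\<^sup>2) = 16 * R\<^sup>2 * (V\<^sup>2 + V)" by (simp add: power2_eq_square algebra_simps)
      also have "\<dots> \<le> 16 * R\<^sup>2 * (V\<^sup>2 + V\<^sup>2)" using \<open>V \<le> V\<^sup>2\<close> by (intro mult_left_mono) auto
      finally have 1: "2 * V * (2 * V + 2) * (4 * R\<^sup>2) \<le> 32 * (R\<^sup>2 * V\<^sup>2)" by simp
      have 2: "2 * V * (R\<^sup>2 * (2 * real CARD('n) + 1)) \<le> 2 * V\<^sup>2 * (R\<^sup>2 * (2 * real CARD('n) + 1))"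
        using \<open>V \<le> V\<^sup>2\<close> by (intro mult_right_mono) auto
      show ?thesis using 1 2 by (simp add: N_def algebra_simps)
    qed
    finally have XR: "X * (R\<^sup>2 - P)\<^sup>2 \<le> 2 * \<delta>\<^sup>2 * N * (R\<^sup>2)\<^sup>2" by (simp add: V_def power_mult_distrib power2_eq_square mult_ac)
    have "(R\<^sup>2 / 2)\<^sup>2 \<le> (R\<^sup>2 - P)\<^sup>2" using R2P P by (intro power_mono) auto
    then have "X * (R\<^sup>2 / 2)\<^sup>2 \<le> X * (R\<^sup>2 - P)\<^sup>2" by (rule mult_left_mono) (simp add: X_def)
    with XR have "X * (R\<^sup>2)\<^sup>2 \<le> 8 * N * \<delta>\<^sup>2 * (R\<^sup>2)\<^sup>2" by (simp add: power_divide mult_ac)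
    moreover have "(R\<^sup>2)\<^sup>2 > 0" using R1 by simp
    ultimately show ?thesis by (metis mult_le_cancel_right_pos)
  qed
  have "X \<le> 0"
  proof (rule ccontr)
    assume "\<not> X \<le> 0"
    have N: "N > 0" by (simp add: N_def add_nonneg_pos)
    \<comment> \<open>With this \<delta> the bound reads \<open>X \<le> X / 2\<close>.\<close>
    have "X \<le> 8 * N * (sqrt (X / (16 * N)))\<^sup>2" using \<open>\<not> X \<le> 0\<close> N by (intro bound) simp
    also have "\<dots> = X / 2" using \<open>\<not> X \<le> 0\<close> N by simp
    finally show False using \<open>\<not> X \<le> 0\<close> by simp
  qed
  moreover have "1 + (grad u (y1, s1) \<bullet> e)\<^sup>2 > 0" by (simp add: add_pos_nonneg)
  ultimately show ?thesis by (simp add: X_def divide_le_0_iff)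
qed

section \<open>Lengths of curves and the distance on the sphere\<close>

text \<open>The end points are added to the finite exceptional set, so nothing is required of the
  derivative there.\<close>

lemma pwC1_I:
  fixes g :: "real \<Rightarrow> 'a::real_normed_vector"
  assumes "continuous_on {a..b} g" "finite S"
    and "\<And>s. s \<in> {a<..<b} - S \<Longrightarrow> (g has_vector_derivative D s) (at s)" "continuous_on ({a<..<b} - S) D"
  shows "g piecewise_C1_differentiable_on {a..b}"
proof -
  have "{a..b} - (S \<union> {a, b}) = {a<..<b} - S" by auto
  then have "g C1_differentiable_on ({a..b} - (S \<union> {a, b}))"
    unfolding C1_differentiable_on_def using assms(3,4) by (intro exI[of _ D]) simp
  moreover have "finite (S \<union> {a, b})" using assms(2) by simp
  ultimately show ?thesis using assms(1) unfolding piecewise_C1_differentiable_on_def by blast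
qed

lemma pwC1_D:
  fixes g :: "real \<Rightarrow> 'a::real_normed_vector"
  assumes "g piecewise_C1_differentiable_on {a..b}"
  obtains S D where "finite S" "\<And>s. s \<in> {a<..<b} - S \<Longrightarrow> (g has_vector_derivative D s) (at s)"
    "continuous_on ({a<..<b} - S) D" "continuous_on {a..b} g"
proof -
  obtain S where S: "finite S" "g C1_differentiable_on ({a..b} - S)" and c: "continuous_on {a..b} g"
    using assms unfolding piecewise_C1_differentiable_on_def by blast
  obtain D where D: "\<forall>x\<in>{a..b} - S. (g has_vector_derivative D x) (at x)" "continuous_on ({a..b} - S) D"
    using S(2) unfolding C1_differentiable_on_def by blast
  have "{a<..<b} - S \<subseteq> {a..b} - S" by auto
  then have "continuous_on ({a<..<b} - S) D" by (rule continuous_on_subset[OF D(2)])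
  then show ?thesis using that[of S D] S(1) D(1) c by auto
qed

lemma pwC1_cong:
  fixes g :: "real \<Rightarrow> 'a::real_normed_vector"
  assumes "g piecewise_C1_differentiable_on {a..b}" "\<And>s. s \<in> {a..b} \<Longrightarrow> g s = h s"
  shows "h piecewise_C1_differentiable_on {a..b}"
proof -
  obtain S D where S: "finite S" "\<And>s. s \<in> {a<..<b} - S \<Longrightarrow> (g has_vector_derivative D s) (at s)"
    "continuous_on ({a<..<b} - S) D" "continuous_on {a..b} g"
    by (rule pwC1_D[OF assms(1)]) blast
  show ?thesis
  proof (rule pwC1_I[OF _ S(1) _ S(3)])
    show "continuous_on {a..b} h" by (rule continuous_on_eq[OF S(4) assms(2)])
    show "(h has_vector_derivative D s) (at s)" if "s \<in> {a<..<b} - S" for s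
      by (rule has_vector_derivative_transform_within_open[OF S(2)[OF that] open_greaterThanLessThan])
        (use that assms(2) in auto)
  qed
qed

lemma smooth_chain_vector_derivative:
  assumes "smooth_open W G" "(g has_vector_derivative v) (at s)" "g s \<in> W"
  shows "((\<lambda>s. G (g s)) has_vector_derivative dd v G (g s)) (at s)"
  unfolding has_vector_derivative_def
  by (rule has_derivative_eq_rhs[OF has_derivative_compose[OF assms(2)[unfolded has_vector_derivative_def] smooth_openD(2)[OF assms(1,3)]]])
    (simp add: linear_scale[OF smooth_openD(5)[OF assms(1,3)]])

lemma continuous_on_dd:
  assumes G: "smooth_open W G" and "continuous_on T g" "continuous_on T D" "g ` T \<subseteq> W"
  shows "continuous_on T (\<lambda>s. dd (D s) G (g s))"
proof -
  have "dd (D s) G (g s) = (\<Sum>b\<in>Basis. (D s \<bullet> b) *\<^sub>R dd b G (g s))" if "s \<in> T" for s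
  proof -
    have l: "linear (frechet_derivative G (at (g s)))" using smooth_openD(5)[OF G] assms(4) that by auto
    have "dd (\<Sum>b\<in>Basis. (D s \<bullet> b) *\<^sub>R b) G (g s) = (\<Sum>b\<in>Basis. (D s \<bullet> b) *\<^sub>R dd b G (g s))"
      by (simp add: linear_sum[OF l] linear_scale[OF l])
    then show ?thesis by (simp only: euclidean_representation)
  qed
  moreover have "continuous_on T (\<lambda>s. \<Sum>b\<in>Basis. (D s \<bullet> b) *\<^sub>R dd b G (g s))"
    by (intro continuous_intros assms(3) continuous_on_compose2[OF smooth_openD(4)[OF smooth_openD(3)[OF G]] assms(2,4)])
  ultimately show ?thesis by (simp cong: continuous_on_cong)
qed

lemma pwC1_smooth_compose:
  assumes "g piecewise_C1_differentiable_on {a..b}" "smooth_open W G" "g ` {a..b} \<subseteq> W"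
  shows "(\<lambda>s. G (g s)) piecewise_C1_differentiable_on {a..b}"
proof -
  obtain S D where S: "finite S" "\<And>s. s \<in> {a<..<b} - S \<Longrightarrow> (g has_vector_derivative D s) (at s)"
    "continuous_on ({a<..<b} - S) D" "continuous_on {a..b} g"
    by (rule pwC1_D[OF assms(1)]) blast
  show ?thesis
  proof (rule pwC1_I[OF _ S(1)])
    show "continuous_on {a..b} (\<lambda>s. G (g s))"
      by (rule continuous_on_compose2[OF smooth_openD(4)[OF assms(2)] S(4) assms(3)])
    show "((\<lambda>s. G (g s)) has_vector_derivative dd (D s) G (g s)) (at s)" if "s \<in> {a<..<b} - S" for s
      by (rule smooth_chain_vector_derivative[OF assms(2) S(2)[OF that]]) (use that assms(3) in auto)
    show "continuous_on ({a<..<b} - S) (\<lambda>s. dd (D s) G (g s))"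
      by (rule continuous_on_dd[OF assms(2) continuous_on_subset[OF S(4)] S(3)]) (use assms(3) in auto)
  qed
qed

lemma smooth_open_C1:
  fixes g :: "real \<Rightarrow> 'a::euclidean_space"
  assumes "smooth_open W g" "T \<subseteq> W"
  shows "g C1_differentiable_on T"
  unfolding C1_differentiable_on_def
proof (intro exI[of _ "dd 1 g"] conjI ballI)
  show "(g has_vector_derivative dd 1 g s) (at s)" if "s \<in> T" for s
    unfolding has_vector_derivative_def
  proof (rule has_derivative_eq_rhs)
    show "(g has_derivative frechet_derivative g (at s)) (at s)"
      using smooth_openD(2)[OF assms(1)] assms(2) that by blast
    have "linear (frechet_derivative g (at s))" using smooth_openD(5)[OF assms(1)] assms(2) that by blast
    note l = linear_scale[OF this]
    show "frechet_derivative g (at s) = (\<lambda>r. r *\<^sub>R dd 1 g s)"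
    proof
      fix r :: real
      have "dd (r *\<^sub>R 1) g s = r *\<^sub>R dd 1 g s" by (rule l)
      then show "dd r g s = r *\<^sub>R dd 1 g s" by (simp only: real_scaleR_def mult_1_right)
    qed
  qed
  show "continuous_on T (dd 1 g)"
    by (rule continuous_on_subset[OF smooth_openD(4)[OF smooth_openD(3)[OF assms(1)]] assms(2)])
qed

lemma pwC1_join:
  fixes f g :: "real \<Rightarrow> 'a::real_normed_vector"
  assumes "f piecewise_C1_differentiable_on {a..b}" "f piecewise_C1_differentiable_on {b..c}" "a \<le> b" "b \<le> c"
  shows "f piecewise_C1_differentiable_on {a..c}"
  using piecewise_C1_differentiable_cases[OF assms refl] by simp

text \<open>D may be unbounded near the exceptional points. If its norm is not integrable, the right
  side is infinite; otherwise the fundamental theorem for the gauge integral applies, which here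
  agrees with the Lebesgue integral.\<close>

lemma norm_diff_le_nn_integral:
  fixes g :: "real \<Rightarrow> 'a::euclidean_space"
  assumes ab: "a \<le> b" and cont: "continuous_on {a..b} g" and S: "finite S"
    and d: "\<And>s. s \<in> {a<..<b} - S \<Longrightarrow> (g has_vector_derivative D s) (at s)" and cD: "continuous_on ({a<..<b} - S) D"
    and le: "\<And>s. s \<in> {a<..<b} - S \<Longrightarrow> norm (D s) \<le> \<rho> s"
  shows "ennreal (norm (g b - g a)) \<le> (\<integral>\<^sup>+ s\<in>{a..b}. ennreal (\<rho> s) \<partial>lborel)"
proof -
  define T where "T = {a<..<b} - S"
  define D' where "D' s = indicator T s *\<^sub>R D s" for s
  have "open T" unfolding T_def using S by (intro open_Diff open_greaterThanLessThan finite_imp_closed)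
  then have meas: "D' \<in> borel_measurable lborel"
    unfolding D'_def[abs_def] using cD borel_measurable_continuous_on_indicator[of T D] by (simp add: T_def borel_open)
  have nn: "(\<integral>\<^sup>+ s. ennreal (norm (D' s)) \<partial>lborel) \<le> (\<integral>\<^sup>+ s\<in>{a..b}. ennreal (\<rho> s) \<partial>lborel)"
    by (rule nn_integral_mono) (use le in \<open>auto simp: D'_def T_def indicator_def intro!: ennreal_leI\<close>)
  show ?thesis
  proof (cases "(\<integral>\<^sup>+ s. ennreal (norm (D' s)) \<partial>lborel) = \<infinity>")
    case True
    then show ?thesis using nn by (metis infinity_ennreal_def top.extremum top.extremum_uniqueI)
  next
    case False
    then have int: "integrable lborel D'"
      by (intro integrableI_bounded meas) (simp add: less_top)
    have "(D has_integral (g b - g a)) {a..b}"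
      by (rule fundamental_theorem_of_calculus_interior_strong[OF S ab d cont])
    then have "(D' has_integral (g b - g a)) {a..b}"
      by (rule has_integral_spike_finite[of "S \<union> {a, b}", rotated 2]) (use S in \<open>auto simp: D'_def T_def\<close>)
    then have "(D' has_integral (g b - g a)) UNIV"
      by (rule has_integral_on_superset) (auto simp: D'_def T_def)
    then have eq: "g b - g a = integral\<^sup>L lborel D'"
      using has_integral_integral_lborel[OF int] has_integral_unique by blast
    have "ennreal (norm (g b - g a)) \<le> ennreal (integral\<^sup>L lborel (\<lambda>s. norm (D' s)))"
      unfolding eq by (intro ennreal_leI integral_norm_bound)
    also have "\<dots> = (\<integral>\<^sup>+ s. ennreal (norm (D' s)) \<partial>lborel)"
      by (rule nn_integral_eq_integral[symmetric]) (use int in auto)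
    finally show ?thesis using nn by simp
  qed
qed

text \<open>Finitely many points form a null set, so the values of \<open>vector_derivative\<close>
  at corners and end points do not matter. Extending D by 0 turns the length into an integral over
  the whole line, ready for affine substitutions.\<close>

lemma curve_length_eqI:
  fixes c :: "real \<Rightarrow> 'a::euclidean_space"
  assumes "finite S" "\<And>s. s \<in> {0<..<1} - S \<Longrightarrow> (c has_vector_derivative D s) (at s)"
    "\<And>s. s \<notin> {0<..<1} - S \<Longrightarrow> D s = 0"
  shows "curve_length c = (\<integral>\<^sup>+ s. ennreal (norm (D s)) \<partial>lborel)"
  unfolding curve_length_def
proof (rule nn_integral_cong_AE)
  have "AE s in lborel. s \<notin> S \<union> {0, 1}"
    by (rule AE_not_in) (use assms(1) in \<open>auto intro!: finite_imp_null_set_lborel\<close>)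
  then show "AE s in lborel. ennreal (norm (vector_derivative c (at s))) * indicator {0..1} s = ennreal (norm (D s))"
  proof (rule AE_mp, intro AE_I2 impI)
    fix s :: real assume s: "s \<notin> S \<union> {0, 1}"
    show "ennreal (norm (vector_derivative c (at s))) * indicator {0..1} s = ennreal (norm (D s))"
    proof (cases "s \<in> {0<..<1}")
      case True
      then show ?thesis using s vector_derivative_at[OF assms(2), of s] by auto
    next
      case False
      then show ?thesis using s assms(3)[of s] by (auto simp: indicator_def)
    qed
  qed
qed

lemma pwC1_speed:
  fixes c :: "real \<Rightarrow> 'a::euclidean_space"
  assumes "c piecewise_C1_differentiable_on {0..1}"
  obtains S D where "finite S" "\<And>s. s \<in> {0<..<1} - S \<Longrightarrow> (c has_vector_derivative D s) (at s)"
    "\<And>s. s \<notin> {0<..<1} - S \<Longrightarrow> D s = 0" "D \<in> borel_measurable borel"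
    "curve_length c = (\<integral>\<^sup>+ s. ennreal (norm (D s)) \<partial>lborel)"
proof -
  obtain S D where S: "finite S" "\<And>s. s \<in> {0<..<1} - S \<Longrightarrow> (c has_vector_derivative D s) (at s)"
    "continuous_on ({0<..<1} - S) D"
    by (rule pwC1_D[OF assms]) blast
  define D' where "D' s = indicator ({0<..<1} - S) s *\<^sub>R D s" for s
  have "open ({0<..<1} - S)" using S(1) by (intro open_Diff open_greaterThanLessThan finite_imp_closed)
  then have "D' \<in> borel_measurable borel"
    unfolding D'_def[abs_def] by (rule borel_measurable_continuous_on_indicator[OF borel_open S(3)])
  moreover have 1: "(c has_vector_derivative D' s) (at s)" if "s \<in> {0<..<1} - S" for s
    using S(2)[OF that] that by (simp add: D'_def)
  moreover have 2: "D' s = 0" if "s \<notin> {0<..<1} - S" for s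
    using that by (simp add: D'_def indicator_def)
  ultimately show ?thesis using S(1) curve_length_eqI[OF S(1) 1 2] that by blast
qed

lemma curve_length_reverse:
  fixes c :: "real \<Rightarrow> 'a::euclidean_space"
  assumes "c piecewise_C1_differentiable_on {0..1}"
  shows "curve_length (\<lambda>s. c (1 - s)) = curve_length c"
proof -
  obtain S D where S: "finite S" "\<And>s. s \<in> {0<..<1} - S \<Longrightarrow> (c has_vector_derivative D s) (at s)"
    "\<And>s. s \<notin> {0<..<1} - S \<Longrightarrow> D s = 0" "D \<in> borel_measurable borel"
    "curve_length c = (\<integral>\<^sup>+ s. ennreal (norm (D s)) \<partial>lborel)"
    by (rule pwC1_speed[OF assms]) blast
  have "curve_length (\<lambda>s. c (1 - s)) = (\<integral>\<^sup>+ s. ennreal (norm (- D (1 - s))) \<partial>lborel)"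
  proof (rule curve_length_eqI[of "(\<lambda>s. 1 - s) ` S"])
    show "finite ((\<lambda>s. 1 - s) ` S)" using S(1) by simp
    fix s
    have iff: "s \<in> {0<..<1} - (\<lambda>s. 1 - s) ` S \<longleftrightarrow> 1 - s \<in> {0<..<1} - S"
      by (force simp: image_iff)
    show "((\<lambda>s. c (1 - s)) has_vector_derivative - D (1 - s)) (at s)" if "s \<in> {0<..<1} - (\<lambda>s. 1 - s) ` S"
    proof -
      have "((\<lambda>s. 1 - s) has_vector_derivative - 1) (at s)" by (auto intro!: derivative_eq_intros)
      from vector_diff_chain_at[OF this, of c "D (1 - s)"] S(2)[of "1 - s"] that iff
      show ?thesis by (simp add: o_def)
    qed
    show "- D (1 - s) = 0" if "s \<notin> {0<..<1} - (\<lambda>s. 1 - s) ` S" 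
    proof -
      have "1 - s \<notin> {0<..<1} - S" using that iff by blast
      from S(3)[OF this] show ?thesis by simp
    qed
  qed
  also have "\<dots> = (\<integral>\<^sup>+ s. ennreal (norm (D s)) \<partial>lborel)"
    using nn_integral_real_affine[of "\<lambda>s. ennreal (norm (D s))" "-1" 1] S(4) by simp
  finally show ?thesis using S(5) by simp
qed

definition join_curves :: "(real \<Rightarrow> 'a) \<Rightarrow> (real \<Rightarrow> 'a) \<Rightarrow> real \<Rightarrow> 'a" where
  "join_curves c1 c2 s = (if s \<le> 1 / 2 then c1 (2 * s) else c2 (2 * s - 1))"

lemma curve_length_join:
  fixes c1 c2 :: "real \<Rightarrow> 'a::euclidean_space"
  assumes "c1 piecewise_C1_differentiable_on {0..1}" "c2 piecewise_C1_differentiable_on {0..1}"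
  shows "curve_length (join_curves c1 c2) \<le> curve_length c1 + curve_length c2"
proof -
  obtain S1 D1 where 1: "finite S1" "\<And>s. s \<in> {0<..<1} - S1 \<Longrightarrow> (c1 has_vector_derivative D1 s) (at s)"
    "\<And>s. s \<notin> {0<..<1} - S1 \<Longrightarrow> D1 s = 0" "D1 \<in> borel_measurable borel"
    "curve_length c1 = (\<integral>\<^sup>+ s. ennreal (norm (D1 s)) \<partial>lborel)"
    by (rule pwC1_speed[OF assms(1)]) blast
  obtain S2 D2 where 2: "finite S2" "\<And>s. s \<in> {0<..<1} - S2 \<Longrightarrow> (c2 has_vector_derivative D2 s) (at s)"
    "\<And>s. s \<notin> {0<..<1} - S2 \<Longrightarrow> D2 s = 0" "D2 \<in> borel_measurable borel"
    "curve_length c2 = (\<integral>\<^sup>+ s. ennreal (norm (D2 s)) \<partial>lborel)"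
    by (rule pwC1_speed[OF assms(2)]) blast
  define S where "S = (\<lambda>s. s / 2) ` S1 \<union> (\<lambda>s. (s + 1) / 2) ` S2 \<union> {1 / 2}"
  \<comment> \<open>Each rescaled velocity vanishes outside its own half, so the sum is the velocity
    on both halves.\<close>
  define D where "D s = (if s \<in> S then 0 else 2 *\<^sub>R D1 (2 * s) + 2 *\<^sub>R D2 (2 * s - 1))" for s
  have S: "finite S" using 1(1) 2(1) by (simp add: S_def)
  have nS: "2 * s \<notin> S1" "2 * s - 1 \<notin> S2" "s \<noteq> 1 / 2" if "s \<notin> S" for s
    using that by (auto simp: S_def image_iff mult.commute[of 2])
  have "curve_length (join_curves c1 c2) = (\<integral>\<^sup>+ s. ennreal (norm (D s)) \<partial>lborel)"
  proof (rule curve_length_eqI[OF S])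
    fix s
    show "(join_curves c1 c2 has_vector_derivative D s) (at s)" if s: "s \<in> {0<..<1} - S"
    proof (cases "s < 1 / 2")
      case True
      have D: "D s = 2 *\<^sub>R D1 (2 * s)" using s True 2(3)[of "2 * s - 1"] by (simp add: D_def)
      have "((\<lambda>s. 2 * s) has_vector_derivative 2) (at s)" by (auto intro!: derivative_eq_intros)
      from vector_diff_chain_at[OF this, of c1 "D1 (2 * s)"] 1(2)[of "2 * s"] True s nS(1)[of s]
      have "((\<lambda>s. c1 (2 * s)) has_vector_derivative 2 *\<^sub>R D1 (2 * s)) (at s)" by (simp add: o_def)
      then show ?thesis unfolding D
        by (rule has_vector_derivative_transform_within_open[of _ _ _ "{..<1 / 2}"])
          (use True in \<open>auto simp: join_curves_def\<close>)
    next
      case False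
      then have gt: "s > 1 / 2" using s nS(3)[of s] by auto
      have D: "D s = 2 *\<^sub>R D2 (2 * s - 1)" using s gt 1(3)[of "2 * s"] by (simp add: D_def)
      have "((\<lambda>s. 2 * s - 1) has_vector_derivative 2) (at s)" by (auto intro!: derivative_eq_intros)
      from vector_diff_chain_at[OF this, of c2 "D2 (2 * s - 1)"] 2(2)[of "2 * s - 1"] gt s nS(2)[of s]
      have "((\<lambda>s. c2 (2 * s - 1)) has_vector_derivative 2 *\<^sub>R D2 (2 * s - 1)) (at s)" by (simp add: o_def)
      then show ?thesis unfolding D
        by (rule has_vector_derivative_transform_within_open[of _ _ _ "{1 / 2<..}"])
          (use gt in \<open>auto simp: join_curves_def\<close>)
    qed
    show "D s = 0" if "s \<notin> {0<..<1} - S"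
      using that 1(3)[of "2 * s"] 2(3)[of "2 * s - 1"] by (auto simp: D_def)
  qed
  also have "\<dots> \<le> (\<integral>\<^sup>+ s. 2 * ennreal (norm (D1 (0 + 2 * s))) + 2 * ennreal (norm (D2 (- 1 + 2 * s))) \<partial>lborel)"
  proof (rule nn_integral_mono)
    fix s
    have "norm (D s) \<le> 2 * norm (D1 (2 * s)) + 2 * norm (D2 (2 * s - 1))"
      using norm_triangle_ineq[of "2 *\<^sub>R D1 (2 * s)" "2 *\<^sub>R D2 (2 * s - 1)"] by (auto simp: D_def)
    from ennreal_leI[OF this]
    show "ennreal (norm (D s)) \<le> 2 * ennreal (norm (D1 (0 + 2 * s))) + 2 * ennreal (norm (D2 (- 1 + 2 * s)))"
      by (simp add: ennreal_plus ennreal_mult add.commute)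
  qed
  also have "\<dots> = curve_length c1 + curve_length c2"
  proof -
    have "2 * (\<integral>\<^sup>+ s. ennreal (norm (D1 (0 + 2 * s))) \<partial>lborel) = curve_length c1"
      unfolding 1(5) using nn_integral_real_affine[of "\<lambda>s. ennreal (norm (D1 s))" 2 0] 1(4) by simp
    moreover have "2 * (\<integral>\<^sup>+ s. ennreal (norm (D2 (- 1 + 2 * s))) \<partial>lborel) = curve_length c2"
      unfolding 2(5) using nn_integral_real_affine[of "\<lambda>s. ennreal (norm (D2 s))" 2 "-1"] 2(4) by simp
    moreover have "(\<lambda>s. D1 (0 + 2 * s)) \<in> borel_measurable borel" "(\<lambda>s. D2 (- 1 + 2 * s)) \<in> borel_measurable borel"
      using measurable_compose[OF _ 1(4), of "\<lambda>s. 0 + 2 * s"] measurable_compose[OF _ 2(4), of "\<lambda>s. - 1 + 2 * s"] by auto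
    ultimately show ?thesis by (simp add: nn_integral_add nn_integral_cmult)
  qed
  finally show ?thesis .
qed

lemma curve_length_bound:
  assumes "\<And>s. s \<in> {0<..<1} \<Longrightarrow> (c has_vector_derivative D s) (at s)" "\<And>s. s \<in> {0<..<1} \<Longrightarrow> norm (D s) \<le> B"
  shows "curve_length (c :: real \<Rightarrow> 'a::euclidean_space) \<le> ennreal B"
proof -
  have "curve_length c = (\<integral>\<^sup>+ s. ennreal (norm (indicator {0<..<1} s *\<^sub>R D s)) \<partial>lborel)"
    by (rule curve_length_eqI[of "{}"]) (use assms(1) in auto)
  also have "\<dots> \<le> (\<integral>\<^sup>+ s. ennreal B * indicator {0<..<1::real} s \<partial>lborel)"
    by (rule nn_integral_mono) (use assms(2) in \<open>auto simp: indicator_def intro!: ennreal_leI\<close>)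
  also have "\<dots> = ennreal B" by (simp add: nn_integral_cmult_indicator)
  finally show ?thesis .
qed

text \<open>The angle to \<open>p\<close> is not differentiable at \<open>p\<close> and \<open>-p\<close>; replacing \<open>arccos x\<close> by
  \<open>arccos (l x)\<close> with \<open>l < 1\<close> removes the singularities without increasing the derivative.\<close>

lemma curve_length_ge_arccos:
  fixes c :: "real \<Rightarrow> 'a::euclidean_space"
  assumes c: "c piecewise_C1_differentiable_on {0..1}" and sph: "c ` {0..1} \<subseteq> sphere 0 1"
    and l: "0 < l" "l < 1"
  shows "ennreal (arccos (l * (c 0 \<bullet> c 1)) - arccos l) \<le> curve_length c"
proof -
  define p where "p = c 0"
  obtain S D where S: "finite S" "\<And>s. s \<in> {0<..<1} - S \<Longrightarrow> (c has_vector_derivative D s) (at s)"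
    "continuous_on ({0<..<1} - S) D" and cc: "continuous_on {0..1} c"
    by (rule pwC1_D[OF c]) blast
  have n1: "c s \<bullet> c s = 1" if "s \<in> {0..1}" for s using sph that by (auto simp: norm_eq_1[symmetric] image_subset_iff)
  have pp: "p \<bullet> p = 1" unfolding p_def by (rule n1) simp
  have x1: "\<bar>p \<bullet> c s\<bar> \<le> 1" if "s \<in> {0..1}" for s
    using Cauchy_Schwarz_ineq2[of p "c s"] pp n1[OF that] by (simp add: norm_eq_sqrt_inner)
  have lx: "\<bar>l * (p \<bullet> c s)\<bar> < 1" if "s \<in> {0..1}" for s
  proof -
    have "l * \<bar>p \<bullet> c s\<bar> \<le> l * 1" using x1[OF that] l by (intro mult_left_mono) auto
    then have "l * \<bar>p \<bullet> c s\<bar> < 1" using l by linarith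
    then show ?thesis using l by (simp add: abs_mult)
  qed
  define g where "g s = arccos (l * (p \<bullet> c s))" for s
  define g' where "g' s = - (l * (p \<bullet> D s)) / sqrt (1 - (l * (p \<bullet> c s))\<^sup>2)" for s
  have pos: "1 - (l * (p \<bullet> c s))\<^sup>2 > 0" if "s \<in> {0..1}" for s
    using lx[OF that] by (simp add: abs_square_less_1)
  have ne: "sqrt (1 - (l * (p \<bullet> c s))\<^sup>2) \<noteq> 0" if "s \<in> {0<..<1}" for s
    using pos[of s] that by auto
  have "ennreal (norm (g 1 - g 0)) \<le> (\<integral>\<^sup>+ s\<in>{0..1}. ennreal (norm (vector_derivative c (at s))) \<partial>lborel)"
  proof (rule norm_diff_le_nn_integral[OF _ _ S(1)])
    show "continuous_on {0..1} g"
      unfolding g_def by (intro continuous_intros cc) (use lx in fastforce)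
    show "continuous_on ({0<..<1} - S) g'" unfolding g'_def
      by (intro continuous_intros S(3) continuous_on_subset[OF cc]) (use ne in auto)
    fix s assume s: "s \<in> {0<..<1} - S"
    then have s01: "s \<in> {0..1}" by auto
    note Ds = S(2)[OF s]
    have "((\<lambda>s. l * (p \<bullet> c s)) has_real_derivative l * (p \<bullet> D s)) (at s)"
      using bounded_linear.has_vector_derivative[OF bounded_linear_compose[OF bounded_linear_mult_right[of l] bounded_linear_inner_right[of p]] Ds]
      by (simp add: has_real_derivative_iff_has_vector_derivative)
    from DERIV_chain2[OF DERIV_arccos this] lx[OF s01]
    show "(g has_vector_derivative g' s) (at s)"
      unfolding g_def[abs_def] g'_def by (simp add: has_real_derivative_iff_has_vector_derivative[symmetric] abs_less_iff divide_inverse mult.commute)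
    have cD: "c s \<bullet> D s = 0"
    proof -
      have "((\<lambda>s. c s \<bullet> c s) has_vector_derivative c s \<bullet> D s + D s \<bullet> c s) (at s)"
        by (rule bounded_bilinear.has_vector_derivative[OF bounded_bilinear_inner Ds Ds])
      moreover have "((\<lambda>s. c s \<bullet> c s) has_vector_derivative 0) (at s)"
        by (rule has_vector_derivative_transform_within_open[of "\<lambda>s. 1" _ _ "{0<..<1}"]) (use s n1 in auto)
      ultimately have "c s \<bullet> D s + D s \<bullet> c s = 0" using vector_derivative_unique_at by blast
      then show ?thesis by (simp add: inner_commute)
    qed
    define x where "x = p \<bullet> c s"
    have xb: "x\<^sup>2 \<le> 1" using x1[OF s01] by (simp add: x_def abs_square_le_1)
    \<comment> \<open>The velocity is orthogonal to \<open>c s\<close>, so only the part of p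
      tangent to the sphere at \<open>c s\<close> counts. Its norm
      \<open>sqrt (1 - x\<^sup>2)\<close> makes up for the denominator in the derivative of
      arccos.\<close>
    have "\<bar>p \<bullet> D s\<bar> = \<bar>(p - x *\<^sub>R c s) \<bullet> D s\<bar>" by (simp add: inner_diff_left cD)
    also have "\<dots> \<le> norm (p - x *\<^sub>R c s) * norm (D s)" by (rule Cauchy_Schwarz_ineq2)
    also have "norm (p - x *\<^sub>R c s) = sqrt (1 - x\<^sup>2)"
      unfolding norm_eq_sqrt_inner
      by (simp add: inner_diff_left inner_diff_right pp n1[OF s01] x_def[symmetric] inner_commute[of "c s" p] power2_eq_square)
    finally have 1: "\<bar>p \<bullet> D s\<bar> \<le> sqrt (1 - x\<^sup>2) * norm (D s)" .
    have "l * sqrt (1 - x\<^sup>2) = sqrt (l\<^sup>2 * (1 - x\<^sup>2))" using l by (simp add: real_sqrt_mult)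
    also have "\<dots> \<le> sqrt (1 - (l * x)\<^sup>2)"
      using l xb by (intro real_sqrt_le_mono) (simp add: power_mult_distrib algebra_simps power_le_one)
    finally have 2: "l * sqrt (1 - x\<^sup>2) \<le> sqrt (1 - (l * x)\<^sup>2)" .
    have "l * \<bar>p \<bullet> D s\<bar> \<le> l * (sqrt (1 - x\<^sup>2) * norm (D s))" using 1 l by (intro mult_left_mono) auto
    also have "\<dots> \<le> sqrt (1 - (l * x)\<^sup>2) * norm (D s)"
      unfolding mult.assoc[symmetric] using 2 by (intro mult_right_mono) auto
    finally have "norm (g' s) \<le> norm (D s)"
      using pos[OF s01] l by (simp add: g'_def x_def[symmetric] abs_mult divide_le_eq mult.commute)
    then show "norm (g' s) \<le> norm (vector_derivative c (at s))" using vector_derivative_at[OF Ds] by simp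
  qed simp
  moreover have "g 1 - g 0 = arccos (l * (c 0 \<bullet> c 1)) - arccos l" using pp by (simp add: g_def p_def)
  moreover have "ennreal (g 1 - g 0) \<le> ennreal (norm (g 1 - g 0))" by (intro ennreal_leI) auto
  ultimately show ?thesis unfolding curve_length_def by (metis order_trans)
qed

text \<open>A great circle arc attains the angle, and \<open>curve_length_ge_arccos\<close> with l
  tending to 1 shows that no curve is shorter. The dimension matters for antipodal points: on a
  sphere of two points no curve joins them.\<close>

lemma sphere_dist_eq_arccos:
  fixes p q :: "'a::euclidean_space"
  assumes dim: "2 \<le> DIM('a)" and p: "p \<in> sphere 0 1" and q: "q \<in> sphere 0 1"
  shows "sphere_dist p q = arccos (p \<bullet> q)"
proof -
  have pp: "p \<bullet> p = 1" and qq: "q \<bullet> q = 1" using p q by (auto simp: norm_eq_1)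
  define x where "x = p \<bullet> q"
  have x: "\<bar>x\<bar> \<le> 1" using Cauchy_Schwarz_ineq2[of p q] p q by (simp add: x_def)
  define \<theta> where "\<theta> = arccos x"
  have \<theta>: "0 \<le> \<theta>" "cos \<theta> = x" "sin \<theta> = sqrt (1 - x\<^sup>2)"
    using x by (auto simp: \<theta>_def arccos_lbound cos_arccos_abs sin_arccos_abs)
  let ?C = "{c. c piecewise_C1_differentiable_on {0..1} \<and> c ` {0..1} \<subseteq> sphere 0 1 \<and> c 0 = p \<and> c 1 = q}"
  have "(INF c\<in>?C. curve_length c) = ennreal \<theta>"
  proof (rule antisym)
    obtain e where e: "p \<bullet> e = 0" "e \<bullet> e = 1" "q = cos \<theta> *\<^sub>R p + sin \<theta> *\<^sub>R e"
    \<comment> \<open>For q = p or q = -p the sine vanishes and any unit vector orthogonal to p can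
      serve as second axis; otherwise Gram-Schmidt applied to q provides it.\<close>
    proof (cases "x\<^sup>2 = 1")
      case True
      obtain e' where e': "e' \<noteq> 0" "orthogonal p e'" using orthogonal_to_vector_exists[OF dim, of p] by blast
      have "(q - x *\<^sub>R p) \<bullet> (q - x *\<^sub>R p) = 0"
        using True by (simp add: inner_diff_left inner_diff_right pp qq x_def[symmetric] inner_commute[of q p] power2_eq_square)
      then have "q = x *\<^sub>R p" by simp
      then show ?thesis using that[of "(1 / norm e') *\<^sub>R e'"] e' True \<theta>
        by (simp add: orthogonal_def dot_square_norm power2_eq_square)
    next
      case False
      then have "x\<^sup>2 < 1" using x by (simp add: abs_square_le_1 order.not_eq_order_implies_strict)
      then have s: "sin \<theta> > 0" "(sin \<theta>)\<^sup>2 = 1 - x\<^sup>2" using \<theta>(3) by auto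
      define e where "e = (1 / sin \<theta>) *\<^sub>R (q - x *\<^sub>R p)"
      have "(q - x *\<^sub>R p) \<bullet> (q - x *\<^sub>R p) = 1 - x\<^sup>2"
        by (simp add: inner_diff_left inner_diff_right pp qq x_def[symmetric] inner_commute[of q p] power2_eq_square)
      then have "e \<bullet> e = 1" using s False by (simp add: e_def power2_eq_square[symmetric] power_divide)
      moreover have "p \<bullet> e = 0" by (simp add: e_def inner_diff_right pp x_def)
      moreover have "q = cos \<theta> *\<^sub>R p + sin \<theta> *\<^sub>R e" using s \<theta>(2) by (simp add: e_def)
      ultimately show ?thesis using that by blast
    qed
    define c where "c s = cos (\<theta> * s) *\<^sub>R p + sin (\<theta> * s) *\<^sub>R e" for s
    define c' where "c' s = (- \<theta> * sin (\<theta> * s)) *\<^sub>R p + (\<theta> * cos (\<theta> * s)) *\<^sub>R e" for s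
    have d: "(c has_vector_derivative c' s) (at s)" for s
    proof -
      have 1: "((\<lambda>s. cos (\<theta> * s)) has_real_derivative - \<theta> * sin (\<theta> * s)) (at s)"
        and 2: "((\<lambda>s. sin (\<theta> * s)) has_real_derivative \<theta> * cos (\<theta> * s)) (at s)"
        by (auto intro!: derivative_eq_intros)
      show ?thesis unfolding c_def[abs_def] c'_def
        using has_vector_derivative_add[OF has_vector_derivative_scaleR[OF 1 has_vector_derivative_const]
          has_vector_derivative_scaleR[OF 2 has_vector_derivative_const]] by simp
    qed
    have nrm: "norm (a *\<^sub>R p + b *\<^sub>R e) = sqrt (a\<^sup>2 + b\<^sup>2)" for a b
      by (simp add: norm_eq_sqrt_inner inner_add_left inner_add_right pp e inner_commute[of e p] power2_eq_square)
    have "c C1_differentiable_on {0..1}"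
      unfolding C1_differentiable_on_def
      by (intro exI[of _ c'] conjI ballI d) (auto simp: c'_def intro!: continuous_intros)
    moreover have "c ` {0..1} \<subseteq> sphere 0 1" by (auto simp: c_def nrm)
    moreover have "c 0 = p" "c 1 = q" using e(3) by (simp_all add: c_def)
    ultimately have cC: "c \<in> ?C" using C1_differentiable_imp_piecewise by blast
    have "norm (c' s) \<le> \<theta>" for s
    proof -
      have "(- \<theta> * sin (\<theta> * s))\<^sup>2 + (\<theta> * cos (\<theta> * s))\<^sup>2 = \<theta>\<^sup>2 * ((sin (\<theta> * s))\<^sup>2 + (cos (\<theta> * s))\<^sup>2)"
        by (simp only: power_mult_distrib distrib_left power2_minus)
      then show ?thesis unfolding c'_def nrm using \<theta>(1) by simp
    qed
    then have "curve_length c \<le> ennreal \<theta>" by (intro curve_length_bound[OF d]) auto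
    then show "(INF c\<in>?C. curve_length c) \<le> ennreal \<theta>" using cC by (meson INF_lower2)
    show "ennreal \<theta> \<le> (INF c\<in>?C. curve_length c)"
    proof (rule INF_greatest)
      fix c assume c: "c \<in> ?C"
      have ge: "ennreal (arccos (l * x) - arccos l) \<le> curve_length c" if "0 < l" "l < 1" for l
        using curve_length_ge_arccos[of c l] c that by (simp add: x_def)
      have "((\<lambda>l. ennreal (arccos (l * x) - arccos l)) \<longlongrightarrow> ennreal (arccos (1 * x) - arccos 1)) (at 1 within {0<..<1})"
      proof (intro tendsto_ennrealI tendsto_diff)
        have "continuous_on {0..1} (\<lambda>l. arccos (l * x))"
        proof (intro continuous_intros ballI)
          fix l :: real assume "l \<in> {0..1}"
          then have "\<bar>l\<bar> * \<bar>x\<bar> \<le> 1" using x by (intro mult_le_one) auto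
          then show "- 1 \<le> l * x \<and> l * x \<le> 1" unfolding abs_mult[symmetric] by (simp add: abs_le_iff)
        qed
        then show "((\<lambda>l. arccos (l * x)) \<longlongrightarrow> arccos (1 * x)) (at 1 within {0<..<1})"
          unfolding continuous_on_def by (meson atLeastAtMost_iff greaterThanLessThan_subseteq_atLeastAtMost_iff order_refl tendsto_within_subset zero_le_one)
        have "continuous_on {0..1} arccos" by (rule continuous_on_subset[OF continuous_on_arccos']) auto
        then show "(arccos \<longlongrightarrow> arccos 1) (at 1 within {0<..<1})"
          unfolding continuous_on_def by (meson atLeastAtMost_iff greaterThanLessThan_subseteq_atLeastAtMost_iff order_refl tendsto_within_subset zero_le_one)
      qed
      then have "ennreal (arccos (1 * x) - arccos 1) \<le> curve_length c"
      proof (rule tendsto_upperbound)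
        show "\<forall>\<^sub>F l in at 1 within {0<..<1}. ennreal (arccos (l * x) - arccos l) \<le> curve_length c"
          by (auto simp: eventually_at_filter ge)
        show "at (1::real) within {0<..<1} \<noteq> bot"
          by (simp add: at_within_eq_bot_iff)
      qed
      then show "ennreal \<theta> \<le> curve_length c" by (simp add: \<theta>_def)
    qed
  qed
  then show ?thesis using \<theta>(1) by (simp add: sphere_dist_def \<theta>_def x_def)
qed

section \<open>The Riemannian distance of an immersion\<close>

lemma smooth_on_imp_smooth_open:
  assumes "smooth_on S f" "open T" "T \<subseteq> S"
  shows "smooth_open T f"
proof (rule smooth_open_local[OF assms(2)])
  fix x assume "x \<in> T"
  then have "x \<in> S" using assms(3) by blast
  then obtain U g where g: "open U" "x \<in> U" "\<forall>k. Ck_on k U g" "\<forall>y\<in>S \<inter> U. g y = f y"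
    using assms(1) unfolding smooth_on_def by blast
  have "smooth_open (T \<inter> U) g"
    unfolding smooth_open_def using g(1,3) assms(2) Ck_on_subset by (metis inf_le2 open_Int)
  then show "\<exists>V g. x \<in> V \<and> smooth_open V g \<and> (\<forall>y\<in>V. g y = f y)" using g \<open>x \<in> T\<close> assms(3) by blast
qed

section \<open>Charts and curves of the manifold\<close>

locale manifold =
  fixes X :: "'m topology" and A :: "('m, 'n::finite) chart set"
  assumes man: "connected_oriented_manifold X A"
begin

lemma hausdorff: "Hausdorff_space X" and connected: "connected_space X" and nonempty: "topspace X \<noteq> {}"
  using man by (auto simp: connected_oriented_manifold_def)

lemma chart_exists: "x \<in> topspace X \<Longrightarrow> \<exists>U \<phi>. (U, \<phi>) \<in> A \<and> x \<in> U"
proof -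
  assume x: "x \<in> topspace X"
  have "(\<Union>c\<in>A. fst c) = topspace X" using man unfolding connected_oriented_manifold_def by blast
  then obtain c where "c \<in> A" "x \<in> fst c" using x by blast
  then show ?thesis by (cases c) auto
qed

context
  fixes U \<phi> assumes c: "(U, \<phi>) \<in> A"
begin

lemma chart:
  shows chart_open: "openin X U" and chart_image_open: "open (\<phi> ` U)"
    and chart_homeomorphic: "homeomorphic_map (subtopology X U) (top_of_set (\<phi> ` U)) \<phi>"
proof -
  have "is_chart X (U, \<phi>)" using man c unfolding connected_oriented_manifold_def by blast
  then show "openin X U" "open (\<phi> ` U)" "homeomorphic_map (subtopology X U) (top_of_set (\<phi> ` U)) \<phi>"
    by (auto simp: is_chart_def)
qed

lemma chart_sub: "U \<subseteq> topspace X"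
  using chart_open openin_subset by blast

lemma chart_inj: "inj_on \<phi> U"
  using homeomorphic_imp_injective_map[OF chart_homeomorphic] chart_sub by (simp add: inf.absorb2)

lemma chart_inv [simp]: "x \<in> U \<Longrightarrow> inv_into U \<phi> (\<phi> x) = x"
  by (rule inv_into_f_f[OF chart_inj])

lemma chart_continuous: "continuous_map (subtopology X U) euclidean \<phi>"
  using homeomorphic_imp_continuous_map[OF chart_homeomorphic] continuous_map_into_fulltopology by blast

lemma chart_preimage_open: "open W \<Longrightarrow> openin X {x \<in> U. \<phi> x \<in> W}"
  using openin_continuous_map_preimage[OF chart_continuous, of W] chart_sub
    openin_trans_full[OF _ chart_open] by (simp add: inf.absorb2)

lemma chart_open_image:
  assumes "openin X N" "N \<subseteq> U"
  shows "open (\<phi> ` N)"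
proof -
  have "openin (subtopology X U) N" using assms by (simp add: openin_subtopology_alt image_iff) blast
  then have "openin (top_of_set (\<phi> ` U)) (\<phi> ` N)"
    using homeomorphic_imp_open_map[OF chart_homeomorphic] by (simp add: open_map_def)
  then show ?thesis using chart_image_open openin_open_trans by blast
qed

lemma chart_inv_continuous: "continuous_map (top_of_set (\<phi> ` U)) X (inv_into U \<phi>)"
proof -
  have "continuous_map (top_of_set (\<phi> ` U)) X (inv_into U \<phi>)"
    unfolding continuous_map
  proof (intro conjI allI impI)
    show "inv_into U \<phi> ` topspace (top_of_set (\<phi> ` U)) \<subseteq> topspace X"
      using chart_sub by auto
    fix W assume W: "openin X W"
    have "{y \<in> topspace (top_of_set (\<phi> ` U)). inv_into U \<phi> y \<in> W} = \<phi> ` (U \<inter> W)"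
      by auto
    moreover have "open (\<phi> ` (U \<inter> W))" by (rule chart_open_image) (use W chart_open in auto)
    ultimately show "openin (top_of_set (\<phi> ` U)) {y \<in> topspace (top_of_set (\<phi> ` U)). inv_into U \<phi> y \<in> W}"
      by (simp add: openin_open_eq[OF chart_image_open]) blast
  qed
  then show ?thesis .
qed

lemma chart_transition:
  assumes "(V, \<psi>) \<in> A"
  shows "smooth_open (\<phi> ` (U \<inter> V)) (\<lambda>y. \<psi> (inv_into U \<phi> y))"
proof -
  have "oriented_compatible (U, \<phi>) (V, \<psi>)" using man c assms unfolding connected_oriented_manifold_def by blast
  then have "smooth_on (\<phi> ` (U \<inter> V)) (\<lambda>y. \<psi> (inv_into U \<phi> y))"
    by (simp add: oriented_compatible_def o_def)
  moreover have "open (\<phi> ` (U \<inter> V))"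
    by (rule chart_open_image) (use chart_open man assms in \<open>auto simp: connected_oriented_manifold_def is_chart_def\<close>)
  ultimately show ?thesis by (rule smooth_on_imp_smooth_open) simp
qed

end

lemma path_near:
  assumes "pathin X c" "openin X W" "s \<in> {0..1}" "c s \<in> W"
  shows "\<exists>d>0. \<forall>r\<in>{0..1}. \<bar>r - s\<bar> < d \<longrightarrow> c r \<in> W"
proof -
  have "openin (top_of_set {0..1}) {r \<in> {0..1}. c r \<in> W}"
    using openin_continuous_map_preimage[OF assms(1)[unfolded pathin_def] assms(2)] by simp
  then show ?thesis
    using assms(3,4) unfolding openin_euclidean_subtopology_iff by (auto simp: dist_real_def)
qed

lemma piecewise_C1_curveD:
  assumes "piecewise_C1_curve X A c" "(U, \<phi>) \<in> A" "0 \<le> a" "a \<le> b" "b \<le> 1" "c ` {a..b} \<subseteq> U"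
  shows "(\<lambda>s. \<phi> (c s)) piecewise_C1_differentiable_on {a..b}"
  using assms unfolding piecewise_C1_curve_def o_def by blast

lemma piecewise_C1_curveI:
  assumes "pathin X c"
    "\<And>U \<phi> a b. (U, \<phi>) \<in> A \<Longrightarrow> 0 \<le> a \<Longrightarrow> a \<le> b \<Longrightarrow> b \<le> 1 \<Longrightarrow> c ` {a..b} \<subseteq> U \<Longrightarrow>
       (\<lambda>s. \<phi> (c s)) piecewise_C1_differentiable_on {a..b}"
  shows "piecewise_C1_curve X A c"
  using assms unfolding piecewise_C1_curve_def o_def by blast

lemma curve_const:
  assumes "x \<in> topspace X"
  shows "piecewise_C1_curve X A (\<lambda>s. x)"
  by (rule piecewise_C1_curveI) (use assms in \<open>auto simp: pathin_def piecewise_C1_differentiable_const\<close>)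

lemma curve_reverse:
  assumes "piecewise_C1_curve X A c"
  shows "piecewise_C1_curve X A (\<lambda>s. c (1 - s))"
proof (rule piecewise_C1_curveI)
  have p: "pathin X c" using assms by (simp add: piecewise_C1_curve_def)
  have "continuous_map (top_of_set {0..1}) (top_of_set {0..1}) (\<lambda>s. 1 - s :: real)"
    by (simp add: continuous_map_in_subtopology) (intro continuous_intros)
  from continuous_map_compose[OF this p[unfolded pathin_def]]
  show "pathin X (\<lambda>s. c (1 - s))" by (simp add: pathin_def o_def)
  fix U \<phi> a b assume h: "(U, \<phi>) \<in> A" "0 \<le> a" "a \<le> b" "b \<le> 1" "(\<lambda>s. c (1 - s)) ` {a..b} \<subseteq> U"
  have im: "(\<lambda>s. - 1 * s + 1) ` {a..b} = {1 - b..1 - a}"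
    by (auto simp: image_iff intro!: bexI[of _ "1 - _"])
  have "c ` {1 - b..1 - a} \<subseteq> U"
  proof
    fix z assume "z \<in> c ` {1 - b..1 - a}"
    then obtain s where s: "s \<in> {1 - b..1 - a}" "z = c (1 - (1 - s))" by auto
    then have "1 - s \<in> {a..b}" by auto
    then show "z \<in> U" using h(5) s(2) by blast
  qed
  from piecewise_C1_curveD[OF assms h(1) _ _ _ this] h
  have "(\<lambda>s. \<phi> (c s)) piecewise_C1_differentiable_on ((\<lambda>s. - 1 * s + 1) ` {a..b})" unfolding im by simp
  from piecewise_C1_differentiable_affine[OF this] show "(\<lambda>s. \<phi> (c (1 - s))) piecewise_C1_differentiable_on {a..b}"
    by (simp add: o_def)
qed

lemma curve_join:
  assumes c1: "piecewise_C1_curve X A c1" and c2: "piecewise_C1_curve X A c2" and eq: "c1 1 = c2 0"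
  shows "piecewise_C1_curve X A (join_curves c1 c2)"
proof (rule piecewise_C1_curveI)
  have p1: "continuous_map (top_of_set {0..1}) X c1" and p2: "continuous_map (top_of_set {0..1}) X c2"
    using c1 c2 by (simp_all add: piecewise_C1_curve_def pathin_def)
  have "continuous_map (top_of_set {0..1}) X (\<lambda>s. if s \<le> 1 / 2 then c1 (2 * s) else c2 (2 * s - 1))"
  proof (rule continuous_map_cases_le)
    have "continuous_map (top_of_set {s \<in> {0..1}. s \<le> 1 / 2}) (top_of_set {0..1}) (\<lambda>s. 2 * s :: real)"
      by (auto simp: continuous_map_in_subtopology intro!: continuous_intros)
    from continuous_map_compose[OF this p1]
    show "continuous_map (subtopology (top_of_set {0..1}) {s \<in> topspace (top_of_set {0..1}). s \<le> 1 / 2}) X (\<lambda>s. c1 (2 * s))"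
      by (simp add: o_def subtopology_subtopology Int_absorb1 subset_iff)
    have "continuous_map (top_of_set {s \<in> {0..1}. 1 / 2 \<le> s}) (top_of_set {0..1}) (\<lambda>s. 2 * s - 1 :: real)"
      by (auto simp: continuous_map_in_subtopology intro!: continuous_intros)
    from continuous_map_compose[OF this p2]
    show "continuous_map (subtopology (top_of_set {0..1}) {s \<in> topspace (top_of_set {0..1}). 1 / 2 \<le> s}) X (\<lambda>s. c2 (2 * s - 1))"
      by (simp add: o_def subtopology_subtopology Int_absorb1 subset_iff)
    show "c1 (2 * s) = c2 (2 * s - 1)" if "s \<in> topspace (top_of_set {0..1})" "s = 1 / 2" for s
      unfolding that(2) using eq by simp
  qed auto
  then show "pathin X (join_curves c1 c2)" by (simp add: pathin_def join_curves_def[abs_def])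
  fix U \<phi> a b assume h: "(U, \<phi>) \<in> A" "0 \<le> a" "a \<le> b" "b \<le> 1" "join_curves c1 c2 ` {a..b} \<subseteq> U"
  have im: "(\<lambda>s. 2 * s + r) ` {a..b} = {2 * a + r..2 * b + r}" for a b r :: real
  proof (intro set_eqI iffI)
    fix x assume "x \<in> {2 * a + r..2 * b + r}"
    then show "x \<in> (\<lambda>s. 2 * s + r) ` {a..b}" by (intro image_eqI[of _ _ "(x - r) / 2"]) (auto simp: field_simps)
  qed auto
  have le: "(\<lambda>s. \<phi> (join_curves c1 c2 s)) piecewise_C1_differentiable_on {a'..b'}"
    if ab: "0 \<le> a'" "a' \<le> b'" "b' \<le> 1 / 2" and sub: "join_curves c1 c2 ` {a'..b'} \<subseteq> U" for a' b'
  proof -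
    have "c1 ` ((\<lambda>s. 2 * s + 0) ` {a'..b'}) \<subseteq> U"
    proof
      fix z assume "z \<in> c1 ` ((\<lambda>s. 2 * s + 0) ` {a'..b'})"
      then obtain s where s: "s \<in> {a'..b'}" "z = c1 (2 * s + 0)" by blast
      then have "z = join_curves c1 c2 s" using ab by (simp add: join_curves_def)
      then show "z \<in> U" using sub s(1) by blast
    qed
    from piecewise_C1_curveD[OF c1 h(1) _ _ _ this[unfolded im]] ab
    have "(\<lambda>s. \<phi> (c1 s)) piecewise_C1_differentiable_on ((\<lambda>s. 2 * s + 0) ` {a'..b'})" unfolding im by simp
    from piecewise_C1_differentiable_affine[OF this] have "(\<lambda>s. \<phi> (c1 (2 * s))) piecewise_C1_differentiable_on {a'..b'}"
      by (simp add: o_def)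
    then show ?thesis by (rule pwC1_cong) (use ab in \<open>auto simp: join_curves_def\<close>)
  qed
  have ge: "(\<lambda>s. \<phi> (join_curves c1 c2 s)) piecewise_C1_differentiable_on {a'..b'}"
    if ab: "1 / 2 \<le> a'" "a' \<le> b'" "b' \<le> 1" and sub: "join_curves c1 c2 ` {a'..b'} \<subseteq> U" for a' b'
  proof -
    have j: "join_curves c1 c2 s = c2 (2 * s + - 1)" if "1 / 2 \<le> s" for s
    proof (cases "s = 1 / 2")
      case True
      show ?thesis unfolding True using eq by (simp add: join_curves_def)
    next
      case False
      then show ?thesis using that by (auto simp: join_curves_def)
    qed
    have "c2 ` ((\<lambda>s. 2 * s + - 1) ` {a'..b'}) \<subseteq> U"
    proof
      fix z assume "z \<in> c2 ` ((\<lambda>s. 2 * s + - 1) ` {a'..b'})"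
      then obtain s where s: "s \<in> {a'..b'}" "z = c2 (2 * s + - 1)" by blast
      then have "z = join_curves c1 c2 s" using ab j[of s] by simp
      then show "z \<in> U" using sub s(1) by blast
    qed
    from piecewise_C1_curveD[OF c2 h(1) _ _ _ this[unfolded im]] ab
    have "(\<lambda>s. \<phi> (c2 s)) piecewise_C1_differentiable_on ((\<lambda>s. 2 * s + - 1) ` {a'..b'})" unfolding im by simp
    from piecewise_C1_differentiable_affine[OF this] have "(\<lambda>s. \<phi> (c2 (2 * s + - 1))) piecewise_C1_differentiable_on {a'..b'}"
      by (simp add: o_def)
    then show ?thesis by (rule pwC1_cong) (use ab j in auto)
  qed
  show "(\<lambda>s. \<phi> (join_curves c1 c2 s)) piecewise_C1_differentiable_on {a..b}"
  proof (cases "b \<le> 1 / 2 \<or> 1 / 2 \<le> a")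
    case True
    then show ?thesis using le[of a b] ge[of a b] h by auto
  next
    case False
    have "join_curves c1 c2 ` {a..1 / 2} \<subseteq> U" "join_curves c1 c2 ` {1 / 2..b} \<subseteq> U"
      using h(5) False by (auto simp: image_subset_iff)
    then show ?thesis using le[of a "1 / 2"] ge[of "1 / 2" b] False h by (intro pwC1_join[of _ a "1 / 2" b]) auto
  qed
qed

text \<open>\<open>piecewise_C1_curve\<close> asks for regularity in every chart of the atlas;
  smooth transition maps carry it over from a single chart.\<close>

lemma curve_in_chart:
  assumes c: "(U, \<phi>) \<in> A" and W: "open W" "{0..1} \<subseteq> W" and g: "smooth_open W g" "g ` W \<subseteq> \<phi> ` U"
  shows "piecewise_C1_curve X A (\<lambda>s. inv_into U \<phi> (g s))"
proof (rule piecewise_C1_curveI)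
  have "continuous_map (top_of_set {0..1}) (top_of_set (\<phi> ` U)) g"
    unfolding continuous_map_in_subtopology using g W continuous_on_subset[OF smooth_openD(4)[OF g(1)] W(2)] by auto
  from continuous_map_compose[OF this chart_inv_continuous[OF c]]
  show "pathin X (\<lambda>s. inv_into U \<phi> (g s))" by (simp add: pathin_def o_def)
  fix V \<psi> a b assume h: "(V, \<psi>) \<in> A" "0 \<le> a" "a \<le> b" "b \<le> 1" "(\<lambda>s. inv_into U \<phi> (g s)) ` {a..b} \<subseteq> V"
  note tr = chart_transition[OF c h(1)]
  define W' where "W' = W \<inter> g -` (\<phi> ` (U \<inter> V))"
  have "open W'" unfolding W'_def
    by (rule continuous_open_preimage[OF smooth_openD(4)[OF g(1)] W(1) smooth_openD(1)[OF tr]])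
  have sub: "{a..b} \<subseteq> W'"
  proof
    fix s assume s: "s \<in> {a..b}"
    then have sW: "s \<in> W" using W(2) h by auto
    then obtain x where x: "x \<in> U" "g s = \<phi> x" using g(2) by auto
    have "inv_into U \<phi> (g s) \<in> V" using h(5) s by auto
    then have "x \<in> V" using x chart_inv[OF c] by simp
    then show "s \<in> W'" using x sW by (auto simp: W'_def)
  qed
  have "smooth_open W' (\<lambda>s. \<psi> (inv_into U \<phi> (g s)))"
    by (rule smooth_open_compose[OF smooth_open_subset[OF g(1) \<open>open W'\<close>] tr]) (auto simp: W'_def)
  from C1_differentiable_imp_piecewise[OF smooth_open_C1[OF this sub]]
  show "(\<lambda>s. \<psi> (inv_into U \<phi> (g s))) piecewise_C1_differentiable_on {a..b}" .
qed

end

section \<open>Curve lengths and the distance of an immersion\<close>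

locale immersed_manifold = manifold X A for X :: "'m topology" and A :: "('m, 'n::finite) chart set" +
  fixes f :: "'m \<Rightarrow> real^('n option)"
  assumes f_smooth: "\<And>U \<phi>. (U, \<phi>) \<in> A \<Longrightarrow> smooth_open (\<phi> ` U) (\<lambda>y. f (inv_into U \<phi> y))"
    and f_immersion: "\<And>U \<phi> x. (U, \<phi>) \<in> A \<Longrightarrow> x \<in> U \<Longrightarrow> inj (frechet_derivative (\<lambda>y. f (inv_into U \<phi> y)) (at (\<phi> x)))"
begin

lemma curve_image_chart:
  assumes "piecewise_C1_curve X A c" "(U, \<phi>) \<in> A" "0 \<le> a" "a \<le> b" "b \<le> 1" "c ` {a..b} \<subseteq> U"
  shows "(f \<circ> c) piecewise_C1_differentiable_on {a..b}"
proof -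
  have "(\<lambda>s. f (inv_into U \<phi> (\<phi> (c s)))) piecewise_C1_differentiable_on {a..b}"
    by (rule pwC1_smooth_compose[OF piecewise_C1_curveD[OF assms] f_smooth[OF assms(2)]]) (use assms(6) in auto)
  then show ?thesis
    by (rule pwC1_cong) (use assms(6) chart_inv[OF assms(2)] in \<open>auto simp: image_subset_iff\<close>)
qed

text \<open>A curve need not stay in one chart. Each parameter has a neighbourhood mapped into a
  chart, and the property is additive over adjacent intervals, so bisection of the unit interval
  applies.\<close>

lemma curve_image:
  assumes c: "piecewise_C1_curve X A c"
  shows "(f \<circ> c) piecewise_C1_differentiable_on {0..1}"
proof -
  define P where "P a b \<longleftrightarrow> (0 \<le> a \<longrightarrow> a \<le> b \<longrightarrow> b \<le> 1 \<longrightarrow> (f \<circ> c) piecewise_C1_differentiable_on {a..b})" for a b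
  have p: "pathin X c" using c by (simp add: piecewise_C1_curve_def)
  have "P 0 1"
  proof (rule Bolzano)
    show "(0::real) \<le> 1" by simp
    show "P a b'" if "P a b" "P b b'" "a \<le> b" "b \<le> b'" for a b b'
      using that pwC1_join[of "f \<circ> c" a b b'] unfolding P_def by auto
    fix x :: real assume x: "0 \<le> x" "x \<le> 1"
    have "c x \<in> topspace X" using p x by (auto simp: pathin_def continuous_map_def)
    then obtain U \<phi> where U: "(U, \<phi>) \<in> A" "c x \<in> U" using chart_exists by blast
    obtain d where d: "d > 0" "\<And>r. r \<in> {0..1} \<Longrightarrow> \<bar>r - x\<bar> < d \<Longrightarrow> c r \<in> U"
      using path_near[OF p chart_open[OF U(1)] _ U(2)] x by auto
    have "P a b" if "a \<le> x" "x \<le> b" "b - a < d" for a b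
      unfolding P_def
    proof (intro impI)
      assume h: "0 \<le> a" "a \<le> b" "b \<le> 1"
      have "c ` {a..b} \<subseteq> U" using d(2) that h by (auto simp: image_subset_iff abs_less_iff)
      from curve_image_chart[OF c U(1) h this] show "(f \<circ> c) piecewise_C1_differentiable_on {a..b}" .
    qed
    then show "\<exists>d>0. \<forall>a b. a \<le> x \<and> x \<le> b \<and> b - a < d \<longrightarrow> P a b" using d(1) by blast
  qed
  then show ?thesis by (simp add: P_def)
qed

abbreviation "L c \<equiv> curve_length (f \<circ> c)"

definition "curves p q = {c. piecewise_C1_curve X A c \<and> c 0 = p \<and> c 1 = q}"

abbreviation "d \<equiv> induced_dist X A f"

lemma d_eq: "d p q = enn2real (INF c\<in>curves p q. L c)"
  by (simp add: induced_dist_def curves_def)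

lemma d_nonneg: "0 \<le> d p q" by (simp add: d_eq)

lemma L_join: "c1 \<in> curves p q \<Longrightarrow> c2 \<in> curves q r \<Longrightarrow> \<exists>c\<in>curves p r. L c \<le> L c1 + L c2"
proof -
  assume c: "c1 \<in> curves p q" "c2 \<in> curves q r"
  have "join_curves c1 c2 \<in> curves p r"
    using curve_join[of c1 c2] c by (auto simp: curves_def join_curves_def)
  moreover have "L (join_curves c1 c2) \<le> L c1 + L c2"
  proof -
    have "f \<circ> join_curves c1 c2 = join_curves (f \<circ> c1) (f \<circ> c2)" by (auto simp: join_curves_def)
    then show ?thesis using curve_length_join[OF curve_image curve_image, of c1 c2] c by (auto simp: curves_def)
  qed
  ultimately show ?thesis by blast
qed

lemma L_reverse: "c \<in> curves p q \<Longrightarrow> \<exists>c'\<in>curves q p. L c' = L c"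
  using curve_reverse[of c] curve_length_reverse[OF curve_image, of c]
  by (intro bexI[of _ "\<lambda>s. c (1 - s)"]) (auto simp: curves_def o_def)

lemma chart_segment:
  assumes c: "(U, \<phi>) \<in> A" and sub: "ball y0 r \<subseteq> \<phi> ` U" and y: "y \<in> ball y0 r" "y' \<in> ball y0 r"
  shows "\<exists>c\<in>curves (inv_into U \<phi> y) (inv_into U \<phi> y'). L c < \<infinity>"
proof -
  define g where "g s = y + s *\<^sub>R (y' - y)" for s :: real
  define W where "W = g -` ball y0 r"
  have gc: "continuous_on UNIV g" unfolding g_def by (intro continuous_intros)
  have W: "open W" unfolding W_def by (rule open_vimage[OF open_ball gc])
  have W01: "{0..1} \<subseteq> W"
  proof
    fix s :: real assume "s \<in> {0..1}"
    then have "(1 - s) *\<^sub>R y + s *\<^sub>R y' \<in> ball y0 r" using y by (intro convexD[OF convex_ball]) auto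
    then show "s \<in> W" by (simp add: W_def g_def algebra_simps)
  qed
  have g: "smooth_open W g"
  proof (rule smooth_open_has_derivative[OF W])
    show "(g has_derivative (\<lambda>h. h *\<^sub>R (y' - y))) (at s)" for s unfolding g_def by (auto intro!: derivative_eq_intros)
    show "smooth_open W (\<lambda>s. v *\<^sub>R (y' - y))" for v by (rule smooth_open_const[OF W])
  qed
  have gW: "g ` W \<subseteq> \<phi> ` U" using sub by (auto simp: W_def)
  let ?c = "\<lambda>s. inv_into U \<phi> (g s)"
  have "?c \<in> curves (inv_into U \<phi> y) (inv_into U \<phi> y')"
    using curve_in_chart[OF c W W01 g gW] by (simp add: curves_def g_def)
  moreover have "L ?c < \<infinity>"
  proof -
    have sm: "smooth_open W (f \<circ> ?c)" using smooth_open_compose[OF g f_smooth[OF c] gW] by (simp add: o_def)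
    obtain D where D: "\<And>s. s \<in> {0..1} \<Longrightarrow> ((f \<circ> ?c) has_vector_derivative D s) (at s)" "continuous_on {0..1} D"
      using smooth_open_C1[OF sm W01] unfolding C1_differentiable_on_def by blast
    have "bounded (D ` {0..1})" by (intro compact_imp_bounded compact_continuous_image D(2) compact_Icc)
    then obtain B where "\<forall>y\<in>D ` {0..1}. norm y \<le> B" unfolding bounded_iff by blast
    then have B: "\<And>s. s \<in> {0..1} \<Longrightarrow> norm (D s) \<le> B" by blast
    have "L ?c \<le> ennreal B" by (rule curve_length_bound[of _ D]) (use D(1) B in auto)
    then show ?thesis by (simp add: order.strict_trans1)
  qed
  ultimately show ?thesis by blast
qed

text \<open>The points reached by curves of finite length form a nonempty open and closed set.
  Finiteness matters because \<open>enn2real\<close> would turn an infinite infimum into distance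
  0.\<close>

lemma finite_curve:
  assumes p: "p \<in> topspace X" and q: "q \<in> topspace X"
  shows "\<exists>c\<in>curves p q. L c < \<infinity>"
proof -
  define R where "R = {q \<in> topspace X. \<exists>c\<in>curves p q. L c < \<infinity>}"
  have loc: "\<exists>N. openin X N \<and> x \<in> N \<and> (\<forall>z\<in>N. \<exists>c\<in>curves x z. L c < \<infinity>)" if xM: "x \<in> topspace X" for x
  proof -
    obtain U \<phi> where U: "(U, \<phi>) \<in> A" "x \<in> U" using chart_exists[OF xM] by blast
    obtain r where r: "r > 0" "ball (\<phi> x) r \<subseteq> \<phi> ` U"
      using chart_image_open[OF U(1)] U(2) by (meson imageI openE)
    have "\<exists>c\<in>curves x z. L c < \<infinity>" if "z \<in> U" "\<phi> z \<in> ball (\<phi> x) r" for z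
      using chart_segment[OF U(1) r(2) _ that(2), of "\<phi> x"] r(1) that U chart_inv[OF U(1)] by simp
    then show ?thesis using chart_preimage_open[OF U(1) open_ball, of "\<phi> x" r] U(2) r(1)
      by (intro exI[of _ "{z \<in> U. \<phi> z \<in> ball (\<phi> x) r}"]) auto
  qed
  have trans: "\<exists>c\<in>curves x z. L c < \<infinity>" if cs: "c1 \<in> curves x y" "L c1 < \<infinity>" "c2 \<in> curves y z" "L c2 < \<infinity>" for x y z c1 c2
  proof -
    obtain c where c: "c \<in> curves x z" "L c \<le> L c1 + L c2" using L_join[OF cs(1,3)] by blast
    have "L c1 + L c2 < \<infinity>" using cs by simp
    then show ?thesis using c by (meson order.strict_trans1)
  qed
  have "openin X R"
  proof (subst openin_subopen, intro ballI)
    fix x assume "x \<in> R"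
    then obtain c where c: "x \<in> topspace X" "c \<in> curves p x" "L c < \<infinity>" by (auto simp: R_def)
    obtain N where N: "openin X N" "x \<in> N" "\<And>z. z \<in> N \<Longrightarrow> \<exists>c\<in>curves x z. L c < \<infinity>" using loc[OF c(1)] by blast
    have "N \<subseteq> R" using N(3) trans[OF c(2,3)] openin_subset[OF N(1)] by (fastforce simp: R_def)
    then show "\<exists>T. openin X T \<and> x \<in> T \<and> T \<subseteq> R" using N by blast
  qed
  moreover have "openin X (topspace X - R)"
  proof (subst openin_subopen, intro ballI)
    fix x assume x: "x \<in> topspace X - R"
    obtain N where N: "openin X N" "x \<in> N" "\<And>z. z \<in> N \<Longrightarrow> \<exists>c\<in>curves x z. L c < \<infinity>" using loc[of x] x by blast
    have "z \<notin> R" if zN: "z \<in> N" for z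
    proof
      assume "z \<in> R"
      then obtain c where c: "c \<in> curves p z" "L c < \<infinity>" by (auto simp: R_def)
      obtain c' where c': "c' \<in> curves x z" "L c' < \<infinity>" using N(3)[OF zN] by blast
      obtain c'' where c'': "c'' \<in> curves z x" "L c'' = L c'" using L_reverse[OF c'(1)] by blast
      then show False using trans[OF c c''(1)] c'(2) x by (auto simp: R_def)
    qed
    then show "\<exists>T. openin X T \<and> x \<in> T \<and> T \<subseteq> topspace X - R" using N openin_subset[OF N(1)] by blast
  qed
  moreover have "p \<in> R"
  proof -
    obtain N where N: "p \<in> N" "\<And>z. z \<in> N \<Longrightarrow> \<exists>c\<in>curves p z. L c < \<infinity>" using loc[OF p] by blast
    then show ?thesis using p by (simp add: R_def)
  qed
  ultimately have "topspace X - R = {}"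
    using connected unfolding connected_space_def by blast
  then show ?thesis using q by (auto simp: R_def)
qed

lemma INF_finite:
  assumes "p \<in> topspace X" "q \<in> topspace X"
  shows "(INF c\<in>curves p q. L c) = ennreal (d p q)"
proof -
  obtain c where "c \<in> curves p q" "L c < \<infinity>" using finite_curve[OF assms] by blast
  then have "(INF c\<in>curves p q. L c) < \<infinity>" by (meson INF_lower order.strict_trans1)
  then show ?thesis by (simp add: d_eq)
qed

lemma d_le: "c \<in> curves p q \<Longrightarrow> L c \<le> ennreal B \<Longrightarrow> 0 \<le> B \<Longrightarrow> d p q \<le> B"
  unfolding d_eq by (rule enn2real_leI) (auto intro: INF_lower2)

lemma d_curve:
  assumes "p \<in> topspace X" "q \<in> topspace X" "d p q < e"
  obtains c where "c \<in> curves p q" "L c < ennreal e"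
proof -
  have "(INF c\<in>curves p q. L c) < ennreal e"
    unfolding INF_finite[OF assms(1,2)] using assms(3) d_nonneg[of p q] by (simp add: ennreal_less_iff)
  then show ?thesis using that unfolding INF_less_iff by blast
qed

text \<open>On a compact coordinate ball the derivative of the immersion stretches vectors by at
  least some m > 0, as it is injective. A curve either stays in the ball, where its length controls
  the coordinate displacement, or has to cross the ball first.\<close>

lemma chart_lower_bound:
  assumes c: "(U, \<phi>) \<in> A" and x: "x \<in> U"
  obtains \<rho> m where "\<rho> > 0" "m > 0"
    "\<And>q c. c \<in> curves x q \<Longrightarrow> ennreal (m * \<rho>) \<le> L c \<or> (q \<in> U \<and> ennreal (m * norm (\<phi> q - \<phi> x)) \<le> L c)"
proof -
  define G where "G = (\<lambda>y. f (inv_into U \<phi> y))"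
  have G: "smooth_open (\<phi> ` U) G" unfolding G_def by (rule f_smooth[OF c])
  obtain \<rho> where \<rho>: "\<rho> > 0" "cball (\<phi> x) \<rho> \<subseteq> \<phi> ` U"
    using chart_image_open[OF c] x by (meson imageI open_contains_cball)
  let ?K = "cball (\<phi> x) \<rho> \<times> sphere (0::real^'n) 1"
  have cont: "continuous_on ?K (\<lambda>p. norm (dd (snd p) G (fst p)))"
    by (intro continuous_on_norm continuous_on_dd[OF G] continuous_intros) (use \<rho>(2) in auto)
  have K: "compact ?K" by (intro compact_Times compact_cball compact_sphere)
  obtain e where "norm (e::real^'n) = 1" using vector_choose_size[of 1] by auto
  then have "(\<phi> x, e) \<in> ?K" using \<rho>(1) by simp
  then have "?K \<noteq> {}" by blast
  then obtain p where p: "p \<in> ?K" "\<And>p'. p' \<in> ?K \<Longrightarrow> norm (dd (snd p) G (fst p)) \<le> norm (dd (snd p') G (fst p'))"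
    using continuous_attains_inf[OF K _ cont] by blast
  define m where "m = norm (dd (snd p) G (fst p))"
  have lin: "linear (frechet_derivative G (at y))" if "y \<in> \<phi> ` U" for y by (rule smooth_openD(5)[OF G that])
  have "m > 0"
  proof -
    have pU: "fst p \<in> \<phi> ` U" using p(1) \<rho>(2) by auto
    then have "inj (frechet_derivative G (at (fst p)))" using f_immersion[OF c] by (auto simp: G_def)
    then have "dd (snd p) G (fst p) \<noteq> 0" using p(1) linear_injective_0[OF lin[OF pU]] by force
    then show ?thesis by (simp add: m_def)
  qed
  have low: "m * norm v \<le> norm (dd v G y)" if "y \<in> cball (\<phi> x) \<rho>" for y v
  proof (cases "v = 0")
    case False
    have l: "linear (frechet_derivative G (at y))" using lin \<rho>(2) that by blast
    have "m \<le> norm (dd ((1 / norm v) *\<^sub>R v) G y)" using p(2)[of "(y, (1 / norm v) *\<^sub>R v)"] that False by (simp add: m_def)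
    also have "\<dots> = norm (dd v G y) / norm v" by (simp add: linear_scale[OF l])
    finally show ?thesis using False by (simp add: pos_le_divide_eq)
  qed simp
  define KK where "KK = inv_into U \<phi> ` cball (\<phi> x) \<rho>"
  have inv: "\<phi> (inv_into U \<phi> y) = y \<and> inv_into U \<phi> y \<in> U" if "y \<in> \<phi> ` U" for y
    using that by (simp add: f_inv_into_f inv_into_into)
  have KU: "KK \<subseteq> U" using \<rho>(2) inv by (auto simp: KK_def subset_iff)
  have K\<phi>: "z \<in> KK \<longleftrightarrow> z \<in> U \<and> \<phi> z \<in> cball (\<phi> x) \<rho>" for z
  proof
    assume "z \<in> KK"
    then obtain y where "y \<in> cball (\<phi> x) \<rho>" "z = inv_into U \<phi> y" by (auto simp: KK_def)
    then show "z \<in> U \<and> \<phi> z \<in> cball (\<phi> x) \<rho>" using inv[of y] \<rho>(2) by auto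
  next
    assume "z \<in> U \<and> \<phi> z \<in> cball (\<phi> x) \<rho>"
    then show "z \<in> KK" unfolding KK_def using chart_inv[OF c, of z] by (metis imageI)
  qed
  have "compactin X KK"
    unfolding KK_def
    by (rule image_compactin[of "top_of_set (\<phi> ` U)"]) (use \<rho>(2) chart_inv_continuous[OF c] in \<open>auto simp: compactin_subtopology\<close>)
  \<comment> \<open>The Hausdorff property makes KK closed in the whole manifold, so a curve is
    still in KK at the moment when it first leaves the open ball.\<close>
  then have closedK: "closedin X KK" using compactin_imp_closedin[OF hausdorff] by blast
  have est: "ennreal (m * norm (\<phi> (\<gamma> s) - \<phi> x)) \<le> L \<gamma>" if \<gamma>: "\<gamma> \<in> curves x q" and s: "s \<in> {0..1}" and sub: "\<gamma> ` {0..s} \<subseteq> KK" for \<gamma> q s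
  proof -
    have pw: "(\<lambda>r. \<phi> (\<gamma> r)) piecewise_C1_differentiable_on {0..s}"
      by (rule piecewise_C1_curveD[OF _ c]) (use \<gamma> s sub KU in \<open>auto simp: curves_def\<close>)
    obtain S D where S: "finite S" "\<And>r. r \<in> {0<..<s} - S \<Longrightarrow> ((\<lambda>r. \<phi> (\<gamma> r)) has_vector_derivative D r) (at r)"
      "continuous_on ({0<..<s} - S) D" "continuous_on {0..s} (\<lambda>r. \<phi> (\<gamma> r))"
      by (rule pwC1_D[OF pw]) blast
    have "ennreal (norm (m *\<^sub>R \<phi> (\<gamma> s) - m *\<^sub>R \<phi> (\<gamma> 0))) \<le> (\<integral>\<^sup>+ r\<in>{0..s}. ennreal (norm (vector_derivative (f \<circ> \<gamma>) (at r))) \<partial>lborel)"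
    proof (rule norm_diff_le_nn_integral[OF _ _ S(1)])
      show "continuous_on {0..s} (\<lambda>r. m *\<^sub>R \<phi> (\<gamma> r))" by (intro continuous_intros S(4))
      show "continuous_on ({0<..<s} - S) (\<lambda>r. m *\<^sub>R D r)" by (intro continuous_intros S(3))
      fix r assume r: "r \<in> {0<..<s} - S"
      show "((\<lambda>r. m *\<^sub>R \<phi> (\<gamma> r)) has_vector_derivative m *\<^sub>R D r) (at r)"
        by (rule bounded_linear.has_vector_derivative[OF bounded_linear_scaleR_right S(2)[OF r]])
      have rK: "\<phi> (\<gamma> r) \<in> cball (\<phi> x) \<rho>" using sub r K\<phi> by (auto simp: image_subset_iff)
      have "((\<lambda>r. G (\<phi> (\<gamma> r))) has_vector_derivative dd (D r) G (\<phi> (\<gamma> r))) (at r)"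
        by (rule smooth_chain_vector_derivative[OF G S(2)[OF r]]) (use rK \<rho>(2) in blast)
      then have "((f \<circ> \<gamma>) has_vector_derivative dd (D r) G (\<phi> (\<gamma> r))) (at r)"
        by (rule has_vector_derivative_transform_within_open[of _ _ _ "{0<..<s}"])
          (use r sub KU chart_inv[OF c] in \<open>auto simp: G_def image_subset_iff subset_iff\<close>)
      then show "norm (m *\<^sub>R D r) \<le> norm (vector_derivative (f \<circ> \<gamma>) (at r))"
        using low[OF rK, of "D r"] \<open>m > 0\<close> by (simp add: vector_derivative_at)
    qed (use s in auto)
    also have "\<dots> \<le> L \<gamma>"
      unfolding curve_length_def by (rule nn_integral_mono) (use s in \<open>auto simp: indicator_def\<close>)
    finally show ?thesis using \<gamma> \<open>m > 0\<close> by (simp add: curves_def flip: scaleR_diff_right)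
  qed
  have main: "ennreal (m * \<rho>) \<le> L \<gamma> \<or> (q \<in> U \<and> ennreal (m * norm (\<phi> q - \<phi> x)) \<le> L \<gamma>)" if \<gamma>: "\<gamma> \<in> curves x q" for \<gamma> q
  proof (cases "\<gamma> ` {0..1} \<subseteq> KK")
    case True
    then have "q \<in> KK" using \<gamma> by (auto simp: curves_def image_subset_iff)
    then show ?thesis using est[OF \<gamma> _ True] \<gamma> KU by (auto simp: curves_def)
  next
    case False
    have p: "pathin X \<gamma>" and \<gamma>0: "\<gamma> 0 = x" using \<gamma> by (auto simp: curves_def piecewise_C1_curve_def)
    define B where "B = {z \<in> U. \<phi> z \<in> ball (\<phi> x) \<rho>}"
    have openB: "openin X B" unfolding B_def by (rule chart_preimage_open[OF c open_ball])
    have BK: "B \<subseteq> KK" by (rule subsetI, subst K\<phi>) (auto simp: B_def)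
    define T where "T = {s \<in> {0..1}. \<gamma> s \<notin> B}"
    obtain s' where "s' \<in> {0..1}" "\<gamma> s' \<notin> KK" using False by blast
    then have Tne: "T \<noteq> {}" using BK by (auto simp: T_def)
    \<comment> \<open>The first exit time from the open ball; at that time the curve is on the
      coordinate sphere of radius \<open>\<rho>\<close>.\<close>
    define s0 where "s0 = Inf T"
    have bd: "bdd_below T" by (auto simp: T_def intro: bdd_belowI[of _ 0])
    have lt: "\<gamma> s \<in> B" if "0 \<le> s" "s < s0" for s
    proof (rule ccontr)
      assume "\<gamma> s \<notin> B"
      moreover have "s0 \<le> 1" unfolding s0_def using Tne bd by (metis (no_types, lifting) T_def atLeastAtMost_iff cInf_lower2 ex_in_conv mem_Collect_eq)
      ultimately have "s \<in> T" using that by (auto simp: T_def)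
      then show False using cInf_lower[OF _ bd] that by (force simp: s0_def)
    qed
    have s01: "s0 \<in> {0..1}"
    proof -
      have "0 \<le> s0" unfolding s0_def by (rule cInf_greatest[OF Tne]) (auto simp: T_def)
      moreover have "s0 \<le> 1" unfolding s0_def using Tne bd by (metis (no_types, lifting) T_def atLeastAtMost_iff cInf_lower2 ex_in_conv mem_Collect_eq)
      ultimately show ?thesis by simp
    qed
    have nB: "\<gamma> s0 \<notin> B"
    proof
      assume "\<gamma> s0 \<in> B"
      then obtain e where e: "e > 0" "\<And>r. r \<in> {0..1} \<Longrightarrow> \<bar>r - s0\<bar> < e \<Longrightarrow> \<gamma> r \<in> B"
        using path_near[OF p openB s01] by blast
      obtain t where t: "t \<in> T" "t < s0 + e" using cInf_lessD[OF Tne, of "s0 + e"] e(1) by (auto simp: s0_def)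
      moreover have "s0 \<le> t" using cInf_lower[OF t(1) bd] by (simp add: s0_def)
      ultimately show False using e(2)[of t] by (auto simp: T_def)
    qed
    have "x \<in> B" using x \<rho>(1) by (simp add: B_def)
    then have "s0 > 0" using nB \<gamma>0 s01 by (cases "s0 = 0") auto
    have sK: "\<gamma> s0 \<in> KK"
    proof (rule ccontr)
      assume "\<gamma> s0 \<notin> KK"
      moreover have "\<gamma> s0 \<in> topspace X" using p s01 by (auto simp: pathin_def continuous_map_def)
      ultimately obtain e where e: "e > 0" "\<And>r. r \<in> {0..1} \<Longrightarrow> \<bar>r - s0\<bar> < e \<Longrightarrow> \<gamma> r \<in> topspace X - KK"
        using path_near[OF p openin_diff[OF openin_topspace closedK] s01] by blast
      define r where "r = max (s0 / 2) (s0 - e / 2)"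
      have "0 \<le> r" "r < s0" "r \<in> {0..1}" "\<bar>r - s0\<bar> < e" using \<open>s0 > 0\<close> e(1) s01 by (auto simp: r_def)
      then show False using e(2)[of r] lt[of r] BK by blast
    qed
    have sub: "\<gamma> ` {0..s0} \<subseteq> KK"
    proof
      fix z assume "z \<in> \<gamma> ` {0..s0}"
      then obtain s where "s \<in> {0..s0}" "z = \<gamma> s" by blast
      then show "z \<in> KK" using lt[of s] sK BK by (cases "s = s0") auto
    qed
    have "\<not> norm (\<phi> (\<gamma> s0) - \<phi> x) < \<rho>" using nB sK KU by (auto simp: B_def dist_norm norm_minus_commute)
    then have "ennreal (m * \<rho>) \<le> ennreal (m * norm (\<phi> (\<gamma> s0) - \<phi> x))" using \<open>m > 0\<close> by (intro ennreal_leI mult_left_mono) auto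
    then show ?thesis using est[OF \<gamma> s01 sub] by (auto intro: order_trans)
  qed
  show ?thesis by (rule that[OF \<rho>(1) \<open>m > 0\<close> main])
qed

lemma d_chart:
  assumes c: "(U, \<phi>) \<in> A" and x: "x \<in> U"
  obtains r m where "r > 0" "m > 0" "\<And>q. q \<in> topspace X \<Longrightarrow> d x q < r \<Longrightarrow> q \<in> U \<and> m * norm (\<phi> q - \<phi> x) \<le> d x q"
proof -
  obtain \<rho> m where \<rho>: "\<rho> > 0" "m > 0"
    and lb: "\<And>q c. c \<in> curves x q \<Longrightarrow> ennreal (m * \<rho>) \<le> L c \<or> (q \<in> U \<and> ennreal (m * norm (\<phi> q - \<phi> x)) \<le> L c)"
    by (rule chart_lower_bound[OF c x]) blast
  have xM: "x \<in> topspace X" using chart_sub[OF c] x by blast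
  show ?thesis
  proof (rule that[of "m * \<rho>" m])
    fix q assume q: "q \<in> topspace X" "d x q < m * \<rho>"
    obtain \<gamma> where \<gamma>: "\<gamma> \<in> curves x q" "L \<gamma> < ennreal (m * \<rho>)" by (rule d_curve[OF xM q])
    then have qU: "q \<in> U" and "ennreal (m * norm (\<phi> q - \<phi> x)) < ennreal (m * \<rho>)" using lb[OF \<gamma>(1)] by auto
    then have "m * norm (\<phi> q - \<phi> x) < m * \<rho>" using \<rho> by (simp add: ennreal_less_iff)
    then have "ennreal (m * norm (\<phi> q - \<phi> x)) \<le> (INF c\<in>curves x q. L c)"
      by (intro INF_greatest) (meson lb ennreal_leI less_imp_le order_trans)
    then have "m * norm (\<phi> q - \<phi> x) \<le> d x q" unfolding INF_finite[OF xM q(1)] by (simp add: d_nonneg)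
    then show "q \<in> U \<and> m * norm (\<phi> q - \<phi> x) \<le> d x q" using qU by simp
  qed (use \<rho> in auto)
qed

text \<open>The one axiom that is not formal is positivity, which is the lower bound in a chart. The
  triangle inequality concatenates almost shortest curves.\<close>

lemma metric: "Metric_space (topspace X) d"
proof
  show "0 \<le> d x y" for x y by (rule d_nonneg)
  show "d x y = d y x" for x y
  proof -
    have "L ` curves x y = L ` curves y x"
      using L_reverse[of _ x y] L_reverse[of _ y x] by (auto simp: image_iff) metis+
    then show ?thesis by (simp add: d_eq)
  qed
  show "d x y = 0 \<longleftrightarrow> x = y" if xy: "x \<in> topspace X" "y \<in> topspace X" for x y
  proof
    assume d0: "d x y = 0"
    obtain U \<phi> where U: "(U, \<phi>) \<in> A" "x \<in> U" using chart_exists[OF xy(1)] by blast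
    obtain r m where r: "r > 0" and m: "m > 0" and rm: "\<And>q. q \<in> topspace X \<Longrightarrow> d x q < r \<Longrightarrow> q \<in> U \<and> m * norm (\<phi> q - \<phi> x) \<le> d x q"
      by (rule d_chart[OF U]) blast
    have "y \<in> U" and "m * norm (\<phi> y - \<phi> x) \<le> 0" using rm[OF xy(2)] r d0 by auto
    then have "y \<in> U" "\<phi> y = \<phi> x" using m by (auto simp: mult_le_0_iff)
    then show "x = y" using chart_inj[OF U(1)] U(2) by (auto dest: inj_onD)
  next
    assume "x = y"
    have "(\<lambda>s. x) \<in> curves x x" using curve_const[OF xy(1)] by (simp add: curves_def)
    moreover have "L (\<lambda>s. x) \<le> ennreal 0"
      by (rule curve_length_bound[of _ "\<lambda>s. 0"]) (auto simp: o_def)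
    ultimately have "d x x \<le> 0" by (rule d_le) simp
    then show "d x y = 0" using d_nonneg[of x x] \<open>x = y\<close> by simp
  qed
  show "d x z \<le> d x y + d y z" if M: "x \<in> topspace X" "y \<in> topspace X" "z \<in> topspace X" for x y z
  proof (rule field_le_epsilon)
    fix e :: real assume e: "e > 0"
    obtain c1 where c1: "c1 \<in> curves x y" "L c1 < ennreal (d x y + e / 2)" by (rule d_curve[OF M(1,2)]) (use e in auto)
    obtain c2 where c2: "c2 \<in> curves y z" "L c2 < ennreal (d y z + e / 2)" by (rule d_curve[OF M(2,3)]) (use e in auto)
    obtain c where c: "c \<in> curves x z" "L c \<le> L c1 + L c2" using L_join[OF c1(1) c2(1)] by blast
    have "L c \<le> ennreal (d x y + e / 2) + ennreal (d y z + e / 2)"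
      using c(2) c1(2) c2(2) by (meson add_mono less_imp_le order_trans)
    also have "\<dots> = ennreal (d x y + d y z + e)"
      using d_nonneg e by (subst ennreal_plus[symmetric]) (auto simp: add_nonneg_nonneg)
    finally show "d x z \<le> d x y + d y z + e" using d_nonneg e by (intro d_le[OF c(1)]) (auto simp: add_nonneg_nonneg)
  qed
qed

text \<open>Small distance balls lie in a chart by \<open>d_chart\<close>, and there the distance
  dominates the coordinate norm. The lifting argument uses this to pass from metric limits to limits
  in X.\<close>

lemma d_neighbourhood:
  assumes W: "openin X W" "x \<in> W"
  shows "\<exists>\<epsilon>>0. \<forall>q\<in>topspace X. d x q < \<epsilon> \<longrightarrow> q \<in> W"
proof -
  have x: "x \<in> topspace X" using W openin_subset by blast
  obtain U \<phi> where U: "(U, \<phi>) \<in> A" "x \<in> U" using chart_exists[OF x] by blast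
  obtain r m where r: "r > 0" "m > 0" "\<And>q. q \<in> topspace X \<Longrightarrow> d x q < r \<Longrightarrow> q \<in> U \<and> m * norm (\<phi> q - \<phi> x) \<le> d x q"
    by (rule d_chart[OF U]) blast
  have "open (\<phi> ` (U \<inter> W))" by (rule chart_open_image[OF U(1)]) (use W chart_open[OF U(1)] in auto)
  then obtain e where e: "e > 0" "ball (\<phi> x) e \<subseteq> \<phi> ` (U \<inter> W)" using U(2) W by (meson IntI imageI openE)
  have "q \<in> W" if q: "q \<in> topspace X" "d x q < min r (m * e)" for q
  proof -
    have qU: "q \<in> U" "m * norm (\<phi> q - \<phi> x) < m * e" using r(3)[OF q(1)] q(2) by auto
    then have "\<phi> q \<in> ball (\<phi> x) e" using r(2) by (simp add: dist_norm norm_minus_commute)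
    then obtain z where "z \<in> U \<inter> W" "\<phi> q = \<phi> z" using e(2) by auto
    then show ?thesis using chart_inj[OF U(1)] qU(1) by (auto dest: inj_onD)
  qed
  then show ?thesis using r(1,2) e(1) by (intro exI[of _ "min r (m * e)"]) auto
qed

end

section \<open>Global inverses of local homeomorphisms\<close>

text \<open>The set of agreement is closed because X is Hausdorff, open because p is injective near
  each value of s1, and B is connected.\<close>

lemma sections_agree:
  assumes X: "Hausdorff_space X" and B: "connected B"
    and s1: "continuous_map (top_of_set B) X s1" and s2: "continuous_map (top_of_set B) X s2"
    and p1: "\<And>y. y \<in> B \<Longrightarrow> p (s1 y) = y" and p2: "\<And>y. y \<in> B \<Longrightarrow> p (s2 y) = y"
    and inj: "\<And>y. y \<in> B \<Longrightarrow> \<exists>N. openin X N \<and> s1 y \<in> N \<and> inj_on p N"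
    and y0: "y0 \<in> B" "s1 y0 = s2 y0" and y: "y \<in> B"
  shows "s1 y = s2 y"
proof -
  let ?E = "{y \<in> B. s1 y = s2 y}"
  have "closedin (top_of_set B) ?E"
    using closedin_continuous_maps_eq[OF X s1 s2] by simp
  moreover have "openin (top_of_set B) ?E"
  proof (subst openin_subopen, intro ballI)
    fix y assume y: "y \<in> ?E"
    obtain N where N: "openin X N" "s1 y \<in> N" "inj_on p N" using inj y by blast
    let ?T = "{z \<in> B. s1 z \<in> N} \<inter> {z \<in> B. s2 z \<in> N}"
    have "openin (top_of_set B) ?T"
      using openin_continuous_map_preimage[OF s1 N(1)] openin_continuous_map_preimage[OF s2 N(1)]
      by (intro openin_Int) simp_all
    moreover have "?T \<subseteq> ?E"
    proof
      fix z assume z: "z \<in> ?T"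
      then have "p (s1 z) = p (s2 z)" using p1 p2 by auto
      then show "z \<in> ?E" using z N(3) by (auto dest: inj_onD)
    qed
    ultimately show "\<exists>T. openin (top_of_set B) T \<and> y \<in> T \<and> T \<subseteq> ?E" using y N(2) by (intro exI[of _ ?T]) auto
  qed
  ultimately have "?E = {} \<or> ?E = B" using B unfolding connected_clopen by blast
  then show ?thesis using y0 y by blast
qed

lemma glue_sections:
  fixes B :: "'i \<Rightarrow> 'e::topological_space set"
  assumes o: "\<And>i. i \<in> I \<Longrightarrow> open (B i)" and s: "\<And>i. i \<in> I \<Longrightarrow> continuous_map (top_of_set (B i)) X (s i)"
    and agree: "\<And>i j y. i \<in> I \<Longrightarrow> j \<in> I \<Longrightarrow> y \<in> B i \<Longrightarrow> y \<in> B j \<Longrightarrow> s i y = s j y"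
  obtains g where "continuous_map (top_of_set (\<Union>i\<in>I. B i)) X g" "\<And>i y. i \<in> I \<Longrightarrow> y \<in> B i \<Longrightarrow> g y = s i y"
proof -
  let ?T = "top_of_set (\<Union>i\<in>I. B i)"
  have sub: "subtopology ?T (B i) = top_of_set (B i)" if "i \<in> I" for i
    using that by (simp add: subtopology_subtopology inf.absorb2 UN_upper)
  obtain g where "continuous_map ?T X g" "\<And>x i. i \<in> I \<Longrightarrow> x \<in> topspace ?T \<inter> B i \<Longrightarrow> g x = s i x"
  proof (rule pasting_lemma_exists[where X = ?T and I = I and T = B and Y = X and f = s])
    show "topspace ?T \<subseteq> (\<Union>i\<in>I. B i)" by simp
    show "openin ?T (B i)" if "i \<in> I" for i
      using that o[OF that] by (intro open_subset) auto
    show "continuous_map (subtopology ?T (B i)) X (s i)" if "i \<in> I" for i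
      using s[OF that] sub[OF that] by simp
    show "s i x = s j x" if "i \<in> I" "j \<in> I" "x \<in> topspace ?T \<inter> B i \<inter> B j" for i j x
      by (rule agree[OF that(1,2)]) (use that(3) in blast)+
  qed blast
  then show ?thesis using that[of g] by auto
qed

text \<open>G is a closed set at whose points p is a local homeomorphism. The last two assumptions
  take the place of a covering property: sections through x0 over balls stay in G and are Lipschitz,
  with a constant that may depend on the ball and the section.\<close>

locale lifting =
  fixes X :: "'m topology" and p :: "'m \<Rightarrow> 'e::euclidean_space" and d :: "'m \<Rightarrow> 'm \<Rightarrow> real"
    and G :: "'m set" and x0 :: 'm
  assumes hausdorff: "Hausdorff_space X" and connected: "connected_space X"
    and p_cont: "continuous_map X euclidean p"
    and metric: "Metric_space (topspace X) d" and complete: "Metric_space.mcomplete (topspace X) d"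
    and d_nbhd: "\<And>W x. openin X W \<Longrightarrow> x \<in> W \<Longrightarrow> \<exists>\<epsilon>>0. \<forall>q\<in>topspace X. d x q < \<epsilon> \<longrightarrow> q \<in> W"
    and G_closed: "closedin X G" and x0: "x0 \<in> G"
    and local_inverse: "\<And>x. x \<in> G \<Longrightarrow> \<exists>\<delta>>0. \<exists>N \<sigma>. openin X N \<and> x \<in> N \<and>
      continuous_map (top_of_set (ball (p x) \<delta>)) X \<sigma> \<and> (\<forall>y\<in>ball (p x) \<delta>. \<sigma> y \<in> N \<and> p (\<sigma> y) = y) \<and>
      (\<forall>x'\<in>N. p x' \<in> ball (p x) \<delta> \<longrightarrow> \<sigma> (p x') = x')"
    and sections_in_G: "\<And>r s. r > 0 \<Longrightarrow> continuous_map (top_of_set (ball (p x0) r)) X s \<Longrightarrow>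
      (\<forall>y\<in>ball (p x0) r. p (s y) = y) \<Longrightarrow> s (p x0) = x0 \<Longrightarrow> s ` ball (p x0) r \<subseteq> G"
    and sections_lipschitz: "\<And>r s. r > 0 \<Longrightarrow> continuous_map (top_of_set (ball (p x0) r)) X s \<Longrightarrow>
      (\<forall>y\<in>ball (p x0) r. p (s y) = y) \<Longrightarrow> s (p x0) = x0 \<Longrightarrow>
      \<exists>V. \<forall>y\<in>ball (p x0) r. \<forall>y'\<in>ball (p x0) r. d (s y) (s y') \<le> V * dist y y'"
begin

abbreviation "y0 \<equiv> p x0"

definition "is_section B s \<longleftrightarrow> continuous_map (top_of_set B) X s \<and> (\<forall>y\<in>B. p (s y) = y) \<and> s y0 = x0"

lemma local_inj: "x \<in> G \<Longrightarrow> \<exists>N. openin X N \<and> x \<in> N \<and> inj_on p N"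
proof -
  assume "x \<in> G"
  then obtain \<delta> N \<sigma> where N: "\<delta> > 0" "openin X N" "x \<in> N" "\<forall>x'\<in>N. p x' \<in> ball (p x) \<delta> \<longrightarrow> \<sigma> (p x') = x'"
    using local_inverse[of x] by blast
  let ?N = "N \<inter> {x' \<in> topspace X. p x' \<in> ball (p x) \<delta>}"
  have "openin X ?N"
    using openin_continuous_map_preimage[OF p_cont, of "ball (p x) \<delta>"] N(2) by (intro openin_Int) auto
  moreover have "inj_on p ?N" by (rule inj_on_inverseI[of _ \<sigma>]) (use N(4) in auto)
  moreover have "x \<in> ?N" using N openin_subset by fastforce
  ultimately show ?thesis by blast
qed

lemma section_G: "is_section (ball y0 r) s \<Longrightarrow> r > 0 \<Longrightarrow> s ` ball y0 r \<subseteq> G"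
  using sections_in_G unfolding is_section_def by blast

lemma section_unique:
  assumes "is_section (ball y0 r) s" "is_section (ball y0 r') s'" "y \<in> ball y0 r" "y \<in> ball y0 r'"
  shows "s y = s' y"
proof -
  let ?m = "min r r'"
  have m: "?m > 0" using assms(3,4) by (auto simp: min_def) (metis dist_not_less_zero not_le order.strict_trans2 not_less)+
  have sub: "ball y0 ?m \<subseteq> ball y0 r" "ball y0 ?m \<subseteq> ball y0 r'" by auto
  have "r > 0" using m by simp
  show ?thesis
  proof (rule sections_agree[OF hausdorff connected_ball[of y0 ?m], where p = p and ?y0.0 = y0])
    show "continuous_map (top_of_set (ball y0 ?m)) X s" "continuous_map (top_of_set (ball y0 ?m)) X s'"
      using assms(1,2) sub continuous_map_from_subtopology_mono unfolding is_section_def by blast+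
    show "\<exists>N. openin X N \<and> s y \<in> N \<and> inj_on p N" if "y \<in> ball y0 ?m" for y
      using local_inj section_G[OF assms(1) \<open>r > 0\<close>] sub that by blast
  qed (use assms sub m in \<open>auto simp: is_section_def\<close>)
qed

lemma union_section:
  assumes "\<And>r. r \<in> R \<Longrightarrow> r > 0 \<and> (\<exists>s. is_section (ball y0 r) s)" "R \<noteq> {}"
  shows "\<exists>s. is_section (\<Union>r\<in>R. ball y0 r) s"
proof -
  obtain S where S: "\<And>r. r \<in> R \<Longrightarrow> is_section (ball y0 r) (S r)" using assms(1) by metis
  obtain g where g: "continuous_map (top_of_set (\<Union>r\<in>R. ball y0 r)) X g" "\<And>r y. r \<in> R \<Longrightarrow> y \<in> ball y0 r \<Longrightarrow> g y = S r y"
  proof (rule glue_sections[of R "ball y0" X S])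
    show "continuous_map (top_of_set (ball y0 r)) X (S r)" if "r \<in> R" for r
      using S[OF that] by (simp add: is_section_def)
    show "S i y = S j y" if "i \<in> R" "j \<in> R" "y \<in> ball y0 i" "y \<in> ball y0 j" for i j y
      by (rule section_unique[OF S[OF that(1)] S[OF that(2)] that(3,4)])
  qed auto
  have "g y0 = x0"
  proof -
    obtain r where r: "r \<in> R" using assms(2) by blast
    then show ?thesis using g(2)[OF r, of y0] S[OF r] assms(1)[OF r] by (simp add: is_section_def)
  qed
  moreover have "p (g y) = y" if "y \<in> (\<Union>r\<in>R. ball y0 r)" for y
  proof -
    obtain r where "r \<in> R" "y \<in> ball y0 r" using \<open>y \<in> _\<close> by blast
    then show ?thesis using g(2) S by (simp add: is_section_def)
  qed
  ultimately have "is_section (\<Union>r\<in>R. ball y0 r) g" using g(1) by (simp add: is_section_def)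
  then show ?thesis by blast
qed

text \<open>The Lipschitz bound sends a radial sequence converging to b to a Cauchy sequence, whose
  limit exists by completeness. The same bound forces s to tend to this limit along the whole ball,
  not only along the radius.\<close>

lemma boundary_limit:
  assumes s: "is_section (ball y0 r) s" and r: "r > 0" and b: "dist y0 b = r"
  obtains xb where "xb \<in> G" "p xb = b" "\<And>W. openin X W \<Longrightarrow> xb \<in> W \<Longrightarrow> \<exists>\<eta>>0. \<forall>y\<in>ball y0 r. dist y b < \<eta> \<longrightarrow> s y \<in> W"
proof -
  interpret M: Metric_space "topspace X" d by (rule metric)
  have sG: "s ` ball y0 r \<subseteq> G" by (rule section_G[OF s r])
  have GM: "G \<subseteq> topspace X" using G_closed closedin_subset by blast
  obtain V0 where V0: "\<And>y y'. y \<in> ball y0 r \<Longrightarrow> y' \<in> ball y0 r \<Longrightarrow> d (s y) (s y') \<le> V0 * dist y y'"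
    using sections_lipschitz[OF r, of s] s unfolding is_section_def by blast
  define V where "V = \<bar>V0\<bar> + 1"
  have V: "V > 0" by (simp add: V_def)
  have lip: "d (s y) (s y') \<le> V * dist y y'" if "y \<in> ball y0 r" "y' \<in> ball y0 r" for y y'
  proof -
    have "V0 * dist y y' \<le> V * dist y y'" by (intro mult_right_mono) (auto simp: V_def)
    then show ?thesis using V0[OF that] by simp
  qed
  define yn where "yn n = b + (1 / real (n + 2)) *\<^sub>R (y0 - b)" for n
  have ynb: "yn n \<in> ball y0 r" for n
  proof -
    have "y0 - yn n = (1 - 1 / real (n + 2)) *\<^sub>R (y0 - b)" by (simp add: yn_def algebra_simps)
    then have "dist y0 (yn n) = (1 - 1 / real (n + 2)) * r" using b by (simp add: dist_norm)
    also have "\<dots> < 1 * r" using r by (intro mult_strict_right_mono) auto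
    finally show ?thesis by simp
  qed
  have ynlim: "yn \<longlonglongrightarrow> b"
  proof -
    have "(\<lambda>n. 1 / real (n + 2)) \<longlonglongrightarrow> 0" using LIMSEQ_ignore_initial_segment[OF lim_const_over_n[of 1], of 2] by simp
    then have "(\<lambda>n. b + (1 / real (n + 2)) *\<^sub>R (y0 - b)) \<longlonglongrightarrow> b + 0 *\<^sub>R (y0 - b)" by (intro tendsto_intros)
    then show ?thesis by (simp add: yn_def[abs_def])
  qed
  have "M.MCauchy (\<lambda>n. s (yn n))"
    unfolding M.MCauchy_def
  proof (intro conjI allI impI)
    show "range (\<lambda>n. s (yn n)) \<subseteq> topspace X" using sG GM ynb by blast
    fix \<epsilon> :: real assume e: "\<epsilon> > 0"
    have "Cauchy yn" using ynlim LIMSEQ_imp_Cauchy by blast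
    then obtain N where N: "\<And>n m. n \<ge> N \<Longrightarrow> m \<ge> N \<Longrightarrow> dist (yn n) (yn m) < \<epsilon> / V"
      using e V unfolding Cauchy_def by (metis divide_pos_pos)
    have "d (s (yn n)) (s (yn m)) < \<epsilon>" if "N \<le> n" "N \<le> m" for n m
      using lip[OF ynb ynb, of n m] N[OF that] V by (simp add: pos_less_divide_eq mult.commute)
    then show "\<exists>N. \<forall>n n'. N \<le> n \<longrightarrow> N \<le> n' \<longrightarrow> d (s (yn n)) (s (yn n')) < \<epsilon>" by blast
  qed
  then obtain xb where xb: "limitin M.mtopology (\<lambda>n. s (yn n)) xb sequentially"
    using complete unfolding M.mcomplete_def by blast
  have xbM: "xb \<in> topspace X" using xb by (simp add: M.limitin_metric)
  have dxb: "d xb (s y) \<le> V * dist y b" if y: "y \<in> ball y0 r" for y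
  proof (rule field_le_epsilon)
    fix e :: real assume e: "e > 0"
    have "\<forall>\<^sub>F n in sequentially. d (s (yn n)) xb < e / 2"
      using xb e unfolding M.limitin_metric by (auto elim!: allE[of _ "e / 2"] eventually_mono)
    moreover have "\<forall>\<^sub>F n in sequentially. dist (yn n) b < e / (2 * V)"
      using tendstoD[OF ynlim, of "e / (2 * V)"] e V by simp
    ultimately obtain n where n: "d (s (yn n)) xb < e / 2" "dist (yn n) b < e / (2 * V)"
      using eventually_happens'[OF sequentially_bot eventually_conj] by metis
    have "d xb (s y) \<le> d xb (s (yn n)) + d (s (yn n)) (s y)"
      using M.triangle xbM sG GM ynb y by blast
    also have "\<dots> \<le> e / 2 + V * dist (yn n) y"
      using n(1) lip[OF ynb y, of n] M.commute[of xb] by simp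
    also have "V * dist (yn n) y \<le> V * (dist (yn n) b + dist y b)"
      using V dist_triangle2[of "yn n" y b] by (intro mult_left_mono) auto
    also have "\<dots> \<le> e / 2 + V * dist y b"
      using n(2) V by (simp add: distrib_left pos_less_divide_eq mult_ac)
    finally show "d xb (s y) \<le> V * dist y b + e" by simp
  qed
  have near: "\<exists>\<eta>>0. \<forall>y\<in>ball y0 r. dist y b < \<eta> \<longrightarrow> s y \<in> W" if W: "openin X W" "xb \<in> W" for W
  proof -
    obtain \<epsilon> where \<epsilon>: "\<epsilon> > 0" "\<forall>q\<in>topspace X. d xb q < \<epsilon> \<longrightarrow> q \<in> W" using d_nbhd[OF W] by blast
    have "s y \<in> W" if y: "y \<in> ball y0 r" "dist y b < \<epsilon> / V" for y
    proof -
      have "d xb (s y) < \<epsilon>" using dxb[OF y(1)] y(2) V by (simp add: pos_less_divide_eq mult.commute)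
      then show ?thesis using \<epsilon>(2) sG GM y(1) by blast
    qed
    then show ?thesis using \<epsilon>(1) V by (intro exI[of _ "\<epsilon> / V"]) auto
  qed
  have close: "\<exists>y\<in>ball y0 r. dist y b < \<eta>" if eta: "\<eta> > 0" for \<eta>
  proof -
    obtain n where "dist (yn n) b < \<eta>"
      using eventually_happens'[OF sequentially_bot tendstoD[OF ynlim eta]] by blast
    then show ?thesis using ynb by blast
  qed
  have xbG: "xb \<in> G"
  proof (rule ccontr)
    assume "xb \<notin> G"
    then obtain \<eta> where "\<eta> > 0" "\<forall>y\<in>ball y0 r. dist y b < \<eta> \<longrightarrow> s y \<in> topspace X - G"
      using near[OF openin_diff[OF openin_topspace G_closed]] xbM by blast
    then show False using close[of \<eta>] sG by blast
  qed
  have "p xb = b"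
  proof (rule ccontr)
    assume ne: "p xb \<noteq> b"
    define e where "e = dist (p xb) b / 2"
    have e: "e > 0" using ne by (simp add: e_def)
    have "openin X {x \<in> topspace X. p x \<in> ball (p xb) e}"
      using openin_continuous_map_preimage[OF p_cont, of "ball (p xb) e"] by simp
    then obtain \<eta> where \<eta>: "\<eta> > 0" "\<forall>y\<in>ball y0 r. dist y b < \<eta> \<longrightarrow> s y \<in> {x \<in> topspace X. p x \<in> ball (p xb) e}"
      using near xbM e by (metis (no_types, lifting) centre_in_ball mem_Collect_eq)
    obtain y where y: "y \<in> ball y0 r" "dist y b < min \<eta> e" using close[of "min \<eta> e"] \<eta>(1) e by auto
    then have "dist (p xb) y < e" using \<eta>(2) s by (auto simp: is_section_def)
    then have "dist (p xb) b < 2 * e" using y(2) dist_triangle[of "p xb" b y] by simp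
    then show False by (simp add: e_def)
  qed
  then show ?thesis using that xbG near by blast
qed

text \<open>Around each boundary point the local inverse at the limit of s continues s. These
  continuations are glued with s, and compactness of the closed ball yields a larger ball covered by
  the pieces.\<close>

lemma extend_section:
  assumes s: "is_section (ball y0 r) s" and r: "r > 0"
  shows "\<exists>r'>r. \<exists>s'. is_section (ball y0 r') s'"
proof -
  have ex: "\<exists>\<delta> \<sigma>. \<delta> > 0 \<and> continuous_map (top_of_set (ball b \<delta>)) X \<sigma> \<and> (\<forall>y\<in>ball b \<delta>. p (\<sigma> y) = y) \<and>
     (\<forall>y\<in>ball b \<delta>. \<exists>N. openin X N \<and> \<sigma> y \<in> N \<and> inj_on p N) \<and> (\<forall>y\<in>ball b \<delta> \<inter> ball y0 r. \<sigma> y = s y)"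
    if b: "b \<in> sphere y0 r" for b
  proof -
    obtain xb where xb: "xb \<in> G" "p xb = b"
      and near: "\<And>W. openin X W \<Longrightarrow> xb \<in> W \<Longrightarrow> \<exists>\<eta>>0. \<forall>y\<in>ball y0 r. dist y b < \<eta> \<longrightarrow> s y \<in> W"
      using boundary_limit[OF s r] b by (metis mem_sphere)
    obtain \<delta> N \<sigma> where N: "\<delta> > 0" "openin X N" "xb \<in> N" and \<sigma>: "continuous_map (top_of_set (ball b \<delta>)) X \<sigma>"
      "\<And>y. y \<in> ball b \<delta> \<Longrightarrow> \<sigma> y \<in> N \<and> p (\<sigma> y) = y" "\<And>x'. x' \<in> N \<Longrightarrow> p x' \<in> ball b \<delta> \<Longrightarrow> \<sigma> (p x') = x'"
      using local_inverse[OF xb(1)] unfolding xb(2) by blast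
    have injN: "\<exists>N. openin X N \<and> \<sigma> y \<in> N \<and> inj_on p N" if y: "y \<in> ball b \<delta>" for y
    proof -
      let ?N = "N \<inter> {x' \<in> topspace X. p x' \<in> ball b \<delta>}"
      have "openin X ?N"
        using openin_continuous_map_preimage[OF p_cont, of "ball b \<delta>"] N(2) by (intro openin_Int) auto
      moreover have "inj_on p ?N" by (rule inj_on_inverseI[of _ \<sigma>]) (use \<sigma>(3) in auto)
      moreover have "\<sigma> y \<in> ?N" using \<sigma>(2)[OF y] y openin_subset[OF N(2)] by auto
      ultimately show ?thesis by blast
    qed
    obtain \<eta> where \<eta>: "\<eta> > 0" "\<forall>y\<in>ball y0 r. dist y b < \<eta> \<longrightarrow> s y \<in> N" using near[OF N(2,3)] by blast
    let ?C = "ball b \<delta> \<inter> ball y0 r"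
    have "\<sigma> y = s y" if y: "y \<in> ?C" for y
    proof -
      have "b \<in> closure (ball y0 r)" using b r by (simp add: closure_ball)
      then obtain y1 where y1: "y1 \<in> ball y0 r" "dist y1 b < min \<eta> \<delta>"
        using closure_approachable[of b "ball y0 r"] \<eta>(1) N(1) by (metis min_less_iff_conj)
      have "s y1 \<in> N" "p (s y1) = y1" using \<eta>(2) y1 s by (auto simp: is_section_def)
      then have eq: "\<sigma> y1 = s y1" using \<sigma>(3)[of "s y1"] y1 by (simp add: dist_commute)
      have mono: "continuous_map (top_of_set ?C) X \<sigma>" "continuous_map (top_of_set ?C) X s"
        using \<sigma>(1) s continuous_map_from_subtopology_mono unfolding is_section_def by blast+
      show ?thesis
        by (rule sections_agree[OF hausdorff _ mono, where p = p and ?y0.0 = y1])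
          (use y y1 eq \<sigma>(2) s injN in \<open>auto simp: is_section_def dist_commute intro: convex_connected convex_Int\<close>)
    qed
    then show ?thesis using N(1) \<sigma>(1,2) injN by blast
  qed
  define Q where "Q b D \<longleftrightarrow> fst D > 0 \<and> continuous_map (top_of_set (ball b (fst D))) X (snd D) \<and>
     (\<forall>y\<in>ball b (fst D). p (snd D y) = y) \<and>
     (\<forall>y\<in>ball b (fst D). \<exists>N. openin X N \<and> snd D y \<in> N \<and> inj_on p N) \<and>
     (\<forall>y\<in>ball b (fst D) \<inter> ball y0 r. snd D y = s y)" for b and D :: "real \<times> ('e \<Rightarrow> 'm)"
  have "\<forall>b\<in>sphere y0 r. \<exists>D. Q b D"
  proof
    fix b assume "b \<in> sphere y0 r"
    from ex[OF this] obtain e t where "Q b (e, t)" unfolding Q_def by auto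
    then show "\<exists>D. Q b D" by blast
  qed
  from bchoice[OF this] obtain DD where DD: "\<forall>b\<in>sphere y0 r. Q b (DD b)" by blast
  define \<delta> where "\<delta> b = fst (DD b)" for b
  define \<sigma> where "\<sigma> b = snd (DD b)" for b
  have \<delta>: "\<delta> b > 0" if "b \<in> sphere y0 r" for b
    using DD[rule_format, OF that] by (simp add: Q_def \<delta>_def)
  have \<sigma>: "\<And>b. b \<in> sphere y0 r \<Longrightarrow> continuous_map (top_of_set (ball b (\<delta> b))) X (\<sigma> b)"
      "\<And>b y. b \<in> sphere y0 r \<Longrightarrow> y \<in> ball b (\<delta> b) \<Longrightarrow> p (\<sigma> b y) = y"
      "\<And>b y. b \<in> sphere y0 r \<Longrightarrow> y \<in> ball b (\<delta> b) \<Longrightarrow> \<exists>N. openin X N \<and> \<sigma> b y \<in> N \<and> inj_on p N"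
      "\<And>b y. b \<in> sphere y0 r \<Longrightarrow> y \<in> ball b (\<delta> b) \<Longrightarrow> y \<in> ball y0 r \<Longrightarrow> \<sigma> b y = s y"
    using DD unfolding Q_def \<delta>_def \<sigma>_def by blast+
  have agree: "\<sigma> b y = \<sigma> b' y" if b: "b \<in> sphere y0 r" "b' \<in> sphere y0 r" and y: "y \<in> ball b (\<delta> b)" "y \<in> ball b' (\<delta> b')" for b b' y
  proof -
    let ?C = "ball b (\<delta> b) \<inter> ball b' (\<delta> b')"
    \<comment> \<open>Two balls centred on the sphere that meet also meet inside the ball of radius
      r: projecting a common point to the closed ball does not increase its distance to either
      centre. So both continuations agree with s somewhere in the overlap.\<close>
    let ?a = "closest_point (cball y0 r) y"
    have cb: "convex (cball y0 r)" "closed (cball y0 r)" "cball y0 r \<noteq> {}" using r by auto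
    have aC: "?a \<in> cball y0 r" by (rule closest_point_in_set[OF cb(2,3)])
    have "dist b ?a \<le> dist b y" "dist b' ?a \<le> dist b' y"
      using closest_point_lipschitz[OF cb, of b y] closest_point_lipschitz[OF cb, of b' y]
        closest_point_self[of b "cball y0 r"] closest_point_self[of b' "cball y0 r"] b by auto
    then have "?a \<in> ?C" using y by auto
    moreover have "?a \<in> closure (ball y0 r)" using aC r by (simp add: closure_ball)
    ultimately have "?C \<inter> ball y0 r \<noteq> {}"
      using open_Int_closure_eq_empty[of ?C "ball y0 r"] by blast
    then obtain y1 where y1: "y1 \<in> ?C" "y1 \<in> ball y0 r" by blast
    have mono: "continuous_map (top_of_set ?C) X (\<sigma> b)" "continuous_map (top_of_set ?C) X (\<sigma> b')"
      using \<sigma>(1)[OF b(1)] \<sigma>(1)[OF b(2)] continuous_map_from_subtopology_mono by blast+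
    have eq: "\<sigma> b y1 = \<sigma> b' y1" using \<sigma>(4)[OF b(1), of y1] \<sigma>(4)[OF b(2), of y1] y1 by auto
    show ?thesis
    proof (rule sections_agree[OF hausdorff _ mono, where p = p and ?y0.0 = y1])
      show "connected ?C" by (intro convex_connected convex_Int convex_ball)
    qed (use y y1(1) eq \<sigma>(2,3) b in blast)+
  qed
  \<comment> \<open>\<open>None\<close> stands for the given section, \<open>Some b\<close> for its
    continuation at the boundary point b.\<close>
  define I where "I = insert None (Some ` sphere y0 r)"
  define B where "B i = (case i of None \<Rightarrow> ball y0 r | Some b \<Rightarrow> ball b (\<delta> b))" for i
  define S where "S i = (case i of None \<Rightarrow> s | Some b \<Rightarrow> \<sigma> b)" for i
  obtain g where g: "continuous_map (top_of_set (\<Union>i\<in>I. B i)) X g" "\<And>i y. i \<in> I \<Longrightarrow> y \<in> B i \<Longrightarrow> g y = S i y"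
  proof (rule glue_sections[of I B X S])
    show "open (B i)" if "i \<in> I" for i by (cases i) (auto simp: B_def)
    show "continuous_map (top_of_set (B i)) X (S i)" if "i \<in> I" for i
      using that s \<sigma>(1) by (auto simp: I_def B_def S_def is_section_def)
    show "S i y = S j y" if "i \<in> I" "j \<in> I" "y \<in> B i" "y \<in> B j" for i j y
    proof (cases i)
      case None
      then show ?thesis using that \<sigma>(4) by (cases j) (auto simp: I_def B_def S_def)
    next
      case (Some b)
      then have b: "b \<in> sphere y0 r" "y \<in> ball b (\<delta> b)" using that by (auto simp: I_def B_def)
      show ?thesis
      proof (cases j)
        case None
        then show ?thesis using \<sigma>(4)[OF b] that Some by (simp add: B_def S_def)
      next
        case (Some b')
        then have "b' \<in> sphere y0 r" "y \<in> ball b' (\<delta> b')" using that by (auto simp: I_def B_def)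
        then show ?thesis using agree[OF b(1) _ b(2)] Some \<open>i = Some b\<close> by (simp add: S_def)
      qed
    qed
  qed auto
  have cover: "cball y0 r \<subseteq> (\<Union>i\<in>I. B i)"
  proof
    fix y assume "y \<in> cball y0 r"
    then consider "y \<in> ball y0 r" | "y \<in> sphere y0 r" by fastforce
    then show "y \<in> (\<Union>i\<in>I. B i)"
    proof cases
      case 1
      then show ?thesis by (intro UN_I[of None]) (auto simp: I_def B_def)
    next
      case 2
      then show ?thesis using \<delta>[OF 2] by (intro UN_I[of "Some y"]) (auto simp: I_def B_def)
    qed
  qed
  have "open (\<Union>i\<in>I. B i)" by (intro open_UN ballI) (auto simp: I_def B_def)
  then obtain e where e: "e > 0" "(\<Union>x\<in>cball y0 r. ball x e) \<subseteq> (\<Union>i\<in>I. B i)"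
    using compact_subset_open_imp_ball_epsilon_subset[OF compact_cball _ cover] by blast
  have sub: "ball y0 (r + e) \<subseteq> (\<Union>i\<in>I. B i)"
  proof
    fix q assume q: "q \<in> ball y0 (r + e)"
    show "q \<in> (\<Union>i\<in>I. B i)"
    proof (cases "q \<in> cball y0 r")
      case False
      then have D: "dist y0 q > r" by simp
      then have ne: "y0 \<noteq> q" "q \<noteq> y0" using r by auto
      let ?a = "y0 + (r / dist y0 q) *\<^sub>R (q - y0)"
      have "dist y0 ?a = r" using D r ne by (simp add: dist_norm norm_minus_commute)
      moreover have "dist ?a q < e"
      proof -
        have "?a - q = (r / dist y0 q - 1) *\<^sub>R (q - y0)" by (simp add: algebra_simps)
        then have "dist ?a q = \<bar>r / dist y0 q - 1\<bar> * dist y0 q" by (simp add: dist_norm norm_minus_commute)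
        also have "\<dots> = dist y0 q - r"
          using D r ne by (simp add: abs_if field_simps)
        finally show ?thesis using q by simp
      qed
      ultimately have "q \<in> (\<Union>x\<in>cball y0 r. ball x e)" by (intro UN_I[of ?a]) auto
      then show ?thesis using e(2) by blast
    qed (use cover in blast)
  qed
  have "is_section (ball y0 (r + e)) g"
    unfolding is_section_def
  proof (intro conjI ballI)
    show "continuous_map (top_of_set (ball y0 (r + e))) X g"
      using g(1) sub continuous_map_from_subtopology_mono by blast
    fix y assume "y \<in> ball y0 (r + e)"
    then obtain i where i: "i \<in> I" "y \<in> B i" using sub by blast
    then show "p (g y) = y" using g(2)[OF i] s \<sigma>(2) by (auto simp: I_def B_def S_def is_section_def)
  next
    show "g y0 = x0" using g(2)[of None y0] s r by (simp add: I_def B_def S_def is_section_def)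
  qed
  then show ?thesis using e(1) by (intro exI[of _ "r + e"]) auto
qed

text \<open>The radii admitting a section are unbounded, since a section over the ball of radius
  \<open>Sup R\<close> could be extended. The resulting E is onto because its range is open, by
  local injectivity of p, and closed, being the set where \<open>E (p x) = x\<close>, and X is
  connected.\<close>

theorem global_inverse:
  obtains E where "continuous_map euclidean X E" "\<And>y. p (E y) = y" "\<And>y. E y \<in> G" "\<And>x. x \<in> topspace X \<Longrightarrow> E (p x) = x"
proof -
  define R where "R = {r. r > 0 \<and> (\<exists>s. is_section (ball y0 r) s)}"
  obtain \<delta> N \<sigma> where N: "\<delta> > 0" "x0 \<in> N" "continuous_map (top_of_set (ball y0 \<delta>)) X \<sigma>"
    "\<forall>y\<in>ball y0 \<delta>. \<sigma> y \<in> N \<and> p (\<sigma> y) = y" "\<forall>x'\<in>N. p x' \<in> ball y0 \<delta> \<longrightarrow> \<sigma> (p x') = x'"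
    using local_inverse[OF x0] by blast
  have "is_section (ball y0 \<delta>) \<sigma>" using N by (simp add: is_section_def)
  then have Rne: "R \<noteq> {}" using N(1) by (auto simp: R_def)
  have un: "\<exists>s. is_section (\<Union>r\<in>R. ball y0 r) s" by (rule union_section) (use Rne in \<open>auto simp: R_def\<close>)
  have unb: "\<not> bdd_above R"
  proof
    assume bd: "bdd_above R"
    have eq: "(\<Union>r\<in>R. ball y0 r) = ball y0 (Sup R)"
      by (auto simp: less_cSup_iff[OF Rne bd])
    obtain r where "r \<in> R" using Rne by blast
    then have "Sup R > 0" using cSup_upper[OF _ bd, of r] by (auto simp: R_def)
    moreover obtain s where "is_section (ball y0 (Sup R)) s" using un eq by auto
    ultimately obtain r' s' where "r' > Sup R" "is_section (ball y0 r') s'" using extend_section by blast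
    then have "r' \<in> R" using \<open>Sup R > 0\<close> by (auto simp: R_def)
    then show False using cSup_upper[OF _ bd, of r'] \<open>r' > Sup R\<close> by simp
  qed
  have U: "(\<Union>r\<in>R. ball y0 r) = UNIV"
  proof -
    have "\<exists>r\<in>R. dist y0 y < r" for y
      using unb unfolding bdd_above_def by (meson not_le)
    then show ?thesis by auto
  qed
  then obtain E where E: "is_section UNIV E" using un by auto
  have Ec: "continuous_map euclidean X E" and pE: "p (E y) = y" for y
    using E by (auto simp: is_section_def)
  have EG: "E y \<in> G" for y
  proof -
    obtain r where r: "r > 0" "y \<in> ball y0 r" using dist_not_less_zero gt_ex[of "dist y0 y"] by (metis dist_commute le_less_trans mem_ball zero_le_dist)
    have "is_section (ball y0 r) E"
      using E continuous_map_from_subtopology[OF Ec] by (simp add: is_section_def)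
    then show ?thesis using section_G r by blast
  qed
  have Esub: "range E \<subseteq> topspace X" using Ec by (auto simp: continuous_map_def)
  have "openin X (range E)"
  proof (subst openin_subopen, intro ballI)
    fix x assume "x \<in> range E"
    then obtain y where y: "x = E y" by blast
    obtain N where N: "openin X N" "x \<in> N" "inj_on p N" using local_inj EG y by blast
    have "openin euclidean {z \<in> topspace euclidean. E z \<in> N}" by (rule openin_continuous_map_preimage[OF Ec N(1)])
    then have o: "open {z. E z \<in> N}" by simp
    let ?T = "N \<inter> {x' \<in> topspace X. p x' \<in> {z. E z \<in> N}}"
    have "openin X ?T"
      using openin_continuous_map_preimage[OF p_cont, of "{z. E z \<in> N}"] N(1) o by (intro openin_Int) auto
    moreover have "?T \<subseteq> range E"
    proof
      fix x' assume x': "x' \<in> ?T"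
      then have "p (E (p x')) = p x'" "E (p x') \<in> N" "x' \<in> N" using pE by auto
      then have "E (p x') = x'" using N(3) by (auto dest: inj_onD)
      then show "x' \<in> range E" by (metis rangeI)
    qed
    moreover have "x \<in> ?T" using N(2) y pE Esub by auto
    ultimately show "\<exists>T. openin X T \<and> x \<in> T \<and> T \<subseteq> range E" by blast
  qed
  moreover have "closedin X (range E)"
  proof -
    have Ep: "continuous_map X X (\<lambda>x. E (p x))" using continuous_map_compose[OF p_cont Ec] by (simp add: o_def)
    then have "closedin X {x \<in> topspace X. E (p x) = x}"
      using closedin_continuous_maps_eq[OF hausdorff Ep continuous_map_id] by simp
    moreover have "{x \<in> topspace X. E (p x) = x} = range E"
      using pE Esub by (auto simp: image_iff) metis
    ultimately show ?thesis by simp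
  qed
  ultimately have "range E = {} \<or> range E = topspace X"
    using connected by (metis connected_space_clopen_in)
  then have surj: "range E = topspace X" by blast
  have "E (p x) = x" if "x \<in> topspace X" for x
    using that surj pE by (metis imageE)
  then show ?thesis using that Ec pE EG by blast
qed

end

section \<open>The flow in graph coordinates\<close>

lemma sum_Basis_axis: "(\<Sum>a\<in>(Basis::(real^'n) set). f a) = (\<Sum>i\<in>UNIV. f (axis i 1))"
proof -
  have 1: "(Basis::(real^'n) set) = range (\<lambda>i. axis i 1)" by (auto simp: Basis_vec_def)
  have "inj (\<lambda>i::'n. axis i (1::real))" by (auto simp: inj_def axis_eq_axis)
  then show ?thesis unfolding 1 by (subst sum.reindex) (simp_all add: o_def)
qed

text \<open>From sin \<theta> = 2 tan(\<theta>/2) cos(\<theta>/2)^2, where the tangent is at least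
  its argument in absolute value and the squared cosine at least 1/2. The constant is not sharp; it
  is absorbed by the \<epsilon> of the growth hypothesis.\<close>

lemma abs_arcsin_le:
  assumes "\<bar>x\<bar> \<le> 1"
  shows "\<bar>arcsin x\<bar> \<le> 2 * \<bar>x\<bar>"
proof -
  define \<theta> where "\<theta> = arcsin x"
  have \<theta>: "- (pi / 2) \<le> \<theta>" "\<theta> \<le> pi / 2" "sin \<theta> = x"
    using assms arcsin_lbound arcsin_ubound by (auto simp: \<theta>_def abs_le_iff)
  have c: "cos \<theta> \<ge> 0" using \<theta> by (intro cos_ge_zero) auto
  have "\<theta> / 2 < pi / 2" "- (pi / 2) < \<theta> / 2" using \<theta>(1,2) pi_gt_zero by linarith+
  then have h: "\<bar>\<theta> / 2\<bar> < pi / 2" by linarith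
  have cp: "cos (\<theta> / 2) > 0" using h by (intro cos_gt_zero_pi) (auto simp: abs_less_iff)
  have "\<bar>x\<bar> = 2 * \<bar>tan (\<theta> / 2)\<bar> * (cos (\<theta> / 2))\<^sup>2"
  proof -
    have "x = 2 * sin (\<theta> / 2) * cos (\<theta> / 2)" using sin_double[of "\<theta> / 2"] \<theta>(3) by simp
    also have "\<dots> = 2 * tan (\<theta> / 2) * (cos (\<theta> / 2))\<^sup>2" using cp by (simp add: tan_def power2_eq_square)
    finally show ?thesis by (simp add: abs_mult)
  qed
  also have "\<dots> \<ge> 2 * \<bar>\<theta> / 2\<bar> * (cos (\<theta> / 2))\<^sup>2"
    using abs_tan_ge[OF h] by (intro mult_right_mono mult_left_mono) auto
  finally have "\<bar>\<theta>\<bar> * (cos (\<theta> / 2))\<^sup>2 \<le> \<bar>x\<bar>" by simp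
  moreover have "(cos (\<theta> / 2))\<^sup>2 \<ge> 1 / 2" using cos_double_cos[of "\<theta> / 2"] c by simp
  then have "\<bar>\<theta>\<bar> * (1 / 2) \<le> \<bar>\<theta>\<bar> * (cos (\<theta> / 2))\<^sup>2" by (intro mult_left_mono) auto
  ultimately show ?thesis unfolding \<theta>_def[symmetric] by linarith
qed

text \<open>The coordinate \<open>None\<close> becomes the height, and a reflection then turns the
  vertical direction into p0.\<close>

lemma graph_coordinates_exist:
  fixes p0 :: "real^('n::finite option)"
  assumes "norm p0 = 1"
  obtains J :: "(real^'n) \<times> real \<Rightarrow> real^('n option)" and Ji where "bounded_linear J" "bounded_linear Ji"
    "\<And>x y. J x \<bullet> J y = x \<bullet> y" "\<And>x y. Ji x \<bullet> Ji y = x \<bullet> y" "\<And>x. Ji (J x) = x" "\<And>x. J (Ji x) = x" "J (0, 1) = p0"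
proof -
  define J1 :: "(real^'n) \<times> real \<Rightarrow> real^('n option)" where "J1 v = (\<chi> c. case c of None \<Rightarrow> snd v | Some i \<Rightarrow> fst v $ i)" for v
  define K1 :: "real^('n option) \<Rightarrow> (real^'n) \<times> real" where "K1 y = ((\<chi> i. y $ Some i), y $ None)" for y
  have in1: "J1 x \<bullet> J1 y = x \<bullet> y" for x y
    by (simp add: inner_vec_def J1_def inner_prod_def UNIV_option_conv sum.reindex)
  have KJ: "K1 (J1 x) = x" and JK: "J1 (K1 y) = y" for x y
    by (auto simp: K1_def J1_def vec_eq_iff split: option.splits)
  have lJ: "linear J1" by (rule linearI) (auto simp: J1_def vec_eq_iff split: option.splits)
  have lK: "linear K1" by (rule linearI) (auto simp: K1_def vec_eq_iff)
  have inK: "K1 x \<bullet> K1 y = x \<bullet> y" for x y using in1[of "K1 x" "K1 y"] by (simp add: JK)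
  have "norm (J1 (0, 1)) = norm p0" using assms by (simp add: norm_eq_sqrt_inner in1)
  then obtain Q where Q: "bounded_linear Q" "\<And>x y. Q x \<bullet> Q y = x \<bullet> y" "\<And>x. Q (Q x) = x" "Q (J1 (0, 1)) = p0"
    by (rule householder_exists) blast
  have bJ: "bounded_linear J1" and bK: "bounded_linear K1" using lJ lK linear_conv_bounded_linear by auto
  show ?thesis
    by (rule that[of "\<lambda>v. Q (J1 v)" "\<lambda>y. K1 (Q y)"])
      (use Q bJ bK in \<open>auto simp: in1 inK KJ JK intro: bounded_linear_compose\<close>)
qed

lemma slice_dd:
  fixes G :: "(real^'n) \<times> real \<Rightarrow> 'b::euclidean_space"
  assumes G: "smooth_open U G" and y: "(y, t) \<in> U"
  shows "((\<lambda>y. G (y, t)) has_derivative (\<lambda>c. dd (c, 0) G (y, t))) (at y)"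
    "frechet_derivative (\<lambda>y. G (y, t)) (at y) = (\<lambda>c. dd (c, 0) G (y, t))"
    "partial i (\<lambda>y. G (y, t)) y = dd (axis i 1, 0) G (y, t)"
    "partial i (partial j (\<lambda>y. G (y, t))) y = dd (axis i 1, 0) (dd (axis j 1, 0) G) (y, t)"
proof -
  have d: "((\<lambda>y. G (y, t)) has_derivative (\<lambda>c. dd (c, 0) G (y, t))) (at y)" if "smooth_open U G" "(y, t) \<in> U" for y and G :: "(real^'n) \<times> real \<Rightarrow> 'b"
  proof -
    have "((\<lambda>y. (y, t)) has_derivative (\<lambda>c. (c, 0))) (at y)" by (intro has_derivative_Pair has_derivative_ident has_derivative_const)
    from has_derivative_compose[OF this, of G] smooth_openD(2)[OF that] show ?thesis by simp
  qed
  show 1: "((\<lambda>y. G (y, t)) has_derivative (\<lambda>c. dd (c, 0) G (y, t))) (at y)" by (rule d[OF G y])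
  have fd: "frechet_derivative (\<lambda>y. G (y, t)) (at y) = (\<lambda>c. dd (c, 0) G (y, t))" if "smooth_open U G" "(y, t) \<in> U" for y and G :: "(real^'n) \<times> real \<Rightarrow> 'b"
    using frechet_derivative_at[OF d[OF that]] by simp
  show "frechet_derivative (\<lambda>y. G (y, t)) (at y) = (\<lambda>c. dd (c, 0) G (y, t))" by (rule fd[OF G y])
  show "partial i (\<lambda>y. G (y, t)) y = dd (axis i 1, 0) G (y, t)" by (simp add: partial_def fd[OF G y])
  have "open {y. (y, t) \<in> U}"
    using continuous_open_preimage[of UNIV "\<lambda>y. (y, t)" U] smooth_openD(1)[OF G]
    by (simp add: vimage_def continuous_intros)
  have "partial i (partial j (\<lambda>y. G (y, t))) y = frechet_derivative (\<lambda>y. dd (axis j 1, 0) G (y, t)) (at y) (axis i 1)"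
    unfolding partial_def
    using dd_transform[OF \<open>open {y. (y, t) \<in> U}\<close>, of y "\<lambda>y. frechet_derivative (\<lambda>y. G (y, t)) (at y) (axis j 1)" "\<lambda>y. dd (axis j 1, 0) G (y, t)"]
      fd[OF G] y by simp
  then show "partial i (partial j (\<lambda>y. G (y, t))) y = dd (axis i 1, 0) (dd (axis j 1, 0) G) (y, t)"
    using fd[OF smooth_openD(3)[OF G] y] by simp
qed

text \<open>Pairing the subtracted projection with a tangent vector produces the Gram matrix times
  its inverse.\<close>

lemma normal_part_orthogonal:
  fixes f :: "real^'n \<Rightarrow> real^('n option)"
  assumes inv: "invertible (gram f y)"
  shows "normal_part f y w \<bullet> partial m f y = 0"
proof -
  let ?g = "gram f y"
  have "(\<Sum>k\<in>UNIV. \<Sum>l\<in>UNIV. matrix_inv ?g $ k $ l * (w \<bullet> partial l f y) * (partial k f y \<bullet> partial m f y))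
    = (\<Sum>l\<in>UNIV. (\<Sum>k\<in>UNIV. ?g $ m $ k * matrix_inv ?g $ k $ l) * (w \<bullet> partial l f y))"
    by (subst sum.swap) (simp add: gram_def sum_distrib_right sum_distrib_left inner_commute mult_ac)
  also have "\<dots> = (\<Sum>l\<in>UNIV. (?g ** matrix_inv ?g) $ m $ l * (w \<bullet> partial l f y))"
    by (simp add: matrix_matrix_mult_def)
  also have "\<dots> = w \<bullet> partial m f y"
  proof -
    have "(\<Sum>l\<in>UNIV. (?g ** matrix_inv ?g) $ m $ l * (w \<bullet> partial l f y)) = (\<Sum>l\<in>UNIV. if l = m then w \<bullet> partial l f y else 0)"
      unfolding matrix_inv_works(1)[OF inv] by (intro sum.cong refl) (auto simp: mat_def)
    then show ?thesis by simp
  qed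
  finally show ?thesis by (simp add: normal_part_def inner_diff_left inner_sum_left)
qed

text \<open>Passes from the inverse metric in \<open>mean_curvature_vector\<close> to frames: if the
  columns of a square matrix X are orthonormal for the metric g, then g^-1 = X X^T, and the trace
  with g^-1 is a sum over the frame. The second claim holds because the mean curvature vector is a
  combination of normal parts.\<close>

lemma normal_mcf_chart:
  fixes G :: "(real^'n) \<times> real \<Rightarrow> real^('n option)"
  assumes G: "smooth_open U G" and y: "(y, t) \<in> U" and inj: "inj (\<lambda>c. dd (c, 0) G (y, t))"
    and flow: "dd (0, 1) G (y, t) = mean_curvature_vector (\<lambda>y. G (y, t)) y"
  shows "normal_mcf G (y, t)" "dd (0, 1) G (y, t) \<bullet> dd (c, 0) G (y, t) = 0"
proof -
  let ?f = "\<lambda>y. G (y, t)"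
  let ?P = "\<lambda>i. partial i ?f y"
  note sl = slice_dd[OF G y]
  note lin = slice_derivative_linear(1)[OF G y]
  have expand: "dd (c, 0) G (y, t) = (\<Sum>i\<in>UNIV. (c $ i) *\<^sub>R ?P i)" for c
  proof -
    have "dd ((\<Sum>i\<in>UNIV. (c $ i) *\<^sub>R axis i 1), 0) G (y, t) = (\<Sum>i\<in>UNIV. (c $ i) *\<^sub>R ?P i)"
      using linear_sum[OF lin, of "\<lambda>i. (c $ i) *\<^sub>R axis i 1" UNIV] linear_scale[OF lin] by (simp add: sl(3))
    then show ?thesis using basis_expansion[of c] by (simp add: scalar_mult_eq_scaleR)
  qed
  have gc: "c \<bullet> (gram ?f y *v e) = dd (c, 0) G (y, t) \<bullet> dd (e, 0) G (y, t)" for c e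
  proof -
    have "c \<bullet> (gram ?f y *v e) = (\<Sum>i\<in>UNIV. \<Sum>j\<in>UNIV. c $ i * (e $ j * (?P i \<bullet> ?P j)))"
      by (simp add: inner_vec_def[of c] matrix_vector_mult_def gram_def sum_distrib_left mult.commute)
    also have "\<dots> = (\<Sum>i\<in>UNIV. (c $ i) *\<^sub>R ?P i) \<bullet> (\<Sum>j\<in>UNIV. (e $ j) *\<^sub>R ?P j)"
      unfolding inner_sum_left unfolding inner_sum_right by (simp add: mult.left_commute)
    finally show ?thesis by (simp only: expand)
  qed
  have inv: "invertible (gram ?f y)"
  proof -
    have "c = 0" if "gram ?f y *v c = 0" for c
    proof -
      have "dd (c, 0) G (y, t) \<bullet> dd (c, 0) G (y, t) = 0" using gc[of c c] that by simp
      then show "c = 0" using inj linear_injective_0[OF lin] by simp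
    qed
    then show ?thesis
      using matrix_left_invertible_ker[of "gram ?f y"] by (simp add: invertible_left_inverse)
  qed
  have orth: "mean_curvature_vector ?f y \<bullet> ?P m = 0" for m
    by (simp add: mean_curvature_vector_def second_fundamental_form_def inner_sum_left normal_part_orthogonal[OF inv])
  then show "dd (0, 1) G (y, t) \<bullet> dd (c, 0) G (y, t) = 0"
    unfolding flow expand by (simp add: inner_sum_right)
  show "normal_mcf G (y, t)"
    unfolding normal_mcf_def
  proof (intro allI impI)
    fix N and \<xi> :: "real^'n \<Rightarrow> real^'n"
    assume N: "\<forall>c. N \<bullet> dd (c, 0) G (y, t) = 0"
      and \<xi>: "\<forall>a\<in>Basis. \<forall>b\<in>Basis. dd (\<xi> a, 0) G (y, t) \<bullet> dd (\<xi> b, 0) G (y, t) = (if a = b then 1 else 0)"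
    have NP: "N \<bullet> ?P k = 0" for k using N by (simp add: sl(3))
    define h where "h i j = N \<bullet> partial i (partial j ?f) y" for i j
    have Nn: "N \<bullet> normal_part ?f y w = N \<bullet> w" for w
      by (simp add: normal_part_def inner_diff_right inner_sum_right NP)
    define X where "X = (\<chi> k i. \<xi> (axis i 1) $ k)"
    have col: "X *v axis i 1 = \<xi> (axis i 1)" for i
      by (simp add: X_def vec_eq_iff matrix_vector_mult_def axis_def if_distrib cong: if_cong)
    \<comment> \<open>Orthonormality of the frame in matrix form. One-sided inverses of square
      matrices are two-sided, so the factors can be cycled to isolate the metric.\<close>
    have "transpose X ** (gram ?f y ** X) = mat 1"
    proof -
      have "(transpose X ** (gram ?f y ** X)) $ i $ j = mat 1 $ i $ j" for i j
      proof -
        have "(transpose X ** (gram ?f y ** X)) $ i $ j = (X *v axis i 1) \<bullet> (gram ?f y *v (X *v axis j 1))"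
          by (simp add: matrix_matrix_mult_def matrix_vector_mult_def inner_vec_def transpose_def axis_def if_distrib cong: if_cong)
        also have "\<dots> = (if i = j then 1 else 0)"
          unfolding col gc using \<xi> by (auto simp: Basis_vec_def axis_eq_axis)
        finally show ?thesis by (simp add: mat_def)
      qed
      then show ?thesis by (simp add: vec_eq_iff)
    qed
    then have "gram ?f y ** (X ** transpose X) = mat 1"
      using matrix_left_right_inverse by (metis matrix_mul_assoc)
    then have ginv: "matrix_inv (gram ?f y) = X ** transpose X"
      using matrix_inv_works(2)[OF inv] by (metis matrix_mul_assoc matrix_mul_lid matrix_mul_rid)
    have "N \<bullet> dd (0, 1) G (y, t) = (\<Sum>i\<in>UNIV. \<Sum>j\<in>UNIV. matrix_inv (gram ?f y) $ i $ j * h i j)"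
      unfolding flow by (simp add: mean_curvature_vector_def second_fundamental_form_def inner_sum_right Nn h_def)
    also have "\<dots> = (\<Sum>i\<in>UNIV. \<Sum>j\<in>UNIV. \<Sum>a\<in>UNIV. \<xi> (axis a 1) $ i * \<xi> (axis a 1) $ j * h i j)"
      unfolding ginv by (simp add: matrix_matrix_mult_def transpose_def X_def sum_distrib_right)
    also have "\<dots> = (\<Sum>i\<in>UNIV. \<Sum>a\<in>UNIV. \<Sum>j\<in>UNIV. \<xi> (axis a 1) $ i * \<xi> (axis a 1) $ j * h i j)"
      by (intro sum.cong refl sum.swap)
    also have "\<dots> = (\<Sum>a\<in>UNIV. \<Sum>i\<in>UNIV. \<Sum>j\<in>UNIV. \<xi> (axis a 1) $ i * \<xi> (axis a 1) $ j * h i j)"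
      by (rule sum.swap)
    also have "\<dots> = (\<Sum>a\<in>UNIV. N \<bullet> dd (\<xi> (axis a 1), 0) (dd (\<xi> (axis a 1), 0) G) (y, t))"
    proof (intro sum.cong refl)
      fix a
      let ?x = "\<xi> (axis a 1)"
      have bx: "?x = (\<Sum>i\<in>UNIV. (?x $ i) *\<^sub>R axis i 1)" using basis_expansion[of ?x] by (simp add: scalar_mult_eq_scaleR)
      have l1: "linear (\<lambda>c. dd (c, 0) (dd (e, 0) G) (y, t))" for e by (rule slice_derivative_linear(1)[OF smooth_openD(3)[OF G] y])
      have s: "dd (c, 0) (dd (e, 0) G) (y, t) = dd (e, 0) (dd (c, 0) G) (y, t)" for c e by (rule dd_commute[OF G y])
      have e1: "dd (?x, 0) (dd (e, 0) G) (y, t) = (\<Sum>i\<in>UNIV. (?x $ i) *\<^sub>R dd (axis i 1, 0) (dd (e, 0) G) (y, t))" for e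
      proof -
        have "dd ((\<Sum>i\<in>UNIV. (?x $ i) *\<^sub>R axis i 1), 0) (dd (e, 0) G) (y, t) = (\<Sum>i\<in>UNIV. (?x $ i) *\<^sub>R dd (axis i 1, 0) (dd (e, 0) G) (y, t))"
          by (simp add: linear_sum[OF l1] linear_scale[OF l1])
        then show ?thesis by (simp only: bx[symmetric])
      qed
      have "dd (?x, 0) (dd (?x, 0) G) (y, t) = (\<Sum>i\<in>UNIV. (?x $ i) *\<^sub>R dd (axis i 1, 0) (dd (?x, 0) G) (y, t))" by (rule e1)
      also have "\<dots> = (\<Sum>i\<in>UNIV. (?x $ i) *\<^sub>R dd (?x, 0) (dd (axis i 1, 0) G) (y, t))"
        by (intro sum.cong refl arg_cong2[of _ _ _ _ scaleR] s)
      also have "\<dots> = (\<Sum>i\<in>UNIV. (?x $ i) *\<^sub>R (\<Sum>j\<in>UNIV. (?x $ j) *\<^sub>R dd (axis j 1, 0) (dd (axis i 1, 0) G) (y, t)))"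
        by (simp only: e1)
      also have "\<dots> = (\<Sum>i\<in>UNIV. (?x $ i) *\<^sub>R (\<Sum>j\<in>UNIV. (?x $ j) *\<^sub>R partial i (partial j ?f) y))"
        unfolding sl(4) by (intro sum.cong refl arg_cong2[of _ _ _ _ scaleR] s)
      finally show "(\<Sum>i\<in>UNIV. \<Sum>j\<in>UNIV. ?x $ i * ?x $ j * h i j) = N \<bullet> dd (?x, 0) (dd (?x, 0) G) (y, t)"
        by (simp add: inner_sum_right h_def sum_distrib_left mult.assoc)
    qed
    finally show "N \<bullet> dd (0, 1) G (y, t) = (\<Sum>a\<in>Basis. N \<bullet> dd (\<xi> a, 0) (dd (\<xi> a, 0) G) (y, t))"
      by (simp add: sum_Basis_axis)
  qed
qed

section \<open>The flow in the coordinates given by p0\<close>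

locale gauss_flow = manifold X A for X :: "'m topology" and A :: "('m, 'n::finite) chart set" +
  fixes F :: "'m \<Rightarrow> real \<Rightarrow> real^('n option)" and \<gamma> :: "'m \<Rightarrow> real \<Rightarrow> real^('n option)"
    and p0 :: "real^('n option)" and J :: "(real^'n) \<times> real \<Rightarrow> real^('n option)" and Ji
  assumes flow: "mean_curvature_flow A {..0} F"
    and complete: "\<And>t. t \<le> 0 \<Longrightarrow> complete_immersion X A (\<lambda>x. F x t)"
    and gauss: "is_gauss_map A {..0} F \<gamma>"
    and J: "bounded_linear J" and Ji: "bounded_linear Ji"
    and J_inner: "\<And>x y. J x \<bullet> J y = x \<bullet> y" and Ji_inner: "\<And>x y. Ji x \<bullet> Ji y = x \<bullet> y"
    and Ji_J: "\<And>x. Ji (J x) = x" and J_Ji: "\<And>x. J (Ji x) = x" and J01: "J (0, 1) = p0"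
begin

text \<open>The horizontal projection whose inversion makes the time slice an entire graph;
  \<open>h\<close> is the height over it.\<close>

definition "p t x = fst (Ji (F x t))"
definition "h t x = snd (Ji (F x t))"
definition "W x t = p0 \<bullet> \<gamma> x t"
definition "G U \<phi> z = F (inv_into U \<phi> (fst z)) (snd z)"
definition "g U \<phi> z = Ji (G U \<phi> z)"
text \<open>Only negative times: at time 0 the flow has one-sided time derivatives, and the domain
  would not be open. Time 0 is reached at the very end by continuity.\<close>

definition "cdom U \<phi> = \<phi> ` U \<times> {..<0::real}"

lemma W_eq: "W x t = snd (Ji (\<gamma> x t))"
  using Ji_inner[of p0 "\<gamma> x t"] Ji_J[of "(0, 1)"] by (simp add: W_def J01 inner_prod_def)

lemma norm_F: "norm (F x t) = norm (p t x, h t x)"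
  using Ji_inner[of "F x t" "F x t"] by (simp add: p_def h_def norm_eq_sqrt_inner)

context
  fixes U \<phi> assumes c: "(U, \<phi>) \<in> A"
begin

lemma G_smooth: "smooth_open (cdom U \<phi>) (G U \<phi>)"
proof -
  have "smooth_on (\<phi> ` U \<times> {..0}) (\<lambda>(y, t). F (inv_into U \<phi> y) t)"
    using flow c unfolding mean_curvature_flow_def by blast
  moreover have "open (cdom U \<phi>)" unfolding cdom_def by (intro open_Times chart_image_open[OF c] open_lessThan)
  moreover have "cdom U \<phi> \<subseteq> \<phi> ` U \<times> {..0}" by (auto simp: cdom_def)
  ultimately show ?thesis
    using smooth_on_imp_smooth_open unfolding G_def[abs_def] by (fastforce simp: case_prod_unfold)
qed

lemma g_smooth: "smooth_open (cdom U \<phi>) (g U \<phi>)"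
  unfolding g_def[abs_def] by (rule smooth_open_linear_compose[OF Ji G_smooth])

lemma cdom_I: "x \<in> U \<Longrightarrow> t < 0 \<Longrightarrow> (\<phi> x, t) \<in> cdom U \<phi>"
  by (auto simp: cdom_def)

lemma g_at: "x \<in> U \<Longrightarrow> g U \<phi> (\<phi> x, t) = (p t x, h t x)"
  by (simp add: g_def G_def p_def h_def chart_inv[OF c])

lemma G_immersion:
  assumes "x \<in> U" "t < 0"
  shows "inj (\<lambda>e. dd (e, 0) (G U \<phi>) (\<phi> x, t))"
proof -
  have "inj (frechet_derivative (\<lambda>y. F (inv_into U \<phi> y) t) (at (\<phi> x)))"
    using flow c assms unfolding mean_curvature_flow_def by fastforce
  then show ?thesis using slice_dd(2)[OF G_smooth cdom_I[OF assms]] by (simp add: G_def)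
qed

lemma dd_g: "z \<in> cdom U \<phi> \<Longrightarrow> dd v (g U \<phi>) z = Ji (dd v (G U \<phi>) z)"
  unfolding g_def[abs_def] by (rule dd_linear(1)[OF Ji G_smooth])

lemma G_time_derivative:
  assumes "x \<in> U" "t < 0"
  shows "dd (0, 1) (G U \<phi>) (\<phi> x, t) = mean_curvature_vector (\<lambda>y. G U \<phi> (y, t)) (\<phi> x)"
    "((\<lambda>s. F x s) has_vector_derivative dd (0, 1) (G U \<phi>) (\<phi> x, t)) (at t)"
proof -
  have 1: "(F x has_vector_derivative mean_curvature_vector (\<lambda>y. F (inv_into U \<phi> y) t) (\<phi> x)) (at t within {..0})"
    using flow c assms unfolding mean_curvature_flow_def by fastforce
  have "at t within {..0} = at t" by (rule at_within_interior) (use assms in auto)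
  with 1 have 2: "(F x has_vector_derivative mean_curvature_vector (\<lambda>y. G U \<phi> (y, t)) (\<phi> x)) (at t)"
    by (simp add: G_def)
  have 3: "((\<lambda>s. F x s) has_vector_derivative dd (0, 1) (G U \<phi>) (\<phi> x, t)) (at t)"
  proof -
    have "((\<lambda>s. (\<phi> x, s)) has_vector_derivative (0, 1)) (at t)"
      unfolding has_vector_derivative_def by (auto intro!: derivative_eq_intros)
    from smooth_chain_vector_derivative[OF G_smooth this cdom_I[OF assms]]
    show ?thesis by (simp add: G_def chart_inv[OF c assms(1)])
  qed
  then show "((\<lambda>s. F x s) has_vector_derivative dd (0, 1) (G U \<phi>) (\<phi> x, t)) (at t)" .
  show "dd (0, 1) (G U \<phi>) (\<phi> x, t) = mean_curvature_vector (\<lambda>y. G U \<phi> (y, t)) (\<phi> x)"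
    using vector_derivative_unique_at[OF 3 2] .
qed

lemma g_mcf:
  assumes "x \<in> U" "t < 0"
  shows "normal_mcf (g U \<phi>) (\<phi> x, t)"
  unfolding g_def[abs_def]
  by (rule normal_mcf_isometry[OF Ji Ji_inner G_smooth cdom_I[OF assms]
    normal_mcf_chart(1)[OF G_smooth cdom_I[OF assms] G_immersion[OF assms] G_time_derivative(1)[OF assms]]])

lemma gauss_g:
  assumes "x \<in> U" "t < 0"
  shows "Ji (\<gamma> x t) \<bullet> dd (e, 0) (g U \<phi>) (\<phi> x, t) = 0" "norm (Ji (\<gamma> x t)) = 1"
proof -
  have un: "is_unit_normal (\<lambda>y. F (inv_into U \<phi> y) t) (\<phi> x) (\<gamma> x t)"
    using gauss c assms unfolding is_gauss_map_def by fastforce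
  note dm = cdom_I[OF assms]
  have "\<gamma> x t \<bullet> dd (axis i 1, 0) (G U \<phi>) (\<phi> x, t) = 0" for i
  proof -
    have "\<gamma> x t \<bullet> partial i (\<lambda>y. G U \<phi> (y, t)) (\<phi> x) = 0" using un by (simp add: is_unit_normal_def G_def)
    then show ?thesis by (simp only: slice_dd(3)[OF G_smooth dm])
  qed
  moreover have lin: "linear (\<lambda>e. \<gamma> x t \<bullet> dd (e, 0) (G U \<phi>) (\<phi> x, t))"
    using linear_compose[OF slice_derivative_linear(1)[OF G_smooth dm] bounded_linear.linear[OF bounded_linear_inner_right]] by (simp add: o_def)
  ultimately have "\<gamma> x t \<bullet> dd (e, 0) (G U \<phi>) (\<phi> x, t) = 0"
  proof -
    have "e = (\<Sum>i\<in>UNIV. (e $ i) *\<^sub>R axis i 1)" using basis_expansion[of e] by (simp add: scalar_mult_eq_scaleR)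
    moreover have "\<gamma> x t \<bullet> dd ((\<Sum>i\<in>UNIV. (e $ i) *\<^sub>R axis i 1), 0) (G U \<phi>) (\<phi> x, t) = 0"
      using linear_sum[OF lin, of "\<lambda>i. (e $ i) *\<^sub>R axis i 1" UNIV] linear_scale[OF lin]
        \<open>\<And>i. \<gamma> x t \<bullet> dd (axis i 1, 0) (G U \<phi>) (\<phi> x, t) = 0\<close> by simp
    ultimately show ?thesis by simp
  qed
  then show "Ji (\<gamma> x t) \<bullet> dd (e, 0) (g U \<phi>) (\<phi> x, t) = 0" by (simp add: dd_g[OF dm] Ji_inner)
  show "norm (Ji (\<gamma> x t)) = 1" using un by (simp add: is_unit_normal_def norm_eq_sqrt_inner Ji_inner)
qed

lemma dd_g_inj:
  assumes "x \<in> U" "t < 0" "dd (e, 0) (g U \<phi>) (\<phi> x, t) = 0"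
  shows "e = 0"
proof -
  have "Ji (dd (e, 0) (G U \<phi>) (\<phi> x, t)) = 0" using assms(3) dd_g[OF cdom_I[OF assms(1,2)]] by simp
  then have "dd (e, 0) (G U \<phi>) (\<phi> x, t) = 0" using J_Ji linear_0[OF bounded_linear.linear[OF J]] by metis
  then show ?thesis
    using G_immersion[OF assms(1,2)] linear_injective_0[OF slice_derivative_linear(1)[OF G_smooth cdom_I[OF assms(1,2)]]] by simp
qed

text \<open>If the normal is not horizontal, no nonzero tangent vector is vertical and
  \<open>local_graph\<close> applies. The unit normal is a multiple of (- grad w, 1), which yields
  the relation between W and \<open>vv w\<close>.\<close>

lemma local_flow_graph:
  assumes x: "x \<in> U" and t: "t < 0" and W: "W x t \<noteq> 0"
  obtains U' Z \<Psi> w where "open U'" "(\<phi> x, t) \<in> U'" "U' \<subseteq> cdom U \<phi>" "open Z"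
    "homeomorphism U' Z (\<lambda>z. (fst (g U \<phi> z), snd z)) \<Psi>" "smooth_open Z \<Psi>" "smooth_open Z w"
    "\<forall>z\<in>Z. normal_mcf (graph_map w) z"
    "\<forall>z\<in>Z. \<exists>x'\<in>U. \<Psi> z = (\<phi> x', snd z) \<and> snd z < 0 \<and> p (snd z) x' = fst z \<and> h (snd z) x' = w z \<and> (W x' (snd z))\<^sup>2 * vv w z = 1"
proof -
  note dm = cdom_I[OF x t]
  have lin: "linear (\<lambda>e. fst (dd (e, 0) (g U \<phi>) (\<phi> x, t)))"
    using linear_compose[OF slice_derivative_linear(1)[OF g_smooth dm] linear_fst] by (simp add: o_def)
  have inj: "inj (\<lambda>e. fst (dd (e, 0) (g U \<phi>) (\<phi> x, t)))"
    unfolding linear_injective_0[OF lin]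
  proof (intro allI impI)
    fix e assume "fst (dd (e, 0) (g U \<phi>) (\<phi> x, t)) = 0"
    then have "snd (dd (e, 0) (g U \<phi>) (\<phi> x, t)) * W x t = 0"
      using gauss_g(1)[OF x t, of e] by (auto simp: inner_prod_def W_eq)
    then have "dd (e, 0) (g U \<phi>) (\<phi> x, t) = 0"
      using W \<open>fst (dd (e, 0) (g U \<phi>) (\<phi> x, t)) = 0\<close> by (simp add: prod_eq_iff)
    then show "e = 0" by (rule dd_g_inj[OF x t])
  qed
  obtain U' Z \<Psi> w where U': "open U'" "(\<phi> x, t) \<in> U'" "U' \<subseteq> cdom U \<phi>" "open Z"
    and hom: "homeomorphism U' Z (\<lambda>z. (fst (g U \<phi> z), snd z)) \<Psi>" and \<Psi>: "smooth_open Z \<Psi>" and w: "smooth_open Z w"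
    and fw: "\<And>z. z \<in> Z \<Longrightarrow> g U \<phi> (\<Psi> z) = graph_map w z"
    and wmcf: "\<And>z. z \<in> Z \<Longrightarrow> normal_mcf (g U \<phi>) (\<Psi> z) \<Longrightarrow> normal_mcf (graph_map w) z"
    by (rule local_graph[OF g_smooth dm inj]) blast
  have "\<Psi> z \<in> U'" and snd\<Psi>: "snd (\<Psi> z) = snd z" if "z \<in> Z" for z
  proof -
    show "\<Psi> z \<in> U'" using homeomorphism_image2[OF hom] that by auto
    have "(fst (g U \<phi> (\<Psi> z)), snd (\<Psi> z)) = z" by (rule homeomorphism_apply2[OF hom that])
    then show "snd (\<Psi> z) = snd z" by (metis snd_conv)
  qed
  then have \<Psi>Z: "\<Psi> ` Z \<subseteq> cdom U \<phi>" using U'(3) by auto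
  have form: "\<exists>x'\<in>U. \<Psi> z = (\<phi> x', snd z) \<and> snd z < 0" if z: "z \<in> Z" for z
  proof -
    have "\<Psi> z \<in> cdom U \<phi>" using \<Psi>Z z by auto
    then show ?thesis using snd\<Psi>[OF z] unfolding cdom_def by (cases "\<Psi> z") auto
  qed
  show ?thesis
  proof (rule that[OF U' hom \<Psi> w])
    show "\<forall>z\<in>Z. normal_mcf (graph_map w) z" using wmcf form g_mcf by metis
    show "\<forall>z\<in>Z. \<exists>x'\<in>U. \<Psi> z = (\<phi> x', snd z) \<and> snd z < 0 \<and> p (snd z) x' = fst z \<and> h (snd z) x' = w z \<and> (W x' (snd z))\<^sup>2 * vv w z = 1"
    proof
      fix z assume z: "z \<in> Z"
      obtain x' where x': "x' \<in> U" "\<Psi> z = (\<phi> x', snd z)" "snd z < 0" using form[OF z] by blast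
      have "(p (snd z) x', h (snd z) x') = (fst z, w z)"
        using fw[OF z] g_at[OF x'(1), of "snd z"] x'(2) by (simp add: graph_map_def)
      then have ph: "p (snd z) x' = fst z" "h (snd z) x' = w z" by auto
      let ?n = "Ji (\<gamma> x' (snd z))"
      have orth: "?n \<bullet> (c, grad w z \<bullet> c) = 0" for c
      proof -
        obtain c' where c': "dd (c, 0) \<Psi> z = (c', 0)"
          using time_preserving_derivative(1)[OF \<Psi> snd\<Psi> z, of "(c, 0)"] by (cases "dd (c, 0) \<Psi> z") auto
        have "dd (c, 0) (graph_map w) z = dd (c, 0) (\<lambda>z. g U \<phi> (\<Psi> z)) z"
          using dd_transform[OF U'(4) z, of "graph_map w" "\<lambda>z. g U \<phi> (\<Psi> z)"] fw by simp
        also have "\<dots> = dd (c', 0) (g U \<phi>) (\<phi> x', snd z)"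
          using dd_dd_compose(1)[OF g_smooth \<Psi> \<Psi>Z z, of "(c, 0)"] c' x'(2) by simp
        finally show ?thesis using gauss_g(1)[OF x'(1,3), of c'] by (simp add: dd_graph_map(1)[OF w z] inner_grad[OF w z])
      qed
      have "(fst ?n + snd ?n *\<^sub>R grad w z) \<bullet> c = 0" for c
        using orth[of c] by (simp add: inner_prod_def inner_add_left)
      from this[of "fst ?n + snd ?n *\<^sub>R grad w z"] have "fst ?n + snd ?n *\<^sub>R grad w z = 0" by simp
      then have n: "fst ?n = - snd ?n *\<^sub>R grad w z" by (simp add: eq_neg_iff_add_eq_0)
      have "?n \<bullet> ?n = 1" using gauss_g(2)[OF x'(1,3)] by (simp add: norm_eq_1)
      then have "(snd ?n)\<^sup>2 * vv w z = 1" by (simp add: inner_prod_def n vv_def power2_eq_square algebra_simps)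
      then show "\<exists>x'\<in>U. \<Psi> z = (\<phi> x', snd z) \<and> snd z < 0 \<and> p (snd z) x' = fst z \<and> h (snd z) x' = w z \<and> (W x' (snd z))\<^sup>2 * vv w z = 1"
        using x' ph by (auto simp: W_eq)
    qed
  qed
qed

end

lemma slice_immersed:
  assumes t: "t < 0"
  shows "immersed_manifold X A (\<lambda>x. F x t)"
proof (unfold_locales)
  fix U \<phi> assume c: "(U, \<phi>) \<in> A"
  have o: "open (\<phi> ` U)" by (rule chart_image_open[OF c])
  have "smooth_open (\<phi> ` U) (\<lambda>y. G U \<phi> (y, t))"
    by (rule smooth_open_compose[OF smooth_open_Pair[OF smooth_open_linear[OF bounded_linear_ident o] smooth_open_const[OF o]] G_smooth[OF c]])
      (use t in \<open>auto simp: cdom_def\<close>)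
  then show "smooth_open (\<phi> ` U) (\<lambda>y. F (inv_into U \<phi> y) t)" by (simp add: G_def)
  show "inj (frechet_derivative (\<lambda>y. F (inv_into U \<phi> y) t) (at (\<phi> x)))" if "x \<in> U" for x
    using flow c t that unfolding mean_curvature_flow_def by fastforce
qed

lemma slice_continuous:
  assumes t: "t < 0"
  shows "continuous_map X euclidean (\<lambda>x. (p t x, h t x))"
proof (rule pasting_lemma[where I = A and T = fst and f = "\<lambda>_ x. (p t x, h t x)"])
  show "openin X (fst c)" if "c \<in> A" for c using chart_open that by (cases c) auto
  show "continuous_map (subtopology X (fst c)) euclidean (\<lambda>x. (p t x, h t x))" if cA: "c \<in> A" for c
  proof -
    obtain U \<phi> where c: "c = (U, \<phi>)" by (cases c)
    then have cU: "(U, \<phi>) \<in> A" using cA by simp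
    have "continuous_on (\<phi> ` U) (\<lambda>y. g U \<phi> (y, t))"
      by (rule continuous_on_compose2[OF smooth_openD(4)[OF g_smooth[OF cU]]]) (use t in \<open>auto simp: cdom_def intro!: continuous_intros\<close>)
    then have 1: "continuous_map (top_of_set (\<phi> ` U)) euclidean (\<lambda>y. g U \<phi> (y, t))" by simp
    have "continuous_map (subtopology X U) euclidean (\<lambda>x. g U \<phi> (\<phi> x, t))"
      using continuous_map_compose[OF homeomorphic_imp_continuous_map[OF chart_homeomorphic[OF cU]] 1] by (simp add: o_def)
    then show ?thesis unfolding c fst_conv
      by (rule continuous_map_eq) (use g_at[OF cU] in auto)
  qed
  show "\<exists>j. j \<in> A \<and> x \<in> fst j \<and> (p t x, h t x) = (p t x, h t x)" if "x \<in> topspace X" for x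
    using chart_exists[OF that] by force
qed auto

lemma p_continuous: "t < 0 \<Longrightarrow> continuous_map X euclidean (p t)"
  using continuous_map_compose[OF slice_continuous, of t euclidean fst] by (simp add: o_def continuous_on_fst)

end

section \<open>Sections of the projection at a fixed time\<close>

lemma convex_segment_mem:
  fixes x y :: "'a::real_vector"
  assumes "convex B" "x \<in> B" "y \<in> B" "0 \<le> \<theta>" "\<theta> \<le> 1"
  shows "x + \<theta> *\<^sub>R (y - x) \<in> B"
proof -
  have "x + \<theta> *\<^sub>R (y - x) = (1 - \<theta>) *\<^sub>R x + \<theta> *\<^sub>R y" by (simp add: algebra_simps)
  then show ?thesis using convexD_alt[OF assms] by simp
qed

lemma open_slice: "open S \<Longrightarrow> open {y. (y, t) \<in> S}"
  using continuous_open_preimage[of UNIV "\<lambda>y. (y, t)" S] by (simp add: vimage_def continuous_intros)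

lemma smooth_open_slice: "smooth_open Z f \<Longrightarrow> smooth_open {y. (y, t) \<in> Z} (\<lambda>y. f (y, t))"
  by (rule smooth_open_compose[OF smooth_open_Pair[OF smooth_open_linear[OF bounded_linear_ident] smooth_open_const]])
    (auto intro: open_slice dest: smooth_openD(1))

context gauss_flow begin

lemma F_J: "F x t = J (p t x, h t x)"
  by (simp add: p_def h_def J_Ji)

text \<open>Adds to \<open>local_flow_graph\<close> the passage from points of the manifold to graph
  parameters; injectivity of the chart identifies the point found over a parameter with the given
  one.\<close>

lemma slice_graph:
  assumes c: "(U, \<phi>) \<in> A" and x: "x \<in> U" and t: "t < 0" and W: "W x t \<noteq> 0"
  obtains U' Z \<Phi> w where "open U'" "(\<phi> x, t) \<in> U'" "open Z" "smooth_open Z \<Phi>" "smooth_open Z w"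
    "\<forall>z\<in>Z. normal_mcf (graph_map w) z"
    "\<forall>z\<in>Z. \<exists>x'\<in>U. \<Phi> z = \<phi> x' \<and> snd z < 0 \<and> (\<phi> x', snd z) \<in> U' \<and> p (snd z) x' = fst z"
    "\<forall>x'\<in>U. \<forall>t'. (\<phi> x', t') \<in> U' \<longrightarrow> t' < 0 \<and> (p t' x', t') \<in> Z \<and> \<Phi> (p t' x', t') = \<phi> x' \<and>
      h t' x' = w (p t' x', t') \<and> (W x' t')\<^sup>2 * vv w (p t' x', t') = 1"
proof -
  obtain U' Z \<Psi> w where U': "open U'" "(\<phi> x, t) \<in> U'" "U' \<subseteq> cdom U \<phi>" "open Z"
    and hom: "homeomorphism U' Z (\<lambda>z. (fst (g U \<phi> z), snd z)) \<Psi>" and \<Psi>: "smooth_open Z \<Psi>" and w: "smooth_open Z w"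
    and mcf: "\<forall>z\<in>Z. normal_mcf (graph_map w) z"
    and ex: "\<forall>z\<in>Z. \<exists>x'\<in>U. \<Psi> z = (\<phi> x', snd z) \<and> snd z < 0 \<and> p (snd z) x' = fst z \<and> h (snd z) x' = w z \<and> (W x' (snd z))\<^sup>2 * vv w z = 1"
    by (rule local_flow_graph[OF c x t W])
  have \<Psi>U': "\<Psi> z \<in> U'" if "z \<in> Z" for z using homeomorphism_image2[OF hom] that by auto
  show ?thesis
  proof (rule that[OF U'(1,2,4) smooth_open_linear_compose[OF bounded_linear_fst \<Psi>] w mcf])
    show "\<forall>z\<in>Z. \<exists>x'\<in>U. fst (\<Psi> z) = \<phi> x' \<and> snd z < 0 \<and> (\<phi> x', snd z) \<in> U' \<and> p (snd z) x' = fst z"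
      using ex \<Psi>U' by (metis fst_conv)
    show "\<forall>x'\<in>U. \<forall>t'. (\<phi> x', t') \<in> U' \<longrightarrow> t' < 0 \<and> (p t' x', t') \<in> Z \<and> fst (\<Psi> (p t' x', t')) = \<phi> x' \<and>
      h t' x' = w (p t' x', t') \<and> (W x' t')\<^sup>2 * vv w (p t' x', t') = 1"
    proof (intro ballI allI impI)
      fix x' t' assume x': "x' \<in> U" and "(\<phi> x', t') \<in> U'"
      have e: "(fst (g U \<phi> (\<phi> x', t')), snd (\<phi> x', t')) = (p t' x', t')" using g_at[OF c x'] by simp
      have z: "(p t' x', t') \<in> Z" using homeomorphism_image1[OF hom] \<open>(\<phi> x', t') \<in> U'\<close> e by force
      have "\<Psi> (p t' x', t') = (\<phi> x', t')" using homeomorphism_apply1[OF hom \<open>(\<phi> x', t') \<in> U'\<close>] e by simp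
      moreover obtain x'' where x'': "x'' \<in> U" "\<Psi> (p t' x', t') = (\<phi> x'', t')" "t' < 0" "h t' x'' = w (p t' x', t')"
        "(W x'' t')\<^sup>2 * vv w (p t' x', t') = 1" using ex z by fastforce
      ultimately have "x'' = x'" using inj_onD[OF chart_inj[OF c]] x' by auto
      then show "t' < 0 \<and> (p t' x', t') \<in> Z \<and> fst (\<Psi> (p t' x', t')) = \<phi> x' \<and>
        h t' x' = w (p t' x', t') \<and> (W x' t')\<^sup>2 * vv w (p t' x', t') = 1"
        using x'' z by auto
    qed
  qed
qed

text \<open>Supplies the assumption \<open>local_inverse\<close> of \<open>lifting\<close>: the
  spacetime inverse restricted to time t is a local inverse of \<open>p t\<close>.\<close>

lemma slice_local_inverse:
  assumes x: "x \<in> topspace X" and t: "t < 0" and W: "W x t \<noteq> 0"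
  shows "\<exists>\<delta>>0. \<exists>N \<sigma>. openin X N \<and> x \<in> N \<and>
      continuous_map (top_of_set (ball (p t x) \<delta>)) X \<sigma> \<and> (\<forall>y\<in>ball (p t x) \<delta>. \<sigma> y \<in> N \<and> p t (\<sigma> y) = y) \<and>
      (\<forall>x'\<in>N. p t x' \<in> ball (p t x) \<delta> \<longrightarrow> \<sigma> (p t x') = x')"
proof -
  obtain U \<phi> where c: "(U, \<phi>) \<in> A" "x \<in> U" using chart_exists[OF x] by blast
  obtain U' Z \<Phi> w where U': "open U'" "(\<phi> x, t) \<in> U'" "open Z" and \<Phi>: "smooth_open Z \<Phi>"
    and ex: "\<forall>z\<in>Z. \<exists>x'\<in>U. \<Phi> z = \<phi> x' \<and> snd z < 0 \<and> (\<phi> x', snd z) \<in> U' \<and> p (snd z) x' = fst z"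
    and at: "\<forall>x'\<in>U. \<forall>t'. (\<phi> x', t') \<in> U' \<longrightarrow> t' < 0 \<and> (p t' x', t') \<in> Z \<and> \<Phi> (p t' x', t') = \<phi> x' \<and>
      h t' x' = w (p t' x', t') \<and> (W x' t')\<^sup>2 * vv w (p t' x', t') = 1"
    by (rule slice_graph[OF c t W]) blast
  have "p t x \<in> {y. (y, t) \<in> Z}" using at c(2) U'(2) by auto
  then obtain \<delta> where \<delta>: "\<delta> > 0" "ball (p t x) \<delta> \<subseteq> {y. (y, t) \<in> Z}"
    using open_slice[OF U'(3)] open_contains_ball by blast
  let ?\<sigma> = "\<lambda>y. inv_into U \<phi> (\<Phi> (y, t))"
  let ?N = "{x' \<in> U. \<phi> x' \<in> {y. (y, t) \<in> U'}}"
  have im: "(\<lambda>y. \<Phi> (y, t)) ` ball (p t x) \<delta> \<subseteq> \<phi> ` U"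
  proof safe
    fix y assume "y \<in> ball (p t x) \<delta>"
    then have "(y, t) \<in> Z" using \<delta>(2) by auto
    then show "\<Phi> (y, t) \<in> \<phi> ` U" using ex by blast
  qed
  have "continuous_on (ball (p t x) \<delta>) (\<lambda>y. \<Phi> (y, t))"
    by (rule continuous_on_compose2[OF smooth_openD(4)[OF \<Phi>]]) (use \<delta>(2) in \<open>auto intro!: continuous_intros\<close>)
  then have "continuous_map (top_of_set (ball (p t x) \<delta>)) (top_of_set (\<phi> ` U)) (\<lambda>y. \<Phi> (y, t))"
    using im by (auto simp: continuous_map_in_subtopology)
  from continuous_map_compose[OF this chart_inv_continuous[OF c(1)]]
  have cont: "continuous_map (top_of_set (ball (p t x) \<delta>)) X ?\<sigma>" by (simp add: o_def)
  show ?thesis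
  proof (intro exI[of _ \<delta>] conjI \<delta>(1) exI[of _ ?N] exI[of _ ?\<sigma>] chart_preimage_open[OF c(1) open_slice[OF U'(1)]] cont ballI impI)
    show "x \<in> ?N" using c(2) U'(2) by simp
    fix y assume "y \<in> ball (p t x) \<delta>"
    then have "(y, t) \<in> Z" using \<delta>(2) by auto
    then obtain x' where "x' \<in> U" "\<Phi> (y, t) = \<phi> x'" "(\<phi> x', t) \<in> U'" "p t x' = y" using ex by fastforce
    then show "?\<sigma> y \<in> ?N" "p t (?\<sigma> y) = y" using chart_inv[OF c(1)] by auto
  next
    fix x' assume "x' \<in> ?N"
    then show "?\<sigma> (p t x') = x'" using at chart_inv[OF c(1)] by auto
  qed
qed

lemma section_local:
  assumes t: "t < 0" and B: "open B" and s: "continuous_map (top_of_set B) X s" and ps: "\<forall>y\<in>B. p t (s y) = y"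
    and c: "(V, \<psi>) \<in> A" and y: "y \<in> B" "s y \<in> V" and W: "W (s y) t \<noteq> 0"
  obtains B' Z \<Phi> w where "open B'" "y \<in> B'" "B' \<subseteq> B" "smooth_open Z \<Phi>" "smooth_open Z w"
    "\<forall>y'\<in>B'. (y', t) \<in> Z \<and> s y' \<in> V \<and> \<psi> (s y') = \<Phi> (y', t) \<and> h t (s y') = w (y', t) \<and> (W (s y') t)\<^sup>2 * vv w (y', t) = 1"
proof -
  obtain U' Z \<Phi> w where U': "open U'" "(\<psi> (s y), t) \<in> U'" "open Z" and \<Phi>: "smooth_open Z \<Phi>" and w: "smooth_open Z w"
    and at: "\<forall>x'\<in>V. \<forall>t'. (\<psi> x', t') \<in> U' \<longrightarrow> t' < 0 \<and> (p t' x', t') \<in> Z \<and> \<Phi> (p t' x', t') = \<psi> x' \<and>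
      h t' x' = w (p t' x', t') \<and> (W x' t')\<^sup>2 * vv w (p t' x', t') = 1"
    by (rule slice_graph[OF c y(2) t W]) blast
  let ?N = "{x' \<in> V. \<psi> x' \<in> {y. (y, t) \<in> U'}}"
  have "openin X ?N" by (rule chart_preimage_open[OF c open_slice[OF U'(1)]])
  from openin_continuous_map_preimage[OF s this]
  have "openin (top_of_set B) {y \<in> B. s y \<in> ?N}" by simp
  then have o: "open {y \<in> B. s y \<in> ?N}" using B openin_open_eq by blast
  show ?thesis
  proof (rule that[OF o _ _ \<Phi> w])
    show "y \<in> {y \<in> B. s y \<in> ?N}" using y U'(2) by simp
    show "\<forall>y'\<in>{y \<in> B. s y \<in> ?N}. (y', t) \<in> Z \<and> s y' \<in> V \<and> \<psi> (s y') = \<Phi> (y', t) \<and> h t (s y') = w (y', t) \<and>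
        (W (s y') t)\<^sup>2 * vv w (y', t) = 1"
    proof
      fix y' assume "y' \<in> {y \<in> B. s y \<in> ?N}"
      then have "s y' \<in> V" "(\<psi> (s y'), t) \<in> U'" "p t (s y') = y'" using ps by auto
      then show "(y', t) \<in> Z \<and> s y' \<in> V \<and> \<psi> (s y') = \<Phi> (y', t) \<and> h t (s y') = w (y', t) \<and>
        (W (s y') t)\<^sup>2 * vv w (y', t) = 1"
        using at[rule_format, of "s y'" t] by simp
    qed
  qed auto
qed

context
  fixes t B s
  assumes t: "t < 0" and B: "open B" and s: "continuous_map (top_of_set B) X s" and ps: "\<forall>y\<in>B. p t (s y) = y"
    and Ws: "\<forall>y\<in>B. W (s y) t \<noteq> 0"
begin

lemma section_in_space: "y \<in> B \<Longrightarrow> s y \<in> topspace X"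
  using continuous_map_funspace[OF s] by auto

lemma section_chart_smooth:
  assumes c: "(V, \<psi>) \<in> A"
  shows "smooth_open {y \<in> B. s y \<in> V} (\<lambda>y. \<psi> (s y))"
proof (rule smooth_open_local)
  have "openin (top_of_set B) {y \<in> B. s y \<in> V}"
    using openin_continuous_map_preimage[OF s chart_open[OF c]] by simp
  then show "open {y \<in> B. s y \<in> V}" using B openin_open_eq by blast
  fix y assume y: "y \<in> {y \<in> B. s y \<in> V}"
  then have yV: "y \<in> B" "s y \<in> V" "W (s y) t \<noteq> 0" using Ws by auto
  obtain B' Z \<Phi> w where B': "open B'" "y \<in> B'" "smooth_open Z \<Phi>"
    "\<forall>y'\<in>B'. (y', t) \<in> Z \<and> s y' \<in> V \<and> \<psi> (s y') = \<Phi> (y', t) \<and> h t (s y') = w (y', t) \<and> (W (s y') t)\<^sup>2 * vv w (y', t) = 1"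
    by (rule section_local[OF t B s ps c yV]) blast
  have "smooth_open B' (\<lambda>y. \<Phi> (y, t))"
    by (rule smooth_open_subset[OF smooth_open_slice[OF B'(3)] B'(1)]) (use B'(4) in auto)
  then show "\<exists>V' g. y \<in> V' \<and> smooth_open V' g \<and> (\<forall>y\<in>V'. g y = \<psi> (s y))" using B'(2,4) by force
qed

text \<open>Near each point the composition is a local graph function w at time t, whose squared
  gradient is \<open>vv w - 1\<close>, less than 1/W^2.\<close>

lemma section_height:
  shows "smooth_open B (\<lambda>y. h t (s y))"
    and "y \<in> B \<Longrightarrow> \<bar>dd v (\<lambda>y. h t (s y)) y\<bar> \<le> inverse \<bar>W (s y) t\<bar> * norm v"
proof -
  have *: "\<exists>V g. y \<in> V \<and> smooth_open V g \<and> (\<forall>y\<in>V. g y = h t (s y)) \<and> (\<forall>v. \<bar>dd v g y\<bar> \<le> inverse \<bar>W (s y) t\<bar> * norm v)" if y: "y \<in> B" for y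
  proof -
    obtain V \<psi> where c: "(V, \<psi>) \<in> A" "s y \<in> V" using chart_exists[OF section_in_space[OF y]] by blast
    have Wy: "W (s y) t \<noteq> 0" using Ws y by blast
    obtain B' Z \<Phi> w where B': "open B'" "y \<in> B'" and w: "smooth_open Z w"
      and B'2: "\<forall>y'\<in>B'. (y', t) \<in> Z \<and> s y' \<in> V \<and> \<psi> (s y') = \<Phi> (y', t) \<and> h t (s y') = w (y', t) \<and> (W (s y') t)\<^sup>2 * vv w (y', t) = 1"
      by (rule section_local[OF t B s ps c(1) y c(2) Wy]) blast
    have z: "(y, t) \<in> Z" using B'2 B'(2) by blast
    have "smooth_open B' (\<lambda>y. w (y, t))"
      by (rule smooth_open_subset[OF smooth_open_slice[OF w] B'(1)]) (use B'2 in auto)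
    moreover have "\<bar>dd v (\<lambda>y. w (y, t)) y\<bar> \<le> inverse \<bar>W (s y) t\<bar> * norm v" for v
    proof -
      have "dd v (\<lambda>y. w (y, t)) y = grad w (y, t) \<bullet> v"
        using slice_dd(2)[OF w z] inner_grad[OF w z] by simp
      then have 1: "\<bar>dd v (\<lambda>y. w (y, t)) y\<bar> \<le> norm (grad w (y, t)) * norm v" by (simp add: Cauchy_Schwarz_ineq2)
      have "(norm (grad w (y, t)))\<^sup>2 \<le> vv w (y, t)" by (simp add: vv_def power2_norm_eq_inner)
      also have "\<dots> = (inverse \<bar>W (s y) t\<bar>)\<^sup>2" using B'2 B'(2) Ws y by (auto simp: field_simps)
      finally have "norm (grad w (y, t)) \<le> inverse \<bar>W (s y) t\<bar>" by (rule power2_le_imp_le) simp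
      then show ?thesis using 1 mult_right_mono[of _ _ "norm v"] by fastforce
    qed
    ultimately show ?thesis using B'(2) B'2 by (intro exI[of _ B'] exI[of _ "\<lambda>y. w (y, t)"]) auto
  qed
  show "smooth_open B (\<lambda>y. h t (s y))" using smooth_open_local[OF B] * by metis
  assume "y \<in> B"
  then obtain V g where V: "y \<in> V" "smooth_open V g" "\<forall>y\<in>V. g y = h t (s y)" "\<forall>v. \<bar>dd v g y\<bar> \<le> inverse \<bar>W (s y) t\<bar> * norm v"
    using * by blast
  then show "\<bar>dd v (\<lambda>y. h t (s y)) y\<bar> \<le> inverse \<bar>W (s y) t\<bar> * norm v"
    using dd_transform[OF smooth_openD(1)[OF V(2)] V(1), of g "\<lambda>y. h t (s y)"] by metis
qed

text \<open>The lift of the straight segment competes in the infimum defining the distance: its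
  image in space is the graph over the segment, with speed at most 1 + K times that of the
  segment.\<close>

lemma section_distance:
  assumes y: "y \<in> B" and y': "y' \<in> B" and conv: "convex B" and K: "\<forall>z\<in>B. inverse \<bar>W (s z) t\<bar> \<le> K"
  shows "induced_dist X A (\<lambda>x. F x t) (s y) (s y') \<le> (1 + K) * dist y y'"
proof -
  interpret im: immersed_manifold X A "\<lambda>x. F x t" by (rule slice_immersed[OF t])
  let ?v = "y' - y"
  let ?l = "\<lambda>\<theta>::real. y + \<theta> *\<^sub>R ?v"
  let ?c = "\<lambda>\<theta>. s (?l \<theta>)"
  let ?k = "\<lambda>y. h t (s y)"
  have lB: "?l \<theta> \<in> B" if "\<theta> \<in> {0..1}" for \<theta>
    by (rule convex_segment_mem[OF conv y y']) (use that in auto)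
  have K0: "0 \<le> K" using K y by (meson abs_ge_zero inverse_nonnegative_iff_nonnegative order_trans)
  have "piecewise_C1_curve X A ?c"
  proof (rule piecewise_C1_curveI)
    have "continuous_map (top_of_set {0..1}) (top_of_set B) ?l"
      using lB by (auto simp: continuous_map_in_subtopology intro!: continuous_intros)
    from continuous_map_compose[OF this s] show "pathin X ?c" by (simp add: pathin_def o_def)
    fix V \<psi> a b assume h: "(V, \<psi>) \<in> A" "0 \<le> a" "a \<le> b" "b \<le> 1" "?c ` {a..b} \<subseteq> V"
    note sm = section_chart_smooth[OF h(1)]
    have l: "smooth_open UNIV ?l"
      by (intro smooth_open_add smooth_open_const smooth_open_linear bounded_linear_scaleR_left) auto
    have o: "open (?l -` {y \<in> B. s y \<in> V})"
      by (rule open_vimage[OF smooth_openD(1)[OF sm]]) (intro continuous_intros)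
    have "smooth_open (?l -` {y \<in> B. s y \<in> V}) (\<lambda>\<theta>. \<psi> (?c \<theta>))"
      by (rule smooth_open_compose[OF smooth_open_subset[OF l o] sm]) auto
    from C1_differentiable_imp_piecewise[OF smooth_open_C1[OF this]]
    show "(\<lambda>\<theta>. \<psi> (?c \<theta>)) piecewise_C1_differentiable_on {a..b}" using h lB by (auto simp: subset_eq)
  qed
  then have curve: "?c \<in> im.curves (s y) (s y')" by (simp add: im.curves_def)
  have "im.L ?c \<le> ennreal ((1 + K) * dist y y')"
  proof (rule curve_length_bound)
    fix \<theta> :: real assume "\<theta> \<in> {0<..<1}"
    then have l: "?l \<theta> \<in> B" using lB by auto
    have *: "((\<lambda>\<theta>. ?k (?l \<theta>)) has_vector_derivative dd ?v ?k (?l \<theta>)) (at \<theta>)"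
      by (rule smooth_open_line[OF section_height(1) l])
    have "((\<lambda>\<theta>. J (?l \<theta>, ?k (?l \<theta>))) has_vector_derivative J (?v, dd ?v ?k (?l \<theta>))) (at \<theta>)"
      by (rule bounded_linear.has_vector_derivative[OF J has_vector_derivative_Pair[OF _ *]])
        (auto intro!: derivative_eq_intros simp: has_vector_derivative_def)
    then show "((\<lambda>x. F x t) \<circ> ?c has_vector_derivative J (?v, dd ?v ?k (?l \<theta>))) (at \<theta>)"
    proof (rule has_vector_derivative_transform_within_open[of _ _ _ "?l -` B"])
      show "open (?l -` B)" by (rule open_vimage[OF B]) (intro continuous_intros)
    qed (use l ps in \<open>auto simp: F_J\<close>)
    have "norm (J (?v, dd ?v ?k (?l \<theta>))) = norm (?v, dd ?v ?k (?l \<theta>))" by (simp add: norm_eq_sqrt_inner J_inner)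
    also have "\<dots> \<le> norm ?v + norm (dd ?v ?k (?l \<theta>))" by (rule norm_Pair_le)
    also have "norm (dd ?v ?k (?l \<theta>)) \<le> K * norm ?v"
      using section_height(2)[OF l, of ?v] mult_right_mono[OF bspec[OF K l], of "norm ?v"] by simp
    finally show "norm (J (?v, dd ?v ?k (?l \<theta>))) \<le> (1 + K) * dist y y'"
      by (simp add: dist_norm norm_minus_commute algebra_simps)
  qed
  from im.d_le[OF curve this] show ?thesis using K0 by simp
qed

text \<open>The gradient of the height \<open>k\<close> of a section grows at most linearly in \<open>k\<close>, so that
  \<open>ln (D\<^sup>2 + k\<^sup>2)\<close> has bounded derivative on a ball.\<close>

lemma section_gradient_bound:
  assumes Beq: "B = ball y0 r" and r: "r > 0" and C: "C \<ge> 0" and K: "\<forall>z\<in>B. inverse \<bar>W (s z) t\<bar> \<le> C * (1 + norm (F (s z) t))"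
  shows "\<exists>K. \<forall>z\<in>B. inverse \<bar>W (s z) t\<bar> \<le> K"
proof -
  let ?k = "\<lambda>y. h t (s y)"
  define D where "D = 1 + norm y0 + r"
  have D: "D \<ge> 1" using r by (simp add: D_def)
  have y0: "y0 \<in> B" using r Beq by simp
  have nF: "1 + norm (F (s z) t) \<le> D + \<bar>?k z\<bar>" if "z \<in> B" for z
  proof -
    have "norm (F (s z) t) \<le> norm z + \<bar>?k z\<bar>" using norm_Pair_le[of z "?k z"] ps that by (simp add: norm_F)
    moreover have "norm z \<le> norm y0 + r" using that norm_triangle_ineq2[of z y0] by (simp add: Beq dist_norm norm_minus_commute)
    ultimately show ?thesis by (simp add: D_def)
  qed
  have kb: "(?k z)\<^sup>2 \<le> (D\<^sup>2 + (?k y0)\<^sup>2) * exp (4 * C * r)" if z: "z \<in> B" for z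
  proof -
    let ?v = "z - y0"
    let ?l = "\<lambda>\<theta>::real. y0 + \<theta> *\<^sub>R ?v"
    let ?q = "\<lambda>\<theta>. ln (D\<^sup>2 + (?k (?l \<theta>))\<^sup>2)"
    let ?q' = "\<lambda>\<theta>. 2 * ?k (?l \<theta>) * dd ?v ?k (?l \<theta>) / (D\<^sup>2 + (?k (?l \<theta>))\<^sup>2)"
    have nv: "norm ?v \<le> r" using z by (simp add: Beq dist_norm norm_minus_commute)
    have lB: "?l \<theta> \<in> B" if "0 \<le> \<theta>" "\<theta> \<le> 1" for \<theta>
      by (rule convex_segment_mem[OF _ y0 z that]) (simp add: Beq)
    have pos: "D\<^sup>2 + a\<^sup>2 > 0" for a :: real using D by (intro add_pos_nonneg) auto
    have d: "(?q has_real_derivative ?q' \<theta>) (at \<theta>)" if "0 \<le> \<theta>" "\<theta> \<le> 1" for \<theta>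
    proof -
      have "((\<lambda>\<theta>. ?k (?l \<theta>)) has_real_derivative dd ?v ?k (?l \<theta>)) (at \<theta>)"
        using smooth_open_line[OF section_height(1) lB[OF that]] by (simp add: has_real_derivative_iff_has_vector_derivative)
      then show ?thesis by (auto intro!: derivative_eq_intros simp: pos field_simps)
    qed
    have "\<exists>\<theta>. 0 < \<theta> \<and> \<theta> < 1 \<and> ?q 1 - ?q 0 = (1 - 0) * ?q' \<theta>" by (rule MVT2) (use d in auto)
    then obtain \<theta> where \<theta>: "0 < \<theta>" "\<theta> < 1" "?q 1 - ?q 0 = ?q' \<theta>" by auto
    let ?a = "\<bar>?k (?l \<theta>)\<bar>"
    have l: "?l \<theta> \<in> B" using lB \<theta> by auto
    have "\<bar>dd ?v ?k (?l \<theta>)\<bar> \<le> inverse \<bar>W (s (?l \<theta>)) t\<bar> * norm ?v" by (rule section_height(2)[OF l])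
    also have "\<dots> \<le> (C * (D + ?a)) * r"
      using K l nF[OF l] nv C D by (intro mult_mono order_trans[OF bspec[OF K l]] mult_left_mono) auto
    finally have dk: "\<bar>dd ?v ?k (?l \<theta>)\<bar> \<le> C * (D + ?a) * r" .
    have "?q' \<theta> \<le> 2 * ?a * \<bar>dd ?v ?k (?l \<theta>)\<bar> / (D\<^sup>2 + ?a\<^sup>2)"
      using pos by (auto intro!: divide_right_mono simp: abs_mult[symmetric] intro: less_imp_le)
    also have "\<dots> \<le> 2 * ?a * (C * (D + ?a) * r) / (D\<^sup>2 + ?a\<^sup>2)"
      using dk pos by (intro divide_right_mono mult_left_mono) (auto intro: less_imp_le)
    also have "\<dots> \<le> 4 * C * r"
    proof -
      have "2 * a * (D + a) \<le> 4 * (D\<^sup>2 + a\<^sup>2)" for a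
      proof -
        have "0 \<le> (D - a)\<^sup>2 + 3 * D\<^sup>2 + a\<^sup>2" by simp
        then show ?thesis by (simp add: power2_eq_square algebra_simps)
      qed
      from this[of ?a] have "2 * ?a * (D + ?a) * (C * r) \<le> 4 * (D\<^sup>2 + ?a\<^sup>2) * (C * r)" using C r by (intro mult_right_mono) auto
      then show ?thesis using pos[of ?a] by (simp add: divide_le_eq mult_ac)
    qed
    finally have "?q 1 \<le> ?q 0 + 4 * C * r" using \<theta>(3) by simp
    then have "exp (?q 1) \<le> exp (?q 0) * exp (4 * C * r)" by (simp add: exp_add[symmetric])
    then have "D\<^sup>2 + (?k z)\<^sup>2 \<le> (D\<^sup>2 + (?k y0)\<^sup>2) * exp (4 * C * r)" using pos by (simp add: exp_ln)
    then show ?thesis using zero_le_power2[of D] by linarith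
  qed
  define M where "M = sqrt ((D\<^sup>2 + (?k y0)\<^sup>2) * exp (4 * C * r))"
  show ?thesis
  proof (intro exI ballI)
    fix z assume z: "z \<in> B"
    have "\<bar>?k z\<bar> \<le> M" unfolding M_def using real_sqrt_le_mono[OF kb[OF z]] by simp
    then show "inverse \<bar>W (s z) t\<bar> \<le> C * (D + M)"
      using K z nF[OF z] C by (intro order_trans[OF bspec[OF K z]] mult_left_mono) auto
  qed
qed

end

text \<open>The locale \<open>lifting\<close> applies with S as the set G: linear growth of 1/|W|
  becomes a bound on each ball by \<open>section_gradient_bound\<close>, and this a Lipschitz bound
  by \<open>section_distance\<close>.\<close>

lemma slice_global_inverse:
  assumes t: "t < 0" and S: "closedin X S" and x0: "x0 \<in> S" and C: "C \<ge> 0"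
    and W: "\<And>x. x \<in> S \<Longrightarrow> W x t \<noteq> 0 \<and> inverse \<bar>W x t\<bar> \<le> C * (1 + norm (F x t))"
    and sections_in_S: "\<And>r s. r > 0 \<Longrightarrow> continuous_map (top_of_set (ball (p t x0) r)) X s \<Longrightarrow>
      (\<forall>y\<in>ball (p t x0) r. p t (s y) = y) \<Longrightarrow> s (p t x0) = x0 \<Longrightarrow> s ` ball (p t x0) r \<subseteq> S"
  obtains E where "continuous_map euclidean X E" "\<And>y. p t (E y) = y" "\<And>y. E y \<in> S" "\<And>x. x \<in> topspace X \<Longrightarrow> E (p t x) = x"
proof -
  interpret im: immersed_manifold X A "\<lambda>x. F x t" by (rule slice_immersed[OF t])
  have SX: "x \<in> S \<Longrightarrow> x \<in> topspace X" for x using closedin_subset[OF S] by auto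
  interpret lifting X "p t" "induced_dist X A (\<lambda>x. F x t)" S x0
  proof (rule lifting.intro)
    show "Metric_space.mcomplete (topspace X) (induced_dist X A (\<lambda>x. F x t))"
      using complete[of t] t by (simp add: complete_immersion_def)
    show "\<exists>\<delta>>0. \<exists>N \<sigma>. openin X N \<and> x \<in> N \<and>
      continuous_map (top_of_set (ball (p t x) \<delta>)) X \<sigma> \<and> (\<forall>y\<in>ball (p t x) \<delta>. \<sigma> y \<in> N \<and> p t (\<sigma> y) = y) \<and>
      (\<forall>x'\<in>N. p t x' \<in> ball (p t x) \<delta> \<longrightarrow> \<sigma> (p t x') = x')" if "x \<in> S" for x
      using slice_local_inverse[OF SX t] W that by blast
    fix r s
    assume r: "r > 0" and s: "continuous_map (top_of_set (ball (p t x0) r)) X s"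
      and ps: "\<forall>y\<in>ball (p t x0) r. p t (s y) = y" and s0: "s (p t x0) = x0"
    show sS: "s ` ball (p t x0) r \<subseteq> S" by (rule sections_in_S[OF r s ps s0])
    have Ws: "\<forall>y\<in>ball (p t x0) r. W (s y) t \<noteq> 0"
      and Ks: "\<forall>y\<in>ball (p t x0) r. inverse \<bar>W (s y) t\<bar> \<le> C * (1 + norm (F (s y) t))" using sS W by blast+
    obtain K where K: "\<forall>z\<in>ball (p t x0) r. inverse \<bar>W (s z) t\<bar> \<le> K"
      using section_gradient_bound[OF t open_ball s ps Ws refl r C Ks] by blast
    show "\<exists>V. \<forall>y\<in>ball (p t x0) r. \<forall>y'\<in>ball (p t x0) r. induced_dist X A (\<lambda>x. F x t) (s y) (s y') \<le> V * dist y y'"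
      using section_distance[OF t open_ball s ps Ws _ _ convex_ball K] by blast
  qed (fact hausdorff connected p_continuous[OF t] im.metric im.d_neighbourhood S x0)+
  show ?thesis by (rule global_inverse) (rule that)
qed

end

section \<open>Rigidity of the flow\<close>

text \<open>Polarization kills the whole spatial Hessian. The graph equation then gives u_t = 0, so
  the spatial gradient is constant in time as well, and the same a and b serve all times.\<close>

lemma flat_graph_affine:
  fixes u :: "(real^'n) \<times> real \<Rightarrow> real"
  assumes u: "smooth_open (UNIV \<times> {..<\<tau>}) u" and mcf: "\<And>z. z \<in> UNIV \<times> {..<\<tau>} \<Longrightarrow> normal_mcf (graph_map u) z"
    and flat: "\<And>y t e. t < \<tau> \<Longrightarrow> norm e = 1 \<Longrightarrow> hess u (y, t) e e = 0"
  shows "\<exists>a b. \<forall>y. \<forall>t<\<tau>. u (y, t) = a \<bullet> y + b"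
proof -
  let ?O = "(UNIV :: (real^'n) set) \<times> {..<\<tau>}"
  have H: "hess u z c d = 0" if z: "z \<in> ?O" for z c d
  proof -
    note lin = hess_props(1)[OF u z] and sym = hess_props(2)[OF u z]
    have q: "hess u z e e = 0" for e
    proof (cases "e = 0")
      case True then show ?thesis using linear_0[OF lin] by simp
    next
      case False
      then have "hess u z (e /\<^sub>R norm e) (e /\<^sub>R norm e) = 0"
        using flat[of "snd z" "e /\<^sub>R norm e" "fst z"] z by auto
      then show ?thesis using False unfolding hess_homogeneous[OF u z] by simp
    qed
    have "hess u z (c + d) (c + d) = hess u z c c + hess u z c d + hess u z d c + hess u z d d"
      using linear_add[OF lin, of c d "c + d"] sym[of c "c + d"] sym[of d "c + d"]
        linear_add[OF lin, of c d c] linear_add[OF lin, of c d d] by simp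
    then show ?thesis using q sym[of c d] by simp
  qed
  have t0: "dd (0, 1) u z = 0" if z: "z \<in> ?O" for z
    using normal_mcf_graph[OF u z mcf[OF z]] H[OF z] by (simp add: hess_def)
  have o: "open ?O" and conv: "convex ?O" by (auto intro!: open_Times convex_Times)
  have "\<exists>k. \<forall>z\<in>?O. dd (d, 0) u z = k" for d
  proof (rule has_derivative_zero_constant[OF conv])
    fix z assume z: "z \<in> ?O"
    note D = smooth_openD(3)[OF u, of "(d, 0)"]
    have "dd (0, 1) (dd (d, 0) u) z = dd (d, 0) (dd (0, 1) u) z" by (rule dd_commute[OF u z])
    also have "\<dots> = dd (d, 0) (\<lambda>z. 0) z"
      using dd_transform[OF o z, of "dd (0, 1) u" "\<lambda>z. 0"] t0 by metis
    finally have "dd (0, 1) (dd (d, 0) u) z = 0" using dd_eqI[OF has_derivative_const] by metis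
    then have "dd v (dd (d, 0) u) z = 0" for v
      using slice_derivative_linear(2)[OF D z, of v] H[OF z, of "fst v" d] by (simp add: hess_def)
    then have "(dd (d, 0) u has_derivative (\<lambda>v. 0)) (at z)" using smooth_openD(2)[OF D z] by presburger
    then show "(dd (d, 0) u has_derivative (\<lambda>v. 0)) (at z within ?O)" by (rule has_derivative_at_withinI)
  qed
  then obtain k where k: "\<And>d z. z \<in> ?O \<Longrightarrow> dd (d, 0) u z = k d" by metis
  define a where "a = (\<Sum>i\<in>Basis. k i *\<^sub>R i)"
  have ga: "grad u z = a" if "z \<in> ?O" for z using k[OF that] by (simp add: grad_def a_def)
  have "\<exists>b. \<forall>z\<in>?O. u z - a \<bullet> fst z = b"
  proof (rule has_derivative_zero_constant[OF conv])
    fix z assume z: "z \<in> ?O"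
    have "dd v u z = a \<bullet> fst v" for v
      using slice_derivative_linear(2)[OF u z, of v] t0[OF z] inner_grad[OF u z, of "fst v"] ga[OF z] by simp
    then have "(u has_derivative (\<lambda>v. a \<bullet> fst v)) (at z)" using smooth_openD(2)[OF u z] by presburger
    then have "((\<lambda>z. u z - a \<bullet> fst z) has_derivative (\<lambda>v. a \<bullet> fst v - a \<bullet> fst v)) (at z)"
      by (auto intro!: derivative_eq_intros)
    then show "((\<lambda>z. u z - a \<bullet> fst z) has_derivative (\<lambda>v. 0)) (at z within ?O)"
      by (simp add: has_derivative_at_withinI)
  qed
  then obtain b where b: "\<forall>z\<in>?O. u z - a \<bullet> fst z = b" by blast
  show ?thesis
  proof (intro exI allI impI)
    fix y t assume "t < \<tau>"
    then show "u (y, t) = a \<bullet> y + b" using bspec[OF b, of "(y, t)"] by simp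
  qed
qed

section \<open>Planar time slices and the resulting stationarity\<close>

context gauss_flow begin

context
  fixes U \<phi> t x a b
  assumes c: "(U, \<phi>) \<in> A" and x: "x \<in> U" and t: "t < 0" and planar: "\<And>x. x \<in> topspace X \<Longrightarrow> h t x = a \<bullet> p t x + b"
begin

lemma planar_tangent: "snd (dd (e, 0) (g U \<phi>) (\<phi> x, t)) = a \<bullet> fst (dd (e, 0) (g U \<phi>) (\<phi> x, t))"
proof -
  let ?m = "\<lambda>y. snd (g U \<phi> (y, t)) - a \<bullet> fst (g U \<phi> (y, t))"
  have "(?m has_derivative (\<lambda>e. snd (dd (e, 0) (g U \<phi>) (\<phi> x, t)) - a \<bullet> fst (dd (e, 0) (g U \<phi>) (\<phi> x, t)))) (at (\<phi> x))"
    using slice_dd(1)[OF g_smooth[OF c] cdom_I[OF c x t]] by (auto intro!: derivative_eq_intros)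
  moreover have "(?m has_derivative (\<lambda>e. 0)) (at (\<phi> x))"
  proof (rule has_derivative_transform_within_open[OF has_derivative_const[of b] chart_image_open[OF c]])
    show "\<phi> x \<in> \<phi> ` U" using x by simp
    fix y assume "y \<in> \<phi> ` U"
    then obtain x' where "x' \<in> U" "y = \<phi> x'" by blast
    then show "b = ?m y" using g_at[OF c] planar chart_sub[OF c] by auto
  qed
  ultimately have "(\<lambda>e. snd (dd (e, 0) (g U \<phi>) (\<phi> x, t)) - a \<bullet> fst (dd (e, 0) (g U \<phi>) (\<phi> x, t))) = (\<lambda>e. 0)"
    by (rule has_derivative_unique)
  from fun_cong[OF this, of e] show ?thesis by simp
qed

text \<open>No nonzero tangent vector is vertical, and an injective linear map of
  \<open>real^'n\<close> to itself is onto; so the tangent space fills the direction space of the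
  hyperplane.\<close>

lemma planar_tangent_surj: "\<exists>e. dd (e, 0) (g U \<phi>) (\<phi> x, t) = (q, a \<bullet> q)"
proof -
  have lin: "linear (\<lambda>e. fst (dd (e, 0) (g U \<phi>) (\<phi> x, t)))"
    using linear_compose[OF slice_derivative_linear(1)[OF g_smooth[OF c] cdom_I[OF c x t]] linear_fst] by (simp add: o_def)
  have "inj (\<lambda>e. fst (dd (e, 0) (g U \<phi>) (\<phi> x, t)))"
    unfolding linear_injective_0[OF lin]
  proof (intro allI impI)
    fix e assume "fst (dd (e, 0) (g U \<phi>) (\<phi> x, t)) = 0"
    then have "dd (e, 0) (g U \<phi>) (\<phi> x, t) = 0" using planar_tangent[of e] by (simp add: prod_eq_iff)
    then show "e = 0" by (rule dd_g_inj[OF c x t])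
  qed
  then have "surj (\<lambda>e. fst (dd (e, 0) (g U \<phi>) (\<phi> x, t)))" by (rule linear_inj_imp_surj[OF lin])
  then obtain e where "q = fst (dd (e, 0) (g U \<phi>) (\<phi> x, t))" by (meson surjD)
  then show ?thesis using planar_tangent[of e] by (metis prod.collapse)
qed

lemma planar_W_chart: "(W x t)\<^sup>2 * (1 + a \<bullet> a) = 1"
proof -
  let ?n = "Ji (\<gamma> x t)"
  have "?n \<bullet> (q, a \<bullet> q) = 0" for q using planar_tangent_surj[of q] gauss_g(1)[OF c x t] by metis
  then have "(fst ?n + snd ?n *\<^sub>R a) \<bullet> q = 0" for q by (simp add: inner_prod_def inner_add_left)
  from this[of "fst ?n + snd ?n *\<^sub>R a"] have "fst ?n + snd ?n *\<^sub>R a = 0" by simp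
  then have n: "fst ?n = - snd ?n *\<^sub>R a" by (simp add: eq_neg_iff_add_eq_0)
  have "?n \<bullet> ?n = 1" using gauss_g(2)[OF c x t] by (simp add: norm_eq_1)
  then show ?thesis by (simp add: inner_prod_def n W_eq power2_eq_square algebra_simps)
qed

end

lemma planar_W:
  assumes "t < 0" "\<And>x. x \<in> topspace X \<Longrightarrow> h t x = a \<bullet> p t x + b" "x \<in> topspace X"
  shows "(W x t)\<^sup>2 * (1 + a \<bullet> a) = 1"
  using planar_W_chart[OF _ _ assms(1,2)] chart_exists[OF assms(3)] by blast

text \<open>Each point moves within a fixed hyperplane, so its velocity is tangential; by the flow
  equation it is also normal, hence zero. Thus the points themselves rest, not only the
  image.\<close>

lemma planar_stationary:
  assumes planar: "\<And>t x. t < \<tau> \<Longrightarrow> x \<in> topspace X \<Longrightarrow> h t x = a \<bullet> p t x + b" and \<tau>: "\<tau> \<le> 0"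
    and x: "x \<in> topspace X" and st: "s < \<tau>" "t < \<tau>"
  shows "F x s = F x t"
proof -
  have "(F x has_vector_derivative 0) (at t)" if t: "t < \<tau>" for t
  proof -
    obtain U \<phi> where c: "(U, \<phi>) \<in> A" "x \<in> U" using chart_exists[OF x] by blast
    have t0: "t < 0" using t \<tau> by simp
    let ?v = "dd (0, 1) (G U \<phi>) (\<phi> x, t)"
    have d: "(F x has_vector_derivative ?v) (at t)" by (rule G_time_derivative(2)[OF c t0])
    have dJ: "((\<lambda>t. Ji (F x t)) has_vector_derivative Ji ?v) (at t)"
      by (rule bounded_linear.has_vector_derivative[OF Ji d])
    have d1: "((\<lambda>t. h t x - a \<bullet> p t x) has_vector_derivative snd (Ji ?v) - a \<bullet> fst (Ji ?v)) (at t)"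
      unfolding h_def p_def
      by (intro has_vector_derivative_diff bounded_linear.has_vector_derivative[OF bounded_linear_inner_right]
        bounded_linear.has_vector_derivative[OF bounded_linear_fst] bounded_linear.has_vector_derivative[OF bounded_linear_snd] dJ)
    have d2: "((\<lambda>t. h t x - a \<bullet> p t x) has_vector_derivative 0) (at t)"
      by (rule has_vector_derivative_transform_within_open[OF has_vector_derivative_const[of b], of "{..<\<tau>}"])
        (use t planar x in auto)
    have "snd (Ji ?v) - a \<bullet> fst (Ji ?v) = 0" by (rule vector_derivative_unique_at[OF d1 d2])
    then have "Ji ?v = (fst (Ji ?v), a \<bullet> fst (Ji ?v))" by (simp add: prod_eq_iff)
    moreover obtain e where "dd (e, 0) (g U \<phi>) (\<phi> x, t) = (fst (Ji ?v), a \<bullet> fst (Ji ?v))"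
      using planar_tangent_surj[OF c t0 planar[OF t]] by blast
    ultimately have e: "Ji (dd (e, 0) (G U \<phi>) (\<phi> x, t)) = Ji ?v" using dd_g[OF c(1) cdom_I[OF c t0]] by simp
    have "?v \<bullet> dd (e, 0) (G U \<phi>) (\<phi> x, t) = 0"
      by (rule normal_mcf_chart(2)[OF G_smooth[OF c(1)] cdom_I[OF c t0] G_immersion[OF c t0] G_time_derivative(1)[OF c t0]])
    moreover have "dd (e, 0) (G U \<phi>) (\<phi> x, t) = ?v" using e J_Ji by metis
    ultimately have "?v = 0" by simp
    then show ?thesis using d by simp
  qed
  then have "\<exists>k. \<forall>t\<in>{..<\<tau>}. F x t = k"
    by (intro has_derivative_zero_constant) (auto simp: has_vector_derivative_def intro: has_derivative_at_withinI)
  then show ?thesis using st by auto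
qed

text \<open>Nothing is assumed on how E depends on time. Smoothness of u in spacetime comes from the
  local graphs, which coincide with u because preimages under \<open>p t\<close> are unique.\<close>

lemma entire_flow_stationary:
  assumes \<tau>: "\<tau> \<le> 0" and E: "\<And>t y. t < \<tau> \<Longrightarrow> E t y \<in> topspace X \<and> p t (E t y) = y"
    and Ep: "\<And>t x. t < \<tau> \<Longrightarrow> x \<in> topspace X \<Longrightarrow> E t (p t x) = x"
    and W: "\<And>t x. t < \<tau> \<Longrightarrow> x \<in> topspace X \<Longrightarrow> W x t \<noteq> 0"
    and growth: "\<And>\<epsilon>. \<epsilon> > 0 \<Longrightarrow> \<exists>C. \<forall>t<\<tau>. \<forall>x\<in>topspace X. inverse \<bar>W x t\<bar> \<le> C + \<epsilon> * sqrt (norm (F x t) + sqrt \<bar>t\<bar>)"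
  shows "\<exists>a b. \<forall>t<\<tau>. \<forall>x\<in>topspace X. h t x = a \<bullet> p t x + b"
proof -
  let ?O = "(UNIV :: (real^'n) set) \<times> {..<\<tau>}"
  have o: "open ?O" by (auto intro!: open_Times)
  define u where "u z = h (snd z) (E (snd z) (fst z))" for z
  have loc: "\<exists>V w. z \<in> V \<and> V \<subseteq> ?O \<and> smooth_open V w \<and> (\<forall>z\<in>V. w z = u z) \<and> normal_mcf (graph_map w) z \<and>
      sqrt (vv w z) = inverse \<bar>W (E (snd z) (fst z)) (snd z)\<bar>" if z: "z \<in> ?O" for z
  proof -
    obtain y t where yt: "z = (y, t)" "t < \<tau>" using z by auto
    let ?x = "E t y"
    have x: "?x \<in> topspace X" "p t ?x = y" using E yt by auto
    obtain U \<phi> where c: "(U, \<phi>) \<in> A" "?x \<in> U" using chart_exists[OF x(1)] by blast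
    have t0: "t < 0" using yt \<tau> by simp
    have W0: "W ?x t \<noteq> 0" by (rule W[OF yt(2) x(1)])
    obtain U' Z \<Phi> w where U': "(\<phi> ?x, t) \<in> U'" "open Z" and w: "smooth_open Z w"
      and nm: "\<forall>z\<in>Z. normal_mcf (graph_map w) z"
      and ex: "\<forall>z\<in>Z. \<exists>x'\<in>U. \<Phi> z = \<phi> x' \<and> snd z < 0 \<and> (\<phi> x', snd z) \<in> U' \<and> p (snd z) x' = fst z"
      and at: "\<forall>x'\<in>U. \<forall>t'. (\<phi> x', t') \<in> U' \<longrightarrow> t' < 0 \<and> (p t' x', t') \<in> Z \<and> \<Phi> (p t' x', t') = \<phi> x' \<and>
        h t' x' = w (p t' x', t') \<and> (W x' t')\<^sup>2 * vv w (p t' x', t') = 1"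
      by (rule slice_graph[OF c t0 W0]) blast
    have zZ: "z \<in> Z" and Wv: "(W ?x t)\<^sup>2 * vv w z = 1" using at[rule_format, OF c(2) U'(1)] x yt by auto
    have eq: "w z' = u z'" if z': "z' \<in> Z \<inter> ?O" for z'
    proof -
      obtain x' where x': "x' \<in> U" "(\<phi> x', snd z') \<in> U'" "p (snd z') x' = fst z'" using ex z' by blast
      have "snd z' < \<tau>" using z' by auto
      then have "E (snd z') (fst z') = x'" using Ep[of "snd z'" x'] x' chart_sub[OF c(1)] by auto
      then show ?thesis using at[rule_format, OF x'(1,2)] x'(3) by (simp add: u_def)
    qed
    have "(sqrt (vv w z))\<^sup>2 = (inverse \<bar>W ?x t\<bar>)\<^sup>2"
      using Wv W0 vv_ge_1[of w z] by (simp add: power_inverse field_simps)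
    then have "sqrt (vv w z) = inverse \<bar>W ?x t\<bar>" using vv_ge_1[of w z] by (simp add: power2_eq_iff_nonneg)
    then show ?thesis
      using smooth_open_subset[OF w open_Int[OF U'(2) o]] zZ z eq nm yt by (intro exI[of _ "Z \<inter> ?O"] exI[of _ w]) auto
  qed
  have u: "smooth_open ?O u"
    by (rule smooth_open_local[OF o]) (use loc in blast)
  have mcf: "normal_mcf (graph_map u) z" and vvu: "sqrt (vv u z) = inverse \<bar>W (E (snd z) (fst z)) (snd z)\<bar>" if z: "z \<in> ?O" for z
  proof -
    obtain V w where V: "z \<in> V" "smooth_open V w" "\<forall>z\<in>V. w z = u z" "normal_mcf (graph_map w) z"
      "sqrt (vv w z) = inverse \<bar>W (E (snd z) (fst z)) (snd z)\<bar>" using loc[OF z] by blast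
    note o = smooth_openD(1)[OF V(2)]
    show "normal_mcf (graph_map u) z"
      by (rule normal_mcf_cong[OF o V(1) _ V(4)]) (use V(3) in \<open>simp add: graph_map_def\<close>)
    have "grad u z = grad w z" unfolding grad_def using dd_transform[OF o V(1), of w u] V(3) by simp
    then show "sqrt (vv u z) = inverse \<bar>W (E (snd z) (fst z)) (snd z)\<bar>" using V(5) by (simp add: vv_def)
  qed
  have gr: "\<exists>C. \<forall>y. \<forall>t<\<tau>. sqrt (vv u (y, t)) \<le> C + \<epsilon> * sqrt (norm (y, u (y, t)) + sqrt \<bar>t\<bar>)" if \<epsilon>: "\<epsilon> > 0" for \<epsilon>
  proof -
    obtain C where C: "\<forall>t<\<tau>. \<forall>x\<in>topspace X. inverse \<bar>W x t\<bar> \<le> C + \<epsilon> * sqrt (norm (F x t) + sqrt \<bar>t\<bar>)"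
      using growth[OF \<epsilon>] by blast
    show ?thesis
    proof (intro exI allI impI)
      fix y t assume t: "t < \<tau>"
      have x: "E t y \<in> topspace X" "p t (E t y) = y" using E t by auto
      have "inverse \<bar>W (E t y) t\<bar> \<le> C + \<epsilon> * sqrt (norm (F (E t y) t) + sqrt \<bar>t\<bar>)" using C t x by blast
      then show "sqrt (vv u (y, t)) \<le> C + \<epsilon> * sqrt (norm (y, u (y, t)) + sqrt \<bar>t\<bar>)"
        using vvu[of "(y, t)"] t x(2) by (simp add: norm_F u_def)
    qed
  qed
  obtain a b where ab: "\<forall>y. \<forall>t<\<tau>. u (y, t) = a \<bullet> y + b"
    using flat_graph_affine[OF u mcf graphical_ancient_solution_flat[OF u mcf gr]] by blast
  show ?thesis
  proof (intro exI allI impI ballI)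
    fix t x assume t: "t < \<tau>" and x: "x \<in> topspace X"
    show "h t x = a \<bullet> p t x + b" using ab[rule_format, OF t, of "p t x"] Ep[OF t x] by (simp add: u_def)
  qed
qed

end

section \<open>Continuation in time\<close>

context gauss_flow begin

lemma F_time_continuous: 
  assumes "x \<in> topspace X"
  shows "continuous_on {..0} (F x)"
proof -
  obtain U \<phi> where c: "(U, \<phi>) \<in> A" "x \<in> U" using chart_exists[OF assms] by blast
  show ?thesis
  proof (rule continuous_on_vector_derivative)
    fix t :: real assume "t \<in> {..0}"
    then show "(F x has_vector_derivative mean_curvature_vector (\<lambda>y. F (inv_into U \<phi> y) t) (\<phi> x)) (at t within {..0})"
      using flow c unfolding mean_curvature_flow_def by fastforce
  qed
qed

lemma stationary_closure:
  assumes "\<And>t. t < \<tau> \<Longrightarrow> F x t = z" "x \<in> topspace X" "\<tau> \<le> 0"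
  shows "F x \<tau> = z"
proof (rule continuous_constant_on_closure[of "{..<\<tau>}"])
  show "continuous_on (closure {..<\<tau>}) (F x)"
    using F_time_continuous[OF assms(2)] by (rule continuous_on_subset) (use assms(3) in auto)
qed (use assms in auto)

text \<open>Common core of the start near -infinity and of the continuation past a later time. S t
  is a region where the gradient is controlled and which sections through x0 cannot leave; the
  global inverse then shows that it is the whole manifold.\<close>

lemma extend_stationary:
  assumes growth: "\<And>\<epsilon>. \<epsilon> > 0 \<Longrightarrow> \<exists>K. \<forall>x\<in>topspace X. \<forall>t\<le>0. norm (F x t) + sqrt \<bar>t\<bar> \<ge> K \<longrightarrow>
      inverse \<bar>W x t\<bar> \<le> \<epsilon> * sqrt (norm (F x t) + sqrt \<bar>t\<bar>)"
    and \<tau>: "\<tau> \<le> 0" and V: "V \<ge> 0"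
    and S: "\<And>t. t < \<tau> \<Longrightarrow> closedin X (S t) \<and> x0 \<in> S t"
    and W: "\<And>t x. t < \<tau> \<Longrightarrow> x \<in> S t \<Longrightarrow> W x t \<noteq> 0 \<and> inverse \<bar>W x t\<bar> \<le> V + sqrt (norm (F x t) + sqrt \<bar>t\<bar>)"
    and sections_in_S: "\<And>t r s. t < \<tau> \<Longrightarrow> r > 0 \<Longrightarrow> continuous_map (top_of_set (ball (p t x0) r)) X s \<Longrightarrow>
      (\<forall>y\<in>ball (p t x0) r. p t (s y) = y) \<Longrightarrow> s (p t x0) = x0 \<Longrightarrow> s ` ball (p t x0) r \<subseteq> S t"
  obtains a b where "\<forall>t<\<tau>. \<forall>x\<in>topspace X. h t x = a \<bullet> p t x + b" "\<forall>x\<in>topspace X. \<forall>s<\<tau>. \<forall>t<\<tau>. F x s = F x t"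
    "\<forall>t<\<tau>. \<exists>E. continuous_map euclidean X E \<and> (\<forall>y. p t (E y) = y) \<and> (\<forall>x\<in>topspace X. E (p t x) = x)"
proof -
  have "\<exists>E. continuous_map euclidean X E \<and> (\<forall>y. p t (E y) = y \<and> E y \<in> S t) \<and> (\<forall>x\<in>topspace X. E (p t x) = x)" if t: "t < \<tau>" for t
  proof -
    have t0: "t < 0" using t \<tau> by simp
    have SX: "closedin X (S t)" and x0: "x0 \<in> S t" using S[OF t] by auto
    \<comment> \<open>By sqrt a \<le> 1 + a the bound in \<open>W\<close> becomes the linear growth
      required by \<open>slice_global_inverse\<close>. C may depend on t, as each slice is inverted
      separately.\<close>
    define C where "C = V + 1 + sqrt \<bar>t\<bar>"
    have C: "C \<ge> 0" using V by (simp add: C_def)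
    have Wt: "W x t \<noteq> 0 \<and> inverse \<bar>W x t\<bar> \<le> C * (1 + norm (F x t))" if x: "x \<in> S t" for x
    proof -
      let ?a = "norm (F x t) + sqrt \<bar>t\<bar>"
      have "sqrt ?a \<le> 1 + ?a" using sqrt_le_D by (intro real_le_lsqrt) (auto simp: power2_eq_square algebra_simps)
      then have "V + sqrt ?a \<le> C + norm (F x t)" by (simp add: C_def)
      also have "\<dots> \<le> C * (1 + norm (F x t))"
        using V mult_right_mono[of 1 C "norm (F x t)"] by (simp add: C_def algebra_simps)
      finally show ?thesis using W[OF t x] by linarith
    qed
    obtain E where "continuous_map euclidean X E" "\<And>y. p t (E y) = y" "\<And>y. E y \<in> S t" "\<And>x. x \<in> topspace X \<Longrightarrow> E (p t x) = x"
      by (rule slice_global_inverse[OF t0 SX x0 C Wt sections_in_S[OF t]]) blast+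
    then show ?thesis by blast
  qed
  then obtain E where E: "\<And>t. t < \<tau> \<Longrightarrow> continuous_map euclidean X (E t)" "\<And>t y. t < \<tau> \<Longrightarrow> p t (E t y) = y \<and> E t y \<in> S t"
    "\<And>t x. t < \<tau> \<Longrightarrow> x \<in> topspace X \<Longrightarrow> E t (p t x) = x" by metis
  have SX: "x \<in> topspace X \<Longrightarrow> x \<in> S t" if "t < \<tau>" for t x using E(2,3)[OF that] by metis
  have EX: "E t y \<in> topspace X \<and> p t (E t y) = y" if "t < \<tau>" for t y using E(2)[OF that] S[OF that] closedin_subset by blast
  have gr: "\<exists>C. \<forall>t<\<tau>. \<forall>x\<in>topspace X. inverse \<bar>W x t\<bar> \<le> C + \<epsilon> * sqrt (norm (F x t) + sqrt \<bar>t\<bar>)" if \<epsilon>: "\<epsilon> > 0" for \<epsilon>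
  proof -
    obtain K where K: "\<forall>x\<in>topspace X. \<forall>t\<le>0. norm (F x t) + sqrt \<bar>t\<bar> \<ge> K \<longrightarrow>
      inverse \<bar>W x t\<bar> \<le> \<epsilon> * sqrt (norm (F x t) + sqrt \<bar>t\<bar>)" using growth[OF \<epsilon>] by blast
    show ?thesis
    proof (intro exI allI impI ballI)
      fix t x assume t: "t < \<tau>" and x: "x \<in> topspace X"
      let ?a = "norm (F x t) + sqrt \<bar>t\<bar>"
      have a: "?a \<ge> 0" by simp
      \<comment> \<open>Where |F| + sqrt|t| is below K the growth hypothesis is silent, but there
        the bound in \<open>W\<close> is at most V + sqrt|K|.\<close>
      show "inverse \<bar>W x t\<bar> \<le> (V + sqrt \<bar>K\<bar>) + \<epsilon> * sqrt ?a"
      proof (cases "?a \<ge> K")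
        case True
        then have "inverse \<bar>W x t\<bar> \<le> \<epsilon> * sqrt ?a" using K x t \<tau> by auto
        moreover have "0 \<le> V + sqrt \<bar>K\<bar>" using V by simp
        ultimately show ?thesis by linarith
      next
        case False
        then have "sqrt ?a \<le> sqrt \<bar>K\<bar>" by simp
        moreover have "0 \<le> \<epsilon> * sqrt ?a" using \<epsilon> a by simp
        ultimately show ?thesis using W[OF t SX[OF t x]] by linarith
      qed
    qed
  qed
  have W0: "W x t \<noteq> 0" if "t < \<tau>" "x \<in> topspace X" for t x using W[OF that(1) SX[OF that]] by simp
  have "\<exists>a b. \<forall>t<\<tau>. \<forall>x\<in>topspace X. h t x = a \<bullet> p t x + b"
    by (rule entire_flow_stationary[OF \<tau> EX E(3) W0 gr])
  then obtain a b where ab: "\<forall>t<\<tau>. \<forall>x\<in>topspace X. h t x = a \<bullet> p t x + b" by blast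
  show ?thesis
  proof (rule that[OF ab])
    show "\<forall>x\<in>topspace X. \<forall>s<\<tau>. \<forall>t<\<tau>. F x s = F x t" using planar_stationary[OF _ \<tau>] ab by blast
    show "\<forall>t<\<tau>. \<exists>E. continuous_map euclidean X E \<and> (\<forall>y. p t (E y) = y) \<and> (\<forall>x\<in>topspace X. E (p t x) = x)"
      using E by blast
  qed
qed

text \<open>Both estimates are open conditions in spacetime: in a local graph 1/W^2 is the
  continuous function \<open>vv w\<close>, and the projection is continuous. The strict bound at
  time T leaves the necessary room.\<close>

lemma perturbation:
  assumes T: "T < 0" and x: "x \<in> topspace X" and W: "W x T \<noteq> 0" and V: "inverse \<bar>W x T\<bar> < V"
  shows "\<exists>N \<delta>. openin X N \<and> x \<in> N \<and> \<delta> > 0 \<and> (\<forall>x'\<in>N. \<forall>t. \<bar>t - T\<bar> < \<delta> \<longrightarrow>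
    t < 0 \<and> dist (p t x') (p T x') < 1 / 2 \<and> W x' t \<noteq> 0 \<and> inverse \<bar>W x' t\<bar> \<le> V)"
proof -
  obtain U \<phi> where c: "(U, \<phi>) \<in> A" "x \<in> U" using chart_exists[OF x] by blast
  obtain U' Z \<Phi> w where U': "open U'" "(\<phi> x, T) \<in> U'" and w: "smooth_open Z w"
    and at: "\<forall>x'\<in>U. \<forall>t'. (\<phi> x', t') \<in> U' \<longrightarrow> t' < 0 \<and> (p t' x', t') \<in> Z \<and> \<Phi> (p t' x', t') = \<phi> x' \<and>
      h t' x' = w (p t' x', t') \<and> (W x' t')\<^sup>2 * vv w (p t' x', t') = 1"
    by (rule slice_graph[OF c T W]) blast
  define U1 where "U1 = U' \<inter> cdom U \<phi>"
  have U1: "open U1" "(\<phi> x, T) \<in> U1"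
    unfolding U1_def using U' smooth_openD(1)[OF g_smooth[OF c(1)]] cdom_I[OF c T] by auto
  let ?P = "\<lambda>z. fst (g U \<phi> z)"
  have Pc: "continuous_on U1 ?P"
    by (rule continuous_on_fst, rule continuous_on_subset[OF smooth_openD(4)[OF g_smooth[OF c(1)]]]) (auto simp: U1_def)
  have gP: "?P (\<phi> x', t) = p t x'" if "x' \<in> U" for x' t using g_at[OF c(1) that] by simp
  have form: "\<exists>x'\<in>U. z = (\<phi> x', snd z)" if "z \<in> U1" for z using that by (cases z) (auto simp: U1_def cdom_def)
  have vvc: "continuous_on Z (vv w)" unfolding vv_def grad_def
    by (intro continuous_intros smooth_openD(4)[OF smooth_openD(3)[OF w]])
  have PZ: "(\<lambda>z. (?P z, snd z)) ` U1 \<subseteq> Z"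
  proof safe
    fix y t assume "(y, t) \<in> U1"
    moreover then obtain x' where "x' \<in> U" "(y, t) = (\<phi> x', t)" using form by fastforce
    ultimately show "(fst (g U \<phi> (y, t)), snd (y, t)) \<in> Z" using at gP by (auto simp: U1_def)
  qed
  have "continuous_on U1 (\<lambda>z. vv w (?P z, snd z))"
    by (rule continuous_on_compose2[OF vvc _ PZ]) (intro continuous_intros Pc)
  then have o1: "open (U1 \<inter> (\<lambda>z. vv w (?P z, snd z)) -` {..<V\<^sup>2})"
    using continuous_open_preimage[OF _ U1(1) open_lessThan] by blast
  \<comment> \<open>Both \<open>p t x'\<close> and \<open>p T x'\<close> stay within 1/4 of
    \<open>p T x\<close>, hence within 1/2 of each other.\<close>
  have o2: "open (U1 \<inter> ?P -` ball (p T x) (1 / 4))" by (rule continuous_open_preimage[OF Pc U1(1) open_ball])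
  let ?O = "(U1 \<inter> (\<lambda>z. vv w (?P z, snd z)) -` {..<V\<^sup>2}) \<inter> (U1 \<inter> ?P -` ball (p T x) (1 / 4))"
  have V0: "V > 0" using V by (meson abs_ge_zero inverse_nonnegative_iff_nonnegative le_less_trans)
  have "(\<phi> x, T) \<in> ?O"
  proof -
    have "vv w (p T x, T) = (inverse \<bar>W x T\<bar>)\<^sup>2" using at[rule_format, OF c(2) U'(2)] W by (auto simp: field_simps)
    also have "\<dots> < V\<^sup>2" using V by (intro power_strict_mono) auto
    finally show ?thesis using U1 gP[OF c(2)] by simp
  qed
  then obtain B T' where BT: "open B" "open T'" "(\<phi> x, T) \<in> B \<times> T'" "B \<times> T' \<subseteq> ?O"
    by (rule open_prod_elim[OF open_Int[OF o1 o2]])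
  obtain \<delta> where \<delta>: "\<delta> > 0" "ball T \<delta> \<subseteq> T'" using BT(2,3) open_contains_ball by blast
  show ?thesis
  proof (intro exI[of _ "{x' \<in> U. \<phi> x' \<in> B}"] exI[of _ \<delta>] conjI ballI allI impI)
    show "openin X {x' \<in> U. \<phi> x' \<in> B}" by (rule chart_preimage_open[OF c(1) BT(1)])
    show "x \<in> {x' \<in> U. \<phi> x' \<in> B}" using c BT by simp
    show "\<delta> > 0" by (rule \<delta>(1))
    fix x' t assume x': "x' \<in> {x' \<in> U. \<phi> x' \<in> B}" and t: "\<bar>t - T\<bar> < \<delta>"
    have tT: "t \<in> T'" using t \<delta>(2) by (auto simp: dist_real_def abs_minus_commute)
    have 1: "(\<phi> x', t) \<in> ?O" "(\<phi> x', T) \<in> ?O" using x' tT BT by blast+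
    have xU: "x' \<in> U" using x' by simp
    have "(\<phi> x', t) \<in> U'" using 1 by (simp add: U1_def)
    note a = at[rule_format, OF xU this]
    show "t < 0" using a by simp
    have "dist (p T x) (p t x') < 1 / 4" "dist (p T x) (p T x') < 1 / 4" using 1 gP[OF xU] by auto
    then show "dist (p t x') (p T x') < 1 / 2" using dist_triangle[of "p t x'" "p T x'" "p T x"] by (simp add: dist_commute)
    show W0: "W x' t \<noteq> 0" using a by auto
    have "vv w (p t x', t) < V\<^sup>2" using 1 gP[OF xU] by simp
    moreover have "vv w (p t x', t) = (inverse \<bar>W x' t\<bar>)\<^sup>2" using a W0 by (auto simp: field_simps)
    ultimately show "inverse \<bar>W x' t\<bar> \<le> V" using V0 power2_le_imp_le[of "inverse \<bar>W x' t\<bar>" V] by linarith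
  qed
qed

lemma perturbation_compact:
  assumes T: "T < 0" and C: "compactin X C" and W: "\<And>x. x \<in> C \<Longrightarrow> W x T \<noteq> 0 \<and> inverse \<bar>W x T\<bar> < V"
  obtains \<delta> where "\<delta> > 0" "\<forall>x\<in>C. \<forall>t. \<bar>t - T\<bar> < \<delta> \<longrightarrow>
    t < 0 \<and> dist (p t x) (p T x) < 1 / 2 \<and> W x t \<noteq> 0 \<and> inverse \<bar>W x t\<bar> \<le> V"
proof -
  let ?R = "\<lambda>\<delta> x. \<forall>t. \<bar>t - T\<bar> < \<delta> \<longrightarrow> t < 0 \<and> dist (p t x) (p T x) < 1 / 2 \<and> W x t \<noteq> 0 \<and> inverse \<bar>W x t\<bar> \<le> V"
  have CX: "C \<subseteq> topspace X" using C by (simp add: compactin_def)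
  have "\<exists>N \<delta>. openin X N \<and> x \<in> N \<and> \<delta> > 0 \<and> (\<forall>x'\<in>N. ?R \<delta> x')" if "x \<in> C" for x
    using perturbation[OF T] W[OF that] CX that by blast
  then obtain N \<delta> where N: "\<And>x. x \<in> C \<Longrightarrow> openin X (N x) \<and> x \<in> N x \<and> \<delta> x > 0 \<and> (\<forall>x'\<in>N x. ?R (\<delta> x) x')" by metis
  have "\<exists>\<F>. finite \<F> \<and> \<F> \<subseteq> N ` C \<and> C \<subseteq> \<Union>\<F>"
    by (rule compactinD[OF C]) (use N in auto)
  then obtain C' where C': "finite C'" "C' \<subseteq> C" "C \<subseteq> \<Union>(N ` C')" by (metis finite_subset_image)
  \<comment> \<open>The minimum over a finite subcover; the inserted 1 keeps the set nonempty when C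
    is empty.\<close>
  define d where "d = Min (insert 1 (\<delta> ` C'))"
  show ?thesis
  proof (rule that[of d])
    show "d > 0" using C' N by (auto simp: d_def)
    show "\<forall>x\<in>C. ?R d x"
    proof
      fix x assume "x \<in> C"
      then obtain x' where x': "x' \<in> C'" "x \<in> N x'" using C'(3) by blast
      have "d \<le> \<delta> x'" using C'(1) x'(1) by (simp add: d_def)
      moreover have "?R (\<delta> x') x" using N[of x'] x' C'(2) by blast
      ultimately show "?R d x" by (meson order_less_le_trans)
    qed
  qed
qed

text \<open>\<open>K1\<close> is the threshold of the growth hypothesis for \<epsilon> = 1, raised
  to at least 1.\<close>

context
  fixes K1 :: real
  assumes growth: "\<And>\<epsilon>. \<epsilon> > 0 \<Longrightarrow> \<exists>K. \<forall>x\<in>topspace X. \<forall>t\<le>0. norm (F x t) + sqrt \<bar>t\<bar> \<ge> K \<longrightarrow>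
      inverse \<bar>W x t\<bar> \<le> \<epsilon> * sqrt (norm (F x t) + sqrt \<bar>t\<bar>)"
    and K1: "K1 \<ge> 1" "\<forall>x\<in>topspace X. \<forall>t\<le>0. norm (F x t) + sqrt \<bar>t\<bar> \<ge> K1 \<longrightarrow>
      W x t \<noteq> 0 \<and> inverse \<bar>W x t\<bar> \<le> sqrt (norm (F x t) + sqrt \<bar>t\<bar>)"
begin

text \<open>For t < -K1^2 already sqrt|t| exceeds K1, so the gradient bound holds on the whole slice
  and the region S t can be the whole manifold.\<close>

lemma initially_stationary:
  obtains a b where "\<forall>t < - K1\<^sup>2. \<forall>x\<in>topspace X. h t x = a \<bullet> p t x + b" "\<forall>x\<in>topspace X. \<forall>s < - K1\<^sup>2. \<forall>t < - K1\<^sup>2. F x s = F x t"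
    "\<forall>t < - K1\<^sup>2. \<exists>E. continuous_map euclidean X E \<and> (\<forall>y. p t (E y) = y) \<and> (\<forall>x\<in>topspace X. E (p t x) = x)"
proof -
  obtain x0 where x0: "x0 \<in> topspace X" using nonempty by blast
  have W0: "W x t \<noteq> 0 \<and> inverse \<bar>W x t\<bar> \<le> 0 + sqrt (norm (F x t) + sqrt \<bar>t\<bar>)" if t: "t < - K1\<^sup>2" and x: "x \<in> topspace X" for t x
  proof -
    have "K1 \<le> sqrt \<bar>t\<bar>" using t K1(1) by (intro real_le_rsqrt) auto
    moreover have "t \<le> 0" using t zero_le_power2[of K1] by linarith
    ultimately show ?thesis using K1(2) x by (simp add: add_increasing)
  qed
  have S: "closedin X (topspace X) \<and> x0 \<in> topspace X" using x0 by simp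
  have sec: "s ` ball (p t x0) r \<subseteq> topspace X" if "continuous_map (top_of_set (ball (p t x0) r)) X s" for s t r
    using continuous_map_image_subset_topspace[OF that] by simp
  have K0: "- K1\<^sup>2 \<le> 0" by simp
  show ?thesis
    by (rule extend_stationary[OF growth K0 order_refl S W0 sec]) (assumption | rule that)+
qed

text \<open>Shortly after time \<open>T\<close>, a section over a segment in the ball of radius \<open>K1 + 1\<close> can only leave
  \<open>S t\<close> by passing through a point \<open>x\<close> with \<open>norm (p T x) = R\<close>.  This is impossible, since \<open>x\<close>
  is in the compact set \<open>C\<close>, where \<open>p t\<close> is close to \<open>p T\<close>.\<close>

lemma continue_stationary:
  assumes T: "T < 0" and planar: "\<And>t x. t \<le> T \<Longrightarrow> x \<in> topspace X \<Longrightarrow> h t x = a \<bullet> p t x + b"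
    and E: "continuous_map euclidean X E" "\<And>y. p T (E y) = y" "\<And>x. x \<in> topspace X \<Longrightarrow> E (p T x) = x"
  obtains \<delta> where "\<delta> > 0" "T + \<delta> \<le> 0" "\<forall>x\<in>topspace X. \<forall>s<T + \<delta>. \<forall>t<T + \<delta>. F x s = F x t"
proof -
  \<comment> \<open>On the hyperplane 1/|W| equals \<open>sqrt (1 + a \<bullet> a)\<close>
    everywhere; the added 1 gives the strict inequality that \<open>perturbation_compact\<close>
    asks for.\<close>
  define V where "V = sqrt (1 + a \<bullet> a) + 1"
  have Wp: "W x t \<noteq> 0 \<and> inverse \<bar>W x t\<bar> < V" if "t \<le> T" "x \<in> topspace X" for t x
  proof -
    have "t < 0" using that T by simp
    then have eq: "(W x t)\<^sup>2 * (1 + a \<bullet> a) = 1" using planar_W[of t a b x] planar that by blast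
    then have W0: "W x t \<noteq> 0" by auto
    have "1 + a \<bullet> a = (inverse \<bar>W x t\<bar>)\<^sup>2" using eq W0 by (auto simp: field_simps)
    then have "sqrt (1 + a \<bullet> a) = inverse \<bar>W x t\<bar>" by simp
    then show ?thesis using W0 by (simp add: V_def)
  qed
  have V: "V \<ge> 0" by (simp add: V_def)
  \<comment> \<open>If \<open>norm (p T x) = R\<close> and \<open>p t x\<close> is within 1/2 of
    \<open>p T x\<close>, then \<open>norm (p t x)\<close> exceeds K1 + 1.\<close>
  define R where "R = K1 + 2"
  have EX: "E y \<in> topspace X" for y using continuous_map_funspace[OF E(1)] by auto
  define C where "C = {x \<in> topspace X. norm (p T x) \<le> R}"
  have "C = E ` cball 0 R"
  proof
    show "C \<subseteq> E ` cball 0 R" using E(3) unfolding C_def by (force simp: image_iff)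
    show "E ` cball 0 R \<subseteq> C" using EX E(2) by (auto simp: C_def)
  qed
  then have C: "compactin X C" using image_compactin[OF _ E(1), of "cball 0 R"] by simp
  obtain \<delta>0 where \<delta>0: "\<delta>0 > 0" "\<forall>x\<in>C. \<forall>t. \<bar>t - T\<bar> < \<delta>0 \<longrightarrow>
    t < 0 \<and> dist (p t x) (p T x) < 1 / 2 \<and> W x t \<noteq> 0 \<and> inverse \<bar>W x t\<bar> \<le> V"
    by (rule perturbation_compact[OF T C, of V]) (use Wp in \<open>auto simp: C_def\<close>)
  define \<delta> where "\<delta> = min \<delta>0 (- T)"
  have \<delta>: "\<delta> > 0" "T + \<delta> \<le> 0" "\<delta> \<le> \<delta>0" using \<delta>0(1) T by (auto simp: \<delta>_def)
  \<comment> \<open>Before T the whole slice is controlled. From T on, C is controlled by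
    perturbation and the points projecting outside radius K1 by the growth hypothesis; points
    outside C that project into the ball of radius K1 at time t are the ones that sections have to
    avoid.\<close>
  define S where "S t = (if t < T then topspace X else C \<union> {x \<in> topspace X. p t x \<in> {y. K1 \<le> norm y}})" for t
  have x0: "E 0 \<in> C" using EX E(2) K1(1) by (simp add: C_def R_def)
  have SX: "S t \<subseteq> topspace X" for t by (auto simp: S_def C_def)
  have near: "t < 0 \<and> dist (p t x) (p T x) < 1 / 2 \<and> W x t \<noteq> 0 \<and> inverse \<bar>W x t\<bar> \<le> V"
    if "x \<in> C" "\<not> t < T" "t < T + \<delta>" for x t
  proof -
    have "\<bar>t - T\<bar> < \<delta>0" using that \<delta>(3) by auto
    then show ?thesis using \<delta>0(2) that(1) by blast
  qed
  have S: "closedin X (S t) \<and> E 0 \<in> S t" if t: "t < T + \<delta>" for t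
  proof -
    have "closedin X {x \<in> topspace X. p t x \<in> {y. K1 \<le> norm y}}"
    proof (rule closedin_continuous_map_preimage[OF p_continuous])
      show "t < 0" using t \<delta>(2) by simp
      show "closedin euclidean {y :: real^'n. K1 \<le> norm y}"
        unfolding closed_closedin[symmetric] by (intro closed_Collect_le continuous_intros)
    qed
    moreover have "closedin X C" by (rule compactin_imp_closedin[OF hausdorff C])
    ultimately show ?thesis using EX x0 by (auto simp: S_def)
  qed
  have W: "W x t \<noteq> 0 \<and> inverse \<bar>W x t\<bar> \<le> V + sqrt (norm (F x t) + sqrt \<bar>t\<bar>)" if t: "t < T + \<delta>" and x: "x \<in> S t" for t x
  proof -
    have xX: "x \<in> topspace X" using x SX by auto
    have s0: "0 \<le> sqrt (norm (F x t) + sqrt \<bar>t\<bar>)" by simp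
    consider "t < T" | "\<not> t < T" "x \<in> C" | "\<not> t < T" "K1 \<le> norm (p t x)" using x by (auto simp: S_def split: if_splits)
    then show ?thesis
    proof cases
      case 1
      then show ?thesis using Wp[of t x] xX s0 by (meson add_increasing2 less_imp_le order_trans)
    next
      case 2
      then show ?thesis using near[OF 2(2,1) t] s0 by linarith
    next
      case 3
      have "norm (p t x) \<le> norm (F x t)" unfolding norm_F using norm_fst_le[of "p t x" "h t x"] by simp
      then have "K1 \<le> norm (F x t) + sqrt \<bar>t\<bar>" using 3(2) by (simp add: add_increasing2)
      moreover have "t \<le> 0" using t \<delta>(2) by simp
      ultimately show ?thesis using K1(2) xX V by (meson add_increasing order_trans order_refl)
    qed
  qed
  have sec: "s ` ball (p t (E 0)) r \<subseteq> S t"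
    if t: "t < T + \<delta>" and r: "r > 0" and s: "continuous_map (top_of_set (ball (p t (E 0)) r)) X s"
      and ps: "\<forall>y\<in>ball (p t (E 0)) r. p t (s y) = y" and s0: "s (p t (E 0)) = E 0" for t r s
  proof
    fix x assume "x \<in> s ` ball (p t (E 0)) r"
    then obtain y where y: "y \<in> ball (p t (E 0)) r" "x = s y" by blast
    have im: "s ` ball (p t (E 0)) r \<subseteq> topspace X" using continuous_map_image_subset_topspace[OF s] by simp
    show "x \<in> S t"
    proof (rule ccontr)
      assume xS: "x \<notin> S t"
      have xX: "x \<in> topspace X" using im y by blast
      have tT: "\<not> t < T" and xC: "x \<notin> C" and small: "norm y < K1"
        using xS xX y ps by (auto simp: S_def split: if_splits)
      let ?y0 = "p t (E 0)"
      let ?l = "\<lambda>\<theta>::real. ?y0 + \<theta> *\<^sub>R (y - ?y0)"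
      have lB: "?l \<theta> \<in> ball ?y0 r" if "\<theta> \<in> {0..1}" for \<theta>
        by (rule convex_segment_mem[OF convex_ball]) (use y(1) r that in auto)
      have "continuous_map (top_of_set {0..1}) (top_of_set (ball ?y0 r)) ?l"
        using lB by (auto simp: continuous_map_in_subtopology simp del: mem_ball intro!: continuous_intros)
      from continuous_map_compose[OF continuous_map_compose[OF this s] p_continuous[OF T]]
      have "continuous_on {0..1} (\<lambda>\<theta>. p T (s (?l \<theta>)))" by (simp add: o_def)
      then have cont: "continuous_on {0..1} (\<lambda>\<theta>. norm (p T (s (?l \<theta>))))" by (rule continuous_on_norm)
      have "\<exists>\<theta>\<ge>0. \<theta> \<le> 1 \<and> norm (p T (s (?l \<theta>))) = R"
      proof (rule IVT'[OF _ _ _ cont])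
        show "norm (p T (s (?l 0))) \<le> R" using s0 E(2) K1(1) by (simp add: R_def)
        show "R \<le> norm (p T (s (?l 1)))" using xC xX y(2) by (simp add: C_def)
      qed simp
      then obtain \<theta> where \<theta>: "\<theta> \<in> {0..1}" "norm (p T (s (?l \<theta>))) = R" by auto
      have "s (?l \<theta>) \<in> topspace X" using im lB[OF \<theta>(1)] by blast
      then have "s (?l \<theta>) \<in> C" using \<theta>(2) by (simp add: C_def)
      then have "dist (p t (s (?l \<theta>))) (p T (s (?l \<theta>))) < 1 / 2" using near[OF _ tT t] by blast
      then have d1: "dist (?l \<theta>) (p T (s (?l \<theta>))) < 1 / 2" using ps lB[OF \<theta>(1)] by auto
      have "R \<le> norm (?l \<theta>) + dist (?l \<theta>) (p T (s (?l \<theta>)))"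
        using \<theta>(2) norm_triangle_ineq2[of "p T (s (?l \<theta>))" "?l \<theta>"] by (simp add: dist_norm norm_minus_commute)
      then have big: "K1 + 1 < norm (?l \<theta>)" using d1 by (simp add: R_def)
      \<comment> \<open>The base point \<open>E 0\<close> projects to the origin at time T, so at
        time t both ends of the segment lie in the ball of radius K1 + 1.\<close>
      have "norm ?y0 < 1 / 2" using near[OF x0 tT t] E(2)[of 0] by simp
      then have "?l \<theta> \<in> ball 0 (K1 + 1)"
        by (intro convex_segment_mem[OF convex_ball]) (use small \<theta>(1) K1(1) in auto)
      then show False using big by simp
    qed
  qed
  obtain a' b' where "\<forall>x\<in>topspace X. \<forall>s<T + \<delta>. \<forall>t<T + \<delta>. F x s = F x t"
    by (rule extend_stationary[OF growth \<delta>(2) V S W sec]) blast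
  then show ?thesis using that \<delta> by blast
qed

text \<open>T is the supremum of the times before which all points rest. Continuity extends the rest
  to T itself, and for negative T \<open>continue_stationary\<close> would go beyond the supremum.
  (- a, 1) is a normal of the graph of the affine function with slope a.\<close>

theorem slices_are_hyperplanes:
  obtains a b where "\<forall>t\<le>0. (\<lambda>x. F x t) ` topspace X = {z. J (- a, 1) \<bullet> z = b}"
proof -
  obtain a b where ab: "\<forall>t < - K1\<^sup>2. \<forall>x\<in>topspace X. h t x = a \<bullet> p t x + b"
    and st: "\<forall>x\<in>topspace X. \<forall>s < - K1\<^sup>2. \<forall>t < - K1\<^sup>2. F x s = F x t"
    and ex: "\<forall>t < - K1\<^sup>2. \<exists>E. continuous_map euclidean X E \<and> (\<forall>y. p t (E y) = y) \<and> (\<forall>x\<in>topspace X. E (p t x) = x)"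
    by (rule initially_stationary) blast
  \<comment> \<open>A reference time in the initial stationary range, with which all later positions
    are compared.\<close>
  define s0 where "s0 = - K1\<^sup>2 - 1"
  have s0: "s0 < - K1\<^sup>2" by (simp add: s0_def)
  obtain E where E: "continuous_map euclidean X E" "\<And>y. p s0 (E y) = y" "\<And>x. x \<in> topspace X \<Longrightarrow> E (p s0 x) = x"
    using ex s0 by blast
  define good where "good \<tau> \<longleftrightarrow> \<tau> \<le> 0 \<and> (\<forall>x\<in>topspace X. \<forall>t<\<tau>. F x t = F x s0)" for \<tau>
  have K0: "- K1\<^sup>2 \<le> 0" by simp
  have g1: "good (- K1\<^sup>2)" unfolding good_def using st s0 K0 by blast
  define T where "T = Sup {\<tau>. good \<tau>}"
  have bdd: "bdd_above {\<tau>. good \<tau>}" by (rule bdd_aboveI[of _ 0]) (auto simp: good_def)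
  have T0: "T \<le> 0" unfolding T_def by (rule cSup_least) (use g1 in blast, simp add: good_def)
  have TK: "- K1\<^sup>2 \<le> T" unfolding T_def by (rule cSup_upper[OF _ bdd]) (use g1 in simp)
  have "F x t = F x s0" if x: "x \<in> topspace X" and t: "t < T" for x t
  proof -
    have "{\<tau>. good \<tau>} \<noteq> {}" using g1 by blast
    then obtain \<tau> where "good \<tau>" "t < \<tau>" using t less_cSup_iff[OF _ bdd] unfolding T_def by blast
    then show ?thesis using x by (simp add: good_def)
  qed
  then have cl: "F x t = F x s0" if "x \<in> topspace X" "t \<le> T" for x t
    using that stationary_closure[OF _ that(1) T0] by (cases "t = T") auto
  have ph: "p t x = p s0 x" "h t x = h s0 x" if "x \<in> topspace X" "t \<le> T" for x t
    using cl[OF that] by (simp_all add: p_def h_def)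
  have "T = 0"
  proof (rule ccontr)
    assume "T \<noteq> 0"
    then have Tn: "T < 0" using T0 by simp
    have EX: "E y \<in> topspace X" for y using continuous_map_funspace[OF E(1)] by auto
    have planar: "h t x = a \<bullet> p t x + b" if "t \<le> T" "x \<in> topspace X" for t x using ph[OF that(2,1)] ab s0 that(2) by simp
    have ET: "p T (E y) = y" for y using ph(1)[OF EX] E(2) by simp
    have TE: "E (p T x) = x" if "x \<in> topspace X" for x using ph(1)[OF that] E(3)[OF that] by simp
    obtain \<delta> where \<delta>: "\<delta> > 0" "T + \<delta> \<le> 0" "\<forall>x\<in>topspace X. \<forall>s<T + \<delta>. \<forall>t<T + \<delta>. F x s = F x t"
      by (rule continue_stationary[OF Tn planar E(1) ET TE])
    have "s0 < T + \<delta>" using s0 TK \<delta>(1) by linarith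
    then have "good (T + \<delta>)" unfolding good_def using \<delta>(2,3) by blast
    then have "T + \<delta> \<le> T" unfolding T_def by (intro cSup_upper[OF _ bdd]) simp
    then show False using \<delta>(1) by simp
  qed
  have "(\<lambda>x. F x t) ` topspace X = {z. J (- a, 1) \<bullet> z = b}" if t: "t \<le> 0" for t
  proof
    have JF: "J (- a, 1) \<bullet> F x t = h s0 x - a \<bullet> p s0 x" if "x \<in> topspace X" for x
      using ph[OF that, of t] t \<open>T = 0\<close> by (simp add: F_J J_inner inner_prod_def)
    then show "(\<lambda>x. F x t) ` topspace X \<subseteq> {z. J (- a, 1) \<bullet> z = b}" using ab s0 by auto
    show "{z. J (- a, 1) \<bullet> z = b} \<subseteq> (\<lambda>x. F x t) ` topspace X"
    proof
      fix z assume "z \<in> {z. J (- a, 1) \<bullet> z = b}"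
      then have "J (- a, 1) \<bullet> J (Ji z) = b" by (simp add: J_Ji)
      then have z: "snd (Ji z) = a \<bullet> fst (Ji z) + b" by (simp add: J_inner inner_prod_def)
      let ?x = "E (fst (Ji z))"
      have x: "?x \<in> topspace X" using continuous_map_funspace[OF E(1)] by auto
      have "F ?x t = J (p s0 ?x, h s0 ?x)" using cl[OF x, of t] t \<open>T = 0\<close> F_J by metis
      also have "(p s0 ?x, h s0 ?x) = Ji z" using ab s0 x E(2) z by (simp add: prod_eq_iff)
      finally show "z \<in> (\<lambda>x. F x t) ` topspace X" using x by (intro image_eqI[of _ _ ?x]) (simp_all add: J_Ji)
    qed
  qed
  then show ?thesis using that by blast
qed

end

end

text \<open>pi/2 minus the angle is the arcsin of the cosine, whose absolute value
  \<open>abs_arcsin_le\<close> bounds by twice that of the cosine. This converts the hypothesis on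
  angles into one on W.\<close>

lemma sphere_dist_gauss_estimate:
  fixes p q :: "'a::euclidean_space"
  assumes dim: "2 \<le> DIM('a)" and p: "p \<in> sphere 0 1" and q: "q \<in> sphere 0 1" and ne: "sphere_dist p q \<noteq> pi / 2"
  shows "p \<bullet> q \<noteq> 0" "inverse \<bar>p \<bullet> q\<bar> \<le> 2 * inverse \<bar>pi / 2 - sphere_dist p q\<bar>"
proof -
  have b: "\<bar>p \<bullet> q\<bar> \<le> 1" using Cauchy_Schwarz_ineq2[of p q] p q by simp
  have eq: "pi / 2 - sphere_dist p q = arcsin (p \<bullet> q)"
    using b sphere_dist_eq_arccos[OF dim p q] by (simp add: arcsin_arccos_eq abs_le_iff)
  then have "arcsin (p \<bullet> q) \<noteq> 0" using ne by simp
  then show nz: "p \<bullet> q \<noteq> 0" by auto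
  have "inverse (2 * \<bar>p \<bullet> q\<bar>) \<le> inverse \<bar>arcsin (p \<bullet> q)\<bar>"
    by (rule le_imp_inverse_le[OF abs_arcsin_le[OF b]]) (use \<open>arcsin (p \<bullet> q) \<noteq> 0\<close> in simp)
  then show "inverse \<bar>p \<bullet> q\<bar> \<le> 2 * inverse \<bar>pi / 2 - sphere_dist p q\<bar>" unfolding eq by simp
qed

theorem theorem2:
  fixes X :: "'m topology"
    and A :: "('m, 'n::finite) chart set"
    and F :: "'m \<Rightarrow> real \<Rightarrow> real^('n option)"
    and \<gamma> :: "'m \<Rightarrow> real \<Rightarrow> real^('n option)"
    and p0 :: "real^('n option)"
    and t0 :: real
  assumes "connected_oriented_manifold X A"
    and "complete_ancient_mcf X A F"
    and "is_gauss_map A {..0} F \<gamma>"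
    and "p0 \<in> sphere 0 1"
    and "t0 \<le> 0"
    and "\<forall>x\<in>topspace X. \<forall>t\<le>t0. sphere_dist p0 (\<gamma> x t) < pi / 2"
    and "\<forall>\<epsilon>>0. \<exists>K>0. \<forall>x\<in>topspace X. \<forall>t\<le>0. norm (F x t) + sqrt \<bar>t\<bar> \<ge> K \<longrightarrow>
           sphere_dist p0 (\<gamma> x t) \<noteq> pi / 2 \<and>
           inverse \<bar>pi / 2 - sphere_dist p0 (\<gamma> x t)\<bar> \<le> \<epsilon> * sqrt (norm (F x t) + sqrt \<bar>t\<bar>)"
  shows "\<forall>t\<le>0. \<exists>a b. a \<noteq> 0 \<and> (\<lambda>x. F x t) ` topspace X = {z. a \<bullet> z = b}"
proof -
  have "norm p0 = 1" using assms(4) by simp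
  then obtain J :: "(real^'n) \<times> real \<Rightarrow> real^('n option)" and Ji where iso: "bounded_linear J" "bounded_linear Ji"
    "\<And>x y. J x \<bullet> J y = x \<bullet> y" "\<And>x y. Ji x \<bullet> Ji y = x \<bullet> y" "\<And>x. Ji (J x) = x" "\<And>x. J (Ji x) = x" "J (0, 1) = p0"
    by (rule graph_coordinates_exist) blast
  have flow: "mean_curvature_flow A {..0} F" and complete: "\<And>t. t \<le> 0 \<Longrightarrow> complete_immersion X A (\<lambda>x. F x t)"
    using assms(2) by (auto simp: complete_ancient_mcf_def)
  interpret gauss_flow X A F \<gamma> p0 J Ji
    by (intro gauss_flow.intro manifold.intro gauss_flow_axioms.intro) (fact assms(1,3) flow complete iso)+
  \<comment> \<open>The type of indices is nonempty, so the ambient dimension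
    \<open>CARD('n) + 1\<close> is at least 2.\<close>
  have dim: "2 \<le> DIM(real^('n option))"
  proof -
    have "0 < CARD('n)" by simp
    then show ?thesis by (simp add: card_UNIV_option)
  qed
  have \<gamma>: "\<gamma> x t \<in> sphere 0 1" if x: "x \<in> topspace X" and t: "t \<le> 0" for x t
  proof -
    obtain U \<phi> where "(U, \<phi>) \<in> A" "x \<in> U" using chart_exists[OF x] by blast
    then have "is_unit_normal (\<lambda>y. F (inv_into U \<phi> y) t) (\<phi> x) (\<gamma> x t)"
      using gauss t unfolding is_gauss_map_def by fastforce
    then show ?thesis by (simp add: is_unit_normal_def)
  qed
  have growth: "\<exists>K>0. \<forall>x\<in>topspace X. \<forall>t\<le>0. norm (F x t) + sqrt \<bar>t\<bar> \<ge> K \<longrightarrow>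
      W x t \<noteq> 0 \<and> inverse \<bar>W x t\<bar> \<le> \<epsilon> * sqrt (norm (F x t) + sqrt \<bar>t\<bar>)" if \<epsilon>: "\<epsilon> > 0" for \<epsilon>
  proof -
    \<comment> \<open>Half of \<epsilon> makes up for the factor 2 in
      \<open>sphere_dist_gauss_estimate\<close>.\<close>
    have "\<epsilon> / 2 > 0" using \<epsilon> by simp
    then obtain K where K: "K > 0" "\<forall>x\<in>topspace X. \<forall>t\<le>0. norm (F x t) + sqrt \<bar>t\<bar> \<ge> K \<longrightarrow>
       sphere_dist p0 (\<gamma> x t) \<noteq> pi / 2 \<and>
       inverse \<bar>pi / 2 - sphere_dist p0 (\<gamma> x t)\<bar> \<le> \<epsilon> / 2 * sqrt (norm (F x t) + sqrt \<bar>t\<bar>)"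
      using assms(7) by blast
    show ?thesis
    proof (intro exI[of _ K] conjI[OF K(1)] ballI allI impI)
      fix x t assume x: "x \<in> topspace X" and t: "t \<le> 0" and ge: "norm (F x t) + sqrt \<bar>t\<bar> \<ge> K"
      have k: "sphere_dist p0 (\<gamma> x t) \<noteq> pi / 2"
        "inverse \<bar>pi / 2 - sphere_dist p0 (\<gamma> x t)\<bar> \<le> \<epsilon> / 2 * sqrt (norm (F x t) + sqrt \<bar>t\<bar>)"
        using K(2) x t ge by blast+
      show "W x t \<noteq> 0 \<and> inverse \<bar>W x t\<bar> \<le> \<epsilon> * sqrt (norm (F x t) + sqrt \<bar>t\<bar>)"
        using sphere_dist_gauss_estimate[OF dim assms(4) \<gamma>[OF x t] k(1)] k(2) unfolding W_def by linarith
    qed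
  qed
  obtain K where K: "\<forall>x\<in>topspace X. \<forall>t\<le>0. norm (F x t) + sqrt \<bar>t\<bar> \<ge> K \<longrightarrow>
      W x t \<noteq> 0 \<and> inverse \<bar>W x t\<bar> \<le> 1 * sqrt (norm (F x t) + sqrt \<bar>t\<bar>)"
    using growth[of 1] by auto
  have K1: "\<forall>x\<in>topspace X. \<forall>t\<le>0. norm (F x t) + sqrt \<bar>t\<bar> \<ge> max 1 K \<longrightarrow>
      W x t \<noteq> 0 \<and> inverse \<bar>W x t\<bar> \<le> sqrt (norm (F x t) + sqrt \<bar>t\<bar>)"
    using K by simp
  have growth': "\<exists>K. \<forall>x\<in>topspace X. \<forall>t\<le>0. norm (F x t) + sqrt \<bar>t\<bar> \<ge> K \<longrightarrow>
      inverse \<bar>W x t\<bar> \<le> \<epsilon> * sqrt (norm (F x t) + sqrt \<bar>t\<bar>)" if "\<epsilon> > 0" for \<epsilon>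
    using growth[OF that] by blast
  obtain a b where ab: "\<forall>t\<le>0. (\<lambda>x. F x t) ` topspace X = {z. J (- a, 1) \<bullet> z = b}"
    by (rule slices_are_hyperplanes[OF growth' _ K1]) auto
  have "J (- a, 1) \<noteq> 0"
  proof
    assume "J (- a, 1) = 0"
    then have "Ji (J (- a, 1)) = 0" using linear_0[OF bounded_linear.linear[OF Ji]] by simp
    then show False by (simp add: Ji_J zero_prod_def)
  qed
  then show ?thesis using ab by blast
qed

end
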